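(* The assertion $$\mathrm{ind}(\Sigma_a)=4\ \text{ and }\ \mathrm{nul}(\Sigma_a)=2\quad\text{for every }a>1/2$$ is equivalent to the conjunction of the following two conditions: (E) $\mu_0^{\mathrm{even}}(2)>0$ for every $a>1/2$; (F) for every $a>1/2$, $\mu_2(0)>0$ and $\mu_n(0)\ne 0$ for every $n\ge 0$.
   Context: For $a>1/2$ put $A(s)=\sqrt{a\cosh(2s)+\tfrac12}$, $B(s)=\sqrt{a\cosh(2s)-\tfrac12}$, $K=K(a)=\sqrt{a^2-\tfrac14}$, and $\varphi(s)=\int_0^s\frac{K}{A(t)^2B(t)}\,dt$. Let $s_0=s_0(a)>0$ be the unique positive solution of $\tanh\varphi(s_0)=\frac{B(s_0)K}{a\sinh(2s_0)}$, and let $r(a)>0$ be defined by $\cosh r(a)=A(s_0)\cosh\varphi(s_0)$. The critical spherical catenoid $\Sigma_a$ is the rotational free boundary minimal annulus $\{(A\cosh\varphi,A\sinh\varphi,B\cos\theta,B\sin\theta)(s):|s|\le s_0\}$ in the geodesic ball of radius $r(a)$ centered at $(1,0,0,0)$ in the hyperboloid model of $\mathbb{H}^3$; it has induced metric $g=ds^2+B(s)^2d\theta^2$ and $|\mathrm{II}|^2=2K^2/B^4$. Index form: $\mathcal{S}(u,u)=\int_{\Sigma_a}\bigl(|\nabla u|_g^2-(|\mathrm{II}|^2-2)u^2\bigr)dA-\coth r(a)\int_{\partial\Sigma_a}u^2\,dL$. $\mathrm{ind}(\Sigma_a)$ is the maximal dimension of a subspace of $H^1(\Sigma_a)$ on which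 $\mathcal{S}$ is negative definite; $\mathrm{nul}(\Sigma_a)$ is the dimension of $\ker\mathcal{S}$, i.e. of the space of $u$ with $\Delta_gu+(|\mathrm{II}|^2-2)u=0$ and $\partial_\eta u=\coth r(a)\,u$ on $\partial\Sigma_a$ ($\eta$ outward unit conormal). For $k\in\mathbb{Z}$ set $W_k=|\mathrm{II}|^2-2-k^2/B^2$ and, for $u\in H^1((-s_0,s_0))$, $\mathcal{S}_k^{\mathrm{rad}}(u,u)=\int_{-s_0}^{s_0}[B(u')^2-BW_ku^2]ds-\coth r(a)B(s_0)[u(s_0)^2+u(-s_0)^2]$. $\mu_n(k)$, $n\ge0$, is the $(n+1)$-th eigenvalue (increasing order, with multiplicity) of $\mathcal{S}_k^{\mathrm{rad}}$ relative to the norm $\int_{-s_0}^{s_0}Bu^2ds$; $\mu_n^{\mathrm{even}}(k)$ is the $(n+1)$-th eigenvalue of the restriction to functions even in $s$. All these depend on $a$. *)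

theory Defs
  imports "HOL-Analysis.Analysis" "HOL-Library.Extended_Nat"
begin

section \<open>The critical spherical catenoids\<close>

definition catA :: "real \<Rightarrow> real \<Rightarrow> real" where
  "catA a s = sqrt (a * cosh (2 * s) + 1/2)"

definition catB :: "real \<Rightarrow> real \<Rightarrow> real" where
  "catB a s = sqrt (a * cosh (2 * s) - 1/2)"

definition catK :: "real \<Rightarrow> real" where
  "catK a = sqrt (a\<^sup>2 - 1/4)"

text \<open>The interval integral is oriented, so this is also the intended (odd) function for \<open>s < 0\<close>.\<close>

definition phi :: "real \<Rightarrow> real \<Rightarrow> real" where
  "phi a s = (LBINT t=ereal 0..ereal s. catK a / ((catA a t)\<^sup>2 * catB a t))"

definition s0 :: "real \<Rightarrow> real" where
  "s0 a = (THE s. s > 0 \<and> tanh (phi a s) = catB a s * catK a / (a * sinh (2 * s)))"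

definition rad :: "real \<Rightarrow> real" where
  "rad a = arcosh (catA a (s0 a) * cosh (phi a (s0 a)))"

definition coth :: "real \<Rightarrow> real" where
  "coth x = cosh x / sinh x"

definition II_sq :: "real \<Rightarrow> real \<Rightarrow> real" where
  "II_sq a s = 2 * (catK a)\<^sup>2 / catB a s ^ 4"


subsection \<open>Consistency of these data with the immersion\<close>

text \<open>
  \<open>catenoid\<close> is the immersion into Minkowski space with form \<open>mink\<close> (the first coordinate is
  timelike), \<open>catenoid_ds\<close> and \<open>catenoid_dt\<close> are its partial derivatives and \<open>catenoid_normal\<close> is
  its unit normal in hyperbolic space. The surface is the image of \<open>\<bar>s\<bar> \<le> s0 a\<close>. The lemmas certify
  what enters the index form: the metric \<open>ds\<^sup>2 + B\<^sup>2 d\<theta>\<^sup>2\<close> and the principal curvatures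
  \<open>\<plusminus>K/B\<^sup>2\<close>, whose squares add up to \<open>II_sq\<close>.
\<close>

type_synonym r4 = "real \<times> real \<times> real \<times> real"

definition mink :: "r4 \<Rightarrow> r4 \<Rightarrow> real" where
  "mink x y = (case (x, y) of ((x0, x1, x2, x3), (y0, y1, y2, y3)) \<Rightarrow>
     - x0 * y0 + x1 * y1 + x2 * y2 + x3 * y3)"

definition catenoid :: "real \<Rightarrow> real \<Rightarrow> real \<Rightarrow> r4" where
  "catenoid a s \<theta> =
     (catA a s * cosh (phi a s), catA a s * sinh (phi a s), catB a s * cos \<theta>, catB a s * sin \<theta>)"

text \<open>The vector \<open>\<alpha> p + \<beta> p' + \<gamma> e\<close> with \<open>p = (cosh \<phi>, sinh \<phi>, 0, 0)\<close>, \<open>p' = (sinh \<phi>, cosh \<phi>, 0, 0)\<close>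
  and \<open>e = (0, 0, cos \<theta>, sin \<theta>)\<close>.\<close>

definition frame_vec :: "real \<Rightarrow> real \<Rightarrow> real \<Rightarrow> real \<Rightarrow> real \<Rightarrow> r4" where
  "frame_vec \<phi> \<theta> \<alpha> \<beta> \<gamma> =
     (\<alpha> * cosh \<phi> + \<beta> * sinh \<phi>, \<alpha> * sinh \<phi> + \<beta> * cosh \<phi>, \<gamma> * cos \<theta>, \<gamma> * sin \<theta>)"

definition catenoid_ds :: "real \<Rightarrow> real \<Rightarrow> real \<Rightarrow> r4" where
  "catenoid_ds a s \<theta> = frame_vec (phi a s) \<theta>
     (a * sinh (2 * s) / catA a s) (catK a / (catA a s * catB a s)) (a * sinh (2 * s) / catB a s)"

definition catenoid_dt :: "real \<Rightarrow> real \<Rightarrow> real \<Rightarrow> r4" where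
  "catenoid_dt a s \<theta> = (0, 0, - catB a s * sin \<theta>, catB a s * cos \<theta>)"

definition catenoid_normal :: "real \<Rightarrow> real \<Rightarrow> real \<Rightarrow> r4" where
  "catenoid_normal a s \<theta> = frame_vec (phi a s) \<theta>
     (catK a / catA a s) (- (a * sinh (2 * s)) / (catA a s * catB a s)) (catK a / catB a s)"

lemma mink_frame_vec:
  "mink (frame_vec \<phi> \<theta> \<alpha> \<beta> \<gamma>) (frame_vec \<phi> \<theta> \<alpha>' \<beta>' \<gamma>') = - \<alpha> * \<alpha>' + \<beta> * \<beta>' + \<gamma> * \<gamma>'"
proof -
  have "mink (frame_vec \<phi> \<theta> \<alpha> \<beta> \<gamma>) (frame_vec \<phi> \<theta> \<alpha>' \<beta>' \<gamma>') =
      (- \<alpha> * \<alpha>' + \<beta> * \<beta>') * ((cosh \<phi>)\<^sup>2 - (sinh \<phi>)\<^sup>2) + \<gamma> * \<gamma>' * ((cos \<theta>)\<^sup>2 + (sin \<theta>)\<^sup>2)"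
    unfolding mink_def frame_vec_def prod.case by algebra
  then show ?thesis by (simp add: cosh_square_eq)
qed

lemma frame_vec_has_vector_derivative:
  assumes "(p has_real_derivative dp) (at s)" "(x has_real_derivative dx) (at s)"
    "(y has_real_derivative dy) (at s)" "(z has_real_derivative dz) (at s)"
  shows "((\<lambda>s. frame_vec (p s) \<theta> (x s) (y s) (z s)) has_vector_derivative
     frame_vec (p s) \<theta> (dx + y s * dp) (dy + x s * dp) dz) (at s)"
  unfolding frame_vec_def
  apply (intro has_vector_derivative_Pair)
  unfolding has_real_derivative_iff_has_vector_derivative[symmetric]
  using assms by (auto intro!: derivative_eq_intros simp: algebra_simps)

context
  fixes a :: real
  assumes a: "a > 1/2"
begin

lemma catK_sq: "(catK a)\<^sup>2 = a\<^sup>2 - 1/4"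
proof -
  have "(1/2)\<^sup>2 \<le> a\<^sup>2" using a by (intro power_mono) auto
  then show ?thesis by (simp add: catK_def power2_eq_square)
qed

lemma a_cosh: "a * cosh (2 * s) > 1/2"
proof -
  have "a * 1 \<le> a * cosh (2 * s)"
    using a by (intro mult_left_mono cosh_real_ge_1) auto
  then show ?thesis using a by linarith
qed

lemma catA_pos: "catA a s > 0" and catB_pos: "catB a s > 0"
  using a_cosh[of s] by (simp_all add: catA_def catB_def)

lemma catA_sq: "(catA a s)\<^sup>2 = a * cosh (2 * s) + 1/2"
  and catB_sq: "(catB a s)\<^sup>2 = a * cosh (2 * s) - 1/2"
  using a_cosh[of s] by (simp_all add: catA_def catB_def)

lemma catA_sq_catB: "(catA a s)\<^sup>2 = (catB a s)\<^sup>2 + 1"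
  by (simp add: catA_sq catB_sq)

lemma sinh_sq: "(a * sinh (2 * s))\<^sup>2 = (catA a s)\<^sup>2 * (catB a s)\<^sup>2 - (catK a)\<^sup>2"
proof -
  have "(a * sinh (2 * s))\<^sup>2 = a\<^sup>2 * ((cosh (2 * s))\<^sup>2 - 1)"
    by (simp add: power_mult_distrib sinh_square_eq)
  then show ?thesis
    unfolding catA_sq catB_sq catK_sq by (simp add: algebra_simps power2_eq_square)
qed

lemma DERIV_catA: "(catA a has_real_derivative a * sinh (2 * s) / catA a s) (at s)"
  using a_cosh[of s] unfolding catA_def[abs_def]
  by (auto intro!: derivative_eq_intros simp: field_simps)

lemma DERIV_catB: "(catB a has_real_derivative a * sinh (2 * s) / catB a s) (at s)"
  using a_cosh[of s] unfolding catB_def[abs_def]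
  by (auto intro!: derivative_eq_intros simp: field_simps)

lemma DERIV_phi: "(phi a has_real_derivative catK a / ((catA a s)\<^sup>2 * catB a s)) (at s)"
proof -
  let ?f = "\<lambda>t. catK a / ((catA a t)\<^sup>2 * catB a t)"
  define R where "R = \<bar>s\<bar> + 1"
  have "isCont (catA a) t" "isCont (catB a) t" "catA a t \<noteq> 0" "catB a t \<noteq> 0" for t
    using DERIV_isCont[OF DERIV_catA] DERIV_isCont[OF DERIV_catB] catA_pos[of t] catB_pos[of t]
    by auto
  then have cont: "continuous_on S ?f" for S
    by (intro continuous_at_imp_continuous_on ballI continuous_intros) auto
  have "((\<lambda>u. LBINT t=ereal 0..ereal u. ?f t) has_vector_derivative ?f s)
          (at s within {-R..R})"
    by (rule interval_integral_FTC2) (use cont in \<open>auto simp: R_def\<close>)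
  moreover have "at s within {-R..R} = at s"
    by (rule at_within_interior) (auto simp: R_def)
  ultimately show ?thesis
    by (simp add: phi_def[abs_def] has_real_derivative_iff_has_vector_derivative)
qed

lemma catenoid_frame: "catenoid a s \<theta> = frame_vec (phi a s) \<theta> (catA a s) 0 (catB a s)"
  by (simp add: catenoid_def frame_vec_def)

lemma catenoid_in_hyperboloid: "mink (catenoid a s \<theta>) (catenoid a s \<theta>) = -1"
  using catA_sq_catB[of s] by (simp add: catenoid_frame mink_frame_vec power2_eq_square)

lemma catenoid_has_derivs:
  "((\<lambda>s. catenoid a s \<theta>) has_vector_derivative catenoid_ds a s \<theta>) (at s)"
  "((\<lambda>\<theta>. catenoid a s \<theta>) has_vector_derivative catenoid_dt a s \<theta>) (at \<theta>)"
proof -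
  have "((\<lambda>s. frame_vec (phi a s) \<theta> (catA a s) 0 (catB a s)) has_vector_derivative
     frame_vec (phi a s) \<theta> (a * sinh (2 * s) / catA a s + 0 * (catK a / ((catA a s)\<^sup>2 * catB a s)))
       (0 + catA a s * (catK a / ((catA a s)\<^sup>2 * catB a s))) (a * sinh (2 * s) / catB a s)) (at s)"
    by (intro frame_vec_has_vector_derivative DERIV_phi DERIV_catA DERIV_catB DERIV_const)
  then show "((\<lambda>s. catenoid a s \<theta>) has_vector_derivative catenoid_ds a s \<theta>) (at s)"
    using catA_pos[of s] by (simp add: catenoid_frame catenoid_ds_def power2_eq_square)
  show "((\<lambda>\<theta>. catenoid a s \<theta>) has_vector_derivative catenoid_dt a s \<theta>) (at \<theta>)"
    unfolding catenoid_def catenoid_dt_def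
    apply (intro has_vector_derivative_Pair)
    unfolding has_real_derivative_iff_has_vector_derivative[symmetric]
    by (auto intro!: derivative_eq_intros)
qed

lemma catenoid_metric:
  "mink (catenoid_ds a s \<theta>) (catenoid_ds a s \<theta>) = 1"
  "mink (catenoid_ds a s \<theta>) (catenoid_dt a s \<theta>) = 0"
  "mink (catenoid_dt a s \<theta>) (catenoid_dt a s \<theta>) = (catB a s)\<^sup>2"
proof -
  note p = catA_pos[of s] catB_pos[of s]
  have diff: "(catA a s)\<^sup>2 - (catB a s)\<^sup>2 = 1" by (simp add: catA_sq_catB)
  have "mink (catenoid_ds a s \<theta>) (catenoid_ds a s \<theta>) =
      ((a * sinh (2 * s))\<^sup>2 * ((catA a s)\<^sup>2 - (catB a s)\<^sup>2) + (catK a)\<^sup>2) / ((catA a s)\<^sup>2 * (catB a s)\<^sup>2)"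
    using p by (simp add: catenoid_ds_def mink_frame_vec field_simps power2_eq_square)
  also have "\<dots> = 1"
    unfolding sinh_sq diff using p by simp
  finally show "mink (catenoid_ds a s \<theta>) (catenoid_ds a s \<theta>) = 1" .
  show "mink (catenoid_ds a s \<theta>) (catenoid_dt a s \<theta>) = 0"
    by (simp add: mink_def catenoid_ds_def catenoid_dt_def frame_vec_def)
  have "mink (catenoid_dt a s \<theta>) (catenoid_dt a s \<theta>) = (catB a s)\<^sup>2 * ((sin \<theta>)\<^sup>2 + (cos \<theta>)\<^sup>2)"
    unfolding mink_def catenoid_dt_def prod.case by algebra
  then show "mink (catenoid_dt a s \<theta>) (catenoid_dt a s \<theta>) = (catB a s)\<^sup>2" by simp
qed

lemma catenoid_unit_normal:
  "mink (catenoid_normal a s \<theta>) (catenoid_normal a s \<theta>) = 1"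
  "mink (catenoid_normal a s \<theta>) (catenoid a s \<theta>) = 0"
  "mink (catenoid_normal a s \<theta>) (catenoid_ds a s \<theta>) = 0"
  "mink (catenoid_normal a s \<theta>) (catenoid_dt a s \<theta>) = 0"
proof -
  note p = catA_pos[of s] catB_pos[of s]
  have diff: "(catA a s)\<^sup>2 - (catB a s)\<^sup>2 = 1" by (simp add: catA_sq_catB)
  have "mink (catenoid_normal a s \<theta>) (catenoid_normal a s \<theta>) =
      ((catK a)\<^sup>2 * ((catA a s)\<^sup>2 - (catB a s)\<^sup>2) + (a * sinh (2 * s))\<^sup>2) / ((catA a s)\<^sup>2 * (catB a s)\<^sup>2)"
    using p by (simp add: catenoid_normal_def mink_frame_vec field_simps power2_eq_square)
  also have "\<dots> = 1"
    unfolding sinh_sq diff using p by simp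
  finally show "mink (catenoid_normal a s \<theta>) (catenoid_normal a s \<theta>) = 1" .
  show "mink (catenoid_normal a s \<theta>) (catenoid a s \<theta>) = 0"
    using p by (simp add: catenoid_normal_def catenoid_frame mink_frame_vec)
  have "mink (catenoid_normal a s \<theta>) (catenoid_ds a s \<theta>) =
      catK a * (a * sinh (2 * s)) * ((catA a s)\<^sup>2 - (catB a s)\<^sup>2 - 1) / ((catA a s)\<^sup>2 * (catB a s)\<^sup>2)"
    using p by (simp add: catenoid_normal_def catenoid_ds_def mink_frame_vec field_simps power2_eq_square)
  then show "mink (catenoid_normal a s \<theta>) (catenoid_ds a s \<theta>) = 0"
    by (simp add: catA_sq_catB)
  show "mink (catenoid_normal a s \<theta>) (catenoid_dt a s \<theta>) = 0"
    by (simp add: mink_def catenoid_normal_def catenoid_dt_def frame_vec_def)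
qed

lemma frame_vec_scaleR: "c *\<^sub>R frame_vec \<phi> \<theta> \<alpha> \<beta> \<gamma> = frame_vec \<phi> \<theta> (c * \<alpha>) (c * \<beta>) (c * \<gamma>)"
  by (simp add: frame_vec_def algebra_simps)

lemma catenoid_principal_curvatures:
  "((\<lambda>s. catenoid_normal a s \<theta>) has_vector_derivative
     (- (catK a / (catB a s)\<^sup>2)) *\<^sub>R catenoid_ds a s \<theta>) (at s)"
  "((\<lambda>\<theta>. catenoid_normal a s \<theta>) has_vector_derivative
     (catK a / (catB a s)\<^sup>2) *\<^sub>R catenoid_dt a s \<theta>) (at \<theta>)"
proof -
  define A B K S C p where "A = catA a s" and "B = catB a s" and "K = catK a"
    and "S = a * sinh (2 * s)" and "C = 2 * (a * cosh (2 * s))" and "p = K / (A\<^sup>2 * B)"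
  note d = A_def B_def K_def S_def
  have pos: "A > 0" "B > 0" using catA_pos catB_pos by (simp_all add: d)
  have AB: "A\<^sup>2 = B\<^sup>2 + 1" by (simp add: d catA_sq_catB)
  have C: "C = A\<^sup>2 + B\<^sup>2" by (simp add: C_def d catA_sq catB_sq)
  have SS: "S\<^sup>2 = A\<^sup>2 * B\<^sup>2 - K\<^sup>2" by (simp add: d sinh_sq)
  have 1: "((\<lambda>s. catK a / catA a s) has_real_derivative - K * S / A ^ 3) (at s)"
    using pos DERIV_catA[of s] unfolding d
    by (auto intro!: derivative_eq_intros simp: field_simps power2_eq_square power3_eq_cube)
  have 2: "((\<lambda>s. catK a / catB a s) has_real_derivative - K * S / B ^ 3) (at s)"
    using pos DERIV_catB[of s] unfolding d
    by (auto intro!: derivative_eq_intros simp: field_simps power2_eq_square power3_eq_cube)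
  have 3: "((\<lambda>s. - (a * sinh (2 * s)) / (catA a s * catB a s)) has_real_derivative
      - C / (A * B) + S * (S / A * B + A * (S / B)) / (A * B)\<^sup>2) (at s)"
    using pos unfolding d
    by (auto intro!: derivative_eq_intros DERIV_catA DERIV_catB
        simp: C_def field_simps power2_eq_square)
  have "((\<lambda>s. catenoid_normal a s \<theta>) has_vector_derivative
      frame_vec (phi a s) \<theta> (- K * S / A ^ 3 + - S / (A * B) * p)
       (- C / (A * B) + S * (S / A * B + A * (S / B)) / (A * B)\<^sup>2 + K / A * p) (- K * S / B ^ 3)) (at s)"
    unfolding catenoid_normal_def
    using frame_vec_has_vector_derivative[OF DERIV_phi 1 3 2, of \<theta>] by (simp add: d p_def)
  moreover have "- K * S / A ^ 3 + - S / (A * B) * p = - (K / B\<^sup>2) * (S / A)"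
  proof -
    have "- K * S / A ^ 3 + - S / (A * B) * p = - K * S * (B\<^sup>2 + 1) / (A ^ 3 * B\<^sup>2)"
      using pos by (simp add: p_def field_simps power2_eq_square power3_eq_cube)
    also have "\<dots> = - (K / B\<^sup>2) * (S / A)"
      unfolding AB[symmetric] using pos by (simp add: field_simps power2_eq_square power3_eq_cube)
    finally show ?thesis .
  qed
  moreover have "- C / (A * B) + S * (S / A * B + A * (S / B)) / (A * B)\<^sup>2 + K / A * p
      = - (K / B\<^sup>2) * (K / (A * B))"
  proof -
    have "- C / (A * B) + S * (S / A * B + A * (S / B)) / (A * B)\<^sup>2 + K / A * p
       = (- C * A\<^sup>2 * B\<^sup>2 + S\<^sup>2 * (A\<^sup>2 + B\<^sup>2) + K\<^sup>2 * B\<^sup>2) / (A ^ 3 * B ^ 3)"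
      using pos by (simp add: p_def field_simps power2_eq_square power3_eq_cube)
    also have "\<dots> = - (K\<^sup>2 * A\<^sup>2) / (A ^ 3 * B ^ 3)"
      unfolding C SS by (simp add: algebra_simps)
    also have "\<dots> = - (K / B\<^sup>2) * (K / (A * B))"
      using pos by (simp add: field_simps power2_eq_square power3_eq_cube)
    finally show ?thesis .
  qed
  moreover have "- K * S / B ^ 3 = - (K / B\<^sup>2) * (S / B)"
    using pos by (simp add: field_simps power2_eq_square power3_eq_cube)
  ultimately have "((\<lambda>s. catenoid_normal a s \<theta>) has_vector_derivative
      frame_vec (phi a s) \<theta> (- (K / B\<^sup>2) * (S / A)) (- (K / B\<^sup>2) * (K / (A * B)))
        (- (K / B\<^sup>2) * (S / B))) (at s)"
    by (simp only:)
  then show "((\<lambda>s. catenoid_normal a s \<theta>) has_vector_derivative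
     (- (catK a / (catB a s)\<^sup>2)) *\<^sub>R catenoid_ds a s \<theta>) (at s)"
    unfolding catenoid_ds_def frame_vec_scaleR d .
  show "((\<lambda>\<theta>. catenoid_normal a s \<theta>) has_vector_derivative
     (catK a / (catB a s)\<^sup>2) *\<^sub>R catenoid_dt a s \<theta>) (at \<theta>)"
    using catB_pos[of s]
    unfolding catenoid_normal_def catenoid_dt_def frame_vec_def scaleR_Pair
    apply (intro has_vector_derivative_Pair)
    unfolding has_real_derivative_iff_has_vector_derivative[symmetric]
    by (auto intro!: derivative_eq_intros simp: power2_eq_square)
qed

lemma II_sq_principal_curvatures:
  "II_sq a s = (- (catK a / (catB a s)\<^sup>2))\<^sup>2 + (catK a / (catB a s)\<^sup>2)\<^sup>2"
  by (simp add: II_sq_def power_divide)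

end


section \<open>Dimension and spectrum modulo null functions\<close>

text \<open>
  Function spaces are sets of functions, and \<open>N\<close> is the set of functions that represent the zero
  class; \<open>dim_mod N V\<close> is the dimension of \<open>V\<close> modulo \<open>N\<close>.
\<close>

definition dim_mod :: "('x \<Rightarrow> real) set \<Rightarrow> ('x \<Rightarrow> real) set \<Rightarrow> enat" where
  "dim_mod N V = Sup {enat n |n. \<exists>f. (\<forall>i<n. f i \<in> V) \<and>
     (\<forall>c :: nat \<Rightarrow> real. (\<lambda>x. \<Sum>i<n. c i * f i x) \<in> N \<longrightarrow> (\<forall>i<n. c i = 0))}"

definition linear_subspace :: "('x \<Rightarrow> real) set \<Rightarrow> bool" where
  "linear_subspace V \<longleftrightarrow> (\<lambda>x. 0) \<in> V \<and> (\<forall>u\<in>V. \<forall>v\<in>V. (\<lambda>x. u x + v x) \<in> V) \<and>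
     (\<forall>u\<in>V. \<forall>c. (\<lambda>x. c * u x) \<in> V)"

text \<open>For a symmetric bilinear form \<open>q\<close> on the space \<open>D\<close>.\<close>

definition form_index ::
  "('x \<Rightarrow> real) set \<Rightarrow> ('x \<Rightarrow> real) set \<Rightarrow> (('x \<Rightarrow> real) \<Rightarrow> ('x \<Rightarrow> real) \<Rightarrow> real) \<Rightarrow> enat" where
  "form_index N D q = Sup {dim_mod N V |V. V \<subseteq> D \<and> linear_subspace V \<and> (\<forall>u\<in>V - N. q u u < 0)}"

definition form_kernel ::
  "('x \<Rightarrow> real) set \<Rightarrow> (('x \<Rightarrow> real) \<Rightarrow> ('x \<Rightarrow> real) \<Rightarrow> real) \<Rightarrow> ('x \<Rightarrow> real) set" where
  "form_kernel D q = {u \<in> D. \<forall>v\<in>D. q u v = 0}"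

text \<open>Eigenspaces of \<open>q\<close> relative to the inner product \<open>m\<close>.\<close>

definition eigenspace ::
  "('x \<Rightarrow> real) set \<Rightarrow> (('x \<Rightarrow> real) \<Rightarrow> ('x \<Rightarrow> real) \<Rightarrow> real) \<Rightarrow>
   (('x \<Rightarrow> real) \<Rightarrow> ('x \<Rightarrow> real) \<Rightarrow> real) \<Rightarrow> real \<Rightarrow> ('x \<Rightarrow> real) set" where
  "eigenspace D q m ev = {u \<in> D. \<forall>v\<in>D. q u v = ev * m u v}"

text \<open>The eigenvalues in increasing order: every real number occurs in the sequence exactly as often
  as its multiplicity says (zero times if it is not an eigenvalue).\<close>

definition eigenvalue_seq ::
  "('x \<Rightarrow> real) set \<Rightarrow> ('x \<Rightarrow> real) set \<Rightarrow> (('x \<Rightarrow> real) \<Rightarrow> ('x \<Rightarrow> real) \<Rightarrow> real) \<Rightarrow>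
   (('x \<Rightarrow> real) \<Rightarrow> ('x \<Rightarrow> real) \<Rightarrow> real) \<Rightarrow> nat \<Rightarrow> real" where
  "eigenvalue_seq N D q m = (THE \<mu>. mono \<mu> \<and>
     (\<forall>ev. finite {n. \<mu> n = ev} \<and> enat (card {n. \<mu> n = ev}) = dim_mod N (eigenspace D q m ev)))"


section \<open>Sobolev spaces\<close>

definition L2_on :: "'x::euclidean_space set \<Rightarrow> ('x \<Rightarrow> real) \<Rightarrow> bool" where
  "L2_on S f \<longleftrightarrow> set_borel_measurable lborel S f \<and> set_integrable lborel S (\<lambda>x. (f x)\<^sup>2)"


subsection \<open>The interval\<close>

definition C1_test :: "real \<Rightarrow> (real \<Rightarrow> real) \<Rightarrow> (real \<Rightarrow> real) \<Rightarrow> bool" where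
  "C1_test l \<psi> \<psi>' \<longleftrightarrow> (\<forall>s. (\<psi> has_real_derivative \<psi>' s) (at s)) \<and> continuous_on UNIV \<psi>' \<and>
     (\<exists>\<rho><l. \<forall>s. \<rho> \<le> \<bar>s\<bar> \<longrightarrow> \<psi> s = 0)"

definition weak_deriv :: "real \<Rightarrow> (real \<Rightarrow> real) \<Rightarrow> (real \<Rightarrow> real) \<Rightarrow> bool" where
  "weak_deriv l u v \<longleftrightarrow> L2_on {-l<..<l} v \<and> (\<forall>\<psi> \<psi>'. C1_test l \<psi> \<psi>' \<longrightarrow>
     (LINT s:{-l<..<l}|lborel. u s * \<psi>' s) = - (LINT s:{-l<..<l}|lborel. v s * \<psi> s))"

text \<open>Each class is represented by its continuous representative on the closed interval, so that
  boundary values are point values. Values outside \<open>[-l, l]\<close> are irrelevant.\<close>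

definition H1_interval :: "real \<Rightarrow> (real \<Rightarrow> real) set" where
  "H1_interval l = {u. continuous_on {-l..l} u \<and> (\<exists>v. weak_deriv l u v)}"

definition H1_even :: "real \<Rightarrow> (real \<Rightarrow> real) set" where
  "H1_even l = {u \<in> H1_interval l. \<forall>s\<in>{-l..l}. u (- s) = u s}"

definition null_interval :: "real \<Rightarrow> (real \<Rightarrow> real) set" where
  "null_interval l = {u. \<forall>s\<in>{-l..l}. u s = 0}"

text \<open>Unique up to null sets for \<open>u \<in> H1_interval l\<close>.\<close>

definition wderiv :: "real \<Rightarrow> (real \<Rightarrow> real) \<Rightarrow> real \<Rightarrow> real" where
  "wderiv l u = (SOME v. weak_deriv l u v)"


subsection \<open>The annulus\<close>

text \<open>
  Functions on the annulus \<open>(-l, l) \<times> S\<^sup>1\<close>, in the coordinates \<open>(s, \<theta>)\<close>, are given almost everywhere by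
  their values on the fundamental domain \<open>annulus l\<close>. The test functions are \<open>2\<pi>\<close>-periodic in \<open>\<theta>\<close> and
  need not vanish along \<open>\<theta> = 0\<close>, so the weak derivatives below are those on the annulus, not on the
  slit annulus.
\<close>

definition annulus :: "real \<Rightarrow> (real \<times> real) set" where
  "annulus l = {-l<..<l} \<times> {0<..<2 * pi}"

definition C1_periodic ::
  "(real \<times> real \<Rightarrow> real) \<Rightarrow> (real \<times> real \<Rightarrow> real) \<Rightarrow> (real \<times> real \<Rightarrow> real) \<Rightarrow> bool" where
  "C1_periodic \<psi> \<psi>s \<psi>t \<longleftrightarrow> (\<forall>x. (\<psi> has_derivative (\<lambda>(h, k). \<psi>s x * h + \<psi>t x * k)) (at x)) \<and>
     continuous_on UNIV \<psi>s \<and> continuous_on UNIV \<psi>t \<and> (\<forall>s \<theta>. \<psi> (s, \<theta> + 2 * pi) = \<psi> (s, \<theta>))"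

definition weak_grad ::
  "real \<Rightarrow> (real \<times> real \<Rightarrow> real) \<Rightarrow> (real \<times> real \<Rightarrow> real) \<Rightarrow> (real \<times> real \<Rightarrow> real) \<Rightarrow> bool" where
  "weak_grad l u us ut \<longleftrightarrow> L2_on (annulus l) us \<and> L2_on (annulus l) ut \<and>
     (\<forall>\<psi> \<psi>s \<psi>t. C1_periodic \<psi> \<psi>s \<psi>t \<and> (\<exists>\<rho><l. \<forall>s \<theta>. \<rho> \<le> \<bar>s\<bar> \<longrightarrow> \<psi> (s, \<theta>) = 0) \<longrightarrow>
       (LINT x:annulus l|lborel. u x * \<psi>s x) = - (LINT x:annulus l|lborel. us x * \<psi> x) \<and>
       (LINT x:annulus l|lborel. u x * \<psi>t x) = - (LINT x:annulus l|lborel. ut x * \<psi> x))"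

text \<open>On \<open>[-s0, s0]\<close> the function \<open>B\<close> is bounded and bounded away from zero, so square integrability
  may be taken with respect to \<open>ds d\<theta>\<close> and the coordinate gradient.\<close>

definition H1_annulus :: "real \<Rightarrow> (real \<times> real \<Rightarrow> real) set" where
  "H1_annulus l = {u. L2_on (annulus l) u \<and> (\<exists>us ut. weak_grad l u us ut)}"

definition null_annulus :: "real \<Rightarrow> (real \<times> real \<Rightarrow> real) set" where
  "null_annulus l = {u. AE x in lborel. x \<in> annulus l \<longrightarrow> u x = 0}"

text \<open>Weak partial derivatives and boundary trace, unique up to null sets for \<open>u \<in> H1_annulus l\<close>.
  The trace is the square integrable function on the two boundary circles \<open>s = \<plusminus>l\<close> for which
  Green's formula holds against all test functions that are \<open>C\<^sup>1\<close> up to the boundary.\<close>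

definition wgrad :: "real \<Rightarrow> (real \<times> real \<Rightarrow> real) \<Rightarrow> (real \<times> real \<Rightarrow> real) \<times> (real \<times> real \<Rightarrow> real)" where
  "wgrad l u = (SOME (us, ut). weak_grad l u us ut)"

definition wds :: "real \<Rightarrow> (real \<times> real \<Rightarrow> real) \<Rightarrow> real \<times> real \<Rightarrow> real" where
  "wds l u = fst (wgrad l u)"

definition wdt :: "real \<Rightarrow> (real \<times> real \<Rightarrow> real) \<Rightarrow> real \<times> real \<Rightarrow> real" where
  "wdt l u = snd (wgrad l u)"

definition is_trace :: "real \<Rightarrow> (real \<times> real \<Rightarrow> real) \<Rightarrow> (real \<times> real \<Rightarrow> real) \<Rightarrow> bool" where
  "is_trace l u \<tau> \<longleftrightarrow> (\<forall>s\<in>{-l, l}. L2_on {0<..<2 * pi} (\<lambda>\<theta>. \<tau> (s, \<theta>))) \<and>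
     (\<forall>\<psi> \<psi>s \<psi>t. C1_periodic \<psi> \<psi>s \<psi>t \<longrightarrow>
       (LINT x:annulus l|lborel. u x * \<psi>s x + wds l u x * \<psi> x) =
       (LINT \<theta>:{0<..<2 * pi}|lborel. \<tau> (l, \<theta>) * \<psi> (l, \<theta>)) -
       (LINT \<theta>:{0<..<2 * pi}|lborel. \<tau> (- l, \<theta>) * \<psi> (- l, \<theta>)))"

definition bdry_trace :: "real \<Rightarrow> (real \<times> real \<Rightarrow> real) \<Rightarrow> real \<times> real \<Rightarrow> real" where
  "bdry_trace l u = (SOME \<tau>. is_trace l u \<tau>)"


section \<open>Index, nullity and radial eigenvalues\<close>

text \<open>Here \<open>dA = B ds d\<theta>\<close>, \<open>dL = B d\<theta>\<close> and \<open>\<langle>\<nabla>u, \<nabla>v\<rangle> = u\<^sub>s v\<^sub>s + u\<^sub>\<theta> v\<^sub>\<theta> / B\<^sup>2\<close>.\<close>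

definition index_form ::
  "real \<Rightarrow> (real \<times> real \<Rightarrow> real) \<Rightarrow> (real \<times> real \<Rightarrow> real) \<Rightarrow> real" where
  "index_form a u v =
     (LINT (s, \<theta>):annulus (s0 a)|lborel.
        (wds (s0 a) u (s, \<theta>) * wds (s0 a) v (s, \<theta>)
         + wdt (s0 a) u (s, \<theta>) * wdt (s0 a) v (s, \<theta>) / (catB a s)\<^sup>2
         - (II_sq a s - 2) * u (s, \<theta>) * v (s, \<theta>)) * catB a s)
     - coth (rad a) * (\<Sum>s\<in>{- s0 a, s0 a}. LINT \<theta>:{0<..<2 * pi}|lborel.
         bdry_trace (s0 a) u (s, \<theta>) * bdry_trace (s0 a) v (s, \<theta>) * catB a s)"

definition ind :: "real \<Rightarrow> enat" where
  "ind a = form_index (null_annulus (s0 a)) (H1_annulus (s0 a)) (index_form a)"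

text \<open>The kernel consists of the weak solutions of \<open>\<Delta>u + (\<bar>II\<bar>\<^sup>2 - 2) u = 0\<close> with the Robin condition
  \<open>\<partial>u/\<partial>\<eta> = coth (rad a) u\<close>.\<close>

definition nul :: "real \<Rightarrow> enat" where
  "nul a = dim_mod (null_annulus (s0 a)) (form_kernel (H1_annulus (s0 a)) (index_form a))"

definition potential :: "real \<Rightarrow> int \<Rightarrow> real \<Rightarrow> real" where
  "potential a k s = II_sq a s - 2 - (real_of_int k)\<^sup>2 / (catB a s)\<^sup>2"

definition radial_form :: "real \<Rightarrow> int \<Rightarrow> (real \<Rightarrow> real) \<Rightarrow> (real \<Rightarrow> real) \<Rightarrow> real" where
  "radial_form a k u v =
     (LINT s:{- s0 a<..<s0 a}|lborel.
        catB a s * wderiv (s0 a) u s * wderiv (s0 a) v s - catB a s * potential a k s * u s * v s)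
     - coth (rad a) * catB a (s0 a) * (u (s0 a) * v (s0 a) + u (- s0 a) * v (- s0 a))"

definition radial_inner :: "real \<Rightarrow> (real \<Rightarrow> real) \<Rightarrow> (real \<Rightarrow> real) \<Rightarrow> real" where
  "radial_inner a u v = (LINT s:{- s0 a<..<s0 a}|lborel. catB a s * u s * v s)"

definition mu :: "real \<Rightarrow> int \<Rightarrow> nat \<Rightarrow> real" where
  "mu a k = eigenvalue_seq (null_interval (s0 a)) (H1_interval (s0 a))
     (radial_form a k) (radial_inner a)"

definition mu_even :: "real \<Rightarrow> int \<Rightarrow> nat \<Rightarrow> real" where
  "mu_even a k = eigenvalue_seq (null_interval (s0 a)) (H1_even (s0 a))
     (radial_form a k) (radial_inner a)"

end

theory Submission
  imports Defs "HOL-Complex_Analysis.Great_Picard"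
begin

text \<open>
  Separation of variables. In the coordinates \<open>(s, \<theta>)\<close> the index form of the catenoid is rotationally
  symmetric, so it decouples into the radial forms \<open>S\<^sub>k\<close> of the modes \<open>cos k\<theta>\<close>, \<open>sin k\<theta>\<close>
  (\<open>index_form_mode\<close>). Formally the index is the sum of the indices of \<open>S\<^sub>k\<close> over all integers \<open>k\<close>, and the
  nullity is the corresponding sum of nullities. The equivalence holds for each parameter \<open>a\<close>
  (\<open>index_nullity_iff\<close>), because enough is known about every mode:

  \<^item> Mode \<open>1\<close>. Isometries of the ambient space give two explicit radial solutions of the Jacobi equation
    (\<open>jacobi_function\<close>). The odd one, \<open>w\<close>, comes from rotations about the centre of the ball and satisfies the
    boundary condition. The even one, \<open>y\<close>, comes from translations, is positive and satisfies
    \<open>S\<^sub>1(y, f) = - \<kappa> (f(l) + f(-l))\<close> with \<open>\<kappa> > 0\<close>. Hence \<open>S\<^sub>1(y, y) < 0\<close>, the kernel of \<open>S\<^sub>1\<close> is spanned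
    by \<open>w\<close> (\<open>rf1_kernel\<close>), and \<open>S\<^sub>1\<close> is nonnegative on functions that vanish at \<open>s = 0\<close>, the only zero of \<open>w\<close>
    (\<open>rf1_nonneg\<close>). So the modes \<open>\<plusminus>1\<close> always contribute \<open>2\<close> to the index and \<open>2\<close> to the nullity.

  \<^item> Mode \<open>0\<close>. Since \<open>S\<^sub>0 < S\<^sub>1\<close>, the form \<open>S\<^sub>0\<close> is negative on the plane spanned by \<open>w\<close> and \<open>y\<close>, so the first two
    eigenvalues are negative (\<open>mu0_negative\<close>). The mode contributes exactly \<open>2\<close> to the index and nothing to the
    nullity if and only if the third eigenvalue is positive and no eigenvalue vanishes.

  \<^item> Modes \<open>|k| \<ge> 2\<close>. By Wirtinger's inequality on the circles these are controlled by \<open>S\<^sub>2\<close>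
    (\<open>high_modes\<close>). On odd functions \<open>S\<^sub>2 > S\<^sub>1 \<ge> 0\<close>, so \<open>S\<^sub>2\<close> is positive if and only if its first even
    eigenvalue is (\<open>rf2_coercive\<close>). Otherwise \<open>S\<^sub>2\<close> has a negative direction or a kernel, which raises the index
    or the nullity.

  Three pieces of analysis support this. A spectral theorem for semibounded forms with compact resolvent
  shows that the eigenvalue sequences exist and obey the variational principle (\<open>spectral_theorem\<close>,
  \<open>robin_compact\<close>). Weak derivatives on the interval are identified with absolutely
  continuous functions (\<open>weak_deriv_iff_ac\<close>), for which integration by parts is available. Fourier series in
  \<open>\<theta>\<close> show that an \<open>H\<^sup>1\<close> function on the annulus is absolutely continuous along almost every meridian and
  determine its weak gradient and boundary trace (\<open>slice_representation\<close>, \<open>slice_trace\<close>, \<open>trace_unique\<close>). Thus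
  the index form can be evaluated on any choice of representatives (\<open>index_form_G\<close>).
\<close>

section \<open>Square integrable functions\<close>

definition L2 :: "'a measure \<Rightarrow> ('a \<Rightarrow> real) \<Rightarrow> bool" where
  "L2 M f \<longleftrightarrow> f \<in> borel_measurable M \<and> integrable M (\<lambda>x. (f x)\<^sup>2)"

lemma L2_measurable [measurable_dest]: "L2 M f \<Longrightarrow> f \<in> borel_measurable M"
  by (simp add: L2_def)

lemma L2_sq: "L2 M f \<Longrightarrow> integrable M (\<lambda>x. (f x)\<^sup>2)"
  by (simp add: L2_def)

lemma L2_mult_integrable:
  assumes "L2 M f" "L2 M g"
  shows "integrable M (\<lambda>x. f x * g x)"
proof (rule Bochner_Integration.integrable_bound)
  show "integrable M (\<lambda>x. (f x)\<^sup>2 + (g x)\<^sup>2)"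
    using assms by (auto simp: L2_def)
  show "(\<lambda>x. f x * g x) \<in> borel_measurable M"
    using assms by (auto simp: L2_def)
  have "\<bar>x * y\<bar> \<le> x\<^sup>2 + y\<^sup>2" for x y :: real
  proof -
    have "2 * (\<bar>x\<bar> * \<bar>y\<bar>) \<le> x\<^sup>2 + y\<^sup>2" "0 \<le> \<bar>x\<bar> * \<bar>y\<bar>"
      using sum_squares_bound[of "\<bar>x\<bar>" "\<bar>y\<bar>"] by (auto simp: mult.assoc)
    then show ?thesis unfolding abs_mult by linarith
  qed
  then show "AE x in M. norm (f x * g x) \<le> norm ((f x)\<^sup>2 + (g x)\<^sup>2)"
    by (intro AE_I2) (auto simp: abs_mult)
qed

lemma L2_scale: "L2 M f \<Longrightarrow> L2 M (\<lambda>x. c * f x)"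
  by (auto simp: L2_def power_mult_distrib)

lemma L2_uminus: "L2 M f \<Longrightarrow> L2 M (\<lambda>x. - f x)"
  by (auto simp: L2_def)

lemma L2_add:
  assumes "L2 M f" "L2 M g"
  shows "L2 M (\<lambda>x. f x + g x)"
proof -
  have "integrable M (\<lambda>x. (f x)\<^sup>2 + (g x)\<^sup>2 + 2 * (f x * g x))"
    using L2_mult_integrable[OF assms] assms by (intro Bochner_Integration.integrable_add) (auto simp: L2_def)
  then show ?thesis
    using assms by (auto simp: L2_def power2_sum mult.assoc)
qed

lemma L2_diff: "L2 M f \<Longrightarrow> L2 M g \<Longrightarrow> L2 M (\<lambda>x. f x - g x)"
  using L2_add[OF _ L2_uminus, of M f g] by simp

lemma L2_zero [simp]: "L2 M (\<lambda>x. 0)"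
  by (simp add: L2_def)

lemma L2_sum: "(\<And>i. i \<in> I \<Longrightarrow> L2 M (f i)) \<Longrightarrow> L2 M (\<lambda>x. \<Sum>i\<in>I. f i x)"
  by (induction I rule: infinite_finite_induct) (auto intro: L2_add)

lemma L2_mult_bounded:
  assumes f: "L2 M f" and g: "g \<in> borel_measurable M" and b: "\<And>x. x \<in> space M \<Longrightarrow> \<bar>g x\<bar> \<le> C"
  shows "L2 M (\<lambda>x. g x * f x)"
  unfolding L2_def
proof
  show "(\<lambda>x. g x * f x) \<in> borel_measurable M"
    using f g by (auto simp: L2_def)
  show "integrable M (\<lambda>x. (g x * f x)\<^sup>2)"
  proof (rule Bochner_Integration.integrable_bound)
    show "integrable M (\<lambda>x. C\<^sup>2 * (f x)\<^sup>2)"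
      using f by (auto simp: L2_def)
    show "(\<lambda>x. (g x * f x)\<^sup>2) \<in> borel_measurable M"
      using f g by (auto simp: L2_def)
    have "(g x)\<^sup>2 \<le> C\<^sup>2" if "x \<in> space M" for x
      using power_mono[OF b[OF that], of 2] by simp
    then show "AE x in M. norm ((g x * f x)\<^sup>2) \<le> norm (C\<^sup>2 * (f x)\<^sup>2)"
      by (intro AE_I2) (auto simp: power_mult_distrib intro!: mult_right_mono)
  qed
qed

lemma (in finite_measure) L2_bounded:
  assumes "g \<in> borel_measurable M" "\<And>x. x \<in> space M \<Longrightarrow> \<bar>g x\<bar> \<le> C"
  shows "L2 M g"
proof -
  have "L2 M (\<lambda>x. 1)" by (simp add: L2_def)
  from L2_mult_bounded[OF this assms] show ?thesis by simp
qed

lemma (in finite_measure) L2_integrable: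
  assumes "L2 M f" shows "integrable M f"
proof -
  have "L2 M (\<lambda>x. 1)" by (simp add: L2_def)
  from L2_mult_integrable[OF assms this] show ?thesis by simp
qed

lemma L2_Cauchy_Schwarz:
  assumes f: "L2 M f" and g: "L2 M g"
  shows "(\<integral>x. f x * g x \<partial>M)\<^sup>2 \<le> (\<integral>x. (f x)\<^sup>2 \<partial>M) * (\<integral>x. (g x)\<^sup>2 \<partial>M)"
proof -
  define F G H where "F = (\<integral>x. (f x)\<^sup>2 \<partial>M)" and "G = (\<integral>x. (g x)\<^sup>2 \<partial>M)" and "H = (\<integral>x. f x * g x \<partial>M)"
  note i = L2_sq[OF f] L2_sq[OF g] L2_mult_integrable[OF f g]
  have *: "0 \<le> s\<^sup>2 * F + t\<^sup>2 * G + 2 * s * t * H" for s t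
  proof -
    have "0 \<le> (\<integral>x. (s * f x + t * g x)\<^sup>2 \<partial>M)" by simp
    also have "\<dots> = (\<integral>x. s\<^sup>2 * (f x)\<^sup>2 + t\<^sup>2 * (g x)\<^sup>2 + 2 * s * t * (f x * g x) \<partial>M)"
      by (intro Bochner_Integration.integral_cong refl) algebra
    also have "\<dots> = s\<^sup>2 * F + t\<^sup>2 * G + 2 * s * t * H"
      using i by (simp add: F_def G_def H_def)
    finally show ?thesis .
  qed
  have "F \<ge> 0" "G \<ge> 0" by (simp_all add: F_def G_def)
  show ?thesis unfolding F_def[symmetric] G_def[symmetric] H_def[symmetric]
  proof (cases "F = 0")
    case True
    have "H = 0"
    proof (rule ccontr)
      assume "H \<noteq> 0"
      have "0 \<le> (-(G+1)/(2*H))\<^sup>2 * F + 1\<^sup>2 * G + 2 * (-(G+1)/(2*H)) * 1 * H" by (rule *)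
      also have "\<dots> = -1" using \<open>H \<noteq> 0\<close> True by (simp add: field_simps)
      finally show False by simp
    qed
    then show "H\<^sup>2 \<le> F * G" using True by simp
  next
    case False
    have "0 \<le> (-H)\<^sup>2 * F + F\<^sup>2 * G + 2 * (-H) * F * H" by (rule *)
    also have "\<dots> = F * (F * G - H\<^sup>2)" by algebra
    finally show "H\<^sup>2 \<le> F * G"
      using False \<open>F \<ge> 0\<close> by (simp add: zero_le_mult_iff)
  qed
qed

lemma L2_zero_AE:
  assumes "L2 M f" "(\<integral>x. (f x)\<^sup>2 \<partial>M) \<le> 0"
  shows "AE x in M. f x = 0"
proof -
  have "(\<integral>x. (f x)\<^sup>2 \<partial>M) = 0"
    using assms(2) by (intro antisym) auto
  then have "AE x in M. (f x)\<^sup>2 = 0"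
    using integral_nonneg_eq_0_iff_AE[OF L2_sq[OF assms(1)]] by auto
  then show ?thesis by simp
qed

section \<open>Absolutely continuous functions of one variable\<close>

text \<open>Integrals over open intervals become integrals over a finite measure: square integrable functions
  are then integrable, and Fubini's theorem applies to products of intervals.\<close>

abbreviation Mi :: "real \<Rightarrow> real \<Rightarrow> real measure" where
  "Mi a b \<equiv> restrict_space lborel {a<..<b}"

lemma space_Mi [simp]: "space (Mi a b) = {a<..<b}"
  by (simp add: space_restrict_space)

interpretation Mi: finite_measure "Mi a b" for a b
  by (rule finite_measureI) (cases "a \<le> b"; simp add: emeasure_restrict_space)

interpretation Mi2: pair_sigma_finite "Mi a b" "Mi c d" for a b c d ..

lemma Mi_integrable: "integrable (Mi a b) f \<longleftrightarrow> integrable lborel (\<lambda>x. indicator {a<..<b} x * (f x :: real))"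
  by (subst integrable_restrict_space) auto

lemma Mi_integral: "integral\<^sup>L (Mi a b) f = (\<integral>x. indicator {a<..<b} x * (f x :: real) \<partial>lborel)"
  by (subst integral_restrict_space) auto

lemma Mi_set_integrable: "set_integrable lborel {a<..<b} f \<longleftrightarrow> integrable (Mi a b) (f :: real \<Rightarrow> real)"
  by (simp add: Mi_integrable set_integrable_def)

lemma Mi_set_integral: "(LINT x:{a<..<b}|lborel. f x) = integral\<^sup>L (Mi a b) (f :: real \<Rightarrow> real)"
  by (simp add: Mi_integral set_lebesgue_integral_def)

lemma Mi_L2_on: "L2_on {a<..<b} f \<longleftrightarrow> L2 (Mi a b) (f :: real \<Rightarrow> real)"
  unfolding L2_on_def L2_def Mi_set_integrable set_borel_measurable_def
  by (subst borel_measurable_restrict_space_iff) auto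

lemma Mi_AE: "(AE x in Mi a b. P x) \<longleftrightarrow> (AE x in lborel. a < x \<and> x < b \<longrightarrow> P x)"
  by (subst AE_restrict_space_iff) auto

lemma Mi_AE_neq: "AE x in Mi a b. x \<noteq> c"
  unfolding Mi_AE using AE_lborel_singleton[of c] by auto

lemma Mi_borel: "f \<in> borel_measurable borel \<Longrightarrow> f \<in> borel_measurable (Mi a b)"
  by (intro measurable_restrict_space1) simp

lemma Mi_continuous_measurable:
  "continuous_on {a..b} f \<Longrightarrow> (f :: real \<Rightarrow> real) \<in> borel_measurable (Mi a b)"
proof -
  assume "continuous_on {a..b} f"
  then have "f \<in> borel_measurable (restrict_space borel {a<..<b})"
    by (intro borel_measurable_continuous_on_restrict) (auto elim: continuous_on_subset)
  also have "borel_measurable (restrict_space borel {a<..<b}) = (borel_measurable (Mi a b) :: (real \<Rightarrow> real) set)"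
    by (intro measurable_cong_sets sets_restrict_space_cong) auto
  finally show ?thesis .
qed

lemma continuous_on_Icc_bounded:
  assumes "continuous_on {a..b} (f :: real \<Rightarrow> real)"
  obtains C where "\<And>x. x \<in> {a..b} \<Longrightarrow> \<bar>f x\<bar> \<le> C" "C > 0"
proof -
  have "bounded (f ` {a..b})"
    using assms by (intro compact_imp_bounded compact_continuous_image) auto
  then obtain C where "C > 0" "\<forall>y\<in>f ` {a..b}. norm y \<le> C" by (auto simp: bounded_pos)
  then show ?thesis using that[of C] by auto
qed

lemma Mi_continuous_L2:
  assumes "continuous_on {a..b} f"
  shows "L2 (Mi a b) f"
proof -
  obtain C where "\<And>x. x \<in> {a..b} \<Longrightarrow> \<bar>f x\<bar> \<le> C" using continuous_on_Icc_bounded[OF assms] by blast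
  then show ?thesis
    by (intro Mi.L2_bounded[where C=C] Mi_continuous_measurable assms) auto
qed

lemma L2_mult_continuous:
  assumes "continuous_on {a..b} g" "L2 (Mi a b) f"
  shows "L2 (Mi a b) (\<lambda>x. g x * f x)"
proof -
  obtain C where "\<And>x. x \<in> {a..b} \<Longrightarrow> \<bar>g x\<bar> \<le> C" using continuous_on_Icc_bounded[OF assms(1)] by blast
  then show ?thesis
    by (intro L2_mult_bounded[where C=C] Mi_continuous_measurable assms) auto
qed

lemma integrable_mult_bounded:
  fixes f g :: "'a \<Rightarrow> real"
  assumes f: "integrable M f" and g: "g \<in> borel_measurable M" and b: "\<And>x. x \<in> space M \<Longrightarrow> \<bar>g x\<bar> \<le> C"
  shows "integrable M (\<lambda>x. g x * f x)"
proof (rule Bochner_Integration.integrable_bound)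
  show "integrable M (\<lambda>x. C * f x)" using f by auto
  show "(\<lambda>x. g x * f x) \<in> borel_measurable M" using f g by auto
  show "AE x in M. norm (g x * f x) \<le> norm (C * f x)"
    using b by (intro AE_I2) (force simp: abs_mult intro!: mult_right_mono)
qed

lemma Mi_integrable_mult_continuous:
  assumes "continuous_on {a..b} (g :: real \<Rightarrow> real)" "integrable (Mi a b) f"
  shows "integrable (Mi a b) (\<lambda>x. g x * f x)"
proof -
  obtain C where "\<And>x. x \<in> {a..b} \<Longrightarrow> \<bar>g x\<bar> \<le> C" using continuous_on_Icc_bounded[OF assms(1)] by blast
  then show ?thesis
    by (intro integrable_mult_bounded[where C=C] Mi_continuous_measurable assms) auto
qed

lemma Mi_continuous_integrable: "continuous_on {a..b} f \<Longrightarrow> integrable (Mi a b) (f :: real \<Rightarrow> real)"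
  by (intro Mi.L2_integrable Mi_continuous_L2)

text \<open>The primitive of \<open>f\<close> on \<open>(a, b)\<close> that vanishes at \<open>a\<close>; it is constant outside the interval.\<close>

definition prim :: "real \<Rightarrow> real \<Rightarrow> (real \<Rightarrow> real) \<Rightarrow> real \<Rightarrow> real" where
  "prim a b f x = (\<integral>t. indicator {..<x} t * f t \<partial>Mi a b)"

lemma integrable_cut:
  assumes "integrable (Mi a b) (f :: real \<Rightarrow> real)" "A \<in> sets borel"
  shows "integrable (Mi a b) (\<lambda>t. indicator A t * f t :: real)"
  using assms(2) by (intro integrable_mult_bounded[OF assms(1), where C=1] Mi_borel) (auto simp: indicator_def)

lemma prim_bound: 
  assumes f: "integrable (Mi a b) (f :: real \<Rightarrow> real)" shows "\<bar>prim a b f x\<bar> \<le> (\<integral>t. \<bar>f t\<bar> \<partial>Mi a b)"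
proof -
  have "\<bar>prim a b f x\<bar> \<le> (\<integral>t. \<bar>indicator {..<x} t * f t\<bar> \<partial>Mi a b)"
    unfolding prim_def by (rule integral_abs_bound)
  also have "\<dots> \<le> (\<integral>t. \<bar>f t\<bar> \<partial>Mi a b)"
    by (intro integral_mono integrable_abs integrable_cut f) (auto simp: indicator_def)
  finally show ?thesis .
qed

lemma prim_measurable:
  assumes [measurable]: "integrable (Mi a b) f"
  shows "prim a b f \<in> borel_measurable borel"
proof -
  have [measurable]: "(\<lambda>p. f (snd p)) \<in> borel_measurable (borel \<Otimes>\<^sub>M Mi a b)"
    by measurable
  have [measurable]: "(\<lambda>p. snd p) \<in> borel_measurable (borel \<Otimes>\<^sub>M Mi a b)"
    by (intro measurable_compose[OF measurable_snd] Mi_borel) auto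
  have "(\<lambda>x. \<integral>t. (if t < x then 1 else 0) * f t \<partial>Mi a b) \<in> borel_measurable borel"
    by (rule Mi.borel_measurable_lebesgue_integral) (simp add: split_beta')
  moreover have "prim a b f = (\<lambda>x. \<integral>t. (if t < x then 1 else 0) * f t \<partial>Mi a b)"
    unfolding prim_def by (intro ext Bochner_Integration.integral_cong) (auto simp: indicator_def)
  ultimately show ?thesis by simp
qed

lemma prim_continuous:
  assumes f: "integrable (Mi a b) f"
  shows "continuous_on UNIV (prim a b f)"
  unfolding continuous_on_sequentially
proof safe
  fix X :: "nat \<Rightarrow> real" and x assume X: "X \<longlonglongrightarrow> x"
  have "(\<lambda>n. \<integral>t. indicator {..<X n} t * f t \<partial>Mi a b) \<longlonglongrightarrow> (\<integral>t. indicator {..<x} t * f t \<partial>Mi a b)"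
  proof (rule integral_dominated_convergence[where w="\<lambda>t. \<bar>f t\<bar>"])
    show "AE t in Mi a b. (\<lambda>n. indicator {..<X n} t * f t) \<longlonglongrightarrow> indicator {..<x} t * f t"
      using Mi_AE_neq[of x a b]
    proof eventually_elim
      case (elim t)
      have "eventually (\<lambda>n. indicator {..<X n} t = (indicator {..<x} t :: real)) sequentially"
      proof (cases "t < x")
        case True
        show ?thesis using order_tendstoD(1)[OF X True] by eventually_elim (use True in \<open>auto simp: indicator_def\<close>)
      next
        case False
        then have xt: "x < t" using elim by auto
        show ?thesis using order_tendstoD(2)[OF X xt] by eventually_elim (use xt in \<open>auto simp: indicator_def\<close>)
      qed
      then show ?case by (intro tendsto_intros tendsto_eventually)
    qed
    show "integrable (Mi a b) (\<lambda>t. \<bar>f t\<bar>)" using f by simp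
    show "(\<lambda>t. indicator {..<x} t * f t) \<in> borel_measurable (Mi a b)"
      "(\<lambda>t. indicator {..<X n} t * f t) \<in> borel_measurable (Mi a b)" for n
      by (intro borel_measurable_integrable integrable_cut f; simp)+
  qed (auto simp: indicator_def)
  then show "(prim a b f \<circ> X) \<longlonglongrightarrow> prim a b f x"
    by (simp add: prim_def o_def)
qed

lemma prim_left: "x \<le> a \<Longrightarrow> prim a b f x = 0"
  unfolding prim_def by (subst Bochner_Integration.integral_cong[OF refl, where g="\<lambda>x. 0"]) auto

lemma prim_right: "b \<le> x \<Longrightarrow> prim a b f x = integral\<^sup>L (Mi a b) f"
  unfolding prim_def by (intro Bochner_Integration.integral_cong refl) auto

text \<open>Integration by parts for two primitives is Fubini's theorem for \<open>f(x) g(y)\<close> on a square,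
  split along the diagonal.\<close>

lemma prim_product:
  assumes f: "integrable (Mi a b) f" and g: "integrable (Mi a b) g"
  shows "(\<integral>x. prim a b f x * g x + f x * prim a b g x \<partial>Mi a b) = integral\<^sup>L (Mi a b) f * integral\<^sup>L (Mi a b) g"
    and "integrable (Mi a b) (\<lambda>x. prim a b f x * g x)" and "integrable (Mi a b) (\<lambda>x. f x * prim a b g x)"
proof -
  let ?M = "Mi a b" and ?N = "Mi a b \<Otimes>\<^sub>M Mi a b"
  have *: "integrable ?M (\<lambda>x. prim a b f' x * g' x)" if "integrable ?M f'" "integrable ?M g'" for f' g'
    using prim_bound[OF that(1)] by (intro integrable_mult_bounded[OF that(2)] Mi_borel prim_measurable that(1)) auto
  show i1: "integrable (Mi a b) (\<lambda>x. prim a b f x * g x)" by (rule *[OF f g])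
  show i2: "integrable (Mi a b) (\<lambda>x. f x * prim a b g x)" using *[OF g f] by (simp add: mult.commute)
  note [measurable] = borel_measurable_integrable[OF f] borel_measurable_integrable[OF g]
  have [measurable]: "(\<lambda>p. fst p) \<in> borel_measurable ?N" "(\<lambda>p. snd p) \<in> borel_measurable ?N"
    by (auto intro!: measurable_compose[OF measurable_snd] measurable_compose[OF measurable_fst] Mi_borel)
  have prod: "integrable ?N (\<lambda>(x, y). f x * g y)"
    by (rule Mi2.Fubini_integrable) (use f g in \<open>auto simp: abs_mult\<close>)
  have up: "integrable ?N (\<lambda>(x, y). indicator {p. fst p < snd p} (x, y) * (f x * g y))"
    by (rule Bochner_Integration.integrable_bound[OF prod]) (auto simp: indicator_def)
  have dn: "integrable ?N (\<lambda>(x, y). indicator {p. snd p \<le> fst p} (x, y) * (f x * g y))"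
    by (rule Bochner_Integration.integrable_bound[OF prod]) (auto simp: indicator_def)
  have "integral\<^sup>L ?M f * integral\<^sup>L ?M g = (\<integral>x. (\<integral>y. f x * g y \<partial>?M) \<partial>?M)"
    by simp
  also have "\<dots> = (\<integral>p. (case p of (x, y) \<Rightarrow> f x * g y) \<partial>?N)"
    using Mi2.integral_fst[OF prod] by simp
  also have "\<dots> = (\<integral>p. (case p of (x, y) \<Rightarrow> indicator {p. fst p < snd p} (x, y) * (f x * g y))
      + (case p of (x, y) \<Rightarrow> indicator {p. snd p \<le> fst p} (x, y) * (f x * g y)) \<partial>?N)"
    by (intro Bochner_Integration.integral_cong) (auto simp: indicator_def)
  also have "\<dots> = (\<integral>p. (case p of (x, y) \<Rightarrow> indicator {p. fst p < snd p} (x, y) * (f x * g y)) \<partial>?N)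
      + (\<integral>p. (case p of (x, y) \<Rightarrow> indicator {p. snd p \<le> fst p} (x, y) * (f x * g y)) \<partial>?N)"
    by (rule Bochner_Integration.integral_add[OF up dn])
  also have "(\<integral>p. (case p of (x, y) \<Rightarrow> indicator {p. fst p < snd p} (x, y) * (f x * g y)) \<partial>?N)
      = (\<integral>y. (\<integral>x. indicator {p. fst p < snd p} (x, y) * (f x * g y) \<partial>?M) \<partial>?M)"
    using Mi2.integral_snd[OF up] by simp
  also have "\<dots> = (\<integral>y. prim a b f y * g y \<partial>?M)"
  proof (intro Bochner_Integration.integral_cong refl)
    fix y
    have "(\<integral>x. indicator {p. fst p < snd p} (x, y) * (f x * g y) \<partial>?M)
        = (\<integral>x. indicator {..<y} x * f x * g y \<partial>?M)"
      by (intro Bochner_Integration.integral_cong) (auto simp: indicator_def)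
    then show "(\<integral>x. indicator {p. fst p < snd p} (x, y) * (f x * g y) \<partial>?M) = prim a b f y * g y"
      by (simp add: prim_def)
  qed
  also have "(\<integral>p. (case p of (x, y) \<Rightarrow> indicator {p. snd p \<le> fst p} (x, y) * (f x * g y)) \<partial>?N)
      = (\<integral>x. (\<integral>y. indicator {p. snd p \<le> fst p} (x, y) * (f x * g y) \<partial>?M) \<partial>?M)"
    using Mi2.integral_fst[OF dn] by simp
  also have "\<dots> = (\<integral>x. f x * prim a b g x \<partial>?M)"
  proof (intro Bochner_Integration.integral_cong refl)
    fix x
    have "(\<integral>y. indicator {p. snd p \<le> fst p} (x, y) * (f x * g y) \<partial>?M)
        = (\<integral>y. f x * (indicator {..<x} y * g y) \<partial>?M)"
    proof (rule integral_cong_AE)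
      show "AE y in ?M. indicator {p. snd p \<le> fst p} (x, y) * (f x * g y) = f x * (indicator {..<x} y * g y)"
        using Mi_AE_neq[of x a b] by eventually_elim (auto simp: indicator_def)
      have [measurable]: "(\<lambda>y. indicator {p. snd p \<le> fst p} (x, y) :: real) \<in> borel_measurable ?M"
        "(\<lambda>y. indicator {..<x} y :: real) \<in> borel_measurable ?M"
        by (auto intro!: Mi_borel simp: indicator_def)
      show "(\<lambda>y. indicator {p. snd p \<le> fst p} (x, y) * (f x * g y)) \<in> borel_measurable ?M"
        "(\<lambda>y. f x * (indicator {..<x} y * g y)) \<in> borel_measurable ?M" by measurable
    qed
    then show "(\<integral>y. indicator {p. snd p \<le> fst p} (x, y) * (f x * g y) \<partial>?M) = f x * prim a b g x"
      by (simp add: prim_def)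
  qed
  finally show "(\<integral>x. prim a b f x * g x + f x * prim a b g x \<partial>Mi a b) = integral\<^sup>L (Mi a b) f * integral\<^sup>L (Mi a b) g"
    using i1 i2 by simp
qed

text \<open>Absolute continuity as being a primitive. The derivative \<open>u'\<close> is a parameter, since it is determined
  only almost everywhere.\<close>

definition ac :: "real \<Rightarrow> real \<Rightarrow> (real \<Rightarrow> real) \<Rightarrow> (real \<Rightarrow> real) \<Rightarrow> bool" where
  "ac a b u u' \<longleftrightarrow> integrable (Mi a b) u' \<and> (\<forall>x\<in>{a..b}. u x = u a + prim a b u' x)"

lemma ac_integrable: "ac a b u u' \<Longrightarrow> integrable (Mi a b) u'"
  unfolding ac_def by blast

lemma ac_eq: "ac a b u u' \<Longrightarrow> x \<in> {a..b} \<Longrightarrow> u x = u a + prim a b u' x"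
  unfolding ac_def by blast

lemma acI: "integrable (Mi a b) u' \<Longrightarrow> (\<And>x. x \<in> {a..b} \<Longrightarrow> u x = u a + prim a b u' x) \<Longrightarrow> ac a b u u'"
  unfolding ac_def by blast

lemma ac_continuous: "ac a b u u' \<Longrightarrow> continuous_on {a..b} u"
proof -
  assume u: "ac a b u u'"
  have "continuous_on {a..b} (\<lambda>x. u a + prim a b u' x)"
    using prim_continuous[OF ac_integrable[OF u]] by (intro continuous_intros) (auto elim: continuous_on_subset)
  then show ?thesis by (subst continuous_on_cong[OF refl ac_eq[OF u]]) auto
qed

lemma ac_integral: "ac a b u u' \<Longrightarrow> a \<le> b \<Longrightarrow> (\<integral>x. u' x \<partial>Mi a b) = u b - u a"
  using ac_eq[of a b u u' b] by (simp only: prim_right[OF order_refl]) simp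

lemma prim_add:
  "integrable (Mi a b) f \<Longrightarrow> integrable (Mi a b) g \<Longrightarrow> prim a b (\<lambda>x. f x + g x) x = prim a b f x + prim a b g x"
  unfolding prim_def distrib_left by (intro Bochner_Integration.integral_add integrable_cut) auto

lemma prim_scale: "prim a b (\<lambda>x. c * f x) x = c * prim a b f x"
  unfolding prim_def by (subst mult.left_commute) simp

lemma ac_add: "ac a b u u' \<Longrightarrow> ac a b v v' \<Longrightarrow> ac a b (\<lambda>x. u x + v x) (\<lambda>x. u' x + v' x)"
proof (rule acI)
  assume u: "ac a b u u'" and v: "ac a b v v'"
  show "integrable (Mi a b) (\<lambda>x. u' x + v' x)" using ac_integrable[OF u] ac_integrable[OF v] by simp
  fix x assume x: "x \<in> {a..b}"
  show "u x + v x = u a + v a + prim a b (\<lambda>x. u' x + v' x) x"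
    using ac_eq[OF u x] ac_eq[OF v x] prim_add[OF ac_integrable[OF u] ac_integrable[OF v], of x] by linarith
qed

lemma ac_scale: "ac a b u u' \<Longrightarrow> ac a b (\<lambda>x. c * u x) (\<lambda>x. c * u' x)"
proof (rule acI)
  assume u: "ac a b u u'"
  show "integrable (Mi a b) (\<lambda>x. c * u' x)" using ac_integrable[OF u] by simp
  fix x assume x: "x \<in> {a..b}"
  show "c * u x = c * u a + prim a b (\<lambda>x. c * u' x) x"
    using arg_cong[OF ac_eq[OF u x], of "\<lambda>z. c * z"] unfolding prim_scale distrib_left .
qed

lemma ac_diff: "ac a b u u' \<Longrightarrow> ac a b v v' \<Longrightarrow> ac a b (\<lambda>x. u x - v x) (\<lambda>x. u' x - v' x)"
  using ac_add[OF _ ac_scale, of a b u u' v v' "-1"] by simp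

text \<open>With \<open>u'\<close> and \<open>v'\<close> cut off at \<open>x\<close>, this is \<open>prim_product\<close> for their primitives.\<close>

lemma ac_mult:
  assumes u: "ac a b u u'" and v: "ac a b v v'"
  shows "ac a b (\<lambda>x. u x * v x) (\<lambda>x. u x * v' x + u' x * v x)"
proof -
  let ?M = "Mi a b"
  note iu = ac_integrable[OF u] and iv = ac_integrable[OF v]
  note cu = ac_continuous[OF u] and cv = ac_continuous[OF v]
  have i1: "integrable ?M (\<lambda>x. u x * v' x)" and i2: "integrable ?M (\<lambda>x. u' x * v x)"
    using Mi_integrable_mult_continuous[OF cu iv] Mi_integrable_mult_continuous[OF cv iu]
    by (auto simp: mult.commute)
  have "u x * v x = u a * v a + prim a b (\<lambda>x. u x * v' x + u' x * v x) x" if x: "x \<in> {a..b}" for x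
  proof -
    define f g where "f = (\<lambda>t. indicator {..<x} t * u' t)" and "g = (\<lambda>t. indicator {..<x} t * v' t)"
    have fi: "integrable ?M f" and gi: "integrable ?M g"
      unfolding f_def g_def by (intro integrable_cut iu iv; simp)+
    have pf: "prim a b f y = prim a b u' y" "prim a b g y = prim a b v' y" if "y < x" for y
      unfolding prim_def f_def g_def using that
      by (auto intro!: Bochner_Integration.integral_cong simp: indicator_def)
    have If: "integral\<^sup>L ?M f = prim a b u' x" "integral\<^sup>L ?M g = prim a b v' x"
      unfolding prim_def f_def g_def by simp_all
    have "prim a b (\<lambda>x. u x * v' x + u' x * v x) x
        = (\<integral>t. u a * g t + v a * f t + (prim a b f t * g t + f t * prim a b g t) \<partial>?M)"
      unfolding prim_def[of a b _ x]
    proof (intro Bochner_Integration.integral_cong refl)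
      fix t assume "t \<in> space ?M"
      then have "t \<in> {a..b}" by auto
      then show "indicator {..<x} t * (u t * v' t + u' t * v t)
        = u a * g t + v a * f t + (prim a b f t * g t + f t * prim a b g t)"
      proof (cases "t < x")
        case True
        have p: "prim a b f t = u t - u a" "prim a b g t = v t - v a"
          using pf[OF True] ac_eq[OF u \<open>t \<in> {a..b}\<close>] ac_eq[OF v \<open>t \<in> {a..b}\<close>] by linarith+
        have ft: "f t = u' t" "g t = v' t" using True by (simp_all add: f_def g_def)
        show ?thesis using True unfolding p ft by (simp add: algebra_simps)
      next
        case False
        then show ?thesis by (simp add: f_def g_def)
      qed
    qed
    also have "\<dots> = u a * prim a b v' x + v a * prim a b u' x + prim a b u' x * prim a b v' x"
      using prim_product[OF fi gi] fi gi by (simp add: If)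
    also have "\<dots> = u x * v x - u a * v a"
      using ac_eq[OF u x] ac_eq[OF v x] by (simp add: algebra_simps)
    finally show ?thesis by simp
  qed
  then show ?thesis using i1 i2 by (intro acI Bochner_Integration.integrable_add)
qed

lemma ac_C1:
  assumes d: "\<And>x. x \<in> {a..b} \<Longrightarrow> (f has_real_derivative f' x) (at x)" and c: "continuous_on {a..b} f'"
  shows "ac a b f f'"
proof (rule acI)
  show "integrable (Mi a b) f'" by (rule Mi_continuous_integrable[OF c])
  fix x assume x: "x \<in> {a..b}"
  have "(LBINT t=ereal a..ereal x. f' t) = f x - f a"
  proof (rule interval_integral_FTC_finite)
    show "continuous_on {min a x..max a x} f'" using x by (intro continuous_on_subset[OF c]) auto
    fix t assume "min a x \<le> t" "t \<le> max a x"
    then show "(f has_vector_derivative f' t) (at t within {min a x..max a x})"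
      using x d[of t] has_field_derivative_at_within
      by (auto simp flip: has_real_derivative_iff_has_vector_derivative)
  qed
  moreover have "(LBINT t=ereal a..ereal x. f' t) = prim a b f' x"
    using x unfolding prim_def Mi_integral
    by (simp add: interval_lebesgue_integral_le_eq set_lebesgue_integral_def)
       (intro Bochner_Integration.integral_cong, auto simp: indicator_def)
  ultimately show "f x = f a + prim a b f' x" by simp
qed

lemma Mi_integrable_sub:
  assumes "integrable (Mi a b) (f :: real \<Rightarrow> real)" "a \<le> c" "d \<le> b"
  shows "integrable (Mi c d) f"
proof -
  have "integrable lborel (\<lambda>x. indicator {c<..<d} x *\<^sub>R (indicator {a<..<b} x * f x))"
    using assms(1) unfolding Mi_integrable by (intro integrable_mult_indicator) auto
  also have "(\<lambda>x. indicator {c<..<d} x *\<^sub>R (indicator {a<..<b} x * f x)) = (\<lambda>x. indicator {c<..<d} x * f x)"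
    using assms(2,3) by (auto simp: indicator_def)
  finally show ?thesis unfolding Mi_integrable .
qed

lemma Mi_L2_sub: "L2 (Mi a b) f \<Longrightarrow> a \<le> c \<Longrightarrow> d \<le> b \<Longrightarrow> L2 (Mi c d) f"
proof -
  assume f: "L2 (Mi a b) f" and cd: "a \<le> c" "d \<le> b"
  have "f \<in> borel_measurable (Mi c d)"
    by (rule borel_measurable_integrable[OF Mi_integrable_sub[OF Mi.L2_integrable[OF f] cd]])
  then show ?thesis using Mi_integrable_sub[OF L2_sq[OF f] cd] by (simp add: L2_def)
qed

lemma Mi_integral_sub: 
  assumes "a \<le> c" "d \<le> b"
  shows "(\<integral>x. (f x :: real) \<partial>Mi c d) = (\<integral>x. indicator {c<..<d} x * f x \<partial>Mi a b)"
  unfolding Mi_integral using assms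
  by (intro Bochner_Integration.integral_cong refl) (auto simp: indicator_def)

lemma ac_sub:
  assumes u: "ac a b u u'" and cd: "a \<le> c" "c \<le> d" "d \<le> b"
  shows "ac c d u u'"
 proof (rule acI)
  show "integrable (Mi c d) u'" using Mi_integrable_sub ac_integrable[OF u] cd by blast
  fix x assume x: "x \<in> {c..d}"
  have "prim c d u' x = (\<integral>t. indicator {c<..<d} t * (indicator {..<x} t * u' t) \<partial>Mi a b)"
    unfolding prim_def using cd by (intro Mi_integral_sub) auto
  also have "\<dots> = (\<integral>t. indicator {..<x} t * u' t - indicator {..<c} t * u' t \<partial>Mi a b)"
  proof (rule integral_cong_AE)
    show "AE t in Mi a b. indicator {c<..<d} t * (indicator {..<x} t * u' t) = indicator {..<x} t * u' t - indicator {..<c} t * u' t"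
      using Mi_AE_neq[of c a b] by eventually_elim (use x in \<open>auto simp: indicator_def\<close>)
  qed (intro borel_measurable_integrable integrable_cut Bochner_Integration.integrable_diff ac_integrable[OF u]; simp)+
  also have "\<dots> = prim a b u' x - prim a b u' c"
    unfolding prim_def by (intro Bochner_Integration.integral_diff integrable_cut ac_integrable[OF u]) auto
  finally show "u x = u c + prim c d u' x"
    using ac_eq[OF u, of x] ac_eq[OF u, of c] x cd by simp
qed

lemma Mi_integral_split:
  assumes f: "integrable (Mi a b) (f :: real \<Rightarrow> real)" and c: "a \<le> c" "c \<le> b"
  shows "(\<integral>x. f x \<partial>Mi a b) = (\<integral>x. f x \<partial>Mi a c) + (\<integral>x. f x \<partial>Mi c b)"
proof -
  have "(\<integral>x. f x \<partial>Mi a b) = (\<integral>x. indicator {a<..<c} x * f x + indicator {c<..<b} x * f x \<partial>Mi a b)"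
  proof (rule integral_cong_AE)
    show "AE x in Mi a b. f x = indicator {a<..<c} x * f x + indicator {c<..<b} x * f x"
      using Mi_AE_neq[of c a b] AE_space by eventually_elim (auto simp: indicator_def)
  qed (intro borel_measurable_integrable integrable_cut Bochner_Integration.integrable_add f; simp)+
  also have "\<dots> = (\<integral>x. indicator {a<..<c} x * f x \<partial>Mi a b) + (\<integral>x. indicator {c<..<b} x * f x \<partial>Mi a b)"
    by (intro Bochner_Integration.integral_add integrable_cut f) auto
  finally show ?thesis using c Mi_integral_sub[of a a c b f] Mi_integral_sub[of a c b b f] by simp
qed

lemma Mi_integral_reflect: "(\<integral>x. (f (- x) :: real) \<partial>Mi a b) = (\<integral>x. f x \<partial>Mi (-b) (-a))"
proof -
  have "(\<integral>x. f x \<partial>Mi (-b) (-a)) = (\<integral>x. indicator {-b<..<-a} (-x) * f (- x) \<partial>lborel)"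
    unfolding Mi_integral using lborel_integral_real_affine[of "-1" "\<lambda>x. indicator {-b<..<-a} x * f x" 0]
    by simp
  also have "\<dots> = (\<integral>x. f (- x) \<partial>Mi a b)"
    unfolding Mi_integral by (intro Bochner_Integration.integral_cong) (auto simp: indicator_def)
  finally show ?thesis ..
qed

lemma Mi_integrable_reflect: "integrable (Mi (-b) (-a)) f \<longleftrightarrow> integrable (Mi a b) (\<lambda>x. f (- x) :: real)"
proof -
  have "integrable (Mi (-b) (-a)) f \<longleftrightarrow> integrable lborel (\<lambda>x. indicator {-b<..<-a} (0 + (-1) * x) * f (0 + (-1) * x))"
    unfolding Mi_integrable by (subst lborel_integrable_real_affine_iff[of "-1" _ 0]) auto
  also have "(\<lambda>x. indicator {-b<..<-a} (0 + (-1) * x) * f (0 + (-1) * x)) = (\<lambda>x. indicator {a<..<b} x * f (- x))"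
    by (auto simp: indicator_def)
  finally show ?thesis unfolding Mi_integrable .
qed

text \<open>An integrable function all of whose primitives vanish is zero, by the \<open>\<pi>\<close>-\<open>\<lambda>\<close> theorem.\<close>

lemma prim_zero_AE:
  assumes f: "integrable (Mi a b) f" and z: "\<And>x. x \<in> {a..b} \<Longrightarrow> prim a b f x = 0"
  shows "AE x in Mi a b. f x = 0"
proof (rule Mi.density_zero[OF f])
  have z': "prim a b f x = 0" for x
  proof (cases "a \<le> b")
    case True
    then show ?thesis
      using z[of x] z[of b] prim_left[of x a b f] prim_right[of b x a f] prim_right[of b b a f]
      by (cases "x < a"; cases "x > b") auto
  next
    case False
    then show ?thesis unfolding prim_def by (intro integral_eq_zero_AE AE_I2) auto
  qed
  have int: "set_lebesgue_integral (Mi a b) A f = 0" if "A \<in> sets borel" for A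
  proof -
    have lessThan_min: "{..<min c d} = {..<c} \<inter> {..<d}" for c d :: real by auto
    have "Int_stable (range (lessThan :: real \<Rightarrow> real set))" "range (lessThan :: real \<Rightarrow> real set) \<subseteq> Pow UNIV"
      "A \<in> sigma_sets UNIV (range lessThan)"
      using that by (auto simp: borel_Iio Int_stable_def simp flip: lessThan_min)
    then show ?thesis
    proof (induction A rule: sigma_sets_induct_disjoint)
      case (basic A)
      then show ?case using z' by (auto simp: prim_def set_lebesgue_integral_def)
    next
      case empty
      show ?case by (simp add: set_lebesgue_integral_def)
    next
      case (compl A)
      then have A: "A \<in> sets borel" by (simp add: borel_Iio)
      have "set_lebesgue_integral (Mi a b) (UNIV - A) f = (\<integral>x. f x - indicator A x * f x \<partial>Mi a b)"
        unfolding set_lebesgue_integral_def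
        by (intro Bochner_Integration.integral_cong) (auto simp: indicator_def)
      also have "\<dots> = integral\<^sup>L (Mi a b) f - set_lebesgue_integral (Mi a b) A f"
        unfolding set_lebesgue_integral_def using A
        by (subst Bochner_Integration.integral_diff) (auto intro!: f integrable_cut)
      also have "integral\<^sup>L (Mi a b) f = 0"
        using z'[of b] by (simp add: prim_right)
      finally show ?case using compl.IH by simp
    next
      case (union A)
      then have A: "A i \<in> sets borel" for i by (auto simp: borel_Iio)
      define B where "B i = A i \<inter> {a<..<b}" for i
      have B: "B i \<in> sets (Mi a b)" for i using A by (auto simp: B_def sets_restrict_space)
      have "set_lebesgue_integral (Mi a b) (\<Union>i. B i) f = (\<Sum>i. set_lebesgue_integral (Mi a b) (B i) f)"
      proof (rule lebesgue_integral_countable_add)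
        show "B i \<inter> B j = {}" if "i \<noteq> j" for i j
          using union.hyps(1) that by (auto simp: disjoint_family_on_def B_def)
        have "(\<Union>i. B i) \<in> sets (Mi a b)" using B by auto
        then show "set_integrable (Mi a b) (\<Union>i. B i) f"
          unfolding set_integrable_def by (intro integrable_mult_indicator f)
      qed (use B in auto)
      moreover have "set_lebesgue_integral (Mi a b) (C \<inter> {a<..<b}) f = set_lebesgue_integral (Mi a b) C f" for C
        unfolding set_lebesgue_integral_def
        by (intro Bochner_Integration.integral_cong) (auto simp: indicator_def)
      moreover have "(\<Union>i. B i) = (\<Union>i. A i) \<inter> {a<..<b}" by (auto simp: B_def)
      ultimately show ?case using union.IH by (simp add: B_def)
    qed
  qed
  fix A assume "A \<in> sets (Mi a b)"
  then have "A \<in> sets borel" by (auto simp: sets_restrict_space)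
  then show "set_lebesgue_integral (Mi a b) A f = 0" by (rule int)
qed

subsection \<open>Weak derivatives\<close>

text \<open>A continuous function with compact support in the open interval and mean zero has a primitive
  that is a test function.\<close>

lemma C1_test_primitive:
  assumes l: "l > 0" and g: "continuous_on UNIV g" and r: "\<rho> < l" "\<And>s. \<rho> \<le> \<bar>s\<bar> \<Longrightarrow> g s = 0"
    and z: "(\<integral>s. g s \<partial>Mi (-l) l) = 0"
  obtains \<psi> where "C1_test l \<psi> g"
proof -
  define \<psi> where "\<psi> s = (LBINT t=ereal (-l)..ereal s. g t)" for s
  have d: "(\<psi> has_real_derivative g s) (at s)" for s
  proof -
    define R where "R = max \<bar>s\<bar> l + 1"
    have "((\<lambda>u. LBINT t=ereal (-l)..ereal u. g t) has_vector_derivative g s) (at s within {-R..R})"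
      by (rule interval_integral_FTC2) (use l in \<open>auto simp: R_def intro: continuous_on_subset[OF g]\<close>)
    moreover have "at s within {-R..R} = at s"
      by (rule at_within_interior) (auto simp: R_def)
    ultimately show ?thesis
      by (simp add: \<psi>_def[abs_def] has_real_derivative_iff_has_vector_derivative)
  qed
  define \<rho>' where "\<rho>' = max \<rho> 0"
  have r': "\<rho>' < l" "0 \<le> \<rho>'" "\<And>s. \<rho>' \<le> \<bar>s\<bar> \<Longrightarrow> g s = 0" using l r by (auto simp: \<rho>'_def)
  have "\<psi> s = 0" if "\<rho>' \<le> \<bar>s\<bar>" for s
  proof -
    consider "s < -l" | "-l \<le> s" "s \<le> -\<rho>'" | "\<rho>' \<le> s" using \<open>\<rho>' \<le> \<bar>s\<bar>\<close> by linarith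
    then show ?thesis
    proof cases
      case 1
      have "(LINT t:{s<..<-l}|lborel. g t) = (LINT t:{s<..<-l}|lborel. 0)"
        by (rule set_lebesgue_integral_cong) (use r'(1,2) in \<open>auto intro!: r'(3)\<close>)
      then show ?thesis using 1 by (simp add: \<psi>_def interval_lebesgue_integral_gt_eq)
    next
      case 2
      have "(LINT t:{-l<..<s}|lborel. g t) = (LINT t:{-l<..<s}|lborel. 0)"
        by (rule set_lebesgue_integral_cong) (use r'(1,2) 2 in \<open>auto intro!: r'(3)\<close>)
      then show ?thesis using 2 by (simp add: \<psi>_def interval_lebesgue_integral_le_eq)
    next
      case 3
      have "(LINT t:{-l<..<s}|lborel. g t) = (LINT t:{-l<..<l}|lborel. g t)"
        unfolding set_lebesgue_integral_def
        by (intro Bochner_Integration.integral_cong)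
           (use r'(1,2) 3 in \<open>auto intro!: r'(3) simp: indicator_def\<close>)
      then show ?thesis using 3 r' z by (simp add: \<psi>_def interval_lebesgue_integral_le_eq Mi_set_integral)
    qed
  qed
  then show ?thesis using that[of \<psi>] d g r'(1) by (auto simp: C1_test_def)
qed

text \<open>Continuous trapezoids supported in \<open>(-l, x)\<close>, equal to \<open>1\<close> at distance at least \<open>2 / (n + 1)\<close> from
  both ends.\<close>

definition hat :: "real \<Rightarrow> real \<Rightarrow> nat \<Rightarrow> real \<Rightarrow> real" where
  "hat l x n t = max 0 (min 1 (min (t + l) (x - t) * real (Suc n) - 1))"

lemma hat_continuous: "continuous_on A (hat l x n)"
  unfolding hat_def by (intro continuous_intros)

lemma hat_bound: "\<bar>hat l x n t\<bar> \<le> 1"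
  by (simp add: hat_def)

lemma hat_zero: 
  assumes "x \<le> l" "l - inverse (real (Suc n)) \<le> \<bar>t\<bar>" shows "hat l x n t = 0"
proof -
  have "min (t + l) (x - t) \<le> inverse (real (Suc n))" using assms by linarith
  then have "min (t + l) (x - t) * real (Suc n) \<le> inverse (real (Suc n)) * real (Suc n)"
    by (intro mult_right_mono) auto
  then show ?thesis unfolding hat_def by simp
qed

lemma hat_tendsto:
  assumes "t \<in> {-l<..<l}" shows "(\<lambda>n. hat l x n t) \<longlonglongrightarrow> indicator {..<x} t"
proof (cases "t < x")
  case True
  define d where "d = min (t + l) (x - t)"
  have "d > 0" using True assms by (auto simp: d_def)
  obtain N :: nat where N: "2 / d < real N" using reals_Archimedean2 by blast
  have "eventually (\<lambda>n. hat l x n t = 1) sequentially"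
    unfolding eventually_sequentially
  proof (intro exI allI impI)
    fix n assume "N \<le> n"
    then have "2 / d \<le> real (Suc n)" using N by linarith
    then have "2 \<le> d * real (Suc n)" using \<open>d > 0\<close> by (simp add: field_simps)
    then show "hat l x n t = 1" unfolding hat_def d_def by simp
  qed
  then show ?thesis using True by (simp add: tendsto_eventually)
next
  case False
  have "hat l x n t = 0" for n
  proof -
    have "min (t + l) (x - t) * real (Suc n) \<le> 0" using False by (intro mult_nonpos_nonneg) auto
    then show ?thesis unfolding hat_def by simp
  qed
  then show ?thesis using False by simp
qed

lemma hat_integral_tendsto:
  assumes f: "integrable (Mi (-l) l) f"
  shows "(\<lambda>n. \<integral>t. hat l x n t * f t \<partial>Mi (-l) l) \<longlonglongrightarrow> prim (-l) l f x"
  unfolding prim_def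
proof (rule integral_dominated_convergence[where w="\<lambda>t. \<bar>f t\<bar>"])
  show "integrable (Mi (-l) l) (\<lambda>t. \<bar>f t\<bar>)" using f by simp
  show "(\<lambda>t. indicator {..<x} t * f t) \<in> borel_measurable (Mi (-l) l)"
    by (intro borel_measurable_integrable integrable_cut f) simp
  show "(\<lambda>t. hat l x n t * f t) \<in> borel_measurable (Mi (-l) l)" for n
    by (intro borel_measurable_integrable Mi_integrable_mult_continuous f hat_continuous)
  show "AE t in Mi (-l) l. (\<lambda>n. hat l x n t * f t) \<longlonglongrightarrow> indicator {..<x} t * f t"
    by (intro AE_I2 tendsto_intros hat_tendsto) auto
  show "AE t in Mi (-l) l. norm (hat l x n t * f t) \<le> \<bar>f t\<bar>" for n
    using hat_bound[of l x n] by (intro AE_I2) (auto simp: abs_mult intro!: mult_left_le_one_le)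
qed

text \<open>The lemma of du Bois-Reymond: the functions \<open>hat\<close> increase to the indicator of \<open>(-l, x)\<close>, and
  after subtraction of a multiple of a fixed bump they are derivatives of test functions.\<close>

lemma du_Bois_Reymond:
  assumes l: "l > 0" and f: "integrable (Mi (-l) l) f"
    and z: "\<And>\<psi> \<psi>'. C1_test l \<psi> \<psi>' \<Longrightarrow> (\<integral>s. f s * \<psi>' s \<partial>Mi (-l) l) = 0"
  obtains c where "AE s in Mi (-l) l. f s = c"
proof -
  let ?M = "Mi (-l) l"
  have one: "integrable ?M (\<lambda>t. 1)" by simp
  have m: "measure ?M (space ?M) = 2 * l"
    using l by (simp add: measure_restrict_space)
  then have "prim (-l) l (\<lambda>t. 1) l = 2 * l" by (simp add: prim_right)
  then have "(\<lambda>n. \<integral>t. hat l l n t \<partial>?M) \<longlonglongrightarrow> 2 * l"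
    using hat_integral_tendsto[OF one, of l] by simp
  from order_tendstoD(1)[OF this, of 0] l obtain N where N: "(\<integral>t. hat l l N t \<partial>?M) > 0"
    by (auto simp: eventually_sequentially)
  define \<eta> where "\<eta> t = hat l l N t / (\<integral>t. hat l l N t \<partial>?M)" for t
  have \<eta>: "continuous_on UNIV \<eta>" "(\<integral>t. \<eta> t \<partial>?M) = 1"
    using N by (auto simp: \<eta>_def[abs_def] intro!: continuous_intros hat_continuous)
  have \<eta>i: "integrable ?M \<eta>" by (rule Mi_continuous_integrable[OF continuous_on_subset[OF \<eta>(1)]]) simp
  define c where "c = (\<integral>t. \<eta> t * f t \<partial>?M)"
  have key: "(\<integral>t. hat l x n t * f t \<partial>?M) = (\<integral>t. hat l x n t \<partial>?M) * c" if x: "x \<le> l" for x n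
  proof -
    define h where "h = (\<integral>t. hat l x n t \<partial>?M)"
    define g where "g t = hat l x n t - h * \<eta> t" for t
    have hi: "integrable ?M (hat l x n)" by (intro Mi_continuous_integrable hat_continuous)
    define \<rho> where "\<rho> = max (l - inverse (real (Suc n))) (l - inverse (real (Suc N)))"
    have "\<rho> < l" by (simp add: \<rho>_def)
    moreover have "g s = 0" if "\<rho> \<le> \<bar>s\<bar>" for s
      using that x by (auto simp: g_def \<eta>_def \<rho>_def hat_zero)
    moreover have "continuous_on UNIV g"
      unfolding g_def by (intro continuous_intros hat_continuous \<eta>)
    moreover have "(\<integral>s. g s \<partial>?M) = 0"
      unfolding g_def using hi \<eta>i \<eta>(2) by (simp add: h_def)
    ultimately obtain \<psi> where "C1_test l \<psi> g" using C1_test_primitive[OF l] by metis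
    then have "0 = (\<integral>s. f s * g s \<partial>?M)" using z by simp
    also have "\<dots> = (\<integral>s. hat l x n s * f s - h * (\<eta> s * f s) \<partial>?M)"
      by (intro Bochner_Integration.integral_cong) (auto simp: g_def algebra_simps)
    also have "\<dots> = (\<integral>s. hat l x n s * f s \<partial>?M) - h * c"
      using Mi_integrable_mult_continuous[OF hat_continuous f, of l x n]
        Mi_integrable_mult_continuous[OF continuous_on_subset[OF \<eta>(1) subset_UNIV] f]
      by (simp add: c_def)
    finally show ?thesis by (simp add: h_def)
  qed
  have "prim (-l) l (\<lambda>t. f t - c) x = 0" if x: "x \<in> {-l..l}" for x
  proof -
    have "(\<lambda>n. (\<integral>t. hat l x n t \<partial>?M) * c) \<longlonglongrightarrow> prim (-l) l (\<lambda>t. 1) x * c"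
      using hat_integral_tendsto[OF one, of x] by (intro tendsto_intros) simp
    moreover have "(\<lambda>n. (\<integral>t. hat l x n t \<partial>?M) * c) \<longlonglongrightarrow> prim (-l) l f x"
      using hat_integral_tendsto[OF f, of x] key[of x] x by simp
    ultimately have "prim (-l) l f x = prim (-l) l (\<lambda>t. 1) x * c"
      using LIMSEQ_unique by blast
    moreover have "prim (-l) l (\<lambda>t. f t + (-c) * 1) x = prim (-l) l f x + (-c) * prim (-l) l (\<lambda>t. 1) x"
      unfolding prim_scale[symmetric] by (intro prim_add f) simp
    ultimately show ?thesis by simp
  qed
  then have "AE s in ?M. f s - c = 0"
    using f by (intro prim_zero_AE) auto
  then show ?thesis using that[of c] by simp
qed

text \<open>A null set contains no interval.\<close>

lemma Mi_AE_closure: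
  assumes ae: "AE x in Mi a b. P x" and x: "x \<in> {a..b}" and "a < b"
  shows "x \<in> closure {x \<in> {a<..<b}. P x}"
  unfolding closure_approachable
proof safe
  fix e :: real assume "e > 0"
  define c d where "c = max a (x - e)" and "d = min b (x + e)"
  have cd: "c < d" using x \<open>e > 0\<close> \<open>a < b\<close> by (auto simp: c_def d_def)
  have "\<not> (AE t in lborel. t \<notin> {c<..<d})"
  proof
    assume "AE t in lborel. t \<notin> {c<..<d}"
    then have "emeasure lborel {c<..<d} = 0"
      by (subst (asm) AE_iff_measurable[of "{c<..<d}"]) auto
    then show False using cd by simp
  qed
  then obtain t where t: "t \<in> {c<..<d}" "P t"
  proof -
    assume n: "\<not> (AE t in lborel. t \<notin> {c<..<d})" and th: "\<And>t. t \<in> {c<..<d} \<Longrightarrow> P t \<Longrightarrow> thesis"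
    have "\<exists>t. t \<in> {c<..<d} \<and> P t"
    proof (rule ccontr)
      assume no: "\<nexists>t. t \<in> {c<..<d} \<and> P t"
      have "AE t in lborel. t \<notin> {c<..<d}"
        using ae unfolding Mi_AE by eventually_elim (use no in \<open>auto simp: c_def d_def\<close>)
      with n show False by simp
    qed
    then show thesis using th by blast
  qed
  then show "\<exists>y\<in>{x \<in> {a<..<b}. P x}. dist y x < e"
    by (intro bexI[of _ t]) (auto simp: c_def d_def dist_real_def)
qed

lemma continuous_AE_eq:
  assumes ae: "AE x in Mi a b. f x = (c::real)" and f: "continuous_on {a..b} f" and "x \<in> {a..b}" "a < b"
  shows "f x = c"
proof (rule continuous_constant_on_closure[where f=f and a=c and x=x and S="{x \<in> {a<..<b}. f x = c}"])
  have "closure {x \<in> {a<..<b}. f x = c} \<subseteq> {a..b}"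
    by (rule closure_minimal) auto
  then show "continuous_on (closure {x \<in> {a<..<b}. f x = c}) f"
    using f continuous_on_subset by blast
qed (use Mi_AE_closure[OF ae assms(3,4)] in auto)

lemma ac_prim: "integrable (Mi a b) f \<Longrightarrow> ac a b (prim a b f) f"
  by (rule acI) (auto simp: prim_left)

lemma C1_test_ac:
  assumes "C1_test l \<psi> \<psi>'" shows "ac (-l) l \<psi> \<psi>'"
  using assms by (intro ac_C1) (auto simp: C1_test_def intro: continuous_on_subset)

lemma C1_test_zero: "C1_test l \<psi> \<psi>' \<Longrightarrow> l > 0 \<Longrightarrow> \<psi> l = 0 \<and> \<psi> (-l) = 0"
  unfolding C1_test_def by fastforce

lemma C1_test_continuous: "C1_test l \<psi> \<psi>' \<Longrightarrow> continuous_on S \<psi> \<and> continuous_on S \<psi>'"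
  unfolding C1_test_def by (meson DERIV_isCont continuous_at_imp_continuous_on continuous_on_subset subset_UNIV)

lemma ac_test:
  assumes u: "ac (-l) l u v" and \<psi>: "C1_test l \<psi> \<psi>'" and l: "l > 0"
  shows "(\<integral>s. u s * \<psi>' s \<partial>Mi (-l) l) = - (\<integral>s. v s * \<psi> s \<partial>Mi (-l) l)"
proof -
  have "(\<integral>s. u s * \<psi>' s + v s * \<psi> s \<partial>Mi (-l) l) = u l * \<psi> l - u (-l) * \<psi> (-l)"
    using l by (intro ac_integral[OF ac_mult[OF u C1_test_ac[OF \<psi>]]]) auto
  also have "\<dots> = 0" using C1_test_zero[OF \<psi> l] by simp
  also have "(\<integral>s. u s * \<psi>' s + v s * \<psi> s \<partial>Mi (-l) l) = (\<integral>s. u s * \<psi>' s \<partial>Mi (-l) l) + (\<integral>s. v s * \<psi> s \<partial>Mi (-l) l)"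
    using Mi_integrable_mult_continuous[of _ _ \<psi>, OF _ ac_integrable[OF u]] C1_test_continuous[OF \<psi>] ac_continuous[OF u]
    by (intro Bochner_Integration.integral_add) (auto simp: mult.commute intro!: Mi_continuous_integrable continuous_intros)
  finally show ?thesis by simp
qed

text \<open>By the product rule the primitive of \<open>v\<close> satisfies the same identity as \<open>u\<close>, so \<open>du_Bois_Reymond\<close> applies
  to the difference.\<close>

lemma weak_primitive:
  assumes l: "l > 0" and u: "integrable (Mi (-l) l) u" and v: "integrable (Mi (-l) l) v"
    and z: "\<And>\<psi> \<psi>'. C1_test l \<psi> \<psi>' \<Longrightarrow> (\<integral>s. u s * \<psi>' s \<partial>Mi (-l) l) = - (\<integral>s. v s * \<psi> s \<partial>Mi (-l) l)"
  obtains c where "AE s in Mi (-l) l. u s = c + prim (-l) l v s"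
proof -
  have pi: "integrable (Mi (-l) l) (prim (-l) l v)"
    by (intro Mi_continuous_integrable continuous_on_subset[OF prim_continuous[OF v]]) auto
  obtain c where "AE s in Mi (-l) l. u s - prim (-l) l v s = c"
  proof (rule du_Bois_Reymond[OF l, where f="\<lambda>s. u s - prim (-l) l v s"])
    show "integrable (Mi (-l) l) (\<lambda>s. u s - prim (-l) l v s)" using u pi by simp
  next
    fix \<psi> \<psi>' assume \<psi>: "C1_test l \<psi> \<psi>'"
    have "(\<integral>s. (u s - prim (-l) l v s) * \<psi>' s \<partial>Mi (-l) l)
      = (\<integral>s. u s * \<psi>' s \<partial>Mi (-l) l) - (\<integral>s. prim (-l) l v s * \<psi>' s \<partial>Mi (-l) l)"
      unfolding left_diff_distrib
      using Mi_integrable_mult_continuous[of _ _ \<psi>', OF _ u] Mi_integrable_mult_continuous[of _ _ \<psi>', OF _ pi]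
        C1_test_continuous[OF \<psi>]
      by (intro Bochner_Integration.integral_diff) (auto simp: mult.commute)
    then show "(\<integral>s. (u s - prim (-l) l v s) * \<psi>' s \<partial>Mi (-l) l) = 0"
      using z[OF \<psi>] ac_test[OF ac_prim[OF v] \<psi> l] by simp
  qed auto
  then show ?thesis using that[of c] by (auto simp: algebra_simps)
qed

lemma weak_zero:
  assumes l: "l > 0" and v: "integrable (Mi (-l) l) v"
    and z: "\<And>\<psi> \<psi>'. C1_test l \<psi> \<psi>' \<Longrightarrow> (\<integral>s. v s * \<psi> s \<partial>Mi (-l) l) = 0"
  shows "AE s in Mi (-l) l. v s = 0"
proof -
  obtain c where "AE s in Mi (-l) l. 0 = c + prim (-l) l v s"
    using weak_primitive[OF l _ v, of "\<lambda>s. 0"] z by auto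
  then have ae: "AE s in Mi (-l) l. prim (-l) l v s = - c" by eventually_elim auto
  have "prim (-l) l v x = - c" if "x \<in> {-l..l}" for x
    by (rule continuous_AE_eq[OF ae _ that]) (use l in \<open>auto intro: continuous_on_subset[OF prim_continuous[OF v]]\<close>)
  from this this[of "-l"] l have "prim (-l) l v x = 0" if "x \<in> {-l..l}" for x
    using that by (simp add: prim_left)
  then show ?thesis by (rule prim_zero_AE[OF v])
qed

text \<open>Through this equivalence all arguments in one variable can be carried out with primitives.\<close>

lemma weak_deriv_iff_ac:
  assumes l: "l > 0" and u: "continuous_on {-l..l} u"
  shows "weak_deriv l u v \<longleftrightarrow> ac (-l) l u v \<and> L2 (Mi (-l) l) v"
proof
  assume a: "ac (-l) l u v \<and> L2 (Mi (-l) l) v"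
  then show "weak_deriv l u v"
    using ac_test[OF conjunct1[OF a] _ l] by (auto simp: weak_deriv_def Mi_L2_on Mi_set_integral)
next
  assume w: "weak_deriv l u v"
  then have v: "L2 (Mi (-l) l) v" by (simp add: weak_deriv_def Mi_L2_on)
  note vi = Mi.L2_integrable[OF v]
  obtain c where "AE s in Mi (-l) l. u s = c + prim (-l) l v s"
    using weak_primitive[OF l Mi_continuous_integrable[OF u] vi] w
    by (auto simp: weak_deriv_def Mi_set_integral)
  then have ae: "AE s in Mi (-l) l. u s - prim (-l) l v s = c" by eventually_elim auto
  have *: "u x - prim (-l) l v x = c" if "x \<in> {-l..l}" for x
    by (rule continuous_AE_eq[OF ae _ that])
      (use l in \<open>auto intro!: continuous_intros u continuous_on_subset[OF prim_continuous[OF vi]]\<close>)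
  have "ac (-l) l u v"
  proof (rule acI[OF vi])
    fix x assume "x \<in> {-l..l}"
    then show "u x = u (-l) + prim (-l) l v x" using *[of x] *[of "-l"] l by (simp add: prim_left)
  qed
  then show "ac (-l) l u v \<and> L2 (Mi (-l) l) v" using v by simp
qed

lemma H1_interval_iff: 
  assumes "l > 0" shows "u \<in> H1_interval l \<longleftrightarrow> (\<exists>v. ac (-l) l u v \<and> L2 (Mi (-l) l) v)"
  using weak_deriv_iff_ac[OF assms] ac_continuous unfolding H1_interval_def by blast

lemma H1_intervalD:
  assumes "l > 0" "u \<in> H1_interval l"
  shows "ac (-l) l u (wderiv l u)" "L2 (Mi (-l) l) (wderiv l u)" "continuous_on {-l..l} u"
proof -
  obtain v where "weak_deriv l u v" and c: "continuous_on {-l..l} u"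
    using assms(2) by (auto simp: H1_interval_def)
  then have "weak_deriv l u (wderiv l u)" unfolding wderiv_def by (metis someI)
  then show "ac (-l) l u (wderiv l u)" "L2 (Mi (-l) l) (wderiv l u)" "continuous_on {-l..l} u"
    using weak_deriv_iff_ac[OF assms(1) c] c by auto
qed

lemma ac_unique:
  assumes u: "ac a b u v" and w: "ac a b u' w" and eq: "\<And>x. x \<in> {a..b} \<Longrightarrow> u x = u' x"
  shows "AE x in Mi a b. v x = w x"
proof (cases "a \<le> b")
  case True
  have "AE x in Mi a b. v x - w x = 0"
  proof (rule prim_zero_AE)
    show "integrable (Mi a b) (\<lambda>x. v x - w x)" using ac_integrable[OF u] ac_integrable[OF w] by simp
    fix x assume x: "x \<in> {a..b}"
    have "prim a b v x = prim a b w x"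
      using ac_eq[OF u x] ac_eq[OF w x] eq[OF x] eq[of a] True by simp
    moreover have "prim a b (\<lambda>x. v x - w x) x = prim a b v x - prim a b w x"
      using prim_add[OF ac_integrable[OF u] ac_integrable[OF ac_scale[OF w, of "-1"]], of x]
        prim_scale[of a b "-1" w x] by simp
    ultimately show "prim a b (\<lambda>x. v x - w x) x = 0" by simp
  qed
  then show ?thesis by eventually_elim simp
next
  case False
  then show ?thesis by (intro AE_I2) auto
qed

lemma wderiv_AE:
  assumes "l > 0" "ac (-l) l u v" "L2 (Mi (-l) l) v"
  shows "AE x in Mi (-l) l. wderiv l u x = v x"
  using H1_intervalD(1)[OF assms(1)] H1_interval_iff[OF assms(1)] assms by (intro ac_unique) auto

section \<open>Dimension counts\<close>

text \<open>Elimination of one unknown with the last equation.\<close>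

lemma homogeneous_system:
  fixes a :: "nat \<Rightarrow> 'i \<Rightarrow> real"
  assumes "finite I" "m < card I"
  shows "\<exists>c. (\<exists>i\<in>I. c i \<noteq> 0) \<and> (\<forall>j<m. (\<Sum>i\<in>I. c i * a j i) = 0)"
  using assms
proof (induction m arbitrary: I a)
  case 0
  then show ?case by (intro exI[of _ "\<lambda>_. 1"]) (auto simp: card_gt_0_iff)
next
  case (Suc m)
  show ?case
  proof (cases "\<forall>i\<in>I. a m i = 0")
    case True
    obtain c where "\<exists>i\<in>I. c i \<noteq> 0" "\<forall>j<m. (\<Sum>i\<in>I. c i * a j i) = 0"
      using Suc.IH[of I a] Suc.prems by auto
    then show ?thesis using True by (intro exI[of _ c]) (auto simp: less_Suc_eq)
  next
    case False
    then obtain p where p: "p \<in> I" "a m p \<noteq> 0" by auto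
    define J where "J = I - {p}"
    have J: "finite J" "m < card J" "p \<notin> J" "I = insert p J"
      using Suc.prems p by (auto simp: J_def card_Diff_singleton)
    obtain c where c: "\<exists>i\<in>J. c i \<noteq> 0" "\<forall>j<m. (\<Sum>i\<in>J. c i * (a j i - a j p * a m i / a m p)) = 0"
      using Suc.IH[OF J(1,2), of "\<lambda>j i. a j i - a j p * a m i / a m p"] by blast
    define d where "d = c(p := - (\<Sum>i\<in>J. c i * a m i) / a m p)"
    have dJ: "(\<Sum>i\<in>J. d i * g i) = (\<Sum>i\<in>J. c i * g i)" for g
      using J(3) by (intro sum.cong) (auto simp: d_def)
    have I: "(\<Sum>i\<in>I. d i * a j i) = (\<Sum>i\<in>J. c i * a j i) - (\<Sum>i\<in>J. c i * a m i) / a m p * a j p" for j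
      using J by (simp add: dJ) (simp add: d_def)
    have "(\<Sum>i\<in>I. d i * a j i) = 0" if "j < Suc m" for j
    proof (cases "j = m")
      case True
      then show ?thesis using I[of m] p by simp
    next
      case False
      then have "(\<Sum>i\<in>J. c i * (a j i - a j p * a m i / a m p)) = 0" using that c(2) by simp
      moreover have "(\<Sum>i\<in>J. c i * (a j i - a j p * a m i / a m p))
        = (\<Sum>i\<in>J. c i * a j i) - (\<Sum>i\<in>J. c i * a m i) / a m p * a j p"
        by (simp add: right_diff_distrib sum_subtractf sum_divide_distrib sum_distrib_right sum_distrib_left mult_ac)
      ultimately show ?thesis using I[of j] by simp
    qed
    moreover have "\<exists>i\<in>I. d i \<noteq> 0" using c(1) J by (auto simp: d_def)
    ultimately show ?thesis by (intro exI[of _ d]) auto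
  qed
qed

abbreviation lincomb :: "nat \<Rightarrow> (nat \<Rightarrow> real) \<Rightarrow> (nat \<Rightarrow> 'x \<Rightarrow> real) \<Rightarrow> 'x \<Rightarrow> real" where
  "lincomb n c f \<equiv> (\<lambda>x. \<Sum>i<n. c i * f i x)"

definition independent_mod :: "('x \<Rightarrow> real) set \<Rightarrow> nat \<Rightarrow> (nat \<Rightarrow> 'x \<Rightarrow> real) \<Rightarrow> bool" where
  "independent_mod N n f \<longleftrightarrow> (\<forall>c. lincomb n c f \<in> N \<longrightarrow> (\<forall>i<n. c i = 0))"

lemma dim_mod_ge:
  "(\<And>i. i < n \<Longrightarrow> f i \<in> V) \<Longrightarrow> independent_mod N n f \<Longrightarrow> enat n \<le> dim_mod N V"
  unfolding dim_mod_def independent_mod_def by (intro Sup_upper) blast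

lemma dim_mod_le:
  assumes "\<And>n f. (\<And>i. i < n \<Longrightarrow> f i \<in> V) \<Longrightarrow> independent_mod N n f \<Longrightarrow> enat n \<le> k"
  shows "dim_mod N V \<le> k"
  unfolding dim_mod_def using assms unfolding independent_mod_def by (intro Sup_least) blast

lemma linear_subspace_lincomb:
  assumes "linear_subspace V" "\<And>i. i < n \<Longrightarrow> f i \<in> V"
  shows "lincomb n c f \<in> V"
  using assms(2)
proof (induction n)
  case 0
  then show ?case using assms(1) by (simp add: linear_subspace_def)
next
  case (Suc n)
  then have "lincomb n c f \<in> V" "f n \<in> V" by auto
  then have "(\<lambda>x. c n * f n x) \<in> V" using assms(1) unfolding linear_subspace_def by blast
  then show ?case using assms(1) \<open>lincomb n c f \<in> V\<close> unfolding linear_subspace_def by auto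
qed

text \<open>A monotone sequence is determined by the multiplicities of its values; this is why the description
  of the eigenvalue sequence by multiplicities is unique.\<close>

lemma mono_seq_eq:
  fixes \<mu> \<nu> :: "nat \<Rightarrow> real"
  assumes m: "mono \<mu>" "mono \<nu>" and fin: "\<And>v. finite {n. \<mu> n = v}" "\<And>v. finite {n. \<nu> n = v}"
    and card: "\<And>v. card {n. \<mu> n = v} = card {n. \<nu> n = v}"
  shows "\<mu> = \<nu>"
proof
  have *: "\<not> \<mu>' n < \<nu>' n"
    if eq: "\<And>i. i < n \<Longrightarrow> \<mu>' i = \<nu>' i" and mn: "mono \<nu>'" and f: "finite {i. \<mu>' i = \<mu>' n}"
      and c: "card {i. \<mu>' i = \<mu>' n} = card {i. \<nu>' i = \<mu>' n}"
    for \<mu>' \<nu>' :: "nat \<Rightarrow> real" and n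
  proof
    assume lt: "\<mu>' n < \<nu>' n"
    have "i < n" if "\<nu>' i = \<mu>' n" for i
    proof (rule ccontr)
      assume "\<not> i < n"
      then have "\<nu>' n \<le> \<nu>' i" using mn by (simp add: monoD)
      then show False using lt that by simp
    qed
    then have "{i. \<nu>' i = \<mu>' n} \<subset> {i. \<mu>' i = \<mu>' n}" using eq lt by fastforce
    from psubset_card_mono[OF f this] show False using c by simp
  qed
  fix n show "\<mu> n = \<nu> n"
  proof (induction n rule: less_induct)
    case (less n)
    have "\<not> \<mu> n < \<nu> n" by (rule *) (use less fin card m in auto)
    moreover have "\<not> \<nu> n < \<mu> n" by (rule *) (use less fin card m in auto)
    ultimately show ?case by simp
  qed
qed

section \<open>Semibounded forms with compact resolvent\<close>

locale sym_form =
  fixes D :: "('x \<Rightarrow> real) set" and b :: "('x \<Rightarrow> real) \<Rightarrow> ('x \<Rightarrow> real) \<Rightarrow> real"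
  assumes sub: "linear_subspace D"
    and b_add: "\<And>u v w. u \<in> D \<Longrightarrow> v \<in> D \<Longrightarrow> w \<in> D \<Longrightarrow> b (\<lambda>x. u x + v x) w = b u w + b v w"
    and b_scale: "\<And>u w c. u \<in> D \<Longrightarrow> w \<in> D \<Longrightarrow> b (\<lambda>x. c * u x) w = c * b u w"
    and b_sym: "\<And>u v. u \<in> D \<Longrightarrow> v \<in> D \<Longrightarrow> b u v = b v u"
begin

lemma D_zero: "(\<lambda>x. 0) \<in> D" and D_add: "u \<in> D \<Longrightarrow> v \<in> D \<Longrightarrow> (\<lambda>x. u x + v x) \<in> D"
  and D_scale: "u \<in> D \<Longrightarrow> (\<lambda>x. c * u x) \<in> D"
  using sub by (auto simp: linear_subspace_def)

lemma D_diff: "u \<in> D \<Longrightarrow> v \<in> D \<Longrightarrow> (\<lambda>x. u x - v x) \<in> D"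
  using D_add[OF _ D_scale[of v "-1"], of u] by simp

lemma D_lincomb: "(\<And>i. i < n \<Longrightarrow> f i \<in> D) \<Longrightarrow> lincomb n c f \<in> D"
  by (rule linear_subspace_lincomb[OF sub])

lemma b_diff: "u \<in> D \<Longrightarrow> v \<in> D \<Longrightarrow> w \<in> D \<Longrightarrow> b (\<lambda>x. u x - v x) w = b u w - b v w"
  using b_add[OF _ D_scale[of v "-1"], of u w] b_scale[of v w "-1"] by simp

lemma b_add2: "u \<in> D \<Longrightarrow> v \<in> D \<Longrightarrow> w \<in> D \<Longrightarrow> b w (\<lambda>x. u x + v x) = b w u + b w v"
  using b_sym[OF _ D_add[of u v], of w] b_add[of u v w] b_sym[of u w] b_sym[of v w] by simp

lemma b_scale2: "u \<in> D \<Longrightarrow> w \<in> D \<Longrightarrow> b w (\<lambda>x. c * u x) = c * b w u"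
  using b_sym[OF _ D_scale[of u c], of w] b_scale[of u w c] b_sym[of u w] by simp

lemma b_diff2: "u \<in> D \<Longrightarrow> v \<in> D \<Longrightarrow> w \<in> D \<Longrightarrow> b w (\<lambda>x. u x - v x) = b w u - b w v"
  using b_sym[OF _ D_diff[of u v], of w] b_diff[of u v w] b_sym[of u w] b_sym[of v w] by simp

lemma b_zero: "w \<in> D \<Longrightarrow> b (\<lambda>x. 0) w = 0"
  using b_scale[of w w 0] by simp

lemma b_lincomb:
  "(\<And>i. i < n \<Longrightarrow> f i \<in> D) \<Longrightarrow> w \<in> D \<Longrightarrow> b (lincomb n c f) w = (\<Sum>i<n. c i * b (f i) w)"
proof (induction n)
  case 0
  then show ?case by (simp add: b_zero)
next
  case (Suc n)
  then show ?case using b_add[OF D_lincomb[of n f c] D_scale[of "f n" "c n"], of w] by (simp add: b_scale)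
qed

lemma b_sq_add:
  "u \<in> D \<Longrightarrow> v \<in> D \<Longrightarrow> b (\<lambda>x. u x + v x) (\<lambda>x. u x + v x) = b u u + 2 * b u v + b v v"
  by (simp add: b_add b_add2 D_add b_sym[of v u])

lemma b_sq_diff:
  "u \<in> D \<Longrightarrow> v \<in> D \<Longrightarrow> b (\<lambda>x. u x - v x) (\<lambda>x. u x - v x) = b u u - 2 * b u v + b v v"
  by (simp add: b_diff b_diff2 D_diff b_sym[of v u])

lemma b_sq_scale: "u \<in> D \<Longrightarrow> b (\<lambda>x. c * u x) (\<lambda>x. c * u x) = c\<^sup>2 * b u u"
  by (simp add: b_scale b_scale2 D_scale power2_eq_square)

end

locale psd_form = sym_form +
  assumes b_nonneg: "\<And>u. u \<in> D \<Longrightarrow> 0 \<le> b u u"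
begin

text \<open>The form may be degenerate: the inequality then says that a null vector lies in the radical. In
  this way minimizers are shown to be eigenfunctions.\<close>

lemma Cauchy_Schwarz: assumes u: "u \<in> D" and v: "v \<in> D" shows "(b u v)\<^sup>2 \<le> b u u * b v v"
proof (cases "b u u = 0")
  case True
  have *: "0 \<le> b v v + 2 * t * b u v" for t
  proof -
    have "0 \<le> b (\<lambda>x. t * u x + v x) (\<lambda>x. t * u x + v x)" by (intro b_nonneg D_add D_scale u v)
    also have "\<dots> = b v v + 2 * t * b u v"
      by (simp add: b_sq_add b_sq_scale b_scale D_scale u v True)
    finally show ?thesis .
  qed
  have "b u v = 0"
  proof (rule ccontr)
    assume "b u v \<noteq> 0"
    then have "b v v + 2 * (- (b v v + 1) / (2 * b u v)) * b u v = -1" by (simp add: field_simps)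
    then show False using *[of "- (b v v + 1) / (2 * b u v)"] by linarith
  qed
  then show ?thesis using True by simp
next
  case False
  then have pos: "b u u > 0" using b_nonneg[OF u] by simp
  have "0 \<le> b (\<lambda>x. (- b u v) * u x + b u u * v x) (\<lambda>x. (- b u v) * u x + b u u * v x)"
    by (intro b_nonneg D_add D_scale u v)
  also have "\<dots> = b u u * (b u u * b v v - (b u v)\<^sup>2)"
    by (subst b_sq_add, simp_all only: b_sq_scale b_scale b_scale2 D_scale u v) algebra
  finally show ?thesis using pos by (simp add: zero_le_mult_iff)
qed

lemma b_tendsto:
  assumes X: "\<And>n. X n \<in> D" and u: "u \<in> D" and v: "v \<in> D"
    and lim: "(\<lambda>n. b (\<lambda>x. X n x - u x) (\<lambda>x. X n x - u x)) \<longlonglongrightarrow> 0"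
  shows "(\<lambda>n. b (X n) v) \<longlonglongrightarrow> b u v" and "(\<lambda>n. b (X n) (X n)) \<longlonglongrightarrow> b u u"
proof -
  define d where "d n x = X n x - u x" for n x
  have d: "d n \<in> D" for n unfolding d_def[abs_def] by (intro D_diff X u)
  have cross: "(\<lambda>n. b (d n) w) \<longlonglongrightarrow> 0" if w: "w \<in> D" for w
  proof -
    have "(\<lambda>n. b (d n) (d n) * b w w) \<longlonglongrightarrow> 0 * b w w"
      using lim unfolding d_def[abs_def] by (intro tendsto_intros)
    then have lim0: "(\<lambda>n. b (d n) (d n) * b w w) \<longlonglongrightarrow> 0" by simp
    have "(\<lambda>n. (b (d n) w)\<^sup>2) \<longlonglongrightarrow> 0"
      by (rule tendsto_sandwich[OF _ _ tendsto_const lim0]) (auto intro!: always_eventually Cauchy_Schwarz d w)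
    then have "(\<lambda>n. sqrt ((b (d n) w)\<^sup>2)) \<longlonglongrightarrow> sqrt 0" by (intro tendsto_intros)
    then show ?thesis by (simp add: tendsto_rabs_zero_iff)
  qed
  have Xd: "X n = (\<lambda>x. u x + d n x)" for n by (simp add: d_def)
  have "(\<lambda>n. b u v + b (d n) v) \<longlonglongrightarrow> b u v + 0" by (intro tendsto_intros cross v)
  then show "(\<lambda>n. b (X n) v) \<longlonglongrightarrow> b u v" unfolding Xd by (simp add: b_add u v d)
  have "(\<lambda>n. b u u + 2 * b (d n) u + b (d n) (d n)) \<longlonglongrightarrow> b u u + 2 * 0 + 0"
    using lim unfolding d_def[symmetric, abs_def] by (intro tendsto_intros cross u)
  then show "(\<lambda>n. b (X n) (X n)) \<longlonglongrightarrow> b u u"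
    unfolding Xd by (simp add: b_sq_add[OF u d] b_sym[OF u d])
qed

end

text \<open>The form \<open>q\<close> is closed and bounded below relative to \<open>m\<close>, and the inclusion of its form domain
  is compact; \<open>E = q + C m\<close> plays the role of the Sobolev norm.\<close>

locale compact_form = M: psd_form D m + Q: sym_form D q
  for N D :: "('x \<Rightarrow> real) set" and q m :: "('x \<Rightarrow> real) \<Rightarrow> ('x \<Rightarrow> real) \<Rightarrow> real" +
  fixes C :: real
  assumes m_null: "\<And>u. u \<in> D \<Longrightarrow> m u u = 0 \<longleftrightarrow> u \<in> N"
    and bounded_below: "\<And>u. u \<in> D \<Longrightarrow> m u u \<le> q u u + C * m u u"
    and complete: "\<And>X :: nat \<Rightarrow> 'x \<Rightarrow> real. (\<And>n. X n \<in> D) \<Longrightarrow>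
      (\<And>e. e > 0 \<Longrightarrow> \<exists>K. \<forall>i\<ge>K. \<forall>j\<ge>K. q (\<lambda>x. X i x - X j x) (\<lambda>x. X i x - X j x)
          + C * m (\<lambda>x. X i x - X j x) (\<lambda>x. X i x - X j x) < e) \<Longrightarrow>
      \<exists>u\<in>D. (\<lambda>n. q (\<lambda>x. X n x - u x) (\<lambda>x. X n x - u x) + C * m (\<lambda>x. X n x - u x) (\<lambda>x. X n x - u x)) \<longlonglongrightarrow> 0"
    and compact: "\<And>(X :: nat \<Rightarrow> 'x \<Rightarrow> real) B. (\<And>n. X n \<in> D) \<Longrightarrow> (\<And>n. q (X n) (X n) + C * m (X n) (X n) \<le> B) \<Longrightarrow>
      \<exists>r :: nat \<Rightarrow> nat. strict_mono r \<and> (\<forall>e>0. \<exists>K. \<forall>i\<ge>K. \<forall>j\<ge>K.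
          m (\<lambda>x. X (r i) x - X (r j) x) (\<lambda>x. X (r i) x - X (r j) x) < e)"
    and infinite_dim: "\<And>n. \<exists>f. (\<forall>i<n. f i \<in> D) \<and> independent_mod N n f"
begin

definition E where "E u v = q u v + C * m u v"

sublocale E: psd_form D E
proof
  fix u assume "u \<in> D"
  then show "0 \<le> E u u" using bounded_below M.b_nonneg unfolding E_def by force
qed (auto simp: E_def Q.b_add M.b_add Q.b_scale M.b_scale Q.b_sym M.b_sym M.sub algebra_simps)

definition orth :: "nat \<Rightarrow> (nat \<Rightarrow> 'x \<Rightarrow> real) \<Rightarrow> ('x \<Rightarrow> real) set" where
  "orth n e = {u \<in> D. \<forall>i<n. m u (e i) = 0}"

lemma orth_subspace:
  assumes "\<And>i. i < n \<Longrightarrow> e i \<in> D" shows "linear_subspace (orth n e)"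
  using assms by (auto simp: linear_subspace_def orth_def M.D_zero M.D_add M.D_scale M.b_add M.b_scale M.b_zero)

lemma orth_unit:
  assumes e: "\<And>i. i < n \<Longrightarrow> e i \<in> D" shows "\<exists>u\<in>orth n e. m u u = 1"
proof -
  obtain f where f: "\<And>i. i < Suc n \<Longrightarrow> f i \<in> D" and ind: "independent_mod N (Suc n) f"
    using infinite_dim[of "Suc n"] by blast
  obtain c where c: "\<exists>i\<in>{..<Suc n}. c i \<noteq> 0" "\<forall>j<n. (\<Sum>i\<in>{..<Suc n}. c i * m (f i) (e j)) = 0"
    using homogeneous_system[of "{..<Suc n}" n "\<lambda>j i. m (f i) (e j)"] by auto
  define u where "u = lincomb (Suc n) c f"
  have u: "u \<in> D" unfolding u_def using f by (rule M.D_lincomb)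
  have uo: "m u (e j) = 0" if "j < n" for j
    unfolding u_def using c(2) that f e by (subst M.b_lincomb) auto
  have "u \<notin> N" using ind c(1) unfolding u_def independent_mod_def by blast
  then have pos: "m u u > 0" using m_null[OF u] M.b_nonneg[OF u] by simp
  define k where "k = 1 / sqrt (m u u)"
  have k: "k\<^sup>2 = 1 / m u u" using pos by (simp add: k_def power_divide)
  define v where "v = (\<lambda>x. k * u x)"
  have "v \<in> orth n e"
    unfolding v_def orth_def using M.D_scale[OF u] M.b_scale[OF u e] uo by auto
  moreover have "m v v = 1"
    unfolding v_def using pos by (subst M.b_sq_scale[OF u]) (simp add: k)
  ultimately show ?thesis by blast
qed

text \<open>A minimising sequence for the Rayleigh quotient has an \<open>m\<close>-convergent subsequence; by the
  parallelogram law it then converges in the form norm as well, so strong limits suffice throughout.\<close>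

lemma minimizer:
  assumes e: "\<And>i. i < n \<Longrightarrow> e i \<in> D"
  obtains u \<mu> where "u \<in> orth n e" "m u u = 1" "q u u = \<mu>" "\<And>v. v \<in> orth n e \<Longrightarrow> \<mu> * m v v \<le> q v v"
proof -
  let ?P = "orth n e"
  note subP = orth_subspace[of n e, OF e]
  have PD: "u \<in> D" if "u \<in> ?P" for u using that by (simp add: orth_def)
  define S where "S = {q u u |u. u \<in> ?P \<and> m u u = 1}"
  define \<mu> where "\<mu> = Inf S"
  have S_ne: "S \<noteq> {}" using orth_unit[of n e, OF e] by (auto simp: S_def)
  have S_lb: "1 - C \<le> x" if "x \<in> S" for x
    using that bounded_below PD by (fastforce simp: S_def)
  have bdd: "bdd_below S" using S_lb by (auto simp: bdd_below_def)
  have \<mu>C: "1 \<le> \<mu> + C" using cInf_greatest[OF S_ne, of "1 - C"] S_lb by (simp add: \<mu>_def)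
  have low: "\<mu> * m v v \<le> q v v" if v: "v \<in> ?P" for v
  proof (cases "m v v = 0")
    case True
    then show ?thesis using bounded_below[OF PD[OF v]] by simp
  next
    case False
    then have pos: "m v v > 0" using M.b_nonneg[OF PD[OF v]] by simp
    define k where "k = 1 / sqrt (m v v)"
    have k: "k\<^sup>2 = 1 / m v v" using pos by (simp add: k_def power_divide)
    define w where "w = (\<lambda>x. k * v x)"
    have "w \<in> ?P" unfolding w_def using subP v unfolding linear_subspace_def by blast
    moreover have "m w w = 1" "q w w = q v v / m v v"
      unfolding w_def using pos by (simp_all add: M.b_sq_scale[OF PD[OF v]] Q.b_sq_scale[OF PD[OF v]] k)
    ultimately have "\<mu> \<le> q v v / m v v" unfolding \<mu>_def
      by (intro cInf_lower bdd) (auto simp: S_def intro!: exI[of _ w])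
    then show ?thesis using pos by (simp add: field_simps)
  qed
  have "\<exists>u. u \<in> ?P \<and> m u u = 1 \<and> q u u < \<mu> + 1 / real (Suc k)" for k
  proof -
    have "\<exists>x\<in>S. x < \<mu> + 1 / real (Suc k)"
      using cInf_lessD[OF S_ne, of "\<mu> + 1 / real (Suc k)"] by (auto simp: \<mu>_def)
    then show ?thesis by (auto simp: S_def)
  qed
  then obtain X where X: "\<And>k. X k \<in> ?P" "\<And>k. m (X k) (X k) = 1" "\<And>k. q (X k) (X k) < \<mu> + 1 / real (Suc k)"
    by metis
  have "q (X k) (X k) + C * m (X k) (X k) \<le> \<mu> + 1 + C" for k
  proof -
    have "1 / real (Suc k) \<le> 1" by simp
    then show ?thesis unfolding X(2) using X(3)[of k] by linarith
  qed
  from compact[OF PD[OF X(1)] this] obtain r :: "nat \<Rightarrow> nat" where r2: "strict_mono r \<and>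
      (\<forall>\<epsilon>>0. \<exists>K. \<forall>i\<ge>K. \<forall>j\<ge>K. m (\<lambda>x. X (r i) x - X (r j) x) (\<lambda>x. X (r i) x - X (r j) x) < \<epsilon>)" ..
  note r = conjunct1[OF r2] and mc = conjunct2[OF r2, rule_format]
  define Y where "Y k = X (r k)" for k
  have Y: "Y k \<in> ?P" "m (Y k) (Y k) = 1" "q (Y k) (Y k) < \<mu> + 1 / real (Suc k)" for k
  proof -
    have "1 / real (Suc (r k)) \<le> 1 / real (Suc k)"
      using seq_suble[OF r, of k] by (intro divide_left_mono) auto
    then show "q (Y k) (Y k) < \<mu> + 1 / real (Suc k)" using X(3)[of "r k"] by (simp add: Y_def)
  qed (auto simp: Y_def X)
  have YD: "Y k \<in> D" for k using Y(1) PD by blast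
  have est: "E (\<lambda>x. Y i x - Y j x) (\<lambda>x. Y i x - Y j x) \<le>
      2 / real (Suc i) + 2 / real (Suc j) + (\<mu> + C) * m (\<lambda>x. Y i x - Y j x) (\<lambda>x. Y i x - Y j x)" for i j
  proof -
    have "(\<lambda>x. Y i x + Y j x) \<in> ?P" using subP Y(1) unfolding linear_subspace_def by blast
    from low[OF this] have "\<mu> * (2 + 2 * m (Y i) (Y j)) \<le> q (Y i) (Y i) + 2 * q (Y i) (Y j) + q (Y j) (Y j)"
      by (simp add: M.b_sq_add Q.b_sq_add YD Y(2))
    then show ?thesis
      using Y(3)[of i] Y(3)[of j]
      by (simp add: E_def M.b_sq_diff Q.b_sq_diff YD Y(2) algebra_simps)
  qed
  have cau: "\<exists>K. \<forall>i\<ge>K. \<forall>j\<ge>K. E (\<lambda>x. Y i x - Y j x) (\<lambda>x. Y i x - Y j x) < \<epsilon>" if "\<epsilon> > 0" for \<epsilon>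
  proof -
    have "\<epsilon> / (2 * (\<mu> + C)) > 0" using that \<mu>C by simp
    then obtain K1 where K1: "\<forall>i\<ge>K1. \<forall>j\<ge>K1. m (\<lambda>x. Y i x - Y j x) (\<lambda>x. Y i x - Y j x) < \<epsilon> / (2 * (\<mu> + C))"
      using mc[of "\<epsilon> / (2 * (\<mu> + C))"] unfolding Y_def by auto
    obtain K2 :: nat where K2: "8 / \<epsilon> < real K2" using reals_Archimedean2 by blast
    show ?thesis
    proof (intro exI[of _ "max K1 K2"] allI impI)
      fix i j assume ij: "max K1 K2 \<le> i" "max K1 K2 \<le> j"
      have fr: "2 / real (Suc k) < \<epsilon> / 4" if "K2 \<le> k" for k
      proof -
        have "8 / \<epsilon> < real (Suc k)" using K2 that by linarith
        then show ?thesis using \<open>\<epsilon> > 0\<close> by (simp add: field_simps)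
      qed
      have "m (\<lambda>x. Y i x - Y j x) (\<lambda>x. Y i x - Y j x) < \<epsilon> / (2 * (\<mu> + C))"
        using K1 ij by simp
      then have "(\<mu> + C) * m (\<lambda>x. Y i x - Y j x) (\<lambda>x. Y i x - Y j x) < \<epsilon> / 2"
        using \<mu>C by (simp add: field_simps)
      then show "E (\<lambda>x. Y i x - Y j x) (\<lambda>x. Y i x - Y j x) < \<epsilon>"
        using est[of i j] fr[of i] fr[of j] ij by simp
    qed
  qed
  obtain u where u: "u \<in> D" and lim: "(\<lambda>k. E (\<lambda>x. Y k x - u x) (\<lambda>x. Y k x - u x)) \<longlonglongrightarrow> 0"
  proof -
    have "\<exists>u\<in>D. (\<lambda>k. E (\<lambda>x. Y k x - u x) (\<lambda>x. Y k x - u x)) \<longlonglongrightarrow> 0"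
      unfolding E_def by (rule complete[OF YD]) (erule cau[unfolded E_def])
    then show ?thesis by (elim bexE) (rule that)
  qed
  have "(\<lambda>k. m (\<lambda>x. Y k x - u x) (\<lambda>x. Y k x - u x)) \<longlonglongrightarrow> 0"
  proof (rule tendsto_sandwich[OF _ _ tendsto_const lim])
    show "\<forall>\<^sub>F k in sequentially. 0 \<le> m (\<lambda>x. Y k x - u x) (\<lambda>x. Y k x - u x)"
      by (intro always_eventually allI M.b_nonneg M.D_diff YD u)
    show "\<forall>\<^sub>F k in sequentially. m (\<lambda>x. Y k x - u x) (\<lambda>x. Y k x - u x) \<le> E (\<lambda>x. Y k x - u x) (\<lambda>x. Y k x - u x)"
      unfolding E_def by (intro always_eventually allI bounded_below M.D_diff YD u)
  qed
  note ml = M.b_tendsto[OF YD u _ this]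
  have mu: "m u u = 1" using ml(2)[OF u] Y(2) by (simp add: LIMSEQ_const_iff)
  have "m u (e i) = 0" if "i < n" for i
    using ml(1)[OF e[OF that]] Y(1) that by (simp add: orth_def LIMSEQ_const_iff)
  then have uP: "u \<in> ?P" using u by (simp add: orth_def)
  have "(\<lambda>k. E (Y k) (Y k) - C) \<longlonglongrightarrow> E u u - C"
    by (intro tendsto_intros E.b_tendsto(2)[OF YD u u lim])
  moreover have "E (Y k) (Y k) - C = q (Y k) (Y k)" for k unfolding E_def Y(2) by simp
  moreover have "E u u - C = q u u" unfolding E_def mu by simp
  ultimately have ql: "(\<lambda>k. q (Y k) (Y k)) \<longlonglongrightarrow> q u u" by simp
  have "(\<lambda>k. \<mu> + 1 / real (Suc k)) \<longlonglongrightarrow> \<mu> + 0"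
    by (intro tendsto_intros LIMSEQ_Suc lim_1_over_n)
  then have lim\<mu>: "(\<lambda>k. \<mu> + 1 / real (Suc k)) \<longlonglongrightarrow> \<mu>" by simp
  have "q u u \<le> \<mu>" by (rule LIMSEQ_le[OF ql lim\<mu>]) (intro exI[of _ 0] allI impI less_imp_le Y(3))
  then have "q u u = \<mu>" using low[OF uP] mu by simp
  then show ?thesis using that[OF uP mu _ low] by blast
qed

text \<open>The minimizer satisfies the eigenvalue equation against functions orthogonal to the previous
  eigenfunctions; against these it holds because both sides vanish.\<close>

lemma next_eigenfunction:
  assumes e: "\<And>i. i < n \<Longrightarrow> e i \<in> D" and on: "\<And>i j. i < n \<Longrightarrow> j < n \<Longrightarrow> m (e i) (e j) = (if i = j then 1 else 0)"
    and ev: "\<And>i v. i < n \<Longrightarrow> v \<in> D \<Longrightarrow> q (e i) v = \<nu> i * m (e i) v"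
  obtains u \<mu> where "u \<in> orth n e" "m u u = 1" "\<And>v. v \<in> D \<Longrightarrow> q u v = \<mu> * m u v"
    "\<And>v. v \<in> orth n e \<Longrightarrow> \<mu> * m v v \<le> q v v"
proof -
  obtain u \<mu> where u: "u \<in> orth n e" "m u u = 1" "q u u = \<mu>"
    and low: "\<And>v. v \<in> orth n e \<Longrightarrow> \<mu> * m v v \<le> q v v"
    using that by (rule minimizer[of n e, OF e, rotated])
  have uD: "u \<in> D" and uo: "\<And>i. i < n \<Longrightarrow> m u (e i) = 0" using u by (auto simp: orth_def)
  have PD: "v \<in> D" if "v \<in> orth n e" for v using that by (simp add: orth_def)
  (* q - \<mu> m is nonnegative on the complement and vanishes at u, so u is in its radical *)
  interpret B: psd_form "orth n e" "\<lambda>v w. q v w - \<mu> * m v w"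
    by unfold_locales (auto simp: orth_subspace[of n e, OF e] PD Q.b_add M.b_add Q.b_scale M.b_scale Q.b_sym M.b_sym low algebra_simps)
  have P: "q u v = \<mu> * m u v" if v: "v \<in> orth n e" for v
    using B.Cauchy_Schwarz[OF u(1) v] u by simp
  have "q u v = \<mu> * m u v" if v: "v \<in> D" for v
  proof -
    define p where "p = lincomb n (\<lambda>i. m v (e i)) e"
    have pD: "p \<in> D" unfolding p_def by (rule M.D_lincomb) (rule e)
    have "m p (e j) = m v (e j)" if "j < n" for j
    proof -
      have "m p (e j) = (\<Sum>i<n. m v (e i) * m (e i) (e j))"
        unfolding p_def using e that by (subst M.b_lincomb) auto
      also have "\<dots> = (\<Sum>i<n. if i = j then m v (e i) else 0)"
        using on that by (intro sum.cong) auto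
      finally show ?thesis using that by simp
    qed
    then have vp: "(\<lambda>x. v x - p x) \<in> orth n e"
      using v pD e by (auto simp: orth_def M.D_diff M.b_diff)
    have "q p u = 0" unfolding p_def using e uD uo ev[OF _ uD]
      by (subst Q.b_lincomb) (auto simp: M.b_sym[OF _ uD])
    moreover have "m p u = 0" unfolding p_def using e uD uo
      by (subst M.b_lincomb) (auto simp: M.b_sym[OF _ uD])
    ultimately have "q u p = 0" "m u p = 0" using Q.b_sym M.b_sym uD pD by auto
    then show ?thesis using P[OF vp] v pD uD by (simp add: Q.b_diff2 M.b_diff2)
  qed
  then show ?thesis using that u low by blast
qed

lemma eigenbasis:
  obtains e :: "nat \<Rightarrow> 'x \<Rightarrow> real" and \<mu> :: "nat \<Rightarrow> real"
  where "\<And>n. e n \<in> D" "\<And>i j. m (e i) (e j) = (if i = j then 1 else 0)"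
    "\<And>n v. v \<in> D \<Longrightarrow> q (e n) v = \<mu> n * m (e n) v" "\<And>n v. v \<in> orth n e \<Longrightarrow> \<mu> n * m v v \<le> q v v"
proof -
  define P where "P f n r \<longleftrightarrow> fst r \<in> orth n (fst \<circ> f) \<and> m (fst r) (fst r) = 1 \<and>
     (\<forall>v\<in>D. q (fst r) v = snd r * m (fst r) v) \<and> (\<forall>v\<in>orth n (fst \<circ> f). snd r * m v v \<le> q v v)"
    for f :: "nat \<Rightarrow> ('x \<Rightarrow> real) \<times> real" and n r
  have "\<exists>f. \<forall>n. P f n (f n)"
  proof (rule dependent_wellorder_choice)
    fix r and f g :: "nat \<Rightarrow> ('x \<Rightarrow> real) \<times> real" and n :: nat assume "\<And>y. y < n \<Longrightarrow> f y = g y"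
    then have "orth n (fst \<circ> f) = orth n (fst \<circ> g)" by (auto simp: orth_def)
    then show "P f n r = P g n r" by (simp add: P_def)
  next
    fix n f assume f: "\<And>y. y < n \<Longrightarrow> P f y (f y)"
    have fD: "(fst \<circ> f) i \<in> D" if "i < n" for i using f[OF that] by (simp add: P_def orth_def)
    have lt: "m (fst (f i)) (fst (f j)) = 0" if "i < n" "j < i" for i j
      using f[OF that(1)] that(2) by (simp add: P_def orth_def)
    have on: "m ((fst \<circ> f) i) ((fst \<circ> f) j) = (if i = j then 1 else 0)" if "i < n" "j < n" for i j
      using f[OF that(1)] lt[of i j] lt[of j i] that M.b_sym[OF fD[of i] fD[of j]]
      by (cases i j rule: linorder_cases) (auto simp: P_def)
    have ev: "q ((fst \<circ> f) i) v = (snd \<circ> f) i * m ((fst \<circ> f) i) v" if "i < n" "v \<in> D" for i v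
      using f[OF that(1)] that(2) by (simp add: P_def)
    show "\<exists>r. P f n r"
      by (rule next_eigenfunction[of n "fst \<circ> f" "snd \<circ> f", OF fD on ev]) (auto simp: P_def)
  qed
  then obtain f where f: "\<And>n. P f n (f n)" by blast
  show ?thesis
  proof (rule that[of "fst \<circ> f" "snd \<circ> f"])
    show D: "(fst \<circ> f) n \<in> D" for n using f[of n] by (simp add: P_def orth_def)
    have lt: "m (fst (f i)) (fst (f j)) = 0" if "j < i" for i j
      using f[of i] that by (simp add: P_def orth_def)
    show "m ((fst \<circ> f) i) ((fst \<circ> f) j) = (if i = j then 1 else 0)" for i j
      using f[of i] lt[of i j] lt[of j i] M.b_sym[OF D[of i] D[of j]]
      by (cases i j rule: linorder_cases) (auto simp: P_def)
  qed (use f in \<open>auto simp: P_def\<close>)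
qed

text \<open>The eigenvalues of the successive minimizers are monotone by construction, and they are unbounded:
  otherwise compactness would give a Cauchy subsequence of an orthonormal sequence. They exhaust the
  spectrum with multiplicity, for an eigenfunction orthogonal to all minimizers violates the variational
  bound once the bound exceeds its eigenvalue. So they satisfy the description of the
  eigenvalue sequence, and by \<open>mono_seq_eq\<close> they are that sequence.\<close>

theorem spectral_theorem:
  defines "\<mu> \<equiv> eigenvalue_seq N D q m"
  obtains e where "\<And>n. e n \<in> D" "\<And>i j. m (e i) (e j) = (if i = j then 1 else 0)"
    "\<And>n v. v \<in> D \<Longrightarrow> q (e n) v = \<mu> n * m (e n) v"
    "\<And>n v. v \<in> D \<Longrightarrow> (\<And>i. i < n \<Longrightarrow> m v (e i) = 0) \<Longrightarrow> \<mu> n * m v v \<le> q v v" "mono \<mu>"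
proof -
  obtain e \<nu> where eD: "\<And>n. e n \<in> D" and on: "\<And>i j. m (e i) (e j) = (if i = j then 1 else 0)"
    and ev: "\<And>n v. v \<in> D \<Longrightarrow> q (e n) v = \<nu> n * m (e n) v" and low: "\<And>n v. v \<in> orth n e \<Longrightarrow> \<nu> n * m v v \<le> q v v"
    by (rule eigenbasis) (rule that; assumption?)
  have mono: "mono \<nu>"
  proof (rule monoI)
    fix i j :: nat assume "i \<le> j"
    then have "e j \<in> orth i e" using eD on by (auto simp: orth_def)
    from low[OF this] show "\<nu> i \<le> \<nu> j" using ev[OF eD] on by simp
  qed
  have unbounded: "\<exists>n. K < \<nu> n" for K
  proof (rule ccontr)
    assume "\<nexists>n. K < \<nu> n"
    then have "q (e n) (e n) + C * m (e n) (e n) \<le> K + C" for n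
      using ev[OF eD] on by (simp add: not_less)
    from compact[OF eD this] obtain r :: "nat \<Rightarrow> nat" where r: "strict_mono r \<and>
        (\<forall>\<epsilon>>0. \<exists>K. \<forall>i\<ge>K. \<forall>j\<ge>K. m (\<lambda>x. e (r i) x - e (r j) x) (\<lambda>x. e (r i) x - e (r j) x) < \<epsilon>)" ..
    obtain K where "\<forall>i\<ge>K. \<forall>j\<ge>K. m (\<lambda>x. e (r i) x - e (r j) x) (\<lambda>x. e (r i) x - e (r j) x) < 2"
      using r[THEN conjunct2, rule_format, of 2] by auto
    then have "m (\<lambda>x. e (r K) x - e (r (Suc K)) x) (\<lambda>x. e (r K) x - e (r (Suc K)) x) < 2" by simp
    moreover have "r K \<noteq> r (Suc K)" using strict_mono_eq[OF conjunct1[OF r]] by simp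
    ultimately show False by (simp add: M.b_sq_diff eD on)
  qed
  have fin: "finite {n. \<nu> n = v}" for v
  proof -
    obtain n where n: "v < \<nu> n" using unbounded by blast
    have "i < n" if "\<nu> i = v" for i
      using n monoD[OF mono, of n i] that by (cases "i < n") auto
    then show ?thesis by (auto intro: finite_subset[of _ "{..<n}"])
  qed
  have dim: "dim_mod N (eigenspace D q m v) = enat (card {n. \<nu> n = v})" for v
  proof (rule antisym)
    let ?S = "{n. \<nu> n = v}" let ?k = "card ?S"
    obtain h where h: "bij_betw h {..<?k} ?S"
      using ex_bij_betw_nat_finite[OF fin[of v]] by (auto simp: atLeast0LessThan)
    have hS: "h i \<in> ?S" if "i < ?k" for i using h that by (auto simp: bij_betw_def)
    have hinj: "i = j" if "h i = h j" "i < ?k" "j < ?k" for i j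
      using h that by (auto simp: bij_betw_def inj_on_def)
    show "enat ?k \<le> dim_mod N (eigenspace D q m v)"
    proof (rule dim_mod_ge[where f="\<lambda>i. e (h i)"])
      show "e (h i) \<in> eigenspace D q m v" if "i < ?k" for i
        using hS[OF that] ev eD by (simp add: eigenspace_def)
      show "independent_mod N ?k (\<lambda>i. e (h i))"
        unfolding independent_mod_def
      proof (intro allI impI)
        fix c j assume N: "lincomb ?k c (\<lambda>i. e (h i)) \<in> N" and j: "j < ?k"
        let ?u = "lincomb ?k c (\<lambda>i. e (h i))"
        have u: "?u \<in> D" by (rule M.D_lincomb) (rule eD)
        have "m ?u (e (h j)) = (\<Sum>i<?k. c i * m (e (h i)) (e (h j)))" by (rule M.b_lincomb) (rule eD)+
        also have "\<dots> = (\<Sum>i<?k. if i = j then c i else 0)"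
          using hinj j by (intro sum.cong) (auto simp: on)
        also have "\<dots> = c j" using j by simp
        finally show "c j = 0"
          using M.Cauchy_Schwarz[OF u eD, of "h j"] N m_null[OF u] by simp
      qed
    qed
    show "dim_mod N (eigenspace D q m v) \<le> enat ?k"
    proof (rule dim_mod_le)
      fix p f assume f: "\<And>i. i < p \<Longrightarrow> f i \<in> eigenspace D q m v" and ind: "independent_mod N p f"
      have fD: "f i \<in> D" if "i < p" for i using f[OF that] by (simp add: eigenspace_def)
      show "enat p \<le> enat ?k"
      proof (rule ccontr)
        assume "\<not> enat p \<le> enat ?k"
        then obtain c where c: "\<exists>i\<in>{..<p}. c i \<noteq> 0" "\<forall>j<?k. (\<Sum>i\<in>{..<p}. c i * m (f i) (e (h j))) = 0"
          using homogeneous_system[of "{..<p}" ?k "\<lambda>j i. m (f i) (e (h j))"] by auto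
        define u where "u = lincomb p c f"
        have u: "u \<in> D" unfolding u_def by (rule M.D_lincomb) (rule fD)
        have uev: "q u w = v * m u w" if w: "w \<in> D" for w
          unfolding u_def using f w fD
          by (simp add: Q.b_lincomb M.b_lincomb eigenspace_def sum_distrib_left mult_ac)
        have "m u (e n) = 0" for n
        proof (cases "\<nu> n = v")
          case True
          then have "n \<in> h ` {..<?k}" using h by (simp add: bij_betw_def)
          then obtain j where "j < ?k" "h j = n" by auto
          then show ?thesis using c(2) fD eD unfolding u_def by (subst M.b_lincomb) auto
        next
          case False
          have "q u (e n) = \<nu> n * m u (e n)" using ev[OF u, of n] Q.b_sym M.b_sym u eD by simp
          then show ?thesis using uev[OF eD, of n] False by simp
        qed
        then have uo: "u \<in> orth n e" for n using u by (simp add: orth_def)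
        obtain n where n: "v < \<nu> n" using unbounded by blast
        have "\<nu> n * m u u \<le> v * m u u" using low[OF uo, of n] uev[OF u] by simp
        then have "m u u = 0" using n M.b_nonneg[OF u] by (simp add: mult_le_cancel_right)
        then have "u \<in> N" using m_null[OF u] by simp
        then show False using ind c(1) unfolding u_def independent_mod_def by blast
      qed
    qed
  qed
  have "\<mu> = \<nu>"
    unfolding \<mu>_def eigenvalue_seq_def
  proof (rule the_equality)
    show "mono \<nu> \<and> (\<forall>v. finite {n. \<nu> n = v} \<and> enat (card {n. \<nu> n = v}) = dim_mod N (eigenspace D q m v))"
      using mono fin dim by simp
    fix \<mu>' :: "nat \<Rightarrow> real"
    assume "mono \<mu>' \<and> (\<forall>v. finite {n. \<mu>' n = v} \<and> enat (card {n. \<mu>' n = v}) = dim_mod N (eigenspace D q m v))"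
    then show "\<mu>' = \<nu>" using mono fin dim by (intro mono_seq_eq) auto
  qed
  then show ?thesis
    using that[of e] eD on ev low mono by (auto simp: orth_def)
qed

end

section \<open>The Robin form on an interval\<close>

text \<open>Completeness of \<open>L2\<close> over a finite measure: an almost everywhere convergent subsequence exists
  by completeness of \<open>L1\<close>, and its limit is the \<open>L2\<close> limit by Fatou's lemma.\<close>

lemma (in finite_measure) L2_complete:
  fixes V :: "nat \<Rightarrow> 'a \<Rightarrow> real"
  assumes V: "\<And>n. L2 M (V n)"
    and cauchy: "\<And>e. e > 0 \<Longrightarrow> \<exists>K. \<forall>i\<ge>K. \<forall>j\<ge>K. (\<integral>x. (V i x - V j x)\<^sup>2 \<partial>M) < e"
  obtains v where "L2 M v" "(\<lambda>n. \<integral>x. (V n x - v x)\<^sup>2 \<partial>M) \<longlonglongrightarrow> 0"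
proof -
  note [measurable] = L2_measurable[OF V]
  have one: "L2 M (\<lambda>x. 1)" by (simp add: L2_def)
  have abs: "L2 M (\<lambda>x. \<bar>V i x - V j x\<bar>)" for i j
    using L2_diff[OF V V, of i j] by (auto simp: L2_def)
  have bound: "(\<integral>x. norm (V i x - V j x) \<partial>M)\<^sup>2 \<le> (\<integral>x. (V i x - V j x)\<^sup>2 \<partial>M) * measure M (space M)" for i j
    using L2_Cauchy_Schwarz[OF abs one, of i j] by simp
  have L1: "\<exists>N. \<forall>i\<ge>N. \<forall>j\<ge>N. (\<integral>x. norm (V i x - V j x) \<partial>M) < e" if e0: "e > 0" for e
  proof -
    define \<mu> where "\<mu> = measure M (space M) + 1"
    have "\<mu> > 0" by (simp add: \<mu>_def add_nonneg_pos)
    then obtain K where K: "\<forall>i\<ge>K. \<forall>j\<ge>K. (\<integral>x. (V i x - V j x)\<^sup>2 \<partial>M) < e\<^sup>2 / \<mu>"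
      using cauchy[of "e\<^sup>2 / \<mu>"] e0 by auto
    have "(\<integral>x. norm (V i x - V j x) \<partial>M) < e" if "i \<ge> K" "j \<ge> K" for i j
    proof -
      have "(\<integral>x. norm (V i x - V j x) \<partial>M)\<^sup>2 \<le> (\<integral>x. (V i x - V j x)\<^sup>2 \<partial>M) * \<mu>"
        by (rule order_trans[OF bound]) (auto simp: \<mu>_def intro!: mult_left_mono)
      also have "\<dots> < e\<^sup>2" using K that \<open>\<mu> > 0\<close> by (simp add: field_simps)
      finally show ?thesis using \<open>e > 0\<close> by (intro power_less_imp_less_base[of _ 2 e]) auto
    qed
    then show ?thesis by blast
  qed
  have VI: "integrable M (V n)" for n by (rule L2_integrable[OF V])
  obtain r where r: "strict_mono r" and ae: "AE x in M. Cauchy (\<lambda>i. V (r i) x)"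
    by (rule cauchy_L1_AE_cauchy_subseq[OF VI], erule L1, rule that)
  define v where "v x = lim (\<lambda>i. V (r i) x)" for x
  have [measurable]: "v \<in> borel_measurable M" unfolding v_def[abs_def] by measurable
  have lim: "AE x in M. (\<lambda>i. V (r i) x) \<longlonglongrightarrow> v x"
    using ae unfolding v_def by eventually_elim (simp add: Cauchy_convergent_iff convergent_LIMSEQ_iff)
  have main: "integrable M (\<lambda>x. (V n x - v x)\<^sup>2) \<and> (\<integral>x. (V n x - v x)\<^sup>2 \<partial>M) \<le> e"
    if n: "\<And>j. j \<ge> K \<Longrightarrow> (\<integral>x. (V n x - V j x)\<^sup>2 \<partial>M) < e" for n K e
  proof -
    have "0 \<le> (\<integral>x. (V n x - V K x)\<^sup>2 \<partial>M)" by simp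
    then have "0 \<le> e" using n[of K] by linarith
    have "(\<integral>\<^sup>+x. ennreal ((V n x - v x)\<^sup>2) \<partial>M) = (\<integral>\<^sup>+x. liminf (\<lambda>i. ennreal ((V n x - V (r i) x)\<^sup>2)) \<partial>M)"
    proof (rule nn_integral_cong_AE)
      show "AE x in M. ennreal ((V n x - v x)\<^sup>2) = liminf (\<lambda>i. ennreal ((V n x - V (r i) x)\<^sup>2))"
        using lim
      proof eventually_elim
        case (elim x)
        then have "(\<lambda>i. ennreal ((V n x - V (r i) x)\<^sup>2)) \<longlonglongrightarrow> ennreal ((V n x - v x)\<^sup>2)"
          by (intro tendsto_intros)
        from lim_imp_Liminf[OF sequentially_bot this] show ?case by simp
      qed
    qed
    also have "\<dots> \<le> liminf (\<lambda>i. \<integral>\<^sup>+x. ennreal ((V n x - V (r i) x)\<^sup>2) \<partial>M)"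
      by (rule nn_integral_liminf) measurable
    also have "\<dots> \<le> ennreal e"
    proof (rule Liminf_le)
      show "\<forall>\<^sub>F i in sequentially. (\<integral>\<^sup>+x. ennreal ((V n x - V (r i) x)\<^sup>2) \<partial>M) \<le> ennreal e"
        unfolding eventually_sequentially
      proof (intro exI[of _ K] allI impI)
        fix i assume "K \<le> i"
        then have "K \<le> r i" using seq_suble[OF r, of i] by simp
        then show "(\<integral>\<^sup>+x. ennreal ((V n x - V (r i) x)\<^sup>2) \<partial>M) \<le> ennreal e"
          using n[of "r i"] L2_sq[OF L2_diff[OF V V], of n "r i"]
          by (subst nn_integral_eq_integral) (auto intro!: ennreal_leI)
      qed
    qed simp
    finally have le: "(\<integral>\<^sup>+x. ennreal ((V n x - v x)\<^sup>2) \<partial>M) \<le> ennreal e" .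
    have int: "integrable M (\<lambda>x. (V n x - v x)\<^sup>2)"
      by (rule integrableI_bounded) (use le in \<open>auto simp: top_unique intro: order_le_less_trans\<close>)
    moreover have "(\<integral>x. (V n x - v x)\<^sup>2 \<partial>M) \<le> e"
      using le \<open>0 \<le> e\<close> nn_integral_eq_integral[OF int] by (simp add: ennreal_le_iff)
    ultimately show ?thesis by simp
  qed
  have Vv: "L2 M (\<lambda>x. V n x - v x)" if "n \<ge> K" "\<forall>i\<ge>K. \<forall>j\<ge>K. (\<integral>x. (V i x - V j x)\<^sup>2 \<partial>M) < 1" for n K
    using main[of K n 1] that by (simp add: L2_def)
  obtain K where K: "\<forall>i\<ge>K. \<forall>j\<ge>K. (\<integral>x. (V i x - V j x)\<^sup>2 \<partial>M) < 1" using cauchy[of 1] by auto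
  have "L2 M (\<lambda>x. V K x - (V K x - v x))" by (intro L2_diff V Vv[of K]) (use K in auto)
  then have v: "L2 M v" by simp
  have "(\<lambda>n. \<integral>x. (V n x - v x)\<^sup>2 \<partial>M) \<longlonglongrightarrow> 0"
    unfolding LIMSEQ_def
  proof (intro allI impI)
    fix e :: real assume "e > 0"
    then obtain K where K: "\<forall>i\<ge>K. \<forall>j\<ge>K. (\<integral>x. (V i x - V j x)\<^sup>2 \<partial>M) < e / 2" using cauchy[of "e/2"] by auto
    show "\<exists>K. \<forall>n\<ge>K. dist (\<integral>x. (V n x - v x)\<^sup>2 \<partial>M) 0 < e"
    proof (intro exI[of _ K] allI impI)
      fix n assume "n \<ge> K"
      then have "(\<integral>x. (V n x - v x)\<^sup>2 \<partial>M) \<le> e / 2" using main[of K n "e/2"] K by auto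
      moreover have "0 \<le> (\<integral>x. (V n x - v x)\<^sup>2 \<partial>M)" by simp
      ultimately show "dist (\<integral>x. (V n x - v x)\<^sup>2 \<partial>M) 0 < e" using \<open>e > 0\<close> by simp
    qed
  qed
  then show ?thesis using that v by blast
qed

lemma integral_mono_nonneg_subset:
  assumes "integrable (Mi a b) f" "\<And>x. 0 \<le> (f x :: real)" "a \<le> c" "d \<le> b"
  shows "(\<integral>x. f x \<partial>Mi c d) \<le> (\<integral>x. f x \<partial>Mi a b)"
  unfolding Mi_integral_sub[OF assms(3,4)]
  by (rule integral_mono[OF integrable_cut[OF assms(1)] assms(1)]) (use assms(2) in \<open>auto simp: indicator_def\<close>)

text \<open>Cauchy-Schwarz for the derivative between the two points: functions with bounded energy are Hoelder
  continuous with exponent \<open>1/2\<close>.\<close>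

lemma ac_Hoelder:
  assumes u: "ac a b u u'" "L2 (Mi a b) u'" and x: "x \<in> {a..b}" and y: "y \<in> {a..b}"
  shows "(u x - u y)\<^sup>2 \<le> \<bar>x - y\<bar> * (\<integral>s. (u' s)\<^sup>2 \<partial>Mi a b)"
proof -
  have *: "(u x - u y)\<^sup>2 \<le> (x - y) * (\<integral>s. (u' s)\<^sup>2 \<partial>Mi a b)" if "x \<in> {a..b}" "y \<in> {a..b}" "y \<le> x" for x y
  proof -
    have sub: "ac y x u u'" "L2 (Mi y x) u'" using that by (auto intro: ac_sub[OF u(1)] Mi_L2_sub[OF u(2)])
    have "(u x - u y)\<^sup>2 = (\<integral>s. u' s * 1 \<partial>Mi y x)\<^sup>2" using ac_integral[OF sub(1)] that by simp
    also have "\<dots> \<le> (\<integral>s. (u' s)\<^sup>2 \<partial>Mi y x) * (\<integral>s. 1\<^sup>2 \<partial>Mi y x)"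
      by (rule L2_Cauchy_Schwarz[OF sub(2)]) (simp add: L2_def)
    also have "(\<integral>s. 1\<^sup>2 \<partial>Mi y x) = x - y" using that by (simp add: measure_restrict_space)
    also have "(\<integral>s. (u' s)\<^sup>2 \<partial>Mi y x) * (x - y) \<le> (\<integral>s. (u' s)\<^sup>2 \<partial>Mi a b) * (x - y)"
      using that by (intro mult_right_mono integral_mono_nonneg_subset L2_sq u(2)) auto
    finally show ?thesis by (simp add: mult.commute)
  qed
  show ?thesis using *[OF x y] *[OF y x] by (cases "y \<le> x") (auto simp: power2_commute)
qed

text \<open>The trace inequality: \<open>u(x)\<^sup>2 - u(y)\<^sup>2\<close> is an integral of \<open>2 u u'\<close>; average over \<open>y\<close>.\<close>

lemma ac_trace:
  assumes u: "ac a b u u'" "L2 (Mi a b) u'" and x: "x \<in> {a..b}" and e: "e > 0" and ab: "a < b"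
  shows "(u x)\<^sup>2 \<le> e * (\<integral>s. (u' s)\<^sup>2 \<partial>Mi a b) + (1 / e + 1 / (b - a)) * (\<integral>s. (u s)\<^sup>2 \<partial>Mi a b)"
proof -
  let ?M = "Mi a b"
  define F G where "F = (\<integral>s. (u' s)\<^sup>2 \<partial>?M)" and "G = (\<integral>s. (u s)\<^sup>2 \<partial>?M)"
  have uL: "L2 ?M u" by (rule Mi_continuous_L2[OF ac_continuous[OF u(1)]])
  define f where "f s = u s * u' s + u' s * u s" for s
  have sq: "ac a b (\<lambda>s. u s * u s) f" unfolding f_def by (rule ac_mult[OF u(1) u(1)])
  have fi: "integrable ?M f" by (rule ac_integrable[OF sq])
  have K: "(\<integral>s. \<bar>f s\<bar> \<partial>?M) \<le> e * F + (1 / e) * G"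
  proof -
    have "\<bar>f s\<bar> \<le> e * (u' s)\<^sup>2 + (1 / e) * (u s)\<^sup>2" for s
    proof -
      have "0 \<le> (sqrt e * \<bar>u' s\<bar> - sqrt (1/e) * \<bar>u s\<bar>)\<^sup>2" by simp
      also have "\<dots> = e * (u' s)\<^sup>2 + (1 / e) * (u s)\<^sup>2 - 2 * (sqrt e * sqrt (1/e)) * (\<bar>u' s\<bar> * \<bar>u s\<bar>)"
        using e by (simp add: power2_diff power_mult_distrib mult_ac)
      also have "sqrt e * sqrt (1/e) = 1" using e by (simp flip: real_sqrt_mult)
      finally have "2 * (\<bar>u' s\<bar> * \<bar>u s\<bar>) \<le> e * (u' s)\<^sup>2 + (1 / e) * (u s)\<^sup>2" by simp
      moreover have "\<bar>f s\<bar> = 2 * (\<bar>u' s\<bar> * \<bar>u s\<bar>)" unfolding f_def by (simp add: mult.commute[of "u s"] flip: abs_mult)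
      ultimately show ?thesis by simp
    qed
    then have "(\<integral>s. \<bar>f s\<bar> \<partial>?M) \<le> (\<integral>s. e * (u' s)\<^sup>2 + (1 / e) * (u s)\<^sup>2 \<partial>?M)"
      using fi L2_sq[OF u(2)] L2_sq[OF uL] by (intro integral_mono) auto
    then show ?thesis using L2_sq[OF u(2)] L2_sq[OF uL] by (simp add: F_def G_def)
  qed
  have pt: "(u x)\<^sup>2 \<le> (u y)\<^sup>2 + (e * F + (1 / e) * G)" if y: "y \<in> {a..b}" for y
  proof -
    have "(u x)\<^sup>2 - (u y)\<^sup>2 = prim a b f x - prim a b f y"
      using ac_eq[OF sq x] ac_eq[OF sq y] by (simp add: power2_eq_square)
    also have "\<dots> = (\<integral>t. indicator {..<x} t * f t - indicator {..<y} t * f t \<partial>?M)"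
      unfolding prim_def by (intro Bochner_Integration.integral_diff[symmetric] integrable_cut fi) auto
    also have "\<dots> \<le> (\<integral>t. \<bar>f t\<bar> \<partial>?M)"
      by (intro integral_mono Bochner_Integration.integrable_diff integrable_cut integrable_abs fi)
         (auto simp: indicator_def)
    finally show ?thesis using K by simp
  qed
  have "(b - a) * (u x)\<^sup>2 = (\<integral>y. (u x)\<^sup>2 \<partial>?M)" using ab by (simp add: measure_restrict_space)
  also have "\<dots> \<le> (\<integral>y. (u y)\<^sup>2 + (e * F + (1 / e) * G) \<partial>?M)"
    using pt L2_sq[OF uL] by (intro integral_mono) auto
  also have "\<dots> = G + (b - a) * (e * F + (1 / e) * G)"
    using L2_sq[OF uL] ab by (simp add: G_def measure_restrict_space)
  finally have "(b - a) * ((u x)\<^sup>2 - (e * F + (1 / e) * G)) \<le> G" by (simp add: algebra_simps)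
  then have "(u x)\<^sup>2 - (e * F + (1 / e) * G) \<le> G / (b - a)" using ab by (simp add: pos_le_divide_eq mult.commute)
  then show ?thesis by (simp add: F_def[symmetric] G_def[symmetric] algebra_simps)
qed

text \<open>Sturm-Liouville forms with Robin boundary terms; the radial form of every mode is of this kind,
  with the same \<open>B\<close> and \<open>\<beta>\<close>.\<close>

locale robin =
  fixes l \<beta> :: real and B P :: "real \<Rightarrow> real"
  assumes l: "l > 0" and B_cont: "continuous_on {-l..l} B" and B_pos: "\<And>s. s \<in> {-l..l} \<Longrightarrow> B s > 0"
    and P_cont: "continuous_on {-l..l} P"
begin

abbreviation "M \<equiv> Mi (-l) l"

definition rq :: "(real \<Rightarrow> real) \<Rightarrow> (real \<Rightarrow> real) \<Rightarrow> real" where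
  "rq u v = (\<integral>s. B s * wderiv l u s * wderiv l v s - P s * u s * v s \<partial>M) - \<beta> * (u l * v l + u (-l) * v (-l))"

definition rm :: "(real \<Rightarrow> real) \<Rightarrow> (real \<Rightarrow> real) \<Rightarrow> real" where
  "rm u v = (\<integral>s. B s * u s * v s \<partial>M)"

definition H :: "(real \<Rightarrow> real) \<Rightarrow> (real \<Rightarrow> real) \<Rightarrow> bool" where
  "H u u' \<longleftrightarrow> ac (-l) l u u' \<and> L2 M u'"

lemma H1_iff: "u \<in> H1_interval l \<longleftrightarrow> (\<exists>u'. H u u')"
  using H1_interval_iff[OF l] by (simp add: H_def)

lemma H_wderiv: "u \<in> H1_interval l \<Longrightarrow> H u (wderiv l u)"
  using H1_intervalD[OF l] by (simp add: H_def)

lemma H_L2: "H u u' \<Longrightarrow> L2 M u'" and H_ac: "H u u' \<Longrightarrow> ac (-l) l u u'"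
  by (auto simp: H_def)

lemma H_cont: "H u u' \<Longrightarrow> continuous_on {-l..l} u"
  by (auto simp: H_def ac_continuous)

lemma H_L2': "H u u' \<Longrightarrow> L2 M u"
  by (intro Mi_continuous_L2 H_cont)

lemma H_add: "H u u' \<Longrightarrow> H v v' \<Longrightarrow> H (\<lambda>x. u x + v x) (\<lambda>x. u' x + v' x)"
  by (auto simp: H_def ac_add L2_add)

lemma H_diff: "H u u' \<Longrightarrow> H v v' \<Longrightarrow> H (\<lambda>x. u x - v x) (\<lambda>x. u' x - v' x)"
  by (auto simp: H_def ac_diff L2_diff)

lemma H_scale: "H u u' \<Longrightarrow> H (\<lambda>x. c * u x) (\<lambda>x. c * u' x)"
  by (auto simp: H_def ac_scale L2_scale)

lemma H_C1: 
  assumes "\<And>x. x \<in> {-l..l} \<Longrightarrow> (f has_real_derivative f' x) (at x)" "continuous_on {-l..l} f'"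
  shows "H f f'"
  unfolding H_def using assms by (auto intro: ac_C1 Mi_continuous_L2)

lemma H_const: "H (\<lambda>x. c) (\<lambda>x. 0)"
  by (rule H_C1) auto

lemma int_B: "L2 M f \<Longrightarrow> L2 M g \<Longrightarrow> integrable M (\<lambda>s. B s * f s * g s)"
  using L2_mult_integrable[OF L2_mult_continuous[OF B_cont]] by blast

lemma int_P: "L2 M f \<Longrightarrow> L2 M g \<Longrightarrow> integrable M (\<lambda>s. P s * f s * g s)"
  using L2_mult_integrable[OF L2_mult_continuous[OF P_cont]] by blast

lemma rq_eq:
  assumes u: "H u u'" and v: "H v v'"
  shows "rq u v = (\<integral>s. B s * u' s * v' s \<partial>M) - (\<integral>s. P s * u s * v s \<partial>M) - \<beta> * (u l * v l + u (-l) * v (-l))"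
proof -
  have D: "u \<in> H1_interval l" "v \<in> H1_interval l" using u v by (auto simp: H1_iff)
  note w = H_wderiv[OF D(1)] H_wderiv[OF D(2)]
  have ae: "AE s in M. wderiv l u s = u' s" "AE s in M. wderiv l v s = v' s"
    using wderiv_AE[OF l] u v by (auto simp: H_def)
  have "(\<integral>s. B s * wderiv l u s * wderiv l v s - P s * u s * v s \<partial>M) = (\<integral>s. B s * u' s * v' s - P s * u s * v s \<partial>M)"
    using int_B[OF H_L2[OF w(1)] H_L2[OF w(2)]] int_B[OF H_L2[OF u] H_L2[OF v]] int_P[OF H_L2'[OF u] H_L2'[OF v]]
  proof (intro integral_cong_AE)
    show "AE s in M. B s * wderiv l u s * wderiv l v s - P s * u s * v s = B s * u' s * v' s - P s * u s * v s"
      using ae by eventually_elim simp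
  qed (auto intro!: borel_measurable_diff)
  then show ?thesis
    unfolding rq_def using int_B[OF H_L2[OF u] H_L2[OF v]] int_P[OF H_L2'[OF u] H_L2'[OF v]] by simp
qed

lemma H1_subspace: "linear_subspace (H1_interval l)"
  unfolding linear_subspace_def
proof (intro conjI ballI allI)
  show "(\<lambda>x. 0) \<in> H1_interval l" using H_const[of 0] H1_iff by blast
  fix u assume "u \<in> H1_interval l"
  then obtain u' where u: "H u u'" using H1_iff by blast
  show "(\<lambda>x. c * u x) \<in> H1_interval l" for c using H_scale[OF u] H1_iff by blast
  fix v assume "v \<in> H1_interval l"
  then obtain v' where v: "H v v'" using H1_iff by blast
  show "(\<lambda>x. u x + v x) \<in> H1_interval l" using H_add[OF u v] H1_iff by blast
qed

lemma H1_even_subspace: "linear_subspace (H1_even l)"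
  using H1_subspace unfolding linear_subspace_def H1_even_def by auto

lemma rq_form: assumes D: "linear_subspace D" "D \<subseteq> H1_interval l" shows "sym_form D rq"
proof
  show "linear_subspace D" by (rule D(1))
  fix u v w assume uvw: "u \<in> D" "v \<in> D" "w \<in> D"
  then obtain u' v' w' where H: "H u u'" "H v v'" "H w w'" using D(2) H1_iff by (meson subsetD)
  note L = H[THEN H_L2] H[THEN H_L2']
  show "rq (\<lambda>x. u x + v x) w = rq u w + rq v w"
    using int_B[OF L(1,3)] int_B[OF L(2,3)] int_P[OF L(4,6)] int_P[OF L(5,6)]
    by (simp add: rq_eq[OF H_add[OF H(1,2)] H(3)] rq_eq[OF H(1,3)] rq_eq[OF H(2,3)] algebra_simps)
next
  fix u w and c :: real assume uw: "u \<in> D" "w \<in> D"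
  then obtain u' w' where H: "H u u'" "H w w'" using D(2) H1_iff by (meson subsetD)
  have i: "(\<integral>s. B s * (c * u' s) * w' s \<partial>M) = c * (\<integral>s. B s * u' s * w' s \<partial>M)"
    "(\<integral>s. P s * (c * u s) * w s \<partial>M) = c * (\<integral>s. P s * u s * w s \<partial>M)"
    by (simp_all only: mult.left_commute mult.assoc Bochner_Integration.integral_mult_right_zero)
  show "rq (\<lambda>x. c * u x) w = c * rq u w"
    unfolding rq_eq[OF H_scale[OF H(1)] H(2)] rq_eq[OF H] i by (simp add: algebra_simps)
next
  fix u v assume "u \<in> D" "v \<in> D"
  show "rq u v = rq v u" unfolding rq_def by (simp add: mult_ac)
qed

lemma rm_form: assumes D: "linear_subspace D" "D \<subseteq> H1_interval l" shows "psd_form D rm"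
proof
  show "linear_subspace D" by (rule D(1))
  fix u v w assume uvw: "u \<in> D" "v \<in> D" "w \<in> D"
  then obtain u' v' w' where H: "H u u'" "H v v'" "H w w'" using D(2) H1_iff by (meson subsetD)
  note L = H[THEN H_L2']
  show "rm (\<lambda>x. u x + v x) w = rm u w + rm v w"
    using int_B[OF L(1,3)] int_B[OF L(2,3)] by (simp add: rm_def algebra_simps)
next
  fix u w and c :: real assume uw: "u \<in> D" "w \<in> D"
  show "rm (\<lambda>x. c * u x) w = c * rm u w"
    unfolding rm_def by (simp only: mult.left_commute mult.assoc Bochner_Integration.integral_mult_right_zero)
next
  fix u v assume "u \<in> D" "v \<in> D"
  show "rm u v = rm v u" unfolding rm_def by (simp add: mult_ac)
next
  fix u assume "u \<in> D"
  show "0 \<le> rm u u" unfolding rm_def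
    by (intro Bochner_Integration.integral_nonneg)
      (auto simp: mult.assoc intro!: mult_nonneg_nonneg[OF less_imp_le[OF B_pos] zero_le_square])
qed

lemma B_bounds:
  obtains b0 b1 where "b0 > 0" "b1 > 0" "\<And>s. s \<in> {-l..l} \<Longrightarrow> b0 \<le> B s" "\<And>s. s \<in> {-l..l} \<Longrightarrow> B s \<le> b1"
proof -
  obtain p where p: "p \<in> {-l..l}" "\<And>s. s \<in> {-l..l} \<Longrightarrow> B p \<le> B s"
    using continuous_attains_inf[OF _ _ B_cont] l by (auto simp: compact_Icc)
  obtain C where "\<And>s. s \<in> {-l..l} \<Longrightarrow> \<bar>B s\<bar> \<le> C" "C > 0" using continuous_on_Icc_bounded[OF B_cont] by blast
  then show ?thesis using that[of "B p" C] p B_pos by fastforce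
qed

lemma rm_bounds:
  assumes b: "\<And>s. s \<in> {-l..l} \<Longrightarrow> b0 \<le> B s" "\<And>s. s \<in> {-l..l} \<Longrightarrow> B s \<le> b1" and u: "L2 M u"
  shows "b0 * (\<integral>s. (u s)\<^sup>2 \<partial>M) \<le> (\<integral>s. B s * u s * u s \<partial>M)" "(\<integral>s. B s * u s * u s \<partial>M) \<le> b1 * (\<integral>s. (u s)\<^sup>2 \<partial>M)"
proof -
  have "(\<integral>s. b0 * (u s)\<^sup>2 \<partial>M) \<le> (\<integral>s. B s * u s * u s \<partial>M)" "(\<integral>s. B s * u s * u s \<partial>M) \<le> (\<integral>s. b1 * (u s)\<^sup>2 \<partial>M)"
    using int_B[OF u u] L2_sq[OF u] b
    by (auto intro!: integral_mono mult_right_mono simp: power2_eq_square mult.assoc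
        simp del: Bochner_Integration.integral_mult_right_zero Bochner_Integration.integral_mult_right)
  then show "b0 * (\<integral>s. (u s)\<^sup>2 \<partial>M) \<le> (\<integral>s. B s * u s * u s \<partial>M)" "(\<integral>s. B s * u s * u s \<partial>M) \<le> b1 * (\<integral>s. (u s)\<^sup>2 \<partial>M)"
    by simp_all
qed

text \<open>The square of the Sobolev norm.\<close>

definition hn :: "(real \<Rightarrow> real) \<Rightarrow> (real \<Rightarrow> real) \<Rightarrow> real" where
  "hn u u' = (\<integral>s. (u' s)\<^sup>2 \<partial>M) + (\<integral>s. (u s)\<^sup>2 \<partial>M)"

lemma hn_parts: "(\<integral>s. (u' s)\<^sup>2 \<partial>M) \<le> hn u u'" "(\<integral>s. (u s)\<^sup>2 \<partial>M) \<le> hn u u'" "0 \<le> hn u u'"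
  by (simp_all add: hn_def)

text \<open>Garding's inequality: with a small \<open>\<epsilon>\<close>, \<open>ac_trace\<close> bounds the boundary term by half of the Dirichlet
  integral and a multiple of the \<open>L2\<close> norm.\<close>

lemma coercive:
  obtains C c0 c1 where "c0 > 0" "c1 > 0"
    "\<And>u u'. H u u' \<Longrightarrow> rm u u + c0 * hn u u' \<le> rq u u + C * rm u u"
    "\<And>u u'. H u u' \<Longrightarrow> rq u u + C * rm u u \<le> c1 * hn u u'"
proof -
  obtain b0 b1 where b: "b0 > 0" "b1 > 0" "\<And>s. s \<in> {-l..l} \<Longrightarrow> b0 \<le> B s" "\<And>s. s \<in> {-l..l} \<Longrightarrow> B s \<le> b1"
    using B_bounds by blast
  obtain p where p: "\<And>s. s \<in> {-l..l} \<Longrightarrow> \<bar>P s\<bar> \<le> p" "p > 0" using continuous_on_Icc_bounded[OF P_cont] by blast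
  define \<epsilon> where "\<epsilon> = b0 / (4 * (\<bar>\<beta>\<bar> + 1))"
  have \<epsilon>: "\<epsilon> > 0" using b by (simp add: \<epsilon>_def divide_pos_pos add_nonneg_pos)
  have \<epsilon>2: "2 * \<bar>\<beta>\<bar> * \<epsilon> \<le> b0 / 2"
  proof -
    have "2 * \<bar>\<beta>\<bar> * \<epsilon> \<le> 2 * (\<bar>\<beta>\<bar> + 1) * \<epsilon>" using \<epsilon> by (intro mult_right_mono) auto
    also have "\<dots> = b0 / 2"
    proof -
      have "\<bar>\<beta>\<bar> + 1 \<noteq> 0" by linarith
      then show ?thesis unfolding \<epsilon>_def by (simp add: divide_simps)
    qed
    finally show ?thesis .
  qed
  define T where "T = 1 / \<epsilon> + 1 / (2 * l)"
  have T: "T > 0" using \<epsilon> l by (simp add: T_def add_pos_pos)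
  define R where "R = p + 2 * \<bar>\<beta>\<bar> * T"
  have R: "R \<ge> 0" using p(2) T by (simp add: R_def)
  define C where "C = (R + b1 + b0 / 2) / b0"
  have C: "C > 0" using R b by (simp add: C_def)
  have est: "\<bar>(\<integral>s. P s * u s * u s \<partial>M) + \<beta> * (u l * u l + u (-l) * u (-l))\<bar> \<le> b0 / 2 * (\<integral>s. (u' s)\<^sup>2 \<partial>M) + R * (\<integral>s. (u s)\<^sup>2 \<partial>M)"
    if H: "H u u'" for u u'
  proof -
    have pL: "\<bar>\<integral>s. P s * u s * u s \<partial>M\<bar> \<le> p * (\<integral>s. (u s)\<^sup>2 \<partial>M)"
    proof -
      have "\<bar>\<integral>s. P s * u s * u s \<partial>M\<bar> \<le> (\<integral>s. \<bar>P s * u s * u s\<bar> \<partial>M)" by (rule integral_abs_bound)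
      also have "\<dots> \<le> (\<integral>s. p * (u s)\<^sup>2 \<partial>M)"
      proof (intro integral_mono)
        show "integrable M (\<lambda>s. \<bar>P s * u s * u s\<bar>)" by (intro integrable_abs int_P H_L2'[OF H])
        show "integrable M (\<lambda>s. p * (u s)\<^sup>2)" using L2_sq[OF H_L2'[OF H]] by simp
        show "\<bar>P s * u s * u s\<bar> \<le> p * (u s)\<^sup>2" if "s \<in> space M" for s
          using p(1)[of s] that by (auto simp: abs_mult power2_eq_square mult.assoc intro!: mult_right_mono)
      qed
      finally show ?thesis by simp
    qed
    have tr: "u x * u x \<le> \<epsilon> * (\<integral>s. (u' s)\<^sup>2 \<partial>M) + T * (\<integral>s. (u s)\<^sup>2 \<partial>M)" if "x \<in> {-l..l}" for x
      using ac_trace[OF H_ac[OF H] H_L2[OF H] that \<epsilon>] l by (simp add: T_def power2_eq_square)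
    have "\<bar>\<beta> * (u l * u l + u (-l) * u (-l))\<bar> = \<bar>\<beta>\<bar> * (u l * u l + u (-l) * u (-l))" by (simp add: abs_mult)
    also have "\<dots> \<le> \<bar>\<beta>\<bar> * (2 * (\<epsilon> * (\<integral>s. (u' s)\<^sup>2 \<partial>M) + T * (\<integral>s. (u s)\<^sup>2 \<partial>M)))"
      using tr[of l] tr[of "-l"] l by (intro mult_left_mono) auto
    also have "\<dots> = 2 * \<bar>\<beta>\<bar> * \<epsilon> * (\<integral>s. (u' s)\<^sup>2 \<partial>M) + 2 * \<bar>\<beta>\<bar> * T * (\<integral>s. (u s)\<^sup>2 \<partial>M)"
      by (simp add: algebra_simps)
    also have "\<dots> \<le> b0 / 2 * (\<integral>s. (u' s)\<^sup>2 \<partial>M) + 2 * \<bar>\<beta>\<bar> * T * (\<integral>s. (u s)\<^sup>2 \<partial>M)"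
      using \<epsilon>2 by (intro add_right_mono mult_right_mono) auto
    finally show ?thesis using pL by (simp add: R_def algebra_simps)
  qed
  show ?thesis
  proof (rule that[of "b0 / 2" "b1 + b0 / 2 + R + C * b1" C])
    show "b0 / 2 > 0" "b1 + b0 / 2 + R + C * b1 > 0" using b R C by (simp_all add: add_pos_nonneg)
    fix u u' assume H: "H u u'"
    let ?F = "\<integral>s. (u' s)\<^sup>2 \<partial>M" and ?G = "\<integral>s. (u s)\<^sup>2 \<partial>M"
    note e = est[OF H]
    note B1 = rm_bounds[OF b(3,4) H_L2[OF H]] and B0 = rm_bounds[OF b(3,4) H_L2'[OF H]]
    have FG: "?F \<ge> 0" "?G \<ge> 0" by simp_all
    have "C * (b0 * ?G) \<le> C * rm u u" using B0 C by (intro mult_left_mono) (auto simp: rm_def)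
    then have "(R + b1 + b0 / 2) * ?G \<le> C * rm u u" using b by (simp add: C_def)
    then show "rm u u + b0 / 2 * hn u u' \<le> rq u u + C * rm u u"
      using e B1(1) B0(2) by (simp add: rq_eq[OF H H] rm_def hn_def abs_le_iff algebra_simps)
    have "C * rm u u \<le> C * (b1 * ?G)" using B0 C by (intro mult_left_mono) (auto simp: rm_def)
    moreover have "0 \<le> b1 * ?G" "0 \<le> R * ?F" "0 \<le> C * b1 * ?F" "0 \<le> b0 / 2 * ?G" using b R C FG by simp_all
    ultimately show "rq u u + C * rm u u \<le> (b1 + b0 / 2 + R + C * b1) * hn u u'"
      using e B1(2) by (simp add: rq_eq[OF H H] rm_def hn_def abs_le_iff algebra_simps)
  qed
qed

lemma H_sup:
  obtains T where "T > 0" "\<And>u u' x. H u u' \<Longrightarrow> x \<in> {-l..l} \<Longrightarrow> (u x)\<^sup>2 \<le> T * hn u u'"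
proof -
  define T where "T = 1 + (1 + 1 / (2 * l))"
  have "T > 0" using l by (simp add: T_def add_pos_pos)
  moreover have "(u x)\<^sup>2 \<le> T * hn u u'" if H: "H u u'" and x: "x \<in> {-l..l}" for u u' x
  proof -
    have "(u x)\<^sup>2 \<le> 1 * (\<integral>s. (u' s)\<^sup>2 \<partial>M) + (1 + 1 / (2 * l)) * (\<integral>s. (u s)\<^sup>2 \<partial>M)"
      using ac_trace[OF H_ac[OF H] H_L2[OF H] x, of 1] l by simp
    also have "\<dots> \<le> 1 * hn u u' + (1 + 1 / (2 * l)) * hn u u'"
      using hn_parts l by (intro add_mono mult_left_mono) auto
    finally show ?thesis by (simp add: T_def algebra_simps)
  qed
  ultimately show ?thesis using that by blast
qed

text \<open>The derivatives converge in \<open>L2\<close> and the values at \<open>-l\<close> converge, so the limit is a primitive;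
  \<open>ac_Hoelder\<close> turns this into uniform convergence of the functions.\<close>

lemma hn_complete:
  assumes X: "\<And>n. H (X n) (X' n)"
    and cauchy: "\<And>e. e > 0 \<Longrightarrow> \<exists>K. \<forall>i\<ge>K. \<forall>j\<ge>K. hn (\<lambda>x. X i x - X j x) (\<lambda>x. X' i x - X' j x) < e"
  obtains u u' where "H u u'" "(\<lambda>n. hn (\<lambda>x. X n x - u x) (\<lambda>x. X' n x - u' x)) \<longlonglongrightarrow> 0"
    "\<And>s. s \<in> {-l..l} \<Longrightarrow> (\<lambda>n. X n s) \<longlonglongrightarrow> u s"
proof -
  have c2: "\<exists>K. \<forall>i\<ge>K. \<forall>j\<ge>K. (\<integral>s. (X' i s - X' j s)\<^sup>2 \<partial>M) < e" if "e > 0" for e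
    using cauchy[OF that] hn_parts(1) by (meson le_less_trans)
  obtain u' where u': "L2 M u'" and lim': "(\<lambda>n. \<integral>s. (X' n s - u' s)\<^sup>2 \<partial>M) \<longlonglongrightarrow> 0"
    by (rule Mi.L2_complete[OF H_L2[OF X]], erule c2, rule that)
  obtain T where T: "T > 0" "\<And>u u' x. H u u' \<Longrightarrow> x \<in> {-l..l} \<Longrightarrow> (u x)\<^sup>2 \<le> T * hn u u'" using H_sup by blast
  have "Cauchy (\<lambda>n. X n (-l))"
    unfolding Cauchy_def
  proof (intro allI impI)
    fix e :: real assume e: "e > 0"
    then obtain K where K: "\<And>i j. i \<ge> K \<Longrightarrow> j \<ge> K \<Longrightarrow> hn (\<lambda>x. X i x - X j x) (\<lambda>x. X' i x - X' j x) < e\<^sup>2 / T"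
      using cauchy[of "e\<^sup>2 / T"] T(1) by auto
    have "dist (X i (-l)) (X j (-l)) < e" if "i \<ge> K" "j \<ge> K" for i j
    proof -
      have "(X i (-l) - X j (-l))\<^sup>2 \<le> T * hn (\<lambda>x. X i x - X j x) (\<lambda>x. X' i x - X' j x)"
        using T(2)[OF H_diff[OF X X], of "-l" i j] l by simp
      also have "\<dots> < e\<^sup>2" using K[OF that] T(1) by (simp add: field_simps)
      finally have "\<bar>X i (-l) - X j (-l)\<bar>\<^sup>2 < e\<^sup>2" by simp
      then show ?thesis unfolding dist_real_def using e by (intro power_less_imp_less_base[of _ 2 e]) auto
    qed
    then show "\<exists>K. \<forall>i\<ge>K. \<forall>j\<ge>K. dist (X i (-l)) (X j (-l)) < e" by blast
  qed
  then obtain c where c: "(\<lambda>n. X n (-l)) \<longlonglongrightarrow> c" using Cauchy_convergent_iff convergent_def by blast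
  define u where "u x = c + prim (-l) l u' x" for x
  have uac: "ac (-l) l u u'"
    by (rule acI) (auto simp: u_def prim_left Mi.L2_integrable[OF u'])
  then have Hu: "H u u'" using u' by (simp add: H_def)
  have uml: "u (-l) = c" by (simp add: u_def prim_left)
  define \<delta> where "\<delta> n = 2 * (X n (-l) - c)\<^sup>2 + 4 * l * (\<integral>s. (X' n s - u' s)\<^sup>2 \<partial>M)" for n
  have \<delta>: "\<delta> \<longlonglongrightarrow> 0"
  proof -
    have "\<delta> \<longlonglongrightarrow> 2 * (c - c)\<^sup>2 + 4 * l * 0" unfolding \<delta>_def[abs_def] by (intro tendsto_intros c lim')
    then show ?thesis by simp
  qed
  have pt: "(X n x - u x)\<^sup>2 \<le> \<delta> n" if x: "x \<in> {-l..l}" for n x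
  proof -
    let ?d = "\<lambda>x. X n x - u x"
    have "(?d x - ?d (-l))\<^sup>2 \<le> \<bar>x - (-l)\<bar> * (\<integral>s. (X' n s - u' s)\<^sup>2 \<partial>M)"
      by (rule ac_Hoelder[OF H_ac[OF H_diff[OF X Hu]] H_L2[OF H_diff[OF X Hu]] x]) (use l in auto)
    also have "\<dots> \<le> (2 * l) * (\<integral>s. (X' n s - u' s)\<^sup>2 \<partial>M)" using x by (intro mult_right_mono) auto
    finally have "2 * (?d x - ?d (-l))\<^sup>2 + 2 * (?d (-l))\<^sup>2 \<le> \<delta> n" by (simp add: \<delta>_def uml)
    moreover have "(?d x)\<^sup>2 \<le> 2 * (?d x - ?d (-l))\<^sup>2 + 2 * (?d (-l))\<^sup>2"
    proof -
      have "(p::real)\<^sup>2 \<le> 2 * (p - q)\<^sup>2 + 2 * q\<^sup>2" for p q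
        using zero_le_power2[of "p - 2 * q"] by (simp add: power2_eq_square algebra_simps)
      then show ?thesis by blast
    qed
    ultimately show ?thesis by linarith
  qed
  have G: "(\<integral>s. (X n s - u s)\<^sup>2 \<partial>M) \<le> 2 * l * \<delta> n" for n
  proof -
    have "(\<integral>s. (X n s - u s)\<^sup>2 \<partial>M) \<le> (\<integral>s. \<delta> n \<partial>M)"
      using L2_sq[OF H_L2'[OF H_diff[OF X Hu]], of n] pt by (intro integral_mono) auto
    then show ?thesis using l by (simp add: measure_restrict_space)
  qed
  have lim0: "(\<lambda>n. (\<integral>s. (X' n s - u' s)\<^sup>2 \<partial>M) + 2 * l * \<delta> n) \<longlonglongrightarrow> 0 + 2 * l * 0"
    by (intro tendsto_intros lim' \<delta>)
  have "(\<lambda>n. hn (\<lambda>x. X n x - u x) (\<lambda>x. X' n x - u' x)) \<longlonglongrightarrow> 0"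
    by (rule tendsto_sandwich[OF _ _ tendsto_const lim0[simplified]])
       (use G in \<open>auto intro!: always_eventually simp: hn_def\<close>)
  moreover have "(\<lambda>n. X n s) \<longlonglongrightarrow> u s" if "s \<in> {-l..l}" for s
  proof -
    have "(\<lambda>n. (X n s - u s)\<^sup>2) \<longlonglongrightarrow> 0"
      by (rule tendsto_sandwich[OF _ _ tendsto_const \<delta>]) (use pt[OF that] in \<open>auto intro!: always_eventually\<close>)
    then have "(\<lambda>n. sqrt ((X n s - u s)\<^sup>2)) \<longlonglongrightarrow> sqrt 0" by (intro tendsto_intros)
    then show ?thesis by (simp add: tendsto_rabs_zero_iff LIM_zero_iff)
  qed
  ultimately show ?thesis using that[OF Hu] by blast
qed

text \<open>A bounded sequence is uniformly bounded and, by \<open>ac_Hoelder\<close>, equicontinuous; apply the theorem of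
  Arzela and Ascoli.\<close>

lemma hn_compact:
  assumes X: "\<And>n. H (X n) (X' n)" and bd: "\<And>n. hn (X n) (X' n) \<le> K"
  obtains r :: "nat \<Rightarrow> nat" where "strict_mono r"
    "\<And>e. e > 0 \<Longrightarrow> \<exists>N. \<forall>i\<ge>N. \<forall>j\<ge>N. rm (\<lambda>x. X (r i) x - X (r j) x) (\<lambda>x. X (r i) x - X (r j) x) < e"
proof -
  obtain T where T: "T > 0" "\<And>u u' x. H u u' \<Longrightarrow> x \<in> {-l..l} \<Longrightarrow> (u x)\<^sup>2 \<le> T * hn u u'" using H_sup by blast
  have K0: "0 \<le> K" using bd[of 0] hn_parts(3) by (meson order_trans)
  have cb: "compact {-l..l}" by simp
  have sup: "norm (X n x) \<le> sqrt (T * K)" if "x \<in> {-l..l}" for n x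
  proof -
    have "(X n x)\<^sup>2 \<le> T * K" using T(2)[OF X that, of n] bd[of n] T(1) by (meson mult_left_mono less_imp_le order_trans)
    then show ?thesis by (simp add: real_le_rsqrt)
  qed
  have eq: "\<exists>d>0. \<forall>n y. y \<in> {-l..l} \<and> norm (x - y) < d \<longrightarrow> norm (X n x - X n y) < e"
    if x: "x \<in> {-l..l}" and e: "0 < e" for x e
  proof (intro exI[of _ "e\<^sup>2 / (K + 1)"] conjI allI impI)
    show "0 < e\<^sup>2 / (K + 1)" using e K0 by simp
    fix n y assume y: "y \<in> {-l..l} \<and> norm (x - y) < e\<^sup>2 / (K + 1)"
    have "(X n x - X n y)\<^sup>2 \<le> \<bar>x - y\<bar> * (\<integral>s. (X' n s)\<^sup>2 \<partial>M)"
      using ac_Hoelder[OF H_ac[OF X] H_L2[OF X] x, of y n] y by simp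
    also have "\<dots> \<le> \<bar>x - y\<bar> * (K + 1)"
      using hn_parts(1)[of "X' n" "X n"] bd[of n] by (intro mult_left_mono) auto
    also have "\<dots> < e\<^sup>2" using y K0 by (simp add: field_simps)
    finally have "\<bar>X n x - X n y\<bar>\<^sup>2 < e\<^sup>2" by simp
    then show "norm (X n x - X n y) < e" using e by (simp add: power2_less_imp_less)
  qed
  obtain g r where r: "strict_mono (r :: nat \<Rightarrow> nat)"
    and conv: "\<And>e. 0 < e \<Longrightarrow> \<exists>N. \<forall>n x. n \<ge> N \<and> x \<in> {-l..l} \<longrightarrow> norm (X (r n) x - g x) < e"
    by (rule Arzela_Ascoli[OF cb, of X, OF sup eq]) (assumption | rule that)+
  obtain b0 b1 where b: "b0 > 0" "b1 > 0" "\<And>s. s \<in> {-l..l} \<Longrightarrow> b0 \<le> B s" "\<And>s. s \<in> {-l..l} \<Longrightarrow> B s \<le> b1"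
    using B_bounds by blast
  have "\<exists>N. \<forall>i\<ge>N. \<forall>j\<ge>N. rm (\<lambda>x. X (r i) x - X (r j) x) (\<lambda>x. X (r i) x - X (r j) x) < e" if e: "e > 0" for e
  proof -
    define \<eta> where "\<eta> = sqrt (e / (16 * l * b1))"
    have \<eta>: "\<eta> > 0" using e l b by (simp add: \<eta>_def)
    obtain N where N: "\<And>n x. n \<ge> N \<Longrightarrow> x \<in> {-l..l} \<Longrightarrow> norm (X (r n) x - g x) < \<eta>" using conv[OF \<eta>] by blast
    have "rm (\<lambda>x. X (r i) x - X (r j) x) (\<lambda>x. X (r i) x - X (r j) x) < e" if ij: "i \<ge> N" "j \<ge> N" for i j
    proof -
      let ?d = "\<lambda>x. X (r i) x - X (r j) x"
      have "(?d x)\<^sup>2 \<le> (2 * \<eta>)\<^sup>2" if "x \<in> {-l..l}" for x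
        using N[OF ij(1) that] N[OF ij(2) that] by (intro abs_le_square_iff[THEN iffD1]) auto
      moreover have "(2 * \<eta>)\<^sup>2 = e / (4 * l * b1)" using e l b by (simp add: \<eta>_def power_mult_distrib)
      ultimately have pt: "(?d x)\<^sup>2 \<le> e / (4 * l * b1)" if "x \<in> {-l..l}" for x
        using that by metis
      have dL: "L2 M ?d" by (rule H_L2'[OF H_diff[OF X X]])
      have "rm ?d ?d \<le> b1 * (\<integral>s. (?d s)\<^sup>2 \<partial>M)" unfolding rm_def by (rule rm_bounds(2)[OF b(3,4) dL])
      also have "\<dots> \<le> b1 * (\<integral>s. e / (4 * l * b1) \<partial>M)"
        using L2_sq[OF dL] pt b by (intro mult_left_mono integral_mono) auto
      also have "\<dots> = e / 2" using l b by (simp add: measure_restrict_space field_simps)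
      finally show ?thesis using e by simp
    qed
    then show ?thesis by blast
  qed
  then show ?thesis using that[OF r] by blast
qed

text \<open>Even monomials show that the spaces of all functions and of even functions are both
  infinite-dimensional.\<close>

lemma even_powers_independent: "independent_mod (null_interval l) n (\<lambda>i s. s ^ (2 * i))"
  unfolding independent_mod_def
proof (intro allI impI)
  fix c j assume N: "lincomb n c (\<lambda>i s. s ^ (2 * i)) \<in> null_interval l" and j: "j < n"
  then obtain k where k: "n = Suc k" by (cases n) auto
  have "(\<Sum>i\<le>k. c i * t ^ i) = 0" if "t \<in> {0..l\<^sup>2}" for t
  proof -
    have "sqrt t \<in> {-l..l}" using that l real_le_lsqrt[of l t] order_trans[of "-l" 0 "sqrt t"] by auto
    then have "(\<Sum>i<n. c i * sqrt t ^ (2 * i)) = 0" using N by (auto simp: null_interval_def)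
    then show ?thesis using that by (simp add: k lessThan_Suc_atMost power_mult)
  qed
  then have "{0..l\<^sup>2} \<subseteq> {t. (\<Sum>i\<le>k. c i * t ^ i) = 0}" by auto
  moreover have "infinite {0..l\<^sup>2}" using l by (simp add: infinite_Icc)
  ultimately have "infinite {t. (\<Sum>i\<le>k. c i * t ^ i) = 0}" using infinite_super by blast
  then show "c j = 0" using polyfun_finite_roots[of c k] j k by auto
qed

theorem robin_compact:
  assumes D: "D = H1_interval l \<or> D = H1_even l"
  obtains C where "compact_form (null_interval l) D rq rm C"
proof -
  obtain C c0 c1 where c: "c0 > 0" "c1 > 0"
    "\<And>u u'. H u u' \<Longrightarrow> rm u u + c0 * hn u u' \<le> rq u u + C * rm u u"
    "\<And>u u'. H u u' \<Longrightarrow> rq u u + C * rm u u \<le> c1 * hn u u'"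
    by (rule coercive) (rule that; assumption)
  have sub: "linear_subspace D" and DH: "D \<subseteq> H1_interval l"
    using D H1_subspace H1_even_subspace by (auto simp: H1_even_def)
  have DW: "H u (wderiv l u)" if "u \<in> D" for u using that DH H_wderiv by blast
  interpret Q: sym_form D rq by (rule rq_form[OF sub DH])
  interpret R: psd_form D rm by (rule rm_form[OF sub DH])
  have "compact_form (null_interval l) D rq rm C"
  proof
    fix u assume u: "u \<in> D"
    note Hu = DW[OF u]
    show "rm u u = 0 \<longleftrightarrow> u \<in> null_interval l"
    proof
      assume z: "rm u u = 0"
      obtain b0 b1 where b: "b0 > 0" "\<And>s. s \<in> {-l..l} \<Longrightarrow> b0 \<le> B s" "\<And>s. s \<in> {-l..l} \<Longrightarrow> B s \<le> b1"
        using B_bounds by metis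
      have "b0 * (\<integral>s. (u s)\<^sup>2 \<partial>M) \<le> 0" using rm_bounds(1)[OF b(2,3) H_L2'[OF Hu]] z by (simp add: rm_def)
      then have "(\<integral>s. (u s)\<^sup>2 \<partial>M) \<le> 0" using b(1) by (simp add: mult_le_0_iff)
      from L2_zero_AE[OF H_L2'[OF Hu] this] have "u s = 0" if "s \<in> {-l..l}" for s
        by (rule continuous_AE_eq[OF _ H_cont[OF Hu] that]) (use l in auto)
      then show "u \<in> null_interval l" by (simp add: null_interval_def)
    next
      assume "u \<in> null_interval l"
      then show "rm u u = 0" unfolding rm_def null_interval_def
        by (intro integral_eq_zero_AE AE_I2) auto
    qed
    have "0 \<le> c0 * hn u (wderiv l u)" using c(1) hn_parts(3) by simp
    then show "rm u u \<le> rq u u + C * rm u u" using c(3)[OF Hu] by linarith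
  next
    fix X :: "nat \<Rightarrow> real \<Rightarrow> real"
    assume X: "\<And>n. X n \<in> D"
      and ca: "\<And>e. e > 0 \<Longrightarrow> \<exists>K. \<forall>i\<ge>K. \<forall>j\<ge>K. rq (\<lambda>x. X i x - X j x) (\<lambda>x. X i x - X j x)
          + C * rm (\<lambda>x. X i x - X j x) (\<lambda>x. X i x - X j x) < e"
    note HX = DW[OF X]
    have cau: "\<exists>K. \<forall>i\<ge>K. \<forall>j\<ge>K. hn (\<lambda>x. X i x - X j x) (\<lambda>x. wderiv l (X i) x - wderiv l (X j) x) < e" if e: "e > 0" for e
    proof -
      have "c0 * e > 0" using c e by simp
      then obtain K where K: "\<And>i j. i \<ge> K \<Longrightarrow> j \<ge> K \<Longrightarrow> rq (\<lambda>x. X i x - X j x) (\<lambda>x. X i x - X j x)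
          + C * rm (\<lambda>x. X i x - X j x) (\<lambda>x. X i x - X j x) < c0 * e" using ca by blast
      have "hn (\<lambda>x. X i x - X j x) (\<lambda>x. wderiv l (X i) x - wderiv l (X j) x) < e" if "i \<ge> K" "j \<ge> K" for i j
      proof -
        have "c0 * hn (\<lambda>x. X i x - X j x) (\<lambda>x. wderiv l (X i) x - wderiv l (X j) x) < c0 * e"
          using c(3)[OF H_diff[OF HX HX], of i j] K[OF that] R.b_nonneg[OF R.D_diff[OF X X], of i j] by linarith
        then show ?thesis using c(1) by simp
      qed
      then show ?thesis by blast
    qed
    obtain u u' where u: "H u u'" and lim: "(\<lambda>n. hn (\<lambda>x. X n x - u x) (\<lambda>x. wderiv l (X n) x - u' x)) \<longlonglongrightarrow> 0"
      and pw: "\<And>s. s \<in> {-l..l} \<Longrightarrow> (\<lambda>n. X n s) \<longlonglongrightarrow> u s"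
      by (rule hn_complete[of X "\<lambda>n. wderiv l (X n)", OF HX], erule cau, rule that)
    have uH: "u \<in> H1_interval l" using u H1_iff by blast
    have "u \<in> D"
    proof (cases "D = H1_interval l")
      case True
      then show ?thesis using uH by simp
    next
      case False
      then have De: "D = H1_even l" using D by simp
      have "u (-s) = u s" if s: "s \<in> {-l..l}" for s
      proof -
        have "X n (-s) = X n s" for n using X[of n] s by (auto simp: De H1_even_def)
        then have "(\<lambda>n. X n s) \<longlonglongrightarrow> u (-s)" using pw[of "-s"] s by auto
        then show ?thesis using pw[OF s] LIMSEQ_unique by blast
      qed
      then show ?thesis using uH by (simp add: De H1_even_def)
    qed
    moreover have "(\<lambda>n. rq (\<lambda>x. X n x - u x) (\<lambda>x. X n x - u x) + C * rm (\<lambda>x. X n x - u x) (\<lambda>x. X n x - u x)) \<longlonglongrightarrow> 0"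
    proof (rule tendsto_sandwich[OF _ _ tendsto_const tendsto_mult_right_zero[OF lim, of c1]])
      show "\<forall>\<^sub>F n in sequentially. 0 \<le> rq (\<lambda>x. X n x - u x) (\<lambda>x. X n x - u x) + C * rm (\<lambda>x. X n x - u x) (\<lambda>x. X n x - u x)"
      proof (intro always_eventually allI)
        fix n
        have "0 \<le> c0 * hn (\<lambda>x. X n x - u x) (\<lambda>x. wderiv l (X n) x - u' x)" using c(1) hn_parts(3) by simp
        then show "0 \<le> rq (\<lambda>x. X n x - u x) (\<lambda>x. X n x - u x) + C * rm (\<lambda>x. X n x - u x) (\<lambda>x. X n x - u x)"
          using c(3)[OF H_diff[OF HX u], of n] R.b_nonneg[OF R.D_diff[OF X \<open>u \<in> D\<close>], of n] by linarith
      qed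
      show "\<forall>\<^sub>F n in sequentially. rq (\<lambda>x. X n x - u x) (\<lambda>x. X n x - u x) + C * rm (\<lambda>x. X n x - u x) (\<lambda>x. X n x - u x)
          \<le> c1 * hn (\<lambda>x. X n x - u x) (\<lambda>x. wderiv l (X n) x - u' x)"
        by (intro always_eventually allI c(4) H_diff HX u)
    qed
    ultimately show "\<exists>u\<in>D. (\<lambda>n. rq (\<lambda>x. X n x - u x) (\<lambda>x. X n x - u x) + C * rm (\<lambda>x. X n x - u x) (\<lambda>x. X n x - u x)) \<longlonglongrightarrow> 0"
      by blast
  next
    fix X :: "nat \<Rightarrow> real \<Rightarrow> real" and K
    assume X: "\<And>n. X n \<in> D" and bd: "\<And>n. rq (X n) (X n) + C * rm (X n) (X n) \<le> K"
    have "hn (X n) (wderiv l (X n)) \<le> K / c0" for n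
      using c(3)[OF DW[OF X], of n] bd[of n] R.b_nonneg[OF X, of n] c(1) by (simp add: field_simps)
    note hc = hn_compact[of X "\<lambda>n. wderiv l (X n)", OF DW[OF X] this]
    show "\<exists>r :: nat \<Rightarrow> nat. strict_mono r \<and> (\<forall>e>0. \<exists>K. \<forall>i\<ge>K. \<forall>j\<ge>K.
          rm (\<lambda>x. X (r i) x - X (r j) x) (\<lambda>x. X (r i) x - X (r j) x) < e)"
    proof (rule hc)
      fix r :: "nat \<Rightarrow> nat"
      assume m: "strict_mono r" and c: "\<And>e. e > 0 \<Longrightarrow> \<exists>N. \<forall>i\<ge>N. \<forall>j\<ge>N. rm (\<lambda>x. X (r i) x - X (r j) x) (\<lambda>x. X (r i) x - X (r j) x) < e"
      show ?thesis by (intro exI[of _ r] conjI allI impI m c)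
    qed
  next
    fix n :: nat
    have "H (\<lambda>s. s ^ (2 * i)) (\<lambda>s. real (2 * i) * s ^ (2 * i - 1))" for i
      by (rule H_C1) (auto intro!: derivative_eq_intros continuous_intros)
    then have "(\<lambda>s. s ^ (2 * i)) \<in> D" for i
      using D H1_iff by (auto simp: H1_even_def)
    then show "\<exists>f. (\<forall>i<n. f i \<in> D) \<and> independent_mod (null_interval l) n f"
      by (intro exI[of _ "\<lambda>i s. s ^ (2 * i)"]) (simp add: even_powers_independent)
  qed
  then show ?thesis by (rule that)
qed

end

section \<open>The catenoid and its Jacobi functions\<close>

abbreviation catS :: "real \<Rightarrow> real \<Rightarrow> real" where "catS a s \<equiv> a * sinh (2 * s)"

context
  fixes a :: real
  assumes a: "a > 1/2"
begin

lemma catK_pos: "catK a > 0"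
proof -
  have "(1/2)\<^sup>2 < a\<^sup>2" using a by (intro power_strict_mono) auto
  then show ?thesis by (simp add: catK_def power2_eq_square)
qed

lemma phi_zero: "phi a 0 = 0"
  by (simp add: phi_def)

lemma catA_minus: "catA a (- s) = catA a s" and catB_minus: "catB a (- s) = catB a s"
  by (simp_all add: catA_def catB_def)

lemma phi_minus: "phi a (- s) = - phi a s"
proof -
  have "((\<lambda>s. phi a s + phi a (- s)) has_real_derivative 0) (at s)" for s
  proof -
    have "((\<lambda>s. phi a (- s)) has_real_derivative catK a / ((catA a (-s))\<^sup>2 * catB a (-s)) * (-1)) (at s)"
      by (rule DERIV_chain2[OF DERIV_phi[OF a]]) (auto intro!: derivative_eq_intros)
    from DERIV_add[OF DERIV_phi[OF a] this] show ?thesis by (simp add: catA_minus catB_minus)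
  qed
  then have "phi a s + phi a (- s) = phi a 0 + phi a (- 0)" by (rule DERIV_isconst_all[rule_format])
  then show ?thesis by (simp add: phi_zero)
qed

lemma phi_strict_mono: assumes "s < t" shows "phi a s < phi a t"
proof (rule DERIV_pos_imp_increasing[OF assms])
  fix x
  have "catK a / ((catA a x)\<^sup>2 * catB a x) > 0"
    using catK_pos catA_pos[OF a, of x] catB_pos[OF a, of x] by simp
  then show "\<exists>y. (phi a has_real_derivative y) (at x) \<and> 0 < y" using DERIV_phi[OF a] by blast
qed

lemma catS_pos: "s > 0 \<Longrightarrow> catS a s > 0"
  using a by simp

lemma catB_strict_mono: "0 \<le> s \<Longrightarrow> s < t \<Longrightarrow> catB a s < catB a t"
  using a cosh_real_strict_mono[of "2 * s" "2 * t"] unfolding catB_def by simp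

lemma catB_lower: "a - 1/2 \<le> (catB a s)\<^sup>2"
proof -
  have "a * 1 \<le> a * cosh (2 * s)" using a by (intro mult_left_mono cosh_real_ge_1) auto
  then show ?thesis by (simp add: catB_sq[OF a])
qed

text \<open>Since \<open>(S/B)\<^sup>2 = B\<^sup>2 + 1 - K\<^sup>2/B\<^sup>2\<close> increases, the right-hand side of the equation for \<open>s0\<close>
  decreases from infinity to zero, while the left-hand side increases.\<close>

lemma SB_sq: "(catS a s)\<^sup>2 / (catB a s)\<^sup>2 = (catB a s)\<^sup>2 + 1 - (catK a)\<^sup>2 / (catB a s)\<^sup>2"
  using catB_pos[OF a, of s] unfolding sinh_sq[OF a] catA_sq_catB[OF a]
  by (simp add: field_simps power2_eq_square)

definition crit where "crit s = catB a s * catK a / catS a s"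

lemma crit_decreasing: assumes "0 < s" "s < t" shows "crit t < crit s"
proof -
  note p = catB_pos[OF a, of s] catB_pos[OF a, of t] catS_pos[of s] catS_pos[of t] catK_pos
  have B: "(catB a s)\<^sup>2 < (catB a t)\<^sup>2"
    using catB_strict_mono[of s t] assms p by (intro power_strict_mono) auto
  moreover have "(catK a)\<^sup>2 / (catB a t)\<^sup>2 < (catK a)\<^sup>2 / (catB a s)\<^sup>2"
    using p B by (intro divide_strict_left_mono) auto
  ultimately have "(catS a s / catB a s)\<^sup>2 < (catS a t / catB a t)\<^sup>2"
    unfolding power_divide SB_sq by simp
  then have lt: "catS a s / catB a s < catS a t / catB a t"
    using p assms by (intro power2_less_imp_less[of "catS a s / catB a s"]) auto
  have "crit t = catK a / (catS a t / catB a t)" "crit s = catK a / (catS a s / catB a s)"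
    using p assms by (simp_all add: crit_def)
  moreover have "catK a / (catS a t / catB a t) < catK a / (catS a s / catB a s)"
    by (rule divide_strict_left_mono[OF lt]) (use p assms in auto)
  ultimately show ?thesis by simp
qed

lemma s0_ex1: "\<exists>!s. s > 0 \<and> tanh (phi a s) = catB a s * catK a / (a * sinh (2 * s))"
proof -
  define g where "g s = tanh (phi a s) - crit s" for s
  have inc: "g s < g t" if "0 < s" "s < t" for s t
    using crit_decreasing[OF that] phi_strict_mono[OF that(2)] by (simp add: g_def diff_strict_mono)
  have cont: "continuous_on {c..d} g" if "c > 0" for c d
  proof -
    have "isCont (phi a) x" "isCont (catB a) x" for x
      using DERIV_isCont[OF DERIV_phi[OF a]] DERIV_isCont[OF DERIV_catB[OF a]] by auto
    moreover have "sinh (2 * x) \<noteq> 0" if "x \<in> {c..d}" for x using that \<open>c > 0\<close> by (simp add: sinh_zero_iff)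
    ultimately show ?thesis unfolding g_def crit_def using a
      by (intro continuous_at_imp_continuous_on ballI continuous_intros) auto
  qed
  obtain s where s: "s > 0" "g s < 0"
  proof -
    have "((\<lambda>s. catK a * catB a s - catS a s) \<longlongrightarrow> catK a * catB a 0 - catS a 0) (at_right 0)"
      by (intro tendsto_intros tendsto_within_subset[OF DERIV_isCont[OF DERIV_catB[OF a], unfolded isCont_def]]) auto
    moreover have "catK a * catB a 0 - catS a 0 > 0" using catK_pos catB_pos[OF a, of 0] by simp
    ultimately have "\<forall>\<^sub>F s in at_right 0. catK a * catB a s - catS a s > 0" by (rule order_tendstoD)
    then have "\<exists>s>0. catK a * catB a s - catS a s > 0"
      unfolding eventually_at_right_field by (metis dense)
    then obtain s where s: "s > 0" "catS a s < catK a * catB a s" by auto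
    then have "crit s > 1" using catS_pos[OF s(1)] by (simp add: crit_def mult.commute)
    then have "g s < 0" using tanh_real_lt_1[of "phi a s"] by (simp add: g_def)
    then show ?thesis using that s by blast
  qed
  obtain t where t: "t > 0" "g t > 0"
  proof -
    define c where "c = tanh (phi a 1)"
    have "phi a 1 > 0" using phi_strict_mono[of 0 1] phi_zero by simp
    then have c: "c > 0" by (simp add: c_def)
    define t where "t = max 1 (1 + (catK a)\<^sup>2 / (a * c\<^sup>2))"
    have t1: "t \<ge> 1" by (simp add: t_def)
    have "exp (2 * t) / 2 \<le> cosh (2 * t)" by (simp add: cosh_def)
    then have "t < cosh (2 * t)" using exp_ge_add_one_self[of "2 * t"] by linarith
    then have ct: "(catK a)\<^sup>2 / (a * c\<^sup>2) < cosh (2 * t) - 1" by (simp add: t_def)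
    note p = catB_pos[OF a, of t] catS_pos[of t] catK_pos
    have "(catK a)\<^sup>2 / (catB a t)\<^sup>2 \<le> (catK a)\<^sup>2 / (a - 1/2)"
      using catB_lower[of t] a p by (intro divide_left_mono mult_pos_pos) auto
    also have "\<dots> = a + 1/2"
      unfolding catK_sq[OF a] using a by (simp add: field_simps power2_eq_square)
    finally have "a * (cosh (2 * t) - 1) \<le> (catS a t / catB a t)\<^sup>2"
      unfolding power_divide SB_sq by (simp add: catB_sq[OF a] algebra_simps)
    moreover have "(catK a)\<^sup>2 / c\<^sup>2 < a * (cosh (2 * t) - 1)"
      using ct a c by (simp add: field_simps)
    ultimately have "(catK a / c)\<^sup>2 < (catS a t / catB a t)\<^sup>2" by (simp add: power_divide)
    then have "catK a / c < catS a t / catB a t"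
      using p t1 by (intro power2_less_imp_less[of "catK a / c"]) auto
    then have "crit t < c" using p t1 c by (simp add: crit_def field_simps)
    moreover have "c \<le> tanh (phi a t)"
      using phi_strict_mono[of 1 t] t1 by (cases "t = 1") (auto simp: c_def)
    ultimately show ?thesis using that[of t] t1 by (simp add: g_def)
  qed
  have "s < t"
  proof (rule ccontr)
    assume "\<not> s < t"
    then have "g t \<le> g s" using inc[of t s] t(1) by (cases "t = s") auto
    then show False using s t by simp
  qed
  have "\<exists>x\<ge>s. x \<le> t \<and> g x = 0"
    by (rule IVT') (use s t \<open>s < t\<close> cont[OF s(1)] in auto)
  then obtain x where "s \<le> x" and gx: "g x = 0" by blast
  with s(1) have x: "x > 0" "g x = 0" by simp_all
  have uniq: "y = x" if "y > 0" "g y = 0" for y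
  proof (rule linorder_cases[of x y])
    assume "x < y" then show ?thesis using inc[OF x(1), of y] x(2) that(2) by simp
  next
    assume "y < x" then show ?thesis using inc[OF that(1), of x] x(2) that(2) by simp
  qed simp
  show ?thesis
  proof (rule ex1I[of _ x])
    show "x > 0 \<and> tanh (phi a x) = catB a x * catK a / catS a x"
      using x unfolding g_def crit_def by linarith
    fix y assume y: "y > 0 \<and> tanh (phi a y) = catB a y * catK a / catS a y"
    then have "g y = 0" unfolding g_def crit_def by linarith
    then show "y = x" using y by (intro uniq) auto
  qed
qed

lemma s0_pos: "s0 a > 0"
  and s0_eq: "tanh (phi a (s0 a)) = catB a (s0 a) * catK a / catS a (s0 a)"
  using theI'[OF s0_ex1] unfolding s0_def by auto

lemma phi_s0_pos: "phi a (s0 a) > 0"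
  using phi_strict_mono[OF s0_pos] phi_zero by simp

lemma phi_nonneg: "s \<ge> 0 \<Longrightarrow> phi a s \<ge> 0"
  using phi_strict_mono[of 0 s] phi_zero by (cases "s = 0") auto

lemma s0_sinh_cosh: "catS a (s0 a) * sinh (phi a (s0 a)) = catB a (s0 a) * catK a * cosh (phi a (s0 a))"
proof -
  have "sinh (phi a (s0 a)) = tanh (phi a (s0 a)) * cosh (phi a (s0 a))" by (simp add: tanh_def)
  moreover have "S * (b / S * c) = b * c" if "S > 0" for S b c :: real using that by simp
  ultimately show ?thesis using catS_pos[OF s0_pos] unfolding s0_eq by metis
qed

text \<open>The hyperbolic tangent is less than \<open>1\<close>, so \<open>B K < S\<close> at the boundary, which is equivalent to \<open>K < B\<close>.
  The sign of \<open>K\<^sup>2 - B\<^sup>2\<close> decides on which side \<open>y\<close> misses the boundary condition below.\<close>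

lemma s0_BK: "(catK a)\<^sup>2 < (catB a (s0 a))\<^sup>2"
proof -
  define B S K A where "B = catB a (s0 a)" and "S = catS a (s0 a)" and "K = catK a" and "A = catA a (s0 a)"
  have p: "B > 0" "S > 0" "K > 0" using catB_pos[OF a] catS_pos[OF s0_pos] catK_pos by (simp_all add: B_def S_def K_def)
  have "B * K / S < 1" using s0_eq tanh_real_lt_1[of "phi a (s0 a)"] by (simp add: B_def S_def K_def)
  then have "B * K < S" using p by simp
  then have "(B * K)\<^sup>2 < S\<^sup>2" using p by (intro power_strict_mono) auto
  moreover have "S\<^sup>2 = (B\<^sup>2 + 1) * B\<^sup>2 - K\<^sup>2"
    using sinh_sq[OF a] catA_sq_catB[OF a] by (simp add: S_def B_def K_def)
  ultimately have "(B\<^sup>2 + 1) * K\<^sup>2 < (B\<^sup>2 + 1) * B\<^sup>2" by (simp add: power_mult_distrib algebra_simps)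
  then show ?thesis unfolding B_def K_def by (rule mult_left_less_imp_less) (simp add: add_nonneg_pos)
qed

text \<open>The free boundary condition: \<open>S / B\<^sup>2 = B' / B\<close> is the geodesic curvature of the boundary circle in the
  annulus, and \<open>coth r\<close> is the curvature of the geodesic sphere that the annulus meets orthogonally.\<close>

lemma coth_rad: "coth (rad a) = catS a (s0 a) / (catB a (s0 a))\<^sup>2"
proof -
  define A B S K c d where "A = catA a (s0 a)" and "B = catB a (s0 a)" and "S = catS a (s0 a)" and "K = catK a"
    and "c = cosh (phi a (s0 a))" and "d = sinh (phi a (s0 a))"
  have p: "A > 0" "B > 0" "S > 0" "K > 0" "c > 0"
    using catA_pos[OF a] catB_pos[OF a] catS_pos[OF s0_pos] catK_pos by (simp_all add: A_def B_def S_def K_def c_def)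
  have AB: "A\<^sup>2 = B\<^sup>2 + 1" by (simp add: A_def B_def catA_sq_catB[OF a])
  have SS: "S\<^sup>2 = A\<^sup>2 * B\<^sup>2 - K\<^sup>2" by (simp add: A_def B_def S_def K_def sinh_sq[OF a])
  have sc: "S * d = B * K * c" using s0_sinh_cosh by (simp add: S_def B_def K_def c_def d_def)
  have cd: "c\<^sup>2 = d\<^sup>2 + 1" by (simp add: c_def d_def cosh_square_eq)
  have A1: "A \<ge> 1"
  proof -
    have "1\<^sup>2 \<le> A\<^sup>2" using AB by simp
    then show ?thesis using p(1) by (intro power2_le_imp_le[of 1 A]) auto
  qed
  have c1: "c \<ge> 1" by (simp add: c_def cosh_real_ge_1)
  have h1: "A * c \<ge> 1" using mult_mono[OF A1 c1] A1 by simp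
  have "S\<^sup>2 * ((A * c)\<^sup>2 - 1) = (A * c * B\<^sup>2)\<^sup>2"
  proof -
    have "S\<^sup>2 * c\<^sup>2 = S\<^sup>2 + (S * d)\<^sup>2" using cd by (simp add: power_mult_distrib algebra_simps)
    also have "(S * d)\<^sup>2 = B\<^sup>2 * K\<^sup>2 * c\<^sup>2" by (simp add: sc power_mult_distrib)
    finally have e: "S\<^sup>2 = S\<^sup>2 * c\<^sup>2 - B\<^sup>2 * K\<^sup>2 * c\<^sup>2" by simp
    have "S\<^sup>2 * ((A * c)\<^sup>2 - 1) = S\<^sup>2 * A\<^sup>2 * c\<^sup>2 - S\<^sup>2" by (simp add: power_mult_distrib algebra_simps)
    also have "\<dots> = S\<^sup>2 * A\<^sup>2 * c\<^sup>2 - (S\<^sup>2 * c\<^sup>2 - B\<^sup>2 * K\<^sup>2 * c\<^sup>2)" using e by simp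
    also have "\<dots> = c\<^sup>2 * (S\<^sup>2 * (A\<^sup>2 - 1) + B\<^sup>2 * K\<^sup>2)" by algebra
    also have "A\<^sup>2 - 1 = B\<^sup>2" using AB by simp
    also have "c\<^sup>2 * (S\<^sup>2 * B\<^sup>2 + B\<^sup>2 * K\<^sup>2) = (A * c * B\<^sup>2)\<^sup>2" unfolding SS by algebra
    finally show ?thesis .
  qed
  then have "(A * c)\<^sup>2 - 1 = (A * c * B\<^sup>2 / S)\<^sup>2" using p by (simp add: power_divide field_simps)
  then have sq: "sqrt ((A * c)\<^sup>2 - 1) = A * c * B\<^sup>2 / S" using p by simp
  have "rad a = arcosh (A * c)" by (simp add: rad_def A_def c_def)
  then have "coth (rad a) = A * c / (A * c * B\<^sup>2 / S)"
    using h1 by (simp add: coth_def cosh_arcosh_real sinh_arcosh_real sq)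
  also have "\<dots> = S / B\<^sup>2" using p by (simp add: field_simps)
  finally show ?thesis by (simp add: S_def B_def)
qed

end

text \<open>The components of position \<open>X\<close>, normal \<open>n\<close> and meridian tangent \<open>z = X'\<close> along a meridian,
  in the plane of the axis: \<open>(C, D)\<close> is \<open>(cosh \<phi>, sinh \<phi>)\<close> for the timelike component and
  \<open>(sinh \<phi>, cosh \<phi>)\<close> for the axial one. The two functions \<open>z\<close> are the radial factors of the Jacobi
  functions, with angular factor \<open>cos \<theta>\<close> or \<open>sin \<theta>\<close>, that come from rotations moving the axis
  and from translations orthogonal to it.\<close>

definition jz where "jz a C D s = catS a s / catA a s * C s + catK a / (catA a s * catB a s) * (D s :: real)"
definition jn where "jn a C D s = catK a / catA a s * C s - catS a s / (catA a s * catB a s) * (D s :: real)"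
definition jd where "jd a C D s = catA a s * C s + catK a / (catB a s)\<^sup>2 * jn a C D s"

text \<open>Along a meridian \<open>z' = X + (K / B\<^sup>2) n\<close> and \<open>n' = - (K / B\<^sup>2) z\<close>, and every component satisfies
  \<open>X - (K / B\<^sup>2) n = (S / B\<^sup>2) z\<close>. Differentiate \<open>B z'\<close> and eliminate \<open>X\<close> and \<open>n\<close>.\<close>

lemma jacobi_function:
  assumes a: "a > 1/2"
    and C: "\<And>s. (C has_real_derivative catK a / ((catA a s)\<^sup>2 * catB a s) * D s) (at s)"
    and D: "\<And>s. (D has_real_derivative catK a / ((catA a s)\<^sup>2 * catB a s) * C s) (at s)"
  shows "(jz a C D has_real_derivative jd a C D s) (at s)"
    and "((\<lambda>s. catB a s * jd a C D s) has_real_derivative - (catB a s * potential a 1 s) * jz a C D s) (at s)"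
proof -
  define A B K S c d q where "A = catA a s" and "B = catB a s" and "K = catK a"
    and "S = catS a s" and "c = C s" and "d = D s" and "q = a * cosh (2 * s)"
  note fold = A_def[symmetric] B_def[symmetric] K_def[symmetric] S_def[symmetric] c_def[symmetric] d_def[symmetric] q_def[symmetric]
  have pos: "A > 0" "B > 0" using catA_pos[OF a] catB_pos[OF a] by (simp_all add: A_def B_def)
  have AB: "A * A = B * B + 1" using catA_sq_catB[OF a, of s] by (simp add: A_def B_def power2_eq_square)
  have SS: "S * S = A * A * (B * B) - K * K" using sinh_sq[OF a, of s] by (simp add: A_def B_def S_def K_def power2_eq_square)
  have q: "2 * q = A * A + B * B" using catA_sq[OF a, of s] catB_sq[OF a, of s] by (simp add: A_def B_def q_def power2_eq_square)
  have dA: "(catA a has_real_derivative S / A) (at s)" and dB: "(catB a has_real_derivative S / B) (at s)"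
    using DERIV_catA[OF a, of s] DERIV_catB[OF a, of s] by (simp_all add: A_def B_def S_def)
  have dS: "(catS a has_real_derivative 2 * q) (at s)"
    by (auto intro!: derivative_eq_intros simp: q_def)
  have dC: "(C has_real_derivative K / (A\<^sup>2 * B) * d) (at s)" and dD: "(D has_real_derivative K / (A\<^sup>2 * B) * c) (at s)"
    using C[of s] D[of s] by (simp_all add: fold)
  note dd = dA dB dS dC dD
  have ne: "catA a s \<noteq> 0" "catB a s \<noteq> 0" using pos by (auto simp: A_def B_def)
  have z: "(jz a C D has_real_derivative
     ((2 * q * A - S * (S / A)) / (A * A) * c + S / A * (K / (A\<^sup>2 * B) * d)
      + (- (K * (S / A * B + A * (S / B))) / (A * B * (A * B)) * d + K / (A * B) * (K / (A\<^sup>2 * B) * c)))) (at s)"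
    unfolding jz_def[abs_def]
    by (rule DERIV_cong[OF DERIV_add[OF DERIV_mult[OF DERIV_divide[OF dS dA ne(1)] dC]
          DERIV_mult[OF DERIV_divide[OF DERIV_const DERIV_mult[OF dA dB]] dD]]])
       (use ne in \<open>unfold fold, simp_all add: algebra_simps\<close>)
  have n: "(jn a C D has_real_derivative
     (- (K * (S / A)) / (A * A) * c + K / A * (K / (A\<^sup>2 * B) * d)
      - ((2 * q * (A * B) - S * (S / A * B + A * (S / B))) / (A * B * (A * B)) * d + S / (A * B) * (K / (A\<^sup>2 * B) * c)))) (at s)"
    unfolding jn_def[abs_def]
    by (rule DERIV_cong[OF DERIV_diff[OF DERIV_mult[OF DERIV_divide[OF DERIV_const dA ne(1)] dC]
          DERIV_mult[OF DERIV_divide[OF dS DERIV_mult[OF dA dB]] dD]]])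
       (use ne in \<open>unfold fold, simp_all add: algebra_simps\<close>)
  have zs: "jz a C D s = S / A * c + K / (A * B) * d" and ns: "jn a C D s = K / A * c - S / (A * B) * d"
    and js: "jd a C D s = A * c + K / B\<^sup>2 * (K / A * c - S / (A * B) * d)"
    by (simp_all add: jz_def jn_def jd_def fold)
  have c1: "(2 * q * A - S * (S / A)) / (A * A) + K / (A * B) * (K / (A\<^sup>2 * B)) = A + K / B\<^sup>2 * (K / A)"
    unfolding q using pos by (simp add: field_simps power2_eq_square) (use AB SS in algebra)
  have c2: "S / A * (K / (A\<^sup>2 * B)) + - (K * (S / A * B + A * (S / B))) / (A * B * (A * B)) = - (K / B\<^sup>2 * (S / (A * B)))"
    using pos by (simp add: field_simps power2_eq_square)
  show "(jz a C D has_real_derivative jd a C D s) (at s)"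
  proof (rule DERIV_cong[OF z])
    have "jd a C D s = (A + K / B\<^sup>2 * (K / A)) * c + (- (K / B\<^sup>2 * (S / (A * B)))) * d"
      unfolding js by (simp add: algebra_simps)
    then show "(2 * q * A - S * (S / A)) / (A * A) * c + S / A * (K / (A\<^sup>2 * B) * d)
      + (- (K * (S / A * B + A * (S / B))) / (A * B * (A * B)) * d + K / (A * B) * (K / (A\<^sup>2 * B) * c)) = jd a C D s"
      unfolding c1[symmetric] c2[symmetric] by (simp add: algebra_simps)
  qed
  have c3: "- (K * (S / A)) / (A * A) - S / (A * B) * (K / (A\<^sup>2 * B)) = - (K / B\<^sup>2) * (S / A)"
    using pos by (simp add: field_simps power2_eq_square) (use AB in algebra)
  have c4: "K / A * (K / (A\<^sup>2 * B)) - (2 * q * (A * B) - S * (S / A * B + A * (S / B))) / (A * B * (A * B)) = - (K / B\<^sup>2) * (K / (A * B))"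
    unfolding q using pos by (simp add: field_simps power2_eq_square) (use AB SS in algebra)
  have n': "(jn a C D has_real_derivative - (K / B\<^sup>2) * jz a C D s) (at s)"
  proof (rule DERIV_cong[OF n])
    have "- (K / B\<^sup>2) * jz a C D s = - (K / B\<^sup>2) * (S / A) * c + - (K / B\<^sup>2) * (K / (A * B)) * d"
      unfolding zs by (simp add: algebra_simps)
    then show "- (K * (S / A)) / (A * A) * c + K / A * (K / (A\<^sup>2 * B) * d)
      - ((2 * q * (A * B) - S * (S / A * B + A * (S / B))) / (A * B * (A * B)) * d + S / (A * B) * (K / (A\<^sup>2 * B) * c)) = - (K / B\<^sup>2) * jz a C D s"
      unfolding c3[symmetric] c4[symmetric] by (simp add: algebra_simps)
  qed
  define z n where "z = jz a C D s" and "n = jn a C D s"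
  have X: "((\<lambda>s. catA a s * C s) has_real_derivative z) (at s)"
    using pos by (auto intro!: derivative_eq_intros dd simp: fold z_def zs field_simps power2_eq_square)
  have "((\<lambda>s. catB a s * jd a C D s) has_real_derivative
     S / B * (A * c + K / B\<^sup>2 * n) + B * (z + (- (K * (2 * B * (S / B))) / (B\<^sup>2 * B\<^sup>2) * n + K / B\<^sup>2 * (- (K / B\<^sup>2) * z)))) (at s)"
    unfolding jd_def[abs_def]
    by (rule DERIV_cong[OF DERIV_mult[OF dB DERIV_add[OF X
          DERIV_mult[OF DERIV_divide[OF DERIV_const DERIV_power[OF dB, of 2]] n']]]])
       (use ne in \<open>unfold fold, simp_all add: z_def[symmetric] n_def[symmetric] algebra_simps power2_eq_square\<close>)
  then show "((\<lambda>s. catB a s * jd a C D s) has_real_derivative - (catB a s * potential a 1 s) * jz a C D s) (at s)"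
  proof (rule DERIV_cong)
    have Xn: "A * c - K / B\<^sup>2 * n = S / B\<^sup>2 * z"
    proof -
      have "A - K / B\<^sup>2 * (K / A) = S / B\<^sup>2 * (S / A)"
        using pos by (simp add: field_simps power2_eq_square) (use SS in algebra)
      then have "(A - K / B\<^sup>2 * (K / A)) * c + K / B\<^sup>2 * (S / (A * B)) * d = S / B\<^sup>2 * (S / A) * c + S / B\<^sup>2 * (K / (A * B)) * d"
        by simp
      then show ?thesis unfolding n_def z_def ns zs by (simp add: algebra_simps)
    qed
    have "S / B * (A * c + K / B\<^sup>2 * n) + B * (z + (- (K * (2 * B * (S / B))) / (B\<^sup>2 * B\<^sup>2) * n + K / B\<^sup>2 * (- (K / B\<^sup>2) * z)))
      = S / B * (A * c - K / B\<^sup>2 * n) + B * (1 - K\<^sup>2 / B ^ 4) * z"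
      using pos by (simp add: field_simps power2_eq_square power4_eq_xxxx)
    also have "\<dots> = (S / B * (S / B\<^sup>2) + B * (1 - K\<^sup>2 / B ^ 4)) * z"
      unfolding Xn by (simp add: algebra_simps)
    also have "S / B * (S / B\<^sup>2) + B * (1 - K\<^sup>2 / B ^ 4) = - (B * (2 * K\<^sup>2 / B ^ 4 - 2 - 1 / B\<^sup>2))"
      using pos by (simp add: field_simps power2_eq_square power4_eq_xxxx) (use AB SS in algebra)
    finally show "S / B * (A * c + K / B\<^sup>2 * n) + B * (z + (- (K * (2 * B * (S / B))) / (B\<^sup>2 * B\<^sup>2) * n + K / B\<^sup>2 * (- (K / B\<^sup>2) * z)))
      = - (catB a s * potential a 1 s) * jz a C D s"
      by (simp add: potential_def II_sq_def fold z_def)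
  qed
qed

section \<open>The radial modes\<close>

lemma ac_reflect:
  assumes u: "ac (-l) l u u'" and l: "l > 0"
  shows "ac (-l) l (\<lambda>x. u (- x)) (\<lambda>x. - u' (- x))"
proof (rule acI)
  have i: "integrable (Mi (-l) l) u'" by (rule ac_integrable[OF u])
  have "integrable (Mi (-l) l) (\<lambda>x. u' (- x))" using Mi_integrable_reflect[of l "-l" u'] i by simp
  then show "integrable (Mi (-l) l) (\<lambda>x. - u' (- x))" by simp
  fix x assume x: "x \<in> {-l..l}"
  have "prim (-l) l (\<lambda>x. - u' (- x)) x = (\<integral>t. - (indicator {..<x} t * u' (- t)) \<partial>Mi (-l) l)"
    by (simp add: prim_def)
  also have "\<dots> = - (\<integral>t. indicator {..<x} (- (- t)) * u' (- t) \<partial>Mi (-l) l)" by simp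
  also have "(\<integral>t. indicator {..<x} (- (- t)) * u' (- t) \<partial>Mi (-l) l) = (\<integral>t. indicator {..<x} (- t) * u' t \<partial>Mi (-l) l)"
    using Mi_integral_reflect[of "-l" l "\<lambda>t. indicator {..<x} (- t) * u' t"] by simp
  also have "\<dots> = (\<integral>t. u' t - indicator {..<-x} t * u' t \<partial>Mi (-l) l)"
  proof (rule integral_cong_AE)
    show "AE t in Mi (-l) l. indicator {..<x} (- t) * u' t = u' t - indicator {..<-x} t * u' t"
      using Mi_AE_neq[of "-x" "-l" l] by eventually_elim (auto simp: indicator_def)
    have "(\<lambda>t. indicator {..<x} (- t) * u' t) = (\<lambda>t. indicator {-x<..} t * u' t)" by (auto simp: indicator_def)
    then show "(\<lambda>t. indicator {..<x} (- t) * u' t) \<in> borel_measurable (Mi (-l) l)"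
      using integrable_cut[OF i, of "{-x<..}"] by auto
    show "(\<lambda>t. u' t - indicator {..<-x} t * u' t) \<in> borel_measurable (Mi (-l) l)"
      using i integrable_cut[OF i, of "{..<-x}"] by auto
  qed
  also have "\<dots> = integral\<^sup>L (Mi (-l) l) u' - prim (-l) l u' (-x)"
    unfolding prim_def by (intro Bochner_Integration.integral_diff i integrable_cut) auto
  also have "\<dots> = u l - u (-x)"
    using ac_integral[OF u] ac_eq[OF u, of "-x"] x l by auto
  finally show "u (- x) = u (- (- l)) + prim (-l) l (\<lambda>x. - u' (- x)) x" by simp
qed

lemma L2_reflect: "L2 (Mi (-l) l) f \<Longrightarrow> L2 (Mi (-l) l) (\<lambda>x. - f (- x))"
proof -
  assume f: "L2 (Mi (-l) l) f"
  have "integrable (Mi (-l) l) f" by (rule Mi.L2_integrable[OF f])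
  then have "integrable (Mi (-l) l) (\<lambda>x. f (- x))" "integrable (Mi (-l) l) (\<lambda>x. (f (- x))\<^sup>2)"
    using L2_sq[OF f] Mi_integrable_reflect[of l "-l" f] Mi_integrable_reflect[of l "-l" "\<lambda>x. (f x)\<^sup>2"] by simp_all
  then show ?thesis by (auto simp: L2_def)
qed

locale catenoid =
  fixes a :: real
  assumes a: "a > 1/2"
begin

definition "l = s0 a"
definition "\<beta> = coth (rad a) * catB a (s0 a)"
abbreviation "B \<equiv> catB a"
abbreviation "P k s \<equiv> catB a s * potential a k s"
abbreviation "M \<equiv> Mi (-l) l"
abbreviation "rf \<equiv> radial_form a"
abbreviation "ri \<equiv> radial_inner a"
abbreviation "H1 \<equiv> H1_interval l"

lemma l_pos: "l > 0" by (simp add: l_def s0_pos[OF a])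

lemma B_pos: "B s > 0" by (rule catB_pos[OF a])

lemma B_cont: "continuous_on S B"
  using DERIV_isCont[OF DERIV_catB[OF a]] by (auto intro: continuous_at_imp_continuous_on)

lemma P_cont: "continuous_on S (P k)"
  unfolding potential_def II_sq_def using B_pos
  by (intro continuous_intros B_cont) (auto simp: less_imp_neq[symmetric])

lemma robin: "robin l B (P k)"
  by (rule robin.intro) (auto intro: l_pos B_pos B_cont P_cont)

sublocale R1: robin l \<beta> B "P 1" by (rule robin)

lemma cont_cancel_B: assumes "continuous_on T (\<lambda>s. B s * f s)" shows "continuous_on T f"
proof -
  have "continuous_on T (\<lambda>s. B s * f s / B s)"
    using B_pos by (intro continuous_on_divide B_cont assms) (auto simp: less_imp_neq[symmetric])
  moreover have "(\<lambda>s. B s * f s / B s) = f" using B_pos by (auto simp: less_imp_neq[symmetric])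
  ultimately show ?thesis by (simp only:)
qed

lemma B_even: "B (- s) = B s" by (rule catB_minus[OF a])

lemma P_even: "P k (- s) = P k s" by (simp add: potential_def II_sq_def B_even)

lemma rf_robin: "rf k = robin.rq l \<beta> B (P k)"
  by (intro ext) (simp add: radial_form_def robin.rq_def[OF robin] Mi_set_integral \<beta>_def flip: l_def)

lemma ri_robin: "ri = robin.rm l B"
  by (intro ext) (simp add: radial_inner_def R1.rm_def Mi_set_integral flip: l_def)

abbreviation "H \<equiv> robin.H l"

lemma rf_eq:
  "H u u' \<Longrightarrow> H v v' \<Longrightarrow> rf k u v = (\<integral>s. B s * u' s * v' s \<partial>M) - (\<integral>s. P k s * u s * v s \<partial>M)
     - \<beta> * (u l * v l + u (-l) * v (-l))"
  unfolding rf_robin by (rule robin.rq_eq[OF robin])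

lemma ri_eq: "ri u v = (\<integral>s. B s * u s * v s \<partial>M)"
  by (simp add: ri_robin R1.rm_def)

sublocale F: sym_form H1 "rf k" for k
  unfolding rf_robin by (rule robin.rq_form[OF robin R1.H1_subspace order_refl])

sublocale I: psd_form H1 ri
  unfolding ri_robin by (rule R1.rm_form[OF R1.H1_subspace order_refl])

lemma spectrum:
  obtains e where "\<And>n. e n \<in> H1" "\<And>i j. ri (e i) (e j) = (if i = j then 1 else 0)"
    "\<And>n v. v \<in> H1 \<Longrightarrow> rf k (e n) v = mu a k n * ri (e n) v"
    "\<And>n v. v \<in> H1 \<Longrightarrow> (\<And>i. i < n \<Longrightarrow> ri v (e i) = 0) \<Longrightarrow> mu a k n * ri v v \<le> rf k v v" "mono (mu a k)"
proof -
  have mu: "mu a k = eigenvalue_seq (null_interval l) H1 (robin.rq l \<beta> B (P k)) (robin.rm l B)"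
    by (simp add: mu_def rf_robin ri_robin flip: l_def)
  obtain C where "compact_form (null_interval l) H1 (robin.rq l \<beta> B (P k)) (robin.rm l B) C"
    by (rule robin.robin_compact[OF robin disjI1[OF refl]])
  note st = compact_form.spectral_theorem[OF this, folded mu rf_robin ri_robin]
  show ?thesis
  proof (rule st)
    fix e
    assume e: "\<And>n. e n \<in> H1" "\<And>i j. ri (e i) (e j) = (if i = j then 1 else 0)"
      "\<And>n v. v \<in> H1 \<Longrightarrow> rf k (e n) v = mu a k n * ri (e n) v"
      "\<And>n v. v \<in> H1 \<Longrightarrow> (\<And>i. i < n \<Longrightarrow> ri v (e i) = 0) \<Longrightarrow> mu a k n * ri v v \<le> rf k v v" "mono (mu a k)"
    show ?thesis by (rule that[of e, OF e])
  qed
qed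

lemma spectrum_even:
  obtains e where "\<And>n. e n \<in> H1_even l" "\<And>i j. ri (e i) (e j) = (if i = j then 1 else 0)"
    "\<And>n v. v \<in> H1_even l \<Longrightarrow> rf k (e n) v = mu_even a k n * ri (e n) v"
    "\<And>n v. v \<in> H1_even l \<Longrightarrow> (\<And>i. i < n \<Longrightarrow> ri v (e i) = 0) \<Longrightarrow> mu_even a k n * ri v v \<le> rf k v v"
proof -
  have mu: "mu_even a k = eigenvalue_seq (null_interval l) (H1_even l) (robin.rq l \<beta> B (P k)) (robin.rm l B)"
    by (simp add: mu_even_def rf_robin ri_robin flip: l_def)
  obtain C where "compact_form (null_interval l) (H1_even l) (robin.rq l \<beta> B (P k)) (robin.rm l B) C"
    by (rule robin.robin_compact[OF robin disjI2[OF refl]])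
  note st = compact_form.spectral_theorem[OF this, folded mu rf_robin ri_robin]
  show ?thesis
  proof (rule st)
    fix e
    assume e: "\<And>n. e n \<in> H1_even l" "\<And>i j. ri (e i) (e j) = (if i = j then 1 else 0)"
      "\<And>n v. v \<in> H1_even l \<Longrightarrow> rf k (e n) v = mu_even a k n * ri (e n) v"
      "\<And>n v. v \<in> H1_even l \<Longrightarrow> (\<And>i. i < n \<Longrightarrow> ri v (e i) = 0) \<Longrightarrow> mu_even a k n * ri v v \<le> rf k v v" "mono (mu_even a k)"
    show ?thesis by (rule that[of e, OF e(1-4)])
  qed
qed

lemma inv_B_cont: "continuous_on S (\<lambda>s. 1 / B s)"
  using B_pos by (intro continuous_intros B_cont) (auto simp: less_imp_neq[symmetric])

lemma rf_modes:
  assumes u: "H u u'" and v: "H v v'"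
  shows "rf k u v = rf j u v + ((real_of_int k)\<^sup>2 - (real_of_int j)\<^sup>2) * (\<integral>s. 1 / B s * u s * v s \<partial>M)"
proof -
  note L = R1.H_L2'[OF u] R1.H_L2'[OF v]
  define J where "J s = 1 / B s * u s * v s" for s
  have i: "integrable M J" unfolding J_def
    by (rule L2_mult_integrable[OF L2_mult_continuous[OF inv_B_cont L(1)] L(2)])
  have ij: "integrable M (\<lambda>s. P j s * u s * v s)" by (rule robin.int_P[OF robin L])
  have "(\<integral>s. P k s * u s * v s \<partial>M)
      = (\<integral>s. P j s * u s * v s - ((real_of_int k)\<^sup>2 - (real_of_int j)\<^sup>2) * J s \<partial>M)"
  proof (intro Bochner_Integration.integral_cong refl)
    fix s show "P k s * u s * v s = P j s * u s * v s - ((real_of_int k)\<^sup>2 - (real_of_int j)\<^sup>2) * J s"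
      using B_pos[of s] by (simp add: potential_def J_def field_simps power2_eq_square)
  qed
  also have "\<dots> = (\<integral>s. P j s * u s * v s \<partial>M) - ((real_of_int k)\<^sup>2 - (real_of_int j)\<^sup>2) * (\<integral>s. J s \<partial>M)"
    using i ij by simp
  finally show ?thesis unfolding rf_eq[OF u v] J_def by simp
qed

lemma H_reflect: "H u u' \<Longrightarrow> H (\<lambda>x. u (- x)) (\<lambda>x. - u' (- x))"
  using ac_reflect[OF _ l_pos] L2_reflect by (simp add: R1.H_def)

lemma rf_reflect:
  assumes u: "H u u'" and v: "H v v'"
  shows "rf k (\<lambda>x. u (- x)) (\<lambda>x. v (- x)) = rf k u v"
proof -
  have "(\<integral>s. B s * - u' (- s) * - v' (- s) \<partial>M) = (\<integral>s. B s * u' s * v' s \<partial>M)"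
    using Mi_integral_reflect[of "-l" l "\<lambda>s. B s * u' s * v' s"] by (simp add: B_even)
  moreover have "(\<integral>s. P k s * u (- s) * v (- s) \<partial>M) = (\<integral>s. P k s * u s * v s \<partial>M)"
    using Mi_integral_reflect[of "-l" l "\<lambda>s. P k s * u s * v s"] by (simp only: P_even) simp
  ultimately show ?thesis unfolding rf_eq[OF u v] rf_eq[OF H_reflect[OF u] H_reflect[OF v]] by simp
qed

subsection \<open>The mode \<open>k = 1\<close>\<close>

text \<open>\<open>w\<close> belongs to the rotations that move the axis. They preserve the ball, so \<open>w\<close> satisfies the boundary
  condition, and \<open>w cos \<theta>\<close>, \<open>w sin \<theta>\<close> lie in the kernel of the index form. \<open>y\<close> belongs to the translations
  orthogonal to the axis; it is a positive solution for which the boundary condition fails with a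
  definite sign.\<close>

definition "w = jz a (\<lambda>s. cosh (phi a s)) (\<lambda>s. sinh (phi a s))"
definition "w' = jd a (\<lambda>s. cosh (phi a s)) (\<lambda>s. sinh (phi a s))"
definition "y = jz a (\<lambda>s. sinh (phi a s)) (\<lambda>s. cosh (phi a s))"
definition "y' = jd a (\<lambda>s. sinh (phi a s)) (\<lambda>s. cosh (phi a s))"

lemma cosh_phi: "((\<lambda>s. cosh (phi a s)) has_real_derivative catK a / ((catA a s)\<^sup>2 * catB a s) * sinh (phi a s)) (at s)"
  and sinh_phi: "((\<lambda>s. sinh (phi a s)) has_real_derivative catK a / ((catA a s)\<^sup>2 * catB a s) * cosh (phi a s)) (at s)"
  by (auto intro!: derivative_eq_intros DERIV_phi[OF a])

lemma w_deriv: "(w has_real_derivative w' s) (at s)" "((\<lambda>s. B s * w' s) has_real_derivative - P 1 s * w s) (at s)"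
  and y_deriv: "(y has_real_derivative y' s) (at s)" "((\<lambda>s. B s * y' s) has_real_derivative - P 1 s * y s) (at s)"
  unfolding w_def w'_def y_def y'_def
  using jacobi_function[OF a cosh_phi sinh_phi] jacobi_function[OF a sinh_phi cosh_phi] by auto

lemma jacobi_odd: "w (- s) = - w s" "w' (- s) = w' s" and jacobi_even: "y (- s) = y s" "y' (- s) = - y' s"
  by (simp_all add: w_def w'_def y_def y'_def jz_def jd_def jn_def phi_minus[OF a] catA_minus[OF a] catB_minus[OF a] algebra_simps)

lemma jacobi_pos:
  shows "y s > 0" "s \<ge> 0 \<Longrightarrow> w s \<ge> 0" "w l > 0"
proof -
  note p = catA_pos[OF a] catB_pos[OF a] catK_pos[OF a]
  have S: "catS a s \<ge> 0" if "s \<ge> 0" for s using a that by simp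
  have y: "y s > 0" if "s \<ge> 0" for s
  proof -
    have "catS a s / catA a s \<ge> 0" by (rule divide_nonneg_pos[OF S[OF that] p(1)])
    then show ?thesis unfolding y_def jz_def using p phi_nonneg[OF a that]
      by (intro add_nonneg_pos mult_nonneg_nonneg mult_pos_pos divide_pos_pos) auto
  qed
  show "y s > 0"
    using y[of s] y[of "-s"] jacobi_even(1)[of s] by (cases "s \<ge> 0") auto
  show "w s \<ge> 0" if "s \<ge> 0"
  proof -
    have "catS a s / catA a s \<ge> 0" by (rule divide_nonneg_pos[OF S[OF that] p(1)])
    moreover have "catK a / (catA a s * catB a s) \<ge> 0" using p by (simp add: less_imp_le)
    ultimately show ?thesis unfolding w_def jz_def using phi_nonneg[OF a that]
      by (intro add_nonneg_nonneg mult_nonneg_nonneg) auto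
  qed
  show "w l > 0"
  proof -
    have "catS a l / catA a l > 0" by (rule divide_pos_pos[OF catS_pos[OF a l_pos] p(1)])
    moreover have "catK a / (catA a l * catB a l) > 0" using p by simp
    ultimately show ?thesis unfolding w_def jz_def using phi_s0_pos[OF a]
      by (intro add_pos_pos mult_pos_pos) (auto simp: l_def)
  qed
qed

text \<open>The equation for \<open>s0\<close> eliminates \<open>sinh \<phi>\<close>. What remains is an identity in \<open>A\<close>, \<open>B\<close>, \<open>K\<close>, \<open>S\<close> for \<open>w\<close>,
  and for \<open>y\<close> a positive multiple of \<open>K\<^sup>2 - B\<^sup>2\<close>.\<close>

lemma boundary:
  shows w_boundary: "w' l = coth (rad a) * w l" and y_boundary: "y' l < coth (rad a) * y l"
proof -
  define A b S K c d where "A = catA a l" and "b = B l" and "S = catS a l" and "K = catK a"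
    and "c = cosh (phi a l)" and "d = sinh (phi a l)"
  have p: "A > 0" "b > 0" "S > 0" "K > 0" "c > 0"
    using catA_pos[OF a] catB_pos[OF a] catS_pos[OF a l_pos] catK_pos[OF a]
    by (simp_all add: A_def b_def S_def K_def c_def)
  have AB: "A * A = b * b + 1" using catA_sq_catB[OF a, of l] by (simp add: A_def b_def power2_eq_square)
  have SS: "S * S = A * A * (b * b) - K * K"
    using sinh_sq[OF a, of l] by (simp add: A_def b_def S_def K_def power2_eq_square)
  have d: "d = b * K * c / S"
  proof -
    have "S * d = b * K * c" using s0_sinh_cosh[OF a] unfolding S_def b_def K_def c_def d_def l_def .
    then show ?thesis using p by (simp add: field_simps)
  qed
  have H: "coth (rad a) = S / b\<^sup>2" using coth_rad[OF a] by (simp add: S_def b_def l_def)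
  have n0: "jn a (\<lambda>s. cosh (phi a s)) (\<lambda>s. sinh (phi a s)) l = 0"
    unfolding jn_def A_def[symmetric] b_def[symmetric] S_def[symmetric] K_def[symmetric]
        c_def[symmetric] d_def[symmetric] d using p by (simp add: field_simps)
  have wl: "w l = S / A * c + K / (A * b) * d" and w'l: "w' l = A * c"
    and yl: "y l = S / A * d + K / (A * b) * c" and y'l: "y' l = A * d + K / b\<^sup>2 * (K / A * d - S / (A * b) * c)"
    using n0 by (simp_all add: w_def y_def w'_def y'_def jz_def jd_def A_def b_def S_def K_def c_def d_def)
       (simp add: jn_def)
  have "S / b\<^sup>2 * w l = (S * S + K * K) * c / (A * (b * b))"
    unfolding wl d using p by (simp add: field_simps power2_eq_square)
  also have "\<dots> = A * c" unfolding SS using p by (simp add: field_simps)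
  finally show "w' l = coth (rad a) * w l" unfolding H w'l by simp
  have "y' l - S / b\<^sup>2 * y l = K * c / (A * (b * (b * b)) * S) *
      (A * A * (b * b) * (b * b) + K * K * (b * b) - S * S - S * S * (b * b + 1))"
    unfolding yl y'l d using p by (simp add: field_simps power2_eq_square)
  also have "A * A * (b * b) * (b * b) + K * K * (b * b) - S * S - S * S * (b * b + 1) = 2 * (A * A) * (K * K - b * b)"
    unfolding SS using AB by algebra
  also have "K * c / (A * (b * (b * b)) * S) * (2 * (A * A) * (K * K - b * b)) < 0"
  proof -
    have "K * K - b * b < 0" using s0_BK[OF a] by (simp add: K_def b_def l_def power2_eq_square)
    then have "2 * (A * A) * (K * K - b * b) < 0" using p by (intro mult_pos_neg) auto
    moreover have "K * c / (A * (b * (b * b)) * S) > 0" using p by simp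
    ultimately show ?thesis by (rule mult_pos_neg[rotated])
  qed
  finally show "y' l < coth (rad a) * y l" unfolding H by simp
qed

lemma jacobi_cont: "continuous_on T w" "continuous_on T y" "continuous_on T w'" "continuous_on T y'"
proof -
  show "continuous_on T w" "continuous_on T y"
    by (intro continuous_at_imp_continuous_on ballI DERIV_isCont[OF w_deriv(1)] DERIV_isCont[OF y_deriv(1)])+
  show "continuous_on T w'"
    by (rule cont_cancel_B, intro continuous_at_imp_continuous_on ballI DERIV_isCont[OF w_deriv(2)])
  show "continuous_on T y'"
    by (rule cont_cancel_B, intro continuous_at_imp_continuous_on ballI DERIV_isCont[OF y_deriv(2)])
qed

lemma H_w: "H w w'" and H_y: "H y y'"
  by (auto intro!: R1.H_C1 w_deriv y_deriv jacobi_cont)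

lemma w_H1: "w \<in> H1" and y_H1: "y \<in> H1"
  using H_w H_y R1.H1_iff by blast+

text \<open>Integration by parts leaves only boundary terms.\<close>

lemma rf_solution:
  assumes z: "\<And>s. ((\<lambda>s. B s * z' s) has_real_derivative - P 1 s * z s) (at s)" "H z z'"
    and zc: "continuous_on {-l..l} z'" and f: "H f f'"
  shows "rf 1 z f = (B l * z' l - \<beta> * z l) * f l + (- B l * z' (-l) - \<beta> * z (-l)) * f (-l)"
proof -
  have c: "continuous_on {-l..l} (\<lambda>s. - P 1 s * z s)"
    by (intro continuous_on_mult continuous_on_minus P_cont R1.H_cont[OF z(2)])
  have "ac (-l) l (\<lambda>s. B s * z' s) (\<lambda>s. - P 1 s * z s)" by (rule ac_C1[OF z(1) c])
  from ac_integral[OF ac_mult[OF this R1.H_ac[OF f]]]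
  have "(\<integral>s. B s * z' s * f' s + - P 1 s * z s * f s \<partial>M) = B l * z' l * f l - B (-l) * z' (-l) * f (-l)"
    using l_pos by simp
  moreover have "(\<integral>s. B s * z' s * f' s + - P 1 s * z s * f s \<partial>M) = (\<integral>s. B s * z' s * f' s \<partial>M) - (\<integral>s. P 1 s * z s * f s \<partial>M)"
    using R1.int_B[OF R1.H_L2[OF z(2)] R1.H_L2[OF f]] R1.int_P[OF R1.H_L2'[OF z(2)] R1.H_L2'[OF f]] by simp
  ultimately show ?thesis unfolding rf_eq[OF z(2) f] by (simp add: B_even algebra_simps)
qed

lemma rf_w: "f \<in> H1 \<Longrightarrow> rf 1 w f = 0"
proof -
  assume "f \<in> H1"
  then obtain f' where f: "H f f'" using R1.H1_iff by blast
  show ?thesis unfolding rf_solution[OF w_deriv(2) H_w jacobi_cont(3) f] \<beta>_def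
    by (simp add: jacobi_odd w_boundary flip: l_def)
qed

lemma rf_y:
  obtains \<kappa> where "\<kappa> > 0" "\<And>f. f \<in> H1 \<Longrightarrow> rf 1 y f = - \<kappa> * (f l + f (-l))"
proof -
  define \<kappa> where "\<kappa> = B l * (coth (rad a) * y l - y' l)"
  have "\<kappa> > 0" using y_boundary B_pos by (simp add: \<kappa>_def)
  moreover have "rf 1 y f = - \<kappa> * (f l + f (-l))" if "f \<in> H1" for f
  proof -
    from that obtain f' where f: "H f f'" using R1.H1_iff by blast
    show ?thesis unfolding rf_solution[OF y_deriv(2) H_y jacobi_cont(4) f] \<beta>_def \<kappa>_def
      by (simp add: jacobi_even algebra_simps flip: l_def)
  qed
  ultimately show ?thesis using that by blast
qed

text \<open>Picone's identity: completion of the square with the logarithmic derivative of a positive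
  solution \<open>p\<close>.\<close>

lemma picone:
  assumes p: "\<And>s. s \<in> {c..d} \<Longrightarrow> p s > 0" "\<And>s. (p has_real_derivative p' s) (at s)"
      "\<And>s. ((\<lambda>s. B s * p' s) has_real_derivative - P 1 s * p s) (at s)"
    and u: "ac c d u u'" "L2 (Mi c d) u'" and cd: "c \<le> d"
  shows "(\<integral>s. B s * u' s * u' s \<partial>Mi c d) - (\<integral>s. P 1 s * u s * u s \<partial>Mi c d)
     = (\<integral>s. B s * (u' s - p' s / p s * u s)\<^sup>2 \<partial>Mi c d) + B d * p' d / p d * (u d)\<^sup>2 - B c * p' c / p c * (u c)\<^sup>2"
    and "integrable (Mi c d) (\<lambda>s. B s * (u' s - p' s / p s * u s)\<^sup>2)"
    and "L2 (Mi c d) (\<lambda>s. u' s - p' s / p s * u s)"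
proof -
  let ?M = "Mi c d"
  define g g' where "g s = B s * p' s / p s" and "g' s = - P 1 s - B s * (p' s / p s)\<^sup>2" for s
  have pc: "continuous_on {c..d} p"
    by (intro continuous_at_imp_continuous_on ballI DERIV_isCont[OF p(2)])
  have "continuous_on {c..d} (\<lambda>s. B s * p' s)"
    by (intro continuous_at_imp_continuous_on ballI DERIV_isCont[OF p(3)])
  then have p'c: "continuous_on {c..d} p'" by (rule cont_cancel_B)
  have qc: "continuous_on {c..d} (\<lambda>s. p' s / p s)"
    using p(1) by (intro continuous_on_divide pc p'c) (auto simp: less_imp_neq[symmetric])
  have g'c: "continuous_on {c..d} g'"
    unfolding g'_def by (intro continuous_on_diff continuous_on_minus continuous_on_mult continuous_on_power B_cont P_cont qc)
  have "(g has_real_derivative g' s) (at s)" if "s \<in> {c..d}" for s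
    unfolding g_def[abs_def]
    by (rule DERIV_cong[OF DERIV_divide[OF p(3) p(2)]])
       (use p(1)[OF that] in \<open>auto simp: g'_def field_simps power2_eq_square\<close>)
  then have g: "ac c d g g'" by (rule ac_C1[OF _ g'c])
  have uu: "ac c d (\<lambda>s. u s * u s) (\<lambda>s. u s * u' s + u' s * u s)" by (rule ac_mult[OF u(1) u(1)])
  note guu = ac_mult[OF g uu]
  have uL: "L2 ?M u" by (rule Mi_continuous_L2[OF ac_continuous[OF u(1)]])
  show L: "L2 ?M (\<lambda>s. u' s - p' s / p s * u s)" by (intro L2_diff u(2) L2_mult_continuous qc uL)
  have "integrable ?M (\<lambda>s. B s * (u' s - p' s / p s * u s) * (u' s - p' s / p s * u s))"
    by (rule L2_mult_integrable[OF L2_mult_continuous[OF B_cont L] L])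
  then show sq: "integrable ?M (\<lambda>s. B s * (u' s - p' s / p s * u s)\<^sup>2)"
    by (simp add: power2_eq_square mult.assoc)
  have i1: "integrable ?M (\<lambda>s. B s * u' s * u' s)"
    by (rule L2_mult_integrable[OF L2_mult_continuous[OF B_cont u(2)] u(2)])
  have i2: "integrable ?M (\<lambda>s. P 1 s * u s * u s)"
    by (rule L2_mult_integrable[OF L2_mult_continuous[OF P_cont uL] uL])
  have "(\<integral>s. B s * u' s * u' s \<partial>?M) - (\<integral>s. P 1 s * u s * u s \<partial>?M)
      = (\<integral>s. B s * u' s * u' s - P 1 s * u s * u s \<partial>?M)" using i1 i2 by simp
  also have "\<dots> = (\<integral>s. B s * (u' s - p' s / p s * u s)\<^sup>2 + (g s * (u s * u' s + u' s * u s) + g' s * (u s * u s)) \<partial>?M)"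
    by (intro Bochner_Integration.integral_cong refl) (simp add: g_def g'_def power2_eq_square algebra_simps)
  also have "\<dots> = (\<integral>s. B s * (u' s - p' s / p s * u s)\<^sup>2 \<partial>?M) + (g d * (u d * u d) - g c * (u c * u c))"
    using sq ac_integrable[OF guu] ac_integral[OF guu cd] by simp
  finally show "(\<integral>s. B s * u' s * u' s \<partial>?M) - (\<integral>s. P 1 s * u s * u s \<partial>?M)
     = (\<integral>s. B s * (u' s - p' s / p s * u s)\<^sup>2 \<partial>?M) + B d * p' d / p d * (u d)\<^sup>2 - B c * p' c / p c * (u c)\<^sup>2"
    by (simp add: g_def power2_eq_square)
qed

text \<open>The second eigenfunction \<open>w\<close> of the mode \<open>1\<close> has its zero at \<open>s = 0\<close>, so the form is nonnegative
  on functions that vanish there. Perturbing \<open>w\<close> by the positive function \<open>y\<close> avoids the singularity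
  of \<open>w'/w\<close>.\<close>

lemma rf1_nonneg:
  assumes u: "u \<in> H1" and u0: "u 0 = 0"
  shows "0 \<le> rf 1 u u"
proof -
  obtain u' where H: "H u u'" using u R1.H1_iff by blast
  note ac = R1.H_ac[OF H] and L = R1.H_L2[OF H] and L' = R1.H_L2'[OF H]
  define \<kappa> where "\<kappa> = B l * (coth (rad a) * y l - y' l) / w l"
  have \<kappa>: "\<kappa> > 0" using y_boundary B_pos jacobi_pos(3) by (simp add: \<kappa>_def)
  have main: "- (\<epsilon> * \<kappa>) * ((u l)\<^sup>2 + (u (-l))\<^sup>2) \<le> rf 1 u u" if \<epsilon>: "\<epsilon> > 0" for \<epsilon>
  proof -
    (* w is odd and nonnegative on [0, l]: positive solutions on the right and on the left half *)
    let ?p = "\<lambda>s. w s + \<epsilon> * y s" and ?p' = "\<lambda>s. w' s + \<epsilon> * y' s"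
    let ?q = "\<lambda>s. - w s + \<epsilon> * y s" and ?q' = "\<lambda>s. - w' s + \<epsilon> * y' s"
    have p: "?p s > 0" if "s \<in> {0..l}" for s
      using jacobi_pos(1)[of s] jacobi_pos(2)[of s] \<epsilon> that by (auto intro: add_nonneg_pos)
    have q: "?q s > 0" if "s \<in> {-l..0}" for s
      using p[of "-s"] that by (simp add: jacobi_odd jacobi_even)
    have dp: "(?p has_real_derivative ?p' s) (at s)" "((\<lambda>s. B s * ?p' s) has_real_derivative - P 1 s * ?p s) (at s)"
      and dq: "(?q has_real_derivative ?q' s) (at s)" "((\<lambda>s. B s * ?q' s) has_real_derivative - P 1 s * ?q s) (at s)" for s
    proof -
      show "(?p has_real_derivative ?p' s) (at s)" "(?q has_real_derivative ?q' s) (at s)"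
        by (auto intro!: derivative_eq_intros w_deriv y_deriv)
      have "((\<lambda>s. B s * w' s + \<epsilon> * (B s * y' s)) has_real_derivative - P 1 s * w s + \<epsilon> * (- P 1 s * y s)) (at s)"
        "((\<lambda>s. - (B s * w' s) + \<epsilon> * (B s * y' s)) has_real_derivative - (- P 1 s * w s) + \<epsilon> * (- P 1 s * y s)) (at s)"
        by (intro DERIV_add DERIV_cmult DERIV_minus w_deriv y_deriv)+
      then show "((\<lambda>s. B s * ?p' s) has_real_derivative - P 1 s * ?p s) (at s)"
        "((\<lambda>s. B s * ?q' s) has_real_derivative - P 1 s * ?q s) (at s)"
        by (simp_all add: algebra_simps)
    qed
    have sub: "ac 0 l u u'" "L2 (Mi 0 l) u'" "ac (-l) 0 u u'" "L2 (Mi (-l) 0) u'"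
      using l_pos by (auto intro: ac_sub[OF ac] Mi_L2_sub[OF L])
    have nn: "0 \<le> (\<integral>s. B s * (f s)\<^sup>2 \<partial>N)" for f and N :: "real measure"
      by (intro Bochner_Integration.integral_nonneg mult_nonneg_nonneg) (auto intro: less_imp_le[OF B_pos])
    have bd: "\<beta> - \<epsilon> * \<kappa> \<le> B l * ?p' l / ?p l"
    proof -
      have pl: "w l > 0" "?p l > 0" "w l \<le> ?p l" using p[of l] jacobi_pos(1)[of l] jacobi_pos(3) \<epsilon> l_pos by auto
      have "B l * (coth (rad a) * y l - y' l) / ?p l \<le> B l * (coth (rad a) * y l - y' l) / w l"
        using pl y_boundary B_pos[of l] by (intro divide_left_mono mult_nonneg_nonneg mult_pos_pos) auto
      then have "\<epsilon> * (B l * (coth (rad a) * y l - y' l) / ?p l) \<le> \<epsilon> * \<kappa>"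
        unfolding \<kappa>_def using \<epsilon> by (intro mult_left_mono) auto
      moreover have "B l * ?p' l / ?p l = \<beta> - \<epsilon> * (B l * (coth (rad a) * y l - y' l) / ?p l)"
        using pl(2) by (simp add: \<beta>_def w_boundary field_simps flip: l_def)
      ultimately show ?thesis by simp
    qed
    have "(\<beta> - \<epsilon> * \<kappa>) * (u l)\<^sup>2 \<le> B l * ?p' l / ?p l * (u l)\<^sup>2" using bd by (intro mult_right_mono) auto
    then have 1: "(\<beta> - \<epsilon> * \<kappa>) * (u l)\<^sup>2 \<le> (\<integral>s. B s * u' s * u' s \<partial>Mi 0 l) - (\<integral>s. P 1 s * u s * u s \<partial>Mi 0 l)"
    proof -
      note e1 = picone(1)[OF p dp sub(1,2) less_imp_le[OF l_pos]]
      have "B 0 * ?p' 0 / ?p 0 * (u 0)\<^sup>2 = 0" using u0 by simp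
      then show ?thesis using e1 nn[of "Mi 0 l" "\<lambda>s. u' s - ?p' s / ?p s * u s"]
          \<open>(\<beta> - \<epsilon> * \<kappa>) * (u l)\<^sup>2 \<le> B l * ?p' l / ?p l * (u l)\<^sup>2\<close> by linarith
    qed
    have ql: "- (B (-l) * ?q' (-l) / ?q (-l)) = B l * ?p' l / ?p l"
      by (simp add: jacobi_odd jacobi_even B_even algebra_simps) (simp add: diff_divide_distrib add_divide_distrib)
    have "(\<beta> - \<epsilon> * \<kappa>) * (u (-l))\<^sup>2 \<le> - (B (-l) * ?q' (-l) / ?q (-l)) * (u (-l))\<^sup>2"
      unfolding ql using bd by (intro mult_right_mono) auto
    then have 2: "(\<beta> - \<epsilon> * \<kappa>) * (u (-l))\<^sup>2 \<le> (\<integral>s. B s * u' s * u' s \<partial>Mi (-l) 0) - (\<integral>s. P 1 s * u s * u s \<partial>Mi (-l) 0)"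
    proof -
      have "-l \<le> 0" using l_pos by simp
      note e1 = picone(1)[OF q dq sub(3,4) this]
      have "B 0 * ?q' 0 / ?q 0 * (u 0)\<^sup>2 = 0" using u0 by simp
      then show ?thesis using e1 nn[of "Mi (-l) 0" "\<lambda>s. u' s - ?q' s / ?q s * u s"]
          \<open>(\<beta> - \<epsilon> * \<kappa>) * (u (-l))\<^sup>2 \<le> - (B (-l) * ?q' (-l) / ?q (-l)) * (u (-l))\<^sup>2\<close> by linarith
    qed
    have "(\<integral>s. B s * u' s * u' s \<partial>M) = (\<integral>s. B s * u' s * u' s \<partial>Mi (-l) 0) + (\<integral>s. B s * u' s * u' s \<partial>Mi 0 l)"
      "(\<integral>s. P 1 s * u s * u s \<partial>M) = (\<integral>s. P 1 s * u s * u s \<partial>Mi (-l) 0) + (\<integral>s. P 1 s * u s * u s \<partial>Mi 0 l)"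
      using l_pos by (auto intro!: Mi_integral_split R1.int_B[OF L L] R1.int_P[OF L' L'])
    then show ?thesis unfolding rf_eq[OF H H] using 1 2 by (simp add: power2_eq_square algebra_simps)
  qed
  show ?thesis
  proof (rule ccontr)
    assume neg: "\<not> 0 \<le> rf 1 u u"
    define T where "T = \<kappa> * ((u l)\<^sup>2 + (u (-l))\<^sup>2)"
    have T: "T \<ge> 0" using \<kappa> by (simp add: T_def)
    define \<epsilon> where "\<epsilon> = - rf 1 u u / (2 * (T + 1))"
    have \<epsilon>: "\<epsilon> > 0" using neg T by (simp add: \<epsilon>_def divide_neg_pos)
    have "\<epsilon> * T \<le> \<epsilon> * (T + 1)" using \<epsilon> by simp
    also have "\<dots> = - rf 1 u u / 2" using T by (simp add: \<epsilon>_def field_simps)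
    finally have "\<epsilon> * T \<le> - rf 1 u u / 2" .
    moreover have "- (\<epsilon> * T) \<le> rf 1 u u" using main[OF \<epsilon>] by (simp add: T_def algebra_simps)
    ultimately show False using neg by linarith
  qed
qed

text \<open>Pairing with \<open>y\<close> gives \<open>u(l) + u(-l) = 0\<close>, so a multiple of the odd function \<open>w\<close> can be subtracted to
  obtain a function \<open>v\<close> in the kernel that vanishes at both ends. Picone's identity with \<open>y\<close> then shows
  \<open>v' = (y'/y) v\<close>, so \<open>v/y\<close> is constant, hence zero.\<close>

lemma rf1_kernel:
  assumes u: "u \<in> H1" and ker: "\<And>f. f \<in> H1 \<Longrightarrow> rf 1 u f = 0"
  obtains c where "\<And>s. s \<in> {-l..l} \<Longrightarrow> u s = c * w s"
proof -
  define c where "c = u l / w l"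
  define v where "v s = u s - c * w s" for s
  obtain \<kappa> where \<kappa>: "\<kappa> > 0" "\<And>f. f \<in> H1 \<Longrightarrow> rf 1 y f = - \<kappa> * (f l + f (-l))" by (rule rf_y) blast
  have "rf 1 y u = 0" using ker[OF y_H1] F.b_sym[OF u y_H1] by simp
  then have ul: "u l + u (-l) = 0" using \<kappa>(1) \<kappa>(2)[OF u] by simp
  have v: "v \<in> H1" unfolding v_def by (intro F.D_diff F.D_scale u w_H1)
  have vl: "v l = 0" "v (-l) = 0" using jacobi_pos(3) ul by (simp_all add: v_def c_def jacobi_odd)
  have vk: "rf 1 v v = 0"
  proof -
    have "rf 1 v v = rf 1 u v - c * rf 1 w v"
      unfolding v_def[abs_def] by (simp add: F.b_diff F.b_scale F.D_scale F.D_diff u w_H1)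
    then show ?thesis using ker[OF v] rf_w[OF v] by simp
  qed
  obtain v' where H: "H v v'" using v R1.H1_iff by blast
  note ac = R1.H_ac[OF H] and L = R1.H_L2[OF H]
  note pic = picone[of "-l" l y y', OF jacobi_pos(1) y_deriv ac L]
  have ll: "-l \<le> l" using l_pos by simp
  have "(\<integral>s. B s * (v' s - y' s / y s * v s)\<^sup>2 \<partial>M) = 0"
    using pic(1)[OF ll] vk unfolding rf_eq[OF H H] by (simp add: vl)
  then have "AE s in M. B s * (v' s - y' s / y s * v s)\<^sup>2 = 0"
    using integral_nonneg_eq_0_iff_AE[OF pic(2)[OF ll]] less_imp_le[OF B_pos] by auto
  then have ae: "AE s in M. v' s = y' s / y s * v s"
    by eventually_elim (use B_pos in \<open>simp add: less_imp_neq[symmetric]\<close>)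
  have yi: "ac (-l) l (\<lambda>s. 1 / y s) (\<lambda>s. - y' s / (y s)\<^sup>2)"
  proof (rule ac_C1)
    show "((\<lambda>s. 1 / y s) has_real_derivative - y' s / (y s)\<^sup>2) (at s)" for s
      using jacobi_pos(1)[of s] by (auto intro!: derivative_eq_intros y_deriv simp: power2_eq_square)
    show "continuous_on {-l..l} (\<lambda>s. - y' s / (y s)\<^sup>2)"
      using jacobi_pos(1) by (intro continuous_intros jacobi_cont) (auto simp: less_imp_neq[symmetric])
  qed
  note m = ac_mult[OF ac yi]
  have z: "AE s in M. v s * (- y' s / (y s)\<^sup>2) + v' s * (1 / y s) = 0"
    using ae by eventually_elim (use jacobi_pos(1) in \<open>simp add: field_simps power2_eq_square\<close>)
  have "v s = 0" if s: "s \<in> {-l..l}" for s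
  proof -
    have "prim (-l) l (\<lambda>s. v s * (- y' s / (y s)\<^sup>2) + v' s * (1 / y s)) s = 0"
      unfolding prim_def by (rule integral_eq_zero_AE) (use z in \<open>eventually_elim, simp\<close>)
    then have "v s * (1 / y s) = v (-l) * (1 / y (-l))" using ac_eq[OF m s] by simp
    then show ?thesis using jacobi_pos(1)[of s] vl by simp
  qed
  then show ?thesis using that[of c] by (simp add: v_def)
qed

lemma w_nonzero: "w \<notin> null_interval l"
  using jacobi_pos(3) l_pos by (force simp: null_interval_def)

lemma integral_B_pos:
  assumes H: "H u u'" and u: "u \<notin> null_interval l"
  shows "(\<integral>s. 1 / B s * u s * u s \<partial>M) > 0"
proof -
  have i: "integrable M (\<lambda>s. 1 / B s * u s * u s)"
    by (rule L2_mult_integrable[OF L2_mult_continuous[OF inv_B_cont R1.H_L2'[OF H]] R1.H_L2'[OF H]])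
  have nn: "0 \<le> 1 / B s * u s * u s" for s
    using B_pos[of s] mult_nonneg_nonneg[of "1 / B s" "u s * u s"] by (simp add: mult.assoc)
  have "(\<integral>s. 1 / B s * u s * u s \<partial>M) \<noteq> 0"
  proof
    assume "(\<integral>s. 1 / B s * u s * u s \<partial>M) = 0"
    then have "AE s in M. 1 / B s * u s * u s = 0"
      using integral_nonneg_eq_0_iff_AE[OF i] nn by auto
    then have ae: "AE s in M. u s = 0" by eventually_elim (use B_pos in \<open>auto simp: less_imp_neq[symmetric]\<close>)
    have "u s = 0" if "s \<in> {-l..l}" for s
      by (rule continuous_AE_eq[OF ae R1.H_cont[OF H] that]) (use l_pos in auto)
    then show False using u by (simp add: null_interval_def)
  qed
  moreover have "0 \<le> (\<integral>s. 1 / B s * u s * u s \<partial>M)" using nn by (intro Bochner_Integration.integral_nonneg) auto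
  ultimately show ?thesis by simp
qed

text \<open>The mode \<open>0\<close> form lies strictly below the mode \<open>1\<close> form, which is nonpositive on the span of
  \<open>w\<close> and \<open>y\<close>.\<close>

lemma rf0_negative:
  assumes "c \<noteq> 0 \<or> d \<noteq> 0"
  shows "rf 0 (\<lambda>s. c * w s + d * y s) (\<lambda>s. c * w s + d * y s) < 0"
proof -
  let ?u = "\<lambda>s. c * w s + d * y s"
  have H: "H ?u (\<lambda>s. c * w' s + d * y' s)" by (intro R1.H_add R1.H_scale H_w H_y)
  obtain \<kappa> where \<kappa>: "\<kappa> > 0" "\<And>f. f \<in> H1 \<Longrightarrow> rf 1 y f = - \<kappa> * (f l + f (-l))" by (rule rf_y) blast
  have "rf 1 ?u ?u = c\<^sup>2 * rf 1 w w + 2 * (c * (d * rf 1 w y)) + d\<^sup>2 * rf 1 y y"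
    by (simp add: F.b_sq_add F.b_sq_scale F.b_scale F.b_scale2 F.D_scale w_H1 y_H1)
  also have "\<dots> = - 2 * d\<^sup>2 * \<kappa> * y l"
    using rf_w[OF w_H1] rf_w[OF y_H1] \<kappa>(2)[OF y_H1] by (simp add: jacobi_even)
  also have "\<dots> \<le> 0" using \<kappa>(1) jacobi_pos(1)[of l] by simp
  finally have le: "rf 1 ?u ?u \<le> 0" .
  have "?u \<notin> null_interval l"
  proof
    assume "?u \<in> null_interval l"
    then have "?u l = 0" "?u (-l) = 0" using l_pos by (auto simp: null_interval_def)
    then have "c * w l + d * y l = 0" "- c * w l + d * y l = 0" by (simp_all add: jacobi_odd jacobi_even)
    then have "c * w l = 0" "d * y l = 0" by simp_all
    then show False using assms jacobi_pos(1)[of l] jacobi_pos(3) by simp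
  qed
  from integral_B_pos[OF H this] le show ?thesis using rf_modes[OF H H, of 0 1] by simp
qed

lemma rf1_y_negative: "rf 1 y y < 0"
proof -
  obtain \<kappa> where \<kappa>: "\<kappa> > 0" "\<And>f. f \<in> H1 \<Longrightarrow> rf 1 y f = - \<kappa> * (f l + f (-l))" by (rule rf_y) blast
  then show ?thesis using \<kappa>(2)[OF y_H1] jacobi_pos(1)[of l] by (simp add: jacobi_even)
qed

subsection \<open>The modes \<open>k = 0\<close> and \<open>k = 2\<close>\<close>

text \<open>Odd functions vanish at \<open>0\<close>, so for them positivity of the mode \<open>2\<close> form follows from the mode
  \<open>1\<close> form; on even functions it is the assumption on \<open>mu_even\<close>.\<close>

lemma rf2_coercive:
  assumes E: "mu_even a 2 0 > 0"
  obtains \<delta> where "\<delta> > 0" "\<And>u. u \<in> H1 \<Longrightarrow> \<delta> * ri u u \<le> rf 2 u u"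
proof -
  obtain b0 b1 where b: "b0 > 0" "b1 > 0" "\<And>s. s \<in> {-l..l} \<Longrightarrow> b0 \<le> B s" "\<And>s. s \<in> {-l..l} \<Longrightarrow> B s \<le> b1"
    by (rule R1.B_bounds) (rule that; assumption)
  define \<delta> where "\<delta> = min (mu_even a 2 0) (3 / b1\<^sup>2)"
  have \<delta>: "\<delta> > 0" using E b by (simp add: \<delta>_def)
  have even: "\<delta> * ri u u \<le> rf 2 u u" if u: "u \<in> H1_even l" for u
  proof -
    have uH: "u \<in> H1" using u by (simp add: H1_even_def)
    have "\<delta> * ri u u \<le> mu_even a 2 0 * ri u u"
      using I.b_nonneg[OF uH] by (intro mult_right_mono) (auto simp: \<delta>_def)
    moreover have "mu_even a 2 0 * ri u u \<le> rf 2 u u"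
      by (rule spectrum_even[of 2]) (use u in blast)
    ultimately show ?thesis by simp
  qed
  have odd: "\<delta> * ri u u \<le> rf 2 u u" if u: "u \<in> H1" and u0: "u 0 = 0" for u
  proof -
    obtain u' where H: "H u u'" using u R1.H1_iff by blast
    note L = R1.H_L2'[OF H]
    have "3 / b1\<^sup>2 * ri u u = (\<integral>s. 3 / b1\<^sup>2 * (B s * u s * u s) \<partial>M)" by (simp add: ri_eq)
    also have "\<dots> \<le> (\<integral>s. 3 * (1 / B s * u s * u s) \<partial>M)"
    proof (intro integral_mono)
      show "integrable M (\<lambda>s. 3 / b1\<^sup>2 * (B s * u s * u s))" using R1.int_B[OF L L] by simp
      show "integrable M (\<lambda>s. 3 * (1 / B s * u s * u s))"
        by (intro integrable_mult_right L2_mult_integrable[OF L2_mult_continuous[OF inv_B_cont L] L])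
      fix s assume "s \<in> space M"
      then have "B s \<le> b1" using b(4) by simp
      then have "(B s)\<^sup>2 \<le> b1\<^sup>2" using B_pos[of s] by (intro power_mono) auto
      then have "B s / b1\<^sup>2 \<le> 1 / B s" using B_pos[of s] b(2) by (simp add: field_simps power2_eq_square)
      then have "3 * (B s / b1\<^sup>2) * (u s * u s) \<le> 3 * (1 / B s) * (u s * u s)" by (intro mult_right_mono) auto
      then show "3 / b1\<^sup>2 * (B s * u s * u s) \<le> 3 * (1 / B s * u s * u s)" by (simp add: mult_ac)
    qed
    also have "\<dots> = rf 2 u u - rf 1 u u"
      unfolding Bochner_Integration.integral_mult_right_zero using rf_modes[OF H H, of 2 1] by simp
    finally have "3 / b1\<^sup>2 * ri u u \<le> rf 2 u u" using rf1_nonneg[OF u u0] by simp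
    moreover have "\<delta> * ri u u \<le> 3 / b1\<^sup>2 * ri u u"
      using I.b_nonneg[OF u] by (intro mult_right_mono) (auto simp: \<delta>_def)
    ultimately show ?thesis by simp
  qed
  have "\<delta> * ri u u \<le> rf 2 u u" if u: "u \<in> H1" for u
  proof -
    obtain u' where H: "H u u'" using u R1.H1_iff by blast
    define v where "v s = u (- s)" for s
    have Hv: "H v (\<lambda>x. - u' (- x))" unfolding v_def by (rule H_reflect[OF H])
    have v: "v \<in> H1" using Hv R1.H1_iff by blast
    define p m where "p s = 1/2 * (u s + v s)" and "m s = 1/2 * (u s - v s)" for s
    have pH: "p \<in> H1" unfolding p_def[abs_def] by (intro F.D_scale F.D_add u v)
    have mH: "m \<in> H1" unfolding m_def[abs_def] by (intro F.D_scale F.D_diff u v)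
    have "p \<in> H1_even l" using pH by (simp add: H1_even_def p_def v_def)
    note ev = even[OF this] and od = odd[OF mH]
    have uu: "u = (\<lambda>s. p s + m s)" by (rule ext) (simp add: p_def m_def field_simps)
    have vv: "rf k v v = rf k u u" for k unfolding v_def by (rule rf_reflect[OF H H])
    have iv: "ri v v = ri u u"
      unfolding ri_eq v_def using Mi_integral_reflect[of "-l" l "\<lambda>s. B s * u s * u s"] by (simp add: B_even)
    have c1: "rf 2 p m = 0"
      unfolding p_def[abs_def] m_def[abs_def]
      by (simp add: F.b_scale F.b_scale2 F.b_add F.b_diff2 F.D_add F.D_diff F.D_scale u v vv F.b_sym[OF v u]
          del: times_divide_eq_left times_divide_eq_right mult_numeral_1 mult_1)
    have c2: "ri p m = 0"
      unfolding p_def[abs_def] m_def[abs_def]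
      by (simp add: I.b_scale I.b_scale2 I.b_add I.b_diff2 F.D_add F.D_diff F.D_scale u v iv I.b_sym[OF v u]
          del: times_divide_eq_left times_divide_eq_right mult_numeral_1 mult_1)
    have "rf 2 u u = rf 2 p p + rf 2 m m" "ri u u = ri p p + ri m m"
      using F.b_sq_add[OF pH mH, of 2] I.b_sq_add[OF pH mH] c1 c2 unfolding uu[symmetric] by simp_all
    moreover have "m 0 = 0" by (simp add: m_def v_def)
    ultimately show ?thesis using ev od by (simp add: algebra_simps)
  qed
  then show ?thesis using that \<delta> by blast
qed

end

section \<open>Fourier series\<close>

text \<open>Negative indices are used for the sines, so that differentiation maps the mode \<open>k\<close> to the mode \<open>-k\<close>
  and both real modes with the same radial form are \<open>\<plusminus>k\<close>.\<close>

definition trig :: "int \<Rightarrow> real \<Rightarrow> real" where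
  "trig k \<theta> = (if 0 \<le> k then cos (real_of_int k * \<theta>) else sin (- real_of_int k * \<theta>))"

lemma trig_deriv: "(trig k has_real_derivative - real_of_int k * trig (- k) \<theta>) (at \<theta>)"
proof (cases "0 \<le> k")
  case True
  have "((\<lambda>\<theta>. cos (real_of_int k * \<theta>)) has_real_derivative - real_of_int k * sin (real_of_int k * \<theta>)) (at \<theta>)"
    by (auto intro!: derivative_eq_intros)
  moreover have "trig k = (\<lambda>\<theta>. cos (real_of_int k * \<theta>))" using True by (simp add: trig_def fun_eq_iff)
  moreover have "- real_of_int k * trig (- k) \<theta> = - real_of_int k * sin (real_of_int k * \<theta>)"
    using True by (cases "k = 0") (auto simp: trig_def)
  ultimately show ?thesis by (simp only:)
next
  case False
  have "((\<lambda>\<theta>. sin (- real_of_int k * \<theta>)) has_real_derivative - real_of_int k * cos (- real_of_int k * \<theta>)) (at \<theta>)"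
    by (auto intro!: derivative_eq_intros)
  moreover have "trig k = (\<lambda>\<theta>. sin (- real_of_int k * \<theta>))" using False by (simp add: trig_def fun_eq_iff)
  moreover have "- real_of_int k * trig (- k) \<theta> = - real_of_int k * cos (- real_of_int k * \<theta>)"
    using False by (simp add: trig_def)
  ultimately show ?thesis by (simp only:)
qed

lemma trig_deriv_minus: "(trig (- k) has_real_derivative real_of_int k * trig k \<theta>) (at \<theta>)"
  using trig_deriv[of "- k" \<theta>] by simp

lemma trig_cont [continuous_intros]: "continuous_on S (trig k)"
  by (intro continuous_at_imp_continuous_on ballI DERIV_isCont[OF trig_deriv])

lemma trig_periodic: "trig k (\<theta> + 2 * pi) = trig k \<theta>"
proof -
  have "cos (real_of_int k * (\<theta> + 2 * pi)) = cos (real_of_int k * \<theta>)"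
    using cos_int_2pin[of k] sin_int_2pin[of k] by (simp add: distrib_left cos_add mult_ac)
  moreover have "sin (- real_of_int k * (\<theta> + 2 * pi)) = sin (- real_of_int k * \<theta>)"
    using cos_int_2pin[of k] sin_int_2pin[of k] by (simp add: distrib_left sin_diff sin_add mult_ac)
  ultimately show ?thesis by (simp add: trig_def)
qed

lemma trig_bound: "\<bar>trig k \<theta>\<bar> \<le> 1"
  by (simp add: trig_def)

lemma trig_zero [simp]: "trig 0 \<theta> = 1"
  by (simp add: trig_def)

lemma trig_square_sum: "(trig k \<theta>)\<^sup>2 + (trig (- k) \<theta>)\<^sup>2 = (if k = 0 then 2 else 1)"
  by (cases k "0::int" rule: linorder_cases) (auto simp: trig_def)

abbreviation "Mc \<equiv> Mi 0 (2 * pi)"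

lemma trig_L2: "L2 Mc (trig k)"
  by (intro Mi_continuous_L2 continuous_intros)

lemma periodic_integral:
  assumes "\<And>x. (f has_real_derivative f' x) (at x)" "continuous_on {0..2*pi} f'" "f (2 * pi) = f 0"
  shows "(\<integral>x. f' x \<partial>Mc) = 0"
  using ac_integral[OF ac_C1[OF assms(1,2)]] assms(3) by simp

text \<open>The square of the \<open>L2\<close> norm of \<open>trig k\<close>.\<close>

definition nrm :: "int \<Rightarrow> real" where "nrm k = (if k = 0 then 2 * pi else pi)"

lemma nrm_pos: "nrm k > 0" by (simp add: nrm_def)

lemma nrm_minus: "nrm (- k) = nrm k" by (simp add: nrm_def)

text \<open>Orthogonality: the \<open>trig k\<close> are eigenfunctions of the second derivative, which is symmetric on
  periodic functions; within an eigenspace, differentiate \<open>trig k * trig (-k)\<close> and its relatives.\<close>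

lemma trig_orthogonal: "(\<integral>\<theta>. trig j \<theta> * trig k \<theta> \<partial>Mc) = (if j = k then nrm k else 0)"
proof -
  have per: "trig k (2 * pi) = trig k 0" for k using trig_periodic[of k 0] by simp
  have i: "integrable Mc (\<lambda>\<theta>. trig j \<theta> * trig k \<theta>)" for j k
    by (rule L2_mult_integrable[OF trig_L2 trig_L2])
  have ne: "(\<integral>\<theta>. trig j \<theta> * trig k \<theta> \<partial>Mc) = 0" if "j\<^sup>2 \<noteq> k\<^sup>2" for j k
  proof -
    let ?f = "\<lambda>\<theta>. real_of_int k * (trig j \<theta> * trig (- k) \<theta>) - real_of_int j * (trig (- j) \<theta> * trig k \<theta>)"
    have "(\<integral>\<theta>. ((real_of_int k)\<^sup>2 - (real_of_int j)\<^sup>2) * (trig j \<theta> * trig k \<theta>) \<partial>Mc) = 0"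
    proof (rule periodic_integral[of ?f])
      show "(?f has_real_derivative ((real_of_int k)\<^sup>2 - (real_of_int j)\<^sup>2) * (trig j x * trig k x)) (at x)" for x
        by (rule DERIV_cong[OF DERIV_diff[OF DERIV_cmult[OF DERIV_mult[OF trig_deriv trig_deriv_minus]]
              DERIV_cmult[OF DERIV_mult[OF trig_deriv_minus trig_deriv]]]])
           (simp add: power2_eq_square algebra_simps)
    qed (auto intro!: continuous_intros simp: per)
    then have "((real_of_int k)\<^sup>2 - (real_of_int j)\<^sup>2) * (\<integral>\<theta>. trig j \<theta> * trig k \<theta> \<partial>Mc) = 0" by simp
    moreover have "(real_of_int k)\<^sup>2 - (real_of_int j)\<^sup>2 \<noteq> 0" using that
      by (metis eq_iff_diff_eq_0 of_int_eq_iff of_int_power)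
    ultimately show ?thesis by simp
  qed
  have opp: "(\<integral>\<theta>. trig k \<theta> * trig (- k) \<theta> \<partial>Mc) = 0" if "k \<noteq> 0" for k
  proof -
    have "(\<integral>\<theta>. real_of_int k * (trig k \<theta> * trig (- k) \<theta>) \<partial>Mc) = 0"
    proof (rule periodic_integral[of "\<lambda>\<theta>. 1/2 * (trig (- k) \<theta> * trig (- k) \<theta>)"])
      show "((\<lambda>\<theta>. 1/2 * (trig (- k) \<theta> * trig (- k) \<theta>)) has_real_derivative real_of_int k * (trig k x * trig (- k) x)) (at x)" for x
        by (rule DERIV_cong[OF DERIV_cmult[OF DERIV_mult[OF trig_deriv_minus trig_deriv_minus]]]) simp
    qed (auto intro!: continuous_intros simp: per)
    then show ?thesis using that by simp
  qed
  have sq: "(\<integral>\<theta>. trig k \<theta> * trig k \<theta> \<partial>Mc) = nrm k" for k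
  proof (cases "k = 0")
    case True
    then show ?thesis by (simp add: nrm_def measure_restrict_space)
  next
    case False
    have "(\<integral>\<theta>. real_of_int k * (trig k \<theta> * trig k \<theta>) - real_of_int k * (trig (- k) \<theta> * trig (- k) \<theta>) \<partial>Mc) = 0"
    proof (rule periodic_integral[of "\<lambda>\<theta>. trig k \<theta> * trig (- k) \<theta>"])
      show "((\<lambda>\<theta>. trig k \<theta> * trig (- k) \<theta>) has_real_derivative
          real_of_int k * (trig k x * trig k x) - real_of_int k * (trig (- k) x * trig (- k) x)) (at x)" for x
        by (rule DERIV_cong[OF DERIV_mult[OF trig_deriv trig_deriv_minus]]) simp
    qed (auto intro!: continuous_intros simp: per)
    then have eq: "(\<integral>\<theta>. trig k \<theta> * trig k \<theta> \<partial>Mc) = (\<integral>\<theta>. trig (- k) \<theta> * trig (- k) \<theta> \<partial>Mc)"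
      using i[of k k] i[of "-k" "-k"] False by simp
    have "(\<integral>\<theta>. trig k \<theta> * trig k \<theta> \<partial>Mc) + (\<integral>\<theta>. trig (- k) \<theta> * trig (- k) \<theta> \<partial>Mc)
      = (\<integral>\<theta>. trig k \<theta> * trig k \<theta> + trig (- k) \<theta> * trig (- k) \<theta> \<partial>Mc)" using i by simp
    also have "\<dots> = (\<integral>\<theta>. 1 \<partial>Mc)"
      using trig_square_sum[of k] False by (intro Bochner_Integration.integral_cong refl) (simp add: power2_eq_square)
    also have "\<dots> = 2 * pi" by (simp add: measure_restrict_space)
    finally show ?thesis using eq False by (simp add: nrm_def)
  qed
  show ?thesis
  proof (cases "j\<^sup>2 = k\<^sup>2")
    case True
    then have "j = k \<or> j = - k" by (simp add: power2_eq_iff)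
    then show ?thesis using sq[of k] opp[of "-k"] by auto
  next
    case False
    then show ?thesis using ne[of j k] by auto
  qed
qed

lemma trig_expansion:
  assumes f: "L2 Mc f" and F: "finite F"
  shows "(\<integral>\<theta>. (f \<theta> - (\<Sum>k\<in>F. c k * trig k \<theta>))\<^sup>2 \<partial>Mc)
    = (\<integral>\<theta>. (f \<theta>)\<^sup>2 \<partial>Mc) - 2 * (\<Sum>k\<in>F. c k * (\<integral>\<theta>. f \<theta> * trig k \<theta> \<partial>Mc)) + (\<Sum>k\<in>F. (c k)\<^sup>2 * nrm k)"
proof -
  let ?p = "\<lambda>\<theta>. \<Sum>k\<in>F. c k * trig k \<theta>"
  have pL: "L2 Mc ?p" by (intro L2_sum L2_scale trig_L2)
  have ft: "integrable Mc (\<lambda>\<theta>. f \<theta> * trig k \<theta>)" for k by (rule L2_mult_integrable[OF f trig_L2])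
  have tt: "integrable Mc (\<lambda>\<theta>. trig j \<theta> * trig k \<theta>)" for j k by (rule L2_mult_integrable[OF trig_L2 trig_L2])
  have fp: "(\<integral>\<theta>. f \<theta> * ?p \<theta> \<partial>Mc) = (\<Sum>k\<in>F. c k * (\<integral>\<theta>. f \<theta> * trig k \<theta> \<partial>Mc))"
  proof -
    have "(\<integral>\<theta>. f \<theta> * ?p \<theta> \<partial>Mc) = (\<integral>\<theta>. (\<Sum>k\<in>F. c k * (f \<theta> * trig k \<theta>)) \<partial>Mc)"
      by (intro Bochner_Integration.integral_cong refl) (simp add: sum_distrib_left mult_ac)
    then show ?thesis using ft by (simp add: Bochner_Integration.integral_sum)
  qed
  have pp: "(\<integral>\<theta>. ?p \<theta> * ?p \<theta> \<partial>Mc) = (\<Sum>k\<in>F. (c k)\<^sup>2 * nrm k)"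
  proof -
    have "(\<integral>\<theta>. ?p \<theta> * ?p \<theta> \<partial>Mc) = (\<integral>\<theta>. (\<Sum>j\<in>F. \<Sum>k\<in>F. c j * c k * (trig j \<theta> * trig k \<theta>)) \<partial>Mc)"
      by (intro Bochner_Integration.integral_cong refl) (simp add: sum_product mult_ac)
    also have "\<dots> = (\<Sum>j\<in>F. \<Sum>k\<in>F. c j * c k * (\<integral>\<theta>. trig j \<theta> * trig k \<theta> \<partial>Mc))"
      using tt by (simp add: Bochner_Integration.integral_sum)
    also have "\<dots> = (\<Sum>j\<in>F. \<Sum>k\<in>F. if k = j then c j * c j * nrm j else 0)"
      by (intro sum.cong refl) (simp add: trig_orthogonal)
    also have "\<dots> = (\<Sum>k\<in>F. (c k)\<^sup>2 * nrm k)" using F by (simp add: sum.delta' power2_eq_square)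
    finally show ?thesis .
  qed
  have "(\<integral>\<theta>. (f \<theta> - ?p \<theta>)\<^sup>2 \<partial>Mc) = (\<integral>\<theta>. (f \<theta>)\<^sup>2 - 2 * (f \<theta> * ?p \<theta>) + ?p \<theta> * ?p \<theta> \<partial>Mc)"
    by (intro Bochner_Integration.integral_cong refl) algebra
  also have "\<dots> = (\<integral>\<theta>. (f \<theta>)\<^sup>2 \<partial>Mc) - 2 * (\<integral>\<theta>. f \<theta> * ?p \<theta> \<partial>Mc) + (\<integral>\<theta>. ?p \<theta> * ?p \<theta> \<partial>Mc)"
    using L2_sq[OF f] L2_mult_integrable[OF f pL] L2_mult_integrable[OF pL pL] by simp
  finally show ?thesis unfolding fp pp .
qed

lemma Bessel:
  assumes f: "L2 Mc f" and F: "finite F"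
  shows "(\<Sum>k\<in>F. (\<integral>\<theta>. f \<theta> * trig k \<theta> \<partial>Mc)\<^sup>2 / nrm k) \<le> (\<integral>\<theta>. (f \<theta>)\<^sup>2 \<partial>Mc)"
proof -
  define h where "h k = (\<integral>\<theta>. f \<theta> * trig k \<theta> \<partial>Mc)" for k
  have "0 \<le> (\<integral>\<theta>. (f \<theta> - (\<Sum>k\<in>F. h k / nrm k * trig k \<theta>))\<^sup>2 \<partial>Mc)" by simp
  also have "\<dots> = (\<integral>\<theta>. (f \<theta>)\<^sup>2 \<partial>Mc) - 2 * (\<Sum>k\<in>F. h k / nrm k * h k) + (\<Sum>k\<in>F. (h k / nrm k)\<^sup>2 * nrm k)"
    unfolding trig_expansion[OF f F] h_def ..
  also have "(\<Sum>k\<in>F. (h k / nrm k)\<^sup>2 * nrm k) = (\<Sum>k\<in>F. h k / nrm k * h k)"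
    using nrm_pos by (intro sum.cong refl) (simp add: power2_eq_square less_imp_neq[symmetric])
  finally show ?thesis by (simp add: h_def power2_eq_square)
qed

subsection \<open>Trigonometric polynomials are dense\<close>

inductive trig_poly :: "(real \<Rightarrow> real) \<Rightarrow> bool" where
  base: "trig_poly (\<lambda>\<theta>. c * trig k \<theta>)"
| add: "trig_poly f \<Longrightarrow> trig_poly g \<Longrightarrow> trig_poly (\<lambda>\<theta>. f \<theta> + g \<theta>)"

lemma trig_poly_scale: "trig_poly f \<Longrightarrow> trig_poly (\<lambda>\<theta>. c * f \<theta>)"
proof (induction rule: trig_poly.induct)
  case (base d k)
  then show ?case using trig_poly.base[of "c * d" k] by (simp add: mult.assoc)
next
  case (add f g)
  then show ?case using trig_poly.add by (simp add: distrib_left)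
qed

lemma trig_poly_cos: "trig_poly (\<lambda>\<theta>. cos (real_of_int n * \<theta>))"
proof -
  have "cos (real_of_int n * \<theta>) = 1 * trig \<bar>n\<bar> \<theta>" for \<theta>
    by (cases "0 \<le> n") (auto simp: trig_def)
  then show ?thesis using trig_poly.base[of 1 "\<bar>n\<bar>"] by presburger
qed

lemma trig_poly_sin: "trig_poly (\<lambda>\<theta>. sin (real_of_int n * \<theta>))"
proof -
  have "sin (real_of_int n * \<theta>) = of_int (sgn n) * trig (- \<bar>n\<bar>) \<theta>" for \<theta>
    by (cases n "0::int" rule: linorder_cases) (auto simp: trig_def)
  then show ?thesis using trig_poly.base[of "of_int (sgn n)" "- \<bar>n\<bar>"] by presburger
qed

lemma trig_poly_trig_mult: "trig_poly (\<lambda>\<theta>. trig j \<theta> * trig k \<theta>)"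
proof -
  have cc: "trig_poly (\<lambda>\<theta>. 1/2 * (cos (real_of_int m * \<theta>) + c * cos (real_of_int n * \<theta>)))" for m n c
    by (intro trig_poly_scale trig_poly.add trig_poly_cos)
  have ss: "trig_poly (\<lambda>\<theta>. 1/2 * (sin (real_of_int m * \<theta>) + sin (real_of_int n * \<theta>)))" for m n
    by (intro trig_poly_scale trig_poly.add trig_poly_sin)
  have sc: "trig_poly (\<lambda>\<theta>. trig j \<theta> * trig k \<theta>)" if "j < 0" "0 \<le> k" for j k
  proof -
    have "trig j \<theta> * trig k \<theta> = 1/2 * (sin (real_of_int (- j + k) * \<theta>) + sin (real_of_int (- j - k) * \<theta>))" for \<theta>
    proof -
      have "trig j \<theta> * trig k \<theta> = sin (- real_of_int j * \<theta>) * cos (real_of_int k * \<theta>)"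
        using that by (simp add: trig_def)
      also have "\<dots> = (sin (- real_of_int j * \<theta> + real_of_int k * \<theta>) + sin (- real_of_int j * \<theta> - real_of_int k * \<theta>)) / 2"
        by (rule sin_times_cos)
      finally show ?thesis by (simp add: algebra_simps)
    qed
    then show ?thesis using ss by presburger
  qed
  consider "j < 0" "0 \<le> k" | "k < 0" "0 \<le> j" | "0 \<le> j" "0 \<le> k" | "j < 0" "k < 0" by linarith
  then show ?thesis
  proof cases
    case 1
    then show ?thesis by (rule sc)
  next
    case 2
    then show ?thesis using sc[of k j] by (simp add: mult.commute)
  next
    case 3
    have "trig j \<theta> * trig k \<theta> = 1/2 * (cos (real_of_int (j - k) * \<theta>) + 1 * cos (real_of_int (j + k) * \<theta>))" for \<theta>
      using 3 by (simp add: trig_def cos_times_cos algebra_simps)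
    then show ?thesis using cc by presburger
  next
    case 4
    have "trig j \<theta> * trig k \<theta> = 1/2 * (cos (real_of_int (k - j) * \<theta>) + (-1) * cos (real_of_int (- j - k) * \<theta>))" for \<theta>
    proof -
      have "trig j \<theta> * trig k \<theta> = sin (- real_of_int j * \<theta>) * sin (- real_of_int k * \<theta>)"
        using 4 by (simp add: trig_def)
      also have "\<dots> = (cos (- real_of_int j * \<theta> - - real_of_int k * \<theta>) - cos (- real_of_int j * \<theta> + - real_of_int k * \<theta>)) / 2"
        by (rule sin_times_sin)
      finally show ?thesis by (simp add: algebra_simps)
    qed
    then show ?thesis using cc by presburger
  qed
qed

lemma trig_poly_mult:
  assumes "trig_poly f" "trig_poly g" shows "trig_poly (\<lambda>\<theta>. f \<theta> * g \<theta>)"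
  using assms(1)
proof (induction rule: trig_poly.induct)
  case (base c j)
  have "trig_poly (\<lambda>\<theta>. trig j \<theta> * g \<theta>)"
    using assms(2)
  proof (induction rule: trig_poly.induct)
    case (base d k)
    then show ?case using trig_poly_scale[OF trig_poly_trig_mult[of j k], of d] by (simp add: mult.left_commute)
  next
    case (add f g)
    then show ?case using trig_poly.add by (simp add: distrib_left)
  qed
  from trig_poly_scale[OF this, of c] show ?case by (simp add: mult.assoc)
next
  case (add f h)
  then show ?case using trig_poly.add by (simp add: distrib_right)
qed

lemma trig_poly_sum:
  assumes "trig_poly f"
  shows "\<exists>n c. f = (\<lambda>\<theta>. \<Sum>k\<in>{-n..n}. c k * trig k \<theta>)"
  using assms
proof (induction rule: trig_poly.induct)
  case (base c k)
  have "(\<Sum>j\<in>{-\<bar>k\<bar>..\<bar>k\<bar>}. (if j = k then c else 0) * trig j \<theta>) = c * trig k \<theta>" for \<theta>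
    by (auto simp: if_distrib[of "\<lambda>c. c * trig _ \<theta>"] sum.delta' abs_if cong: if_cong)
  then have "(\<lambda>\<theta>. c * trig k \<theta>) = (\<lambda>\<theta>. \<Sum>j\<in>{-\<bar>k\<bar>..\<bar>k\<bar>}. (if j = k then c else 0) * trig j \<theta>)"
    by (intro ext) simp
  then show ?case by - (rule exI[of _ "\<bar>k\<bar>"], rule exI, assumption)
next
  case (add f g)
  then obtain n c m d where f: "f = (\<lambda>\<theta>. \<Sum>k\<in>{-n..n}. c k * trig k \<theta>)" and g: "g = (\<lambda>\<theta>. \<Sum>k\<in>{-m..m}. d k * trig k \<theta>)"
    by blast
  have widen: "(\<Sum>k\<in>{-n..n}. c k * trig k \<theta>) = (\<Sum>k\<in>{-N..N}. (if k \<in> {-n..n} then c k else 0) * trig k \<theta>)"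
    if "n \<le> N" for n N :: int and c :: "int \<Rightarrow> real" and \<theta>
    using that by (intro sum.mono_neutral_cong_left) auto
  have "f \<theta> + g \<theta> = (\<Sum>k\<in>{-max n m..max n m}. ((if k \<in> {-n..n} then c k else 0) + (if k \<in> {-m..m} then d k else 0)) * trig k \<theta>)" for \<theta>
    unfolding f g widen[OF max.cobounded1[of n m], of c \<theta>] widen[OF max.cobounded2[of m n], of d \<theta>]
    by (simp add: sum.distrib distrib_right)
  then have "(\<lambda>\<theta>. f \<theta> + g \<theta>) = (\<lambda>\<theta>. \<Sum>k\<in>{-max n m..max n m}. ((if k \<in> {-n..n} then c k else 0) + (if k \<in> {-m..m} then d k else 0)) * trig k \<theta>)"
    by (rule ext)
  then show ?case by - (rule exI[of _ "max n m"], rule exI, assumption)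
qed

lemma trig_poly_real_polynomial:
  assumes "real_polynomial_function p"
  shows "trig_poly (\<lambda>\<theta>. p (cis \<theta>))"
  using assms
proof (induction rule: real_polynomial_function.induct)
  case (linear h)
  then interpret bounded_linear h .
  have "cis \<theta> = cos \<theta> *\<^sub>R 1 + sin \<theta> *\<^sub>R \<i>" for \<theta> by (simp add: complex_eq_iff)
  then have "h (cis \<theta>) = h 1 * cos (real_of_int 1 * \<theta>) + h \<i> * sin (real_of_int 1 * \<theta>)" for \<theta>
    by (simp add: add scaleR)
  then show ?case
    using trig_poly.add[OF trig_poly_scale[OF trig_poly_cos[of 1], of "h 1"] trig_poly_scale[OF trig_poly_sin[of 1], of "h \<i>"]]
    by presburger
next
  case (const c)
  then show ?case using trig_poly.base[of c 0] by simp
next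
  case (add f g)
  then show ?case by (intro trig_poly.add)
next
  case (mult f g)
  then show ?case by (intro trig_poly_mult)
qed

text \<open>Stone-Weierstrass on the unit circle: polynomials in the two coordinates restrict to trigonometric
  polynomials.\<close>

lemma trig_poly_dense:
  assumes F: "continuous_on {0..2*pi} F" and per: "F 0 = F (2 * pi)" and e: "e > 0"
  obtains f where "trig_poly f" "\<And>\<theta>. \<theta> \<in> {0..2*pi} \<Longrightarrow> \<bar>F \<theta> - f \<theta>\<bar> < e"
proof -
  let ?S = "sphere (0::complex) 1"
  define g where "g z = F (Arg2pi z)" for z
  have g: "g (cis \<theta>) = F \<theta>" if "\<theta> \<in> {0..2*pi}" for \<theta>
  proof (cases "\<theta> = 2 * pi")
    case True
    moreover have "Arg2pi 1 = 0" by (rule Arg2pi_unique[of 1]) auto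
    ultimately show ?thesis using per by (simp add: g_def cis_2pi)
  next
    case False
    then have "Arg2pi (cis \<theta>) = \<theta>" using that by (intro Arg2pi_unique[of 1]) (auto simp: cis_conv_exp)
    then show ?thesis by (simp add: g_def)
  qed
  have cisA: "cis (Arg2pi z) = z" if "z \<in> ?S" for z
    using that Arg2pi_eq[of z] by (simp add: cis_conv_exp)
  have cont: "continuous_on ?S g"
  proof (subst continuous_on_closed_vimage[OF closed_sphere], intro allI impI)
    fix T :: "real set" assume T: "closed T"
    have "closed ({0..2*pi} \<inter> F -` T)"
      using continuous_on_closed_vimage[of "{0..2*pi}" F] F T by (auto simp: Int_commute)
    then have "compact ({0..2*pi} \<inter> F -` T)"
      by (metis compact_Icc compact_Int_closed inf.left_idem)
    moreover have "continuous_on ({0..2*pi} \<inter> F -` T) cis" by (intro continuous_intros)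
    ultimately have "compact (cis ` ({0..2*pi} \<inter> F -` T))" by (rule compact_continuous_image[rotated])
    moreover have "cis ` ({0..2*pi} \<inter> F -` T) = g -` T \<inter> ?S"
    proof safe
      fix \<theta> assume "\<theta> \<in> {0..2*pi}" "F \<theta> \<in> T"
      then show "cis \<theta> \<in> g -` T" "cis \<theta> \<in> ?S" using g[of \<theta>] by auto
    next
      fix z assume z: "g z \<in> T" "z \<in> ?S"
      have "Arg2pi z \<in> {0..2*pi} \<inter> F -` T"
        using z(1) Arg2pi_ge_0[of z] Arg2pi_lt_2pi[of z] by (auto simp: g_def)
      then show "z \<in> cis ` ({0..2*pi} \<inter> F -` T)" using cisA[OF z(2)] by (metis imageI)
    qed
    ultimately show "closed (g -` T \<inter> ?S)" by (simp add: compact_imp_closed)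
  qed
  obtain p where p: "real_polynomial_function p" "\<And>z. z \<in> ?S \<Longrightarrow> \<bar>g z - p z\<bar> < e"
    by (rule Stone_Weierstrass_real_polynomial_function[OF compact_sphere cont e]) (rule that; assumption)
  show ?thesis
  proof (rule that[OF trig_poly_real_polynomial[OF p(1)]])
    fix \<theta> assume "\<theta> \<in> {0..2*pi}"
    then show "\<bar>F \<theta> - p (cis \<theta>)\<bar> < e" using p(2)[of "cis \<theta>"] g[of \<theta>] by simp
  qed
qed

text \<open>Parseval's inequality for continuous periodic functions: a finite Fourier sum is the best
  approximation of its degree in the mean.\<close>

lemma Parseval_upper:
  assumes F: "continuous_on {0..2*pi} F" and per: "F 0 = F (2 * pi)" and e: "e > 0"
  obtains n where "(\<integral>\<theta>. (F \<theta>)\<^sup>2 \<partial>Mc) \<le> (\<Sum>k\<in>{-n..n}. (\<integral>\<theta>. F \<theta> * trig k \<theta> \<partial>Mc)\<^sup>2 / nrm k) + e"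
proof -
  define d where "d = sqrt (e / (2 * pi))"
  have d: "d > 0" using e by (simp add: d_def)
  obtain f where f: "trig_poly f" "\<And>\<theta>. \<theta> \<in> {0..2*pi} \<Longrightarrow> \<bar>F \<theta> - f \<theta>\<bar> < d"
    using trig_poly_dense[OF F per d] by blast
  obtain n c where fc: "f = (\<lambda>\<theta>. \<Sum>k\<in>{-n..n}. c k * trig k \<theta>)" using trig_poly_sum[OF f(1)] by blast
  have FL: "L2 Mc F" by (rule Mi_continuous_L2[OF F])
  have fL: "L2 Mc f" unfolding fc by (intro L2_sum L2_scale trig_L2)
  define h where "h k = (\<integral>\<theta>. F \<theta> * trig k \<theta> \<partial>Mc)" for k
  have "(\<integral>\<theta>. (F \<theta> - f \<theta>)\<^sup>2 \<partial>Mc) \<le> (\<integral>\<theta>. d\<^sup>2 \<partial>Mc)"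
  proof (intro integral_mono)
    fix \<theta> assume "\<theta> \<in> space Mc"
    then have "\<bar>F \<theta> - f \<theta>\<bar> \<le> \<bar>d\<bar>" using f(2)[of \<theta>] d by auto
    then show "(F \<theta> - f \<theta>)\<^sup>2 \<le> d\<^sup>2" by (simp add: abs_le_square_iff)
  qed (use L2_sq[OF L2_diff[OF FL fL]] in auto)
  also have "\<dots> = e" using e by (simp add: d_def measure_restrict_space)
  finally have le: "(\<integral>\<theta>. (F \<theta> - f \<theta>)\<^sup>2 \<partial>Mc) \<le> e" .
  have fin: "finite {-n..n}" by simp
  have "(\<integral>\<theta>. (F \<theta> - f \<theta>)\<^sup>2 \<partial>Mc)
      = (\<integral>\<theta>. (F \<theta>)\<^sup>2 \<partial>Mc) - 2 * (\<Sum>k\<in>{-n..n}. c k * h k) + (\<Sum>k\<in>{-n..n}. (c k)\<^sup>2 * nrm k)"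
    unfolding fc trig_expansion[OF FL fin] h_def ..
  also have "\<dots> = (\<integral>\<theta>. (F \<theta>)\<^sup>2 \<partial>Mc) - (\<Sum>k\<in>{-n..n}. 2 * (c k * h k) - (c k)\<^sup>2 * nrm k)"
    by (simp add: sum_subtractf sum_distrib_left)
  also have "\<dots> \<ge> (\<integral>\<theta>. (F \<theta>)\<^sup>2 \<partial>Mc) - (\<Sum>k\<in>{-n..n}. (h k)\<^sup>2 / nrm k)"
  proof (intro diff_left_mono sum_mono)
    fix k
    have "0 \<le> (c k * nrm k - h k)\<^sup>2 / nrm k" using nrm_pos[of k] by simp
    then show "2 * (c k * h k) - (c k)\<^sup>2 * nrm k \<le> (h k)\<^sup>2 / nrm k"
      using nrm_pos[of k] by (simp add: power2_diff field_simps power2_eq_square)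
  qed
  finally show ?thesis using that[of n] le by (simp add: h_def)
qed

text \<open>The primitive of \<open>h\<close> is continuous and periodic, and its Fourier coefficients vanish except possibly
  for the mean; by \<open>Parseval_upper\<close> it is constant.\<close>

lemma Fourier_unique:
  assumes h: "integrable Mc h" and z: "\<And>k. (\<integral>\<theta>. h \<theta> * trig k \<theta> \<partial>Mc) = 0"
  shows "AE \<theta> in Mc. h \<theta> = 0"
proof -
  let ?F = "prim 0 (2 * pi) h"
  have Fac: "ac 0 (2*pi) ?F h" by (rule ac_prim[OF h])
  have F0: "?F 0 = 0" by (rule prim_left) simp
  have F1: "?F (2 * pi) = 0" using z[of 0] by (simp add: prim_right)
  define c where "c = (\<integral>\<theta>. ?F \<theta> \<partial>Mc) / (2 * pi)"
  have Fc: "continuous_on {0..2*pi} ?F" by (rule ac_continuous[OF Fac])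
  have Fk: "(\<integral>\<theta>. ?F \<theta> * trig k \<theta> \<partial>Mc) = 0" if "k \<noteq> 0" for k
  proof -
    have tac: "ac 0 (2*pi) (trig (- k)) (\<lambda>\<theta>. real_of_int k * trig k \<theta>)"
      by (rule ac_C1) (auto intro!: trig_deriv_minus continuous_intros)
    have "(\<integral>\<theta>. ?F \<theta> * (real_of_int k * trig k \<theta>) + h \<theta> * trig (- k) \<theta> \<partial>Mc) = 0"
      using ac_integral[OF ac_mult[OF Fac tac]] F0 F1 by simp
    moreover have "(\<integral>\<theta>. ?F \<theta> * (real_of_int k * trig k \<theta>) + h \<theta> * trig (- k) \<theta> \<partial>Mc)
      = (\<integral>\<theta>. real_of_int k * (?F \<theta> * trig k \<theta>) \<partial>Mc) + (\<integral>\<theta>. h \<theta> * trig (- k) \<theta> \<partial>Mc)"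
    proof -
      have "integrable Mc (\<lambda>\<theta>. real_of_int k * (?F \<theta> * trig k \<theta>))" "integrable Mc (\<lambda>\<theta>. h \<theta> * trig (- k) \<theta>)"
        using L2_mult_integrable[OF Mi_continuous_L2[OF Fc] trig_L2] Mi_integrable_mult_continuous[OF trig_cont h]
        by (simp_all add: mult.commute)
      from Bochner_Integration.integral_add[OF this] show ?thesis by (simp only: mult.left_commute)
    qed
    ultimately show ?thesis using z[of "-k"] that by simp
  qed
  have Gk: "(\<integral>\<theta>. (?F \<theta> - c) * trig k \<theta> \<partial>Mc) = 0" for k
  proof -
    have "(\<integral>\<theta>. (?F \<theta> - c) * trig k \<theta> \<partial>Mc) = (\<integral>\<theta>. ?F \<theta> * trig k \<theta> \<partial>Mc) - c * (\<integral>\<theta>. trig k \<theta> \<partial>Mc)"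
      using L2_mult_integrable[OF Mi_continuous_L2[OF Fc] trig_L2[of k]] Mi.L2_integrable[OF trig_L2[of k]]
      by (simp add: left_diff_distrib)
    moreover have "(\<integral>\<theta>. trig k \<theta> \<partial>Mc) = (if k = 0 then 2 * pi else 0)"
      using trig_orthogonal[of 0 k] by (auto simp: nrm_def)
    ultimately show ?thesis using Fk[of k] by (cases "k = 0") (auto simp: c_def)
  qed
  have Gc: "continuous_on {0..2*pi} (\<lambda>\<theta>. ?F \<theta> - c)" by (intro continuous_intros Fc)
  have "(\<integral>\<theta>. (?F \<theta> - c)\<^sup>2 \<partial>Mc) \<le> 0"
  proof (rule field_le_epsilon)
    fix e :: real assume "e > 0"
    from Parseval_upper[OF Gc _ this] F0 F1 show "(\<integral>\<theta>. (?F \<theta> - c)\<^sup>2 \<partial>Mc) \<le> 0 + e" by (auto simp: Gk)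
  qed
  from L2_zero_AE[OF Mi_continuous_L2[OF Gc] this] have ae: "AE \<theta> in Mc. ?F \<theta> = c" by eventually_elim simp
  have "?F \<theta> = c" if "\<theta> \<in> {0..2*pi}" for \<theta>
    by (rule continuous_AE_eq[OF ae Fc that]) simp
  from this this[of 0] F0 have "?F \<theta> = 0" if "\<theta> \<in> {0..2*pi}" for \<theta> using that by simp
  then show ?thesis by (rule prim_zero_AE[OF h])
qed

text \<open>Wirtinger's inequality on the complement of the modes \<open>0, \<plusminus>1\<close>. The derivative \<open>g\<close> is known only
  through its Fourier coefficients; its primitive is continuous and has those of \<open>f\<close>.\<close>

lemma Wirtinger:
  assumes f: "L2 Mc f" and g: "L2 Mc g"
    and fg: "\<And>k. (\<integral>\<theta>. g \<theta> * trig k \<theta> \<partial>Mc) = real_of_int k * (\<integral>\<theta>. f \<theta> * trig (- k) \<theta> \<partial>Mc)"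
    and low: "\<And>k. \<bar>k\<bar> \<le> 1 \<Longrightarrow> (\<integral>\<theta>. f \<theta> * trig k \<theta> \<partial>Mc) = 0"
  shows "4 * (\<integral>\<theta>. (f \<theta>)\<^sup>2 \<partial>Mc) \<le> (\<integral>\<theta>. (g \<theta>)\<^sup>2 \<partial>Mc)"
proof -
  have gi: "integrable Mc g" by (rule Mi.L2_integrable[OF g])
  let ?G = "prim 0 (2 * pi) g"
  have Gac: "ac 0 (2*pi) ?G g" by (rule ac_prim[OF gi])
  have Gc: "continuous_on {0..2*pi} ?G" by (rule ac_continuous[OF Gac])
  define c where "c = - (\<integral>\<theta>. ?G \<theta> \<partial>Mc) / (2 * pi)"
  define W where "W \<theta> = ?G \<theta> + c" for \<theta>
  have Wac: "ac 0 (2*pi) W g"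
    using ac_add[OF Gac ac_C1[of 0 "2*pi" "\<lambda>\<theta>. c" "\<lambda>\<theta>. 0"]] by (simp add: W_def[abs_def])
  have Wc: "continuous_on {0..2*pi} W" by (rule ac_continuous[OF Wac])
  have WL: "L2 Mc W" by (rule Mi_continuous_L2[OF Wc])
  have "?G (2 * pi) = 0" using fg[of 0] by (simp add: prim_right)
  then have W0: "W 0 = W (2 * pi)" by (simp add: W_def prim_left)
  have Wint: "(\<integral>\<theta>. W \<theta> \<partial>Mc) = 0"
    using Mi_continuous_integrable[OF Gc] by (simp add: W_def c_def measure_restrict_space)
  have per: "trig k (2 * pi) = trig k 0" for k using trig_periodic[of k 0] by simp
  have Wk: "(\<integral>\<theta>. W \<theta> * trig k \<theta> \<partial>Mc) = (\<integral>\<theta>. f \<theta> * trig k \<theta> \<partial>Mc)" for k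
  proof (cases "k = 0")
    case True
    then show ?thesis using Wint low[of 0] by simp
  next
    case False
    have tac: "ac 0 (2*pi) (trig (- k)) (\<lambda>\<theta>. real_of_int k * trig k \<theta>)"
      by (rule ac_C1) (auto intro!: trig_deriv_minus continuous_intros)
    have "(\<integral>\<theta>. W \<theta> * (real_of_int k * trig k \<theta>) + g \<theta> * trig (- k) \<theta> \<partial>Mc) = 0"
      using ac_integral[OF ac_mult[OF Wac tac]] W0 per by simp
    moreover have "(\<integral>\<theta>. W \<theta> * (real_of_int k * trig k \<theta>) + g \<theta> * trig (- k) \<theta> \<partial>Mc)
      = (\<integral>\<theta>. real_of_int k * (W \<theta> * trig k \<theta>) \<partial>Mc) + (\<integral>\<theta>. g \<theta> * trig (- k) \<theta> \<partial>Mc)"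
      using L2_mult_integrable[OF WL trig_L2] L2_mult_integrable[OF g trig_L2]
      by (subst Bochner_Integration.integral_add[symmetric]) (auto simp: mult.left_commute)
    ultimately show ?thesis using fg[of "-k"] False by simp
  qed
  have "AE \<theta> in Mc. W \<theta> - f \<theta> = 0"
  proof (rule Fourier_unique)
    show "integrable Mc (\<lambda>\<theta>. W \<theta> - f \<theta>)" using Mi.L2_integrable[OF WL] Mi.L2_integrable[OF f] by simp
    show "(\<integral>\<theta>. (W \<theta> - f \<theta>) * trig k \<theta> \<partial>Mc) = 0" for k
      using L2_mult_integrable[OF WL trig_L2] L2_mult_integrable[OF f trig_L2] Wk[of k] by (simp add: left_diff_distrib)
  qed
  then have "AE \<theta> in Mc. (f \<theta>)\<^sup>2 = (W \<theta>)\<^sup>2" by eventually_elim simp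
  then have fW: "(\<integral>\<theta>. (f \<theta>)\<^sup>2 \<partial>Mc) = (\<integral>\<theta>. (W \<theta>)\<^sup>2 \<partial>Mc)"
    using L2_sq[OF f] L2_sq[OF WL] by (intro integral_cong_AE) auto
  define h where "h k = (\<integral>\<theta>. f \<theta> * trig k \<theta> \<partial>Mc)" for k
  have "4 * (\<integral>\<theta>. (W \<theta>)\<^sup>2 \<partial>Mc) \<le> (\<integral>\<theta>. (g \<theta>)\<^sup>2 \<partial>Mc) + e" if "e > 0" for e
  proof -
    obtain n where n: "(\<integral>\<theta>. (W \<theta>)\<^sup>2 \<partial>Mc) \<le> (\<Sum>k\<in>{-n..n}. (h k)\<^sup>2 / nrm k) + e / 4"
      using Parseval_upper[OF Wc W0, of "e/4"] \<open>e > 0\<close> unfolding Wk h_def by (metis zero_less_divide_iff zero_less_numeral)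
    have "4 * (\<Sum>k\<in>{-n..n}. (h k)\<^sup>2 / nrm k) \<le> (\<Sum>k\<in>{-n..n}. (real_of_int k)\<^sup>2 * ((h k)\<^sup>2 / nrm k))"
      unfolding sum_distrib_left
    proof (intro sum_mono)
      fix k
      show "4 * ((h k)\<^sup>2 / nrm k) \<le> (real_of_int k)\<^sup>2 * ((h k)\<^sup>2 / nrm k)"
      proof (cases "\<bar>k\<bar> \<le> 1")
        case True
        then show ?thesis using low[of k] by (simp add: h_def)
      next
        case False
        then have "2 \<le> \<bar>real_of_int k\<bar>" by linarith
        then have "2\<^sup>2 \<le> (real_of_int k)\<^sup>2" by (metis abs_le_square_iff abs_numeral)
        then show ?thesis using nrm_pos[of k] by (intro mult_right_mono) auto
      qed
    qed
    also have "\<dots> = (\<Sum>k\<in>{-n..n}. (real_of_int (- k))\<^sup>2 * ((h (- k))\<^sup>2 / nrm (- k)))"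
      by (rule sum.reindex_bij_witness[of _ uminus uminus]) auto
    also have "\<dots> = (\<Sum>k\<in>{-n..n}. (\<integral>\<theta>. g \<theta> * trig k \<theta> \<partial>Mc)\<^sup>2 / nrm k)"
      by (intro sum.cong refl) (simp add: fg h_def nrm_minus power_mult_distrib)
    also have "\<dots> \<le> (\<integral>\<theta>. (g \<theta>)\<^sup>2 \<partial>Mc)" by (rule Bessel[OF g]) simp
    finally show ?thesis using n by simp
  qed
  then show ?thesis unfolding fW by (rule field_le_epsilon)
qed

section \<open>Functions on the annulus\<close>

lemma C1_periodic_continuous:
  assumes "C1_periodic \<psi> \<psi>s \<psi>t"
  shows "continuous_on S \<psi>" "continuous_on S \<psi>s" "continuous_on S \<psi>t"
proof -
  have "(\<psi> has_derivative (\<lambda>(h, k). \<psi>s x * h + \<psi>t x * k)) (at x)" for x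
    using assms unfolding C1_periodic_def by blast
  then show "continuous_on S \<psi>"
    by (intro continuous_at_imp_continuous_on ballI has_derivative_continuous)
  show "continuous_on S \<psi>s" "continuous_on S \<psi>t"
    using assms continuous_on_subset by (auto simp: C1_periodic_def)
qed

lemma C1_periodic_partial:
  assumes "C1_periodic \<psi> \<psi>s \<psi>t"
  shows "((\<lambda>s. \<psi> (s, \<theta>)) has_real_derivative \<psi>s (s, \<theta>)) (at s)"
    and "((\<lambda>\<theta>. \<psi> (s, \<theta>)) has_real_derivative \<psi>t (s, \<theta>)) (at \<theta>)"
proof -
  have d: "(\<psi> has_derivative (\<lambda>(h, k). \<psi>s x * h + \<psi>t x * k)) (at x within A)" for x A
    using assms unfolding C1_periodic_def by (blast intro: has_derivative_at_withinI)
  have "((\<lambda>s. (s, \<theta>)) has_derivative (\<lambda>h. (h, 0))) (at s)" by (auto intro!: derivative_eq_intros)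
  from has_derivative_in_compose[OF this d]
  show "((\<lambda>s. \<psi> (s, \<theta>)) has_real_derivative \<psi>s (s, \<theta>)) (at s)"
    unfolding has_field_derivative_def by (rule has_derivative_eq_rhs) auto
  have "((\<lambda>\<theta>. (s, \<theta>)) has_derivative (\<lambda>h. (0, h))) (at \<theta>)" by (auto intro!: derivative_eq_intros)
  from has_derivative_in_compose[OF this d]
  show "((\<lambda>\<theta>. \<psi> (s, \<theta>)) has_real_derivative \<psi>t (s, \<theta>)) (at \<theta>)"
    unfolding has_field_derivative_def by (rule has_derivative_eq_rhs) auto
qed

lemma C1_periodic_product:
  assumes "\<And>s. (\<psi> has_real_derivative \<psi>' s) (at s)" "continuous_on UNIV \<psi>'"
  shows "C1_periodic (\<lambda>x. \<psi> (fst x) * trig k (snd x)) (\<lambda>x. \<psi>' (fst x) * trig k (snd x))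
    (\<lambda>x. \<psi> (fst x) * (- real_of_int k * trig (- k) (snd x)))"
  unfolding C1_periodic_def
proof (intro conjI allI)
  fix x :: "real \<times> real"
  have p: "((\<lambda>x. \<psi> (fst x)) has_derivative (\<lambda>h. \<psi>' (fst x) * fst h)) (at x)"
    by (rule has_derivative_in_compose[OF has_derivative_fst[OF has_derivative_ident]
          has_derivative_at_withinI[OF assms(1)[unfolded has_field_derivative_def]]])
  have t: "((\<lambda>x. trig k (snd x)) has_derivative (\<lambda>h. - real_of_int k * trig (- k) (snd x) * snd h)) (at x)"
    by (rule has_derivative_in_compose[OF has_derivative_snd[OF has_derivative_ident]
          has_derivative_at_withinI[OF trig_deriv[unfolded has_field_derivative_def]]])
  show "((\<lambda>x. \<psi> (fst x) * trig k (snd x)) has_derivative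
     (\<lambda>(h, h'). \<psi>' (fst x) * trig k (snd x) * h + \<psi> (fst x) * (- real_of_int k * trig (- k) (snd x)) * h')) (at x)"
    by (rule has_derivative_eq_rhs[OF has_derivative_mult[OF p t]]) (auto simp: fun_eq_iff algebra_simps)
next
  have "continuous_on UNIV \<psi>" by (intro continuous_at_imp_continuous_on ballI DERIV_isCont[OF assms(1)])
  then have c: "continuous_on UNIV (\<lambda>x::real \<times> real. \<psi> (fst x))" "continuous_on UNIV (\<lambda>x::real \<times> real. \<psi>' (fst x))"
    "continuous_on UNIV (\<lambda>x::real \<times> real. trig j (snd x))" for j
    using continuous_on_compose2[OF _ continuous_on_fst[OF continuous_on_id]] assms(2)
      continuous_on_compose2[OF trig_cont[of UNIV] continuous_on_snd[OF continuous_on_id]] by auto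
  show "continuous_on UNIV (\<lambda>x. \<psi>' (fst x) * trig k (snd x))"
    "continuous_on UNIV (\<lambda>x. \<psi> (fst x) * (- real_of_int k * trig (- k) (snd x)))"
    by (intro continuous_on_mult c continuous_on_const)+
qed (simp add: trig_periodic)

text \<open>The fundamental domain of the annulus is a rectangle, so integrals over it are integrals with respect
  to a product measure.\<close>

locale cylinder =
  fixes l :: real
  assumes l: "l > 0"
begin

abbreviation "M \<equiv> Mi (-l) l"
abbreviation "R \<equiv> Mi (-l) l \<Otimes>\<^sub>M Mi 0 (2 * pi)"

lemma R_eq: "restrict_space lborel (annulus l) = R"
proof (rule pair_measure_eqI[symmetric])
  show "sigma_finite_measure M" "sigma_finite_measure Mc" by unfold_locales
  let ?L = "lborel :: (real \<times> real) measure"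
  have an: "annulus l \<in> sets ?L" by (auto simp: annulus_def intro!: borel_open open_Times)
  show "sets R = sets (restrict_space ?L (annulus l))"
  proof
    show "sets R \<subseteq> sets (restrict_space ?L (annulus l))"
    proof (rule sets_pair_in_sets)
      fix A B assume "A \<in> sets M" "B \<in> sets Mc"
      then obtain A' B' where "A = {-l<..<l} \<inter> A'" "B = {0<..<2*pi} \<inter> B'" "A' \<in> sets borel" "B' \<in> sets borel"
        by (auto simp: sets_restrict_space)
      moreover from this have "A' \<times> B' \<in> sets ?L" by (simp add: borel_Times)
      ultimately show "A \<times> B \<in> sets (restrict_space ?L (annulus l))"
        by (auto simp: sets_restrict_space annulus_def intro!: image_eqI[of _ _ "A' \<times> B'"])
    qed
    show "sets (restrict_space ?L (annulus l)) \<subseteq> sets R"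
    proof
      fix X assume "X \<in> sets (restrict_space ?L (annulus l))"
      then obtain Y where Y: "X = annulus l \<inter> Y" "Y \<in> sets (borel :: (real \<times> real) measure)"
        by (auto simp: sets_restrict_space)
      have "(\<lambda>x. (fst x, snd x)) \<in> measurable R (borel \<Otimes>\<^sub>M borel)"
        by (intro measurable_Pair measurable_compose[OF measurable_fst] measurable_compose[OF measurable_snd] Mi_borel) auto
      then have "(\<lambda>x. x) \<in> measurable R borel" by (simp add: borel_prod)
      from measurable_sets[OF this Y(2)] show "X \<in> sets R"
        by (simp add: Y(1) space_pair_measure annulus_def Int_commute)
    qed
  qed
  fix A B assume "A \<in> sets M" "B \<in> sets Mc"
  then have A: "A \<in> sets borel" "A \<subseteq> {-l<..<l}" and B: "B \<in> sets borel" "B \<subseteq> {0<..<2*pi}"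
    by (auto simp: sets_restrict_space)
  have "emeasure (restrict_space ?L (annulus l)) (A \<times> B) = emeasure ?L (A \<times> B)"
    using A B an by (intro emeasure_restrict_space) (auto simp: annulus_def)
  also have "\<dots> = emeasure lborel A * emeasure lborel B"
    using A B lborel.emeasure_pair_measure_Times[of A lborel B] by (simp add: lborel_prod)
  also have "emeasure lborel A = emeasure M A" using A by (subst emeasure_restrict_space) auto
  also have "emeasure lborel B = emeasure Mc B" using B by (subst emeasure_restrict_space) auto
  finally show "emeasure M A * emeasure Mc B = emeasure (restrict_space ?L (annulus l)) (A \<times> B)" by simp
qed

sublocale R: finite_measure R
  by (rule finite_measure_pair_measure) unfold_locales

lemma annulus_sets: "annulus l \<in> sets (lborel :: (real \<times> real) measure)"
  by (auto simp: annulus_def intro!: borel_open open_Times)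

lemma R_integral: "(LINT x:annulus l|lborel. f x) = integral\<^sup>L R (f :: real \<times> real \<Rightarrow> real)"
  unfolding R_eq[symmetric] using annulus_sets by (subst integral_restrict_space) (auto simp: set_lebesgue_integral_def)

lemma R_L2_on: "L2_on (annulus l) f \<longleftrightarrow> L2 R (f :: real \<times> real \<Rightarrow> real)"
  unfolding R_eq[symmetric] L2_on_def L2_def set_borel_measurable_def set_integrable_def using annulus_sets
  by (subst borel_measurable_restrict_space_iff, simp, subst integrable_restrict_space) auto

lemma R_AE: "(AE x in lborel. x \<in> annulus l \<longrightarrow> P x) \<longleftrightarrow> (AE x in R. P x)"
  unfolding R_eq[symmetric] using annulus_sets by (subst AE_restrict_space_iff) auto

lemma R_borel: "f \<in> borel_measurable borel \<Longrightarrow> f \<in> borel_measurable R"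
  unfolding R_eq[symmetric] by (intro measurable_restrict_space1) simp

lemma space_R: "space R = {-l<..<l} \<times> {0<..<2 * pi}"
  by (simp add: space_pair_measure)

lemma R_continuous_L2:
  assumes f: "continuous_on UNIV (f :: real \<times> real \<Rightarrow> real)" shows "L2 R f"
proof -
  have "bounded (f ` ({-l..l} \<times> {0..2*pi}))"
    by (intro compact_imp_bounded compact_continuous_image compact_Times continuous_on_subset[OF f]) auto
  then obtain C where "\<forall>x\<in>{-l..l} \<times> {0..2*pi}. \<bar>f x\<bar> \<le> C" by (auto simp: bounded_iff)
  then show ?thesis
    using f by (intro R.L2_bounded[where C=C] R_borel borel_measurable_continuous_onI) (auto simp: space_R)
qed

lemma section_s: "f \<in> borel_measurable R \<Longrightarrow> s \<in> space M \<Longrightarrow> (\<lambda>\<theta>. f (s, \<theta>)) \<in> borel_measurable Mc"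
  by (rule measurable_Pair2)

lemma section_t: "f \<in> borel_measurable R \<Longrightarrow> \<theta> \<in> space Mc \<Longrightarrow> (\<lambda>s. f (s, \<theta>)) \<in> borel_measurable M"
  by (rule measurable_Pair1)

lemma Fubini_s:
  fixes f :: "real \<times> real \<Rightarrow> real" assumes f: "integrable R f"
  shows "AE s in M. integrable Mc (\<lambda>\<theta>. f (s, \<theta>))" "integrable M (\<lambda>s. \<integral>\<theta>. f (s, \<theta>) \<partial>Mc)"
    "integral\<^sup>L R f = (\<integral>s. (\<integral>\<theta>. f (s, \<theta>) \<partial>Mc) \<partial>M)"
  using Mi2.AE_integrable_fst'[OF f] Mi2.integrable_fst'[OF f] Mi2.integral_fst'[OF f] by auto

lemma Fubini_t:
  fixes f :: "real \<times> real \<Rightarrow> real" assumes f: "integrable R f"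
  shows "AE \<theta> in Mc. integrable M (\<lambda>s. f (s, \<theta>))" "integrable Mc (\<lambda>\<theta>. \<integral>s. f (s, \<theta>) \<partial>M)"
    "integral\<^sup>L R f = (\<integral>\<theta>. (\<integral>s. f (s, \<theta>) \<partial>M) \<partial>Mc)"
proof -
  have f': "integrable R (case_prod (\<lambda>s \<theta>. f (s, \<theta>)))" using f by simp
  show "AE \<theta> in Mc. integrable M (\<lambda>s. f (s, \<theta>))" "integrable Mc (\<lambda>\<theta>. \<integral>s. f (s, \<theta>) \<partial>M)"
    "integral\<^sup>L R f = (\<integral>\<theta>. (\<integral>s. f (s, \<theta>) \<partial>M) \<partial>Mc)"
    using Mi2.AE_integrable_snd[OF f'] Mi2.integrable_snd[OF f'] Mi2.integral_snd[OF f'] by auto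
qed

lemma L2_slice_s: assumes f: "L2 R f" shows "AE s in M. L2 Mc (\<lambda>\<theta>. f (s, \<theta>))"
  using Fubini_s(1)[OF L2_sq[OF f]] AE_space
  by eventually_elim (use section_s[OF L2_measurable[OF f]] in \<open>auto simp: L2_def\<close>)

lemma L2_slice_t: assumes f: "L2 R f" shows "AE \<theta> in Mc. L2 M (\<lambda>s. f (s, \<theta>))"
  using Fubini_t(1)[OF L2_sq[OF f]] AE_space
  by eventually_elim (use section_t[OF L2_measurable[OF f]] in \<open>auto simp: L2_def\<close>)

lemma fst_measurable: "f \<in> borel_measurable M \<Longrightarrow> (\<lambda>x. f (fst x)) \<in> borel_measurable R"
  and snd_measurable: "g \<in> borel_measurable Mc \<Longrightarrow> (\<lambda>x. g (snd x)) \<in> borel_measurable R"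
  by (auto intro: measurable_compose[OF measurable_fst] measurable_compose[OF measurable_snd])

lemma tensor_L2:
  assumes f: "L2 M f" and g: "L2 Mc g" shows "L2 R (\<lambda>x. f (fst x) * g (snd x))"
  unfolding L2_def
proof
  show m: "(\<lambda>x. f (fst x) * g (snd x)) \<in> borel_measurable R"
    by (intro borel_measurable_times fst_measurable snd_measurable L2_measurable f g)
  show "integrable R (\<lambda>x. (f (fst x) * g (snd x))\<^sup>2)"
  proof (rule Mi2.Fubini_integrable)
    show "(\<lambda>x. (f (fst x) * g (snd x))\<^sup>2) \<in> borel_measurable R" using m by simp
    show "integrable M (\<lambda>s. \<integral>\<theta>. norm ((f (fst (s, \<theta>)) * g (snd (s, \<theta>)))\<^sup>2) \<partial>Mc)"
      using L2_sq[OF f] by (simp add: power_mult_distrib)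
    show "AE s in M. integrable Mc (\<lambda>\<theta>. (f (fst (s, \<theta>)) * g (snd (s, \<theta>)))\<^sup>2)"
      using L2_sq[OF g] by (simp add: power_mult_distrib)
  qed
qed

lemma L2_fst_mult:
  assumes "continuous_on {-l..l} g" "L2 R f" shows "L2 R (\<lambda>x. g (fst x) * f x)"
proof -
  obtain C where "\<And>x. x \<in> {-l..l} \<Longrightarrow> \<bar>g x\<bar> \<le> C" using continuous_on_Icc_bounded[OF assms(1)] by blast
  then show ?thesis
    by (intro L2_mult_bounded[where C=C] fst_measurable Mi_continuous_measurable assms) (auto simp: space_R)
qed

lemma L2_trig_mult: "L2 R f \<Longrightarrow> L2 R (\<lambda>x. trig k (snd x) * f x)"
  by (rule L2_mult_bounded[OF _ snd_measurable[OF L2_measurable[OF trig_L2]], where C=1]) (auto intro!: trig_bound)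

lemma AE_R_snd: assumes "AE \<theta> in Mc. Q \<theta>" shows "AE x in R. Q (snd x)"
proof -
  obtain Z where Z: "{\<theta>\<in>space Mc. \<not> Q \<theta>} \<subseteq> Z" "emeasure Mc Z = 0" "Z \<in> sets Mc"
    using assms by (auto elim!: AE_E)
  have "space M \<times> Z \<in> sets R" by (intro pair_measureI sets.top Z(3))
  moreover have "emeasure R (space M \<times> Z) = emeasure M (space M) * emeasure Mc Z"
    by (rule Mi.emeasure_pair_measure_Times[OF sets.top Z(3)])
  then have "emeasure R (space M \<times> Z) = 0" using Z(2) by simp
  moreover have "{x\<in>space R. \<not> Q (snd x)} \<subseteq> space M \<times> Z"
    using Z(1) by (auto simp: space_pair_measure)
  ultimately show ?thesis by (intro AE_I)
qed

lemma AE_R_swap: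
  assumes f: "f \<in> borel_measurable R" and g: "g \<in> borel_measurable R" and eq: "AE x in R. f x = (g x :: real)"
  shows "AE s in M. AE \<theta> in Mc. f (s, \<theta>) = g (s, \<theta>)" "AE \<theta> in Mc. AE s in M. f (s, \<theta>) = g (s, \<theta>)"
proof -
  show 1: "AE s in M. AE \<theta> in Mc. f (s, \<theta>) = g (s, \<theta>)" by (rule Mi2.AE_pair[OF eq])
  have "{x \<in> space R. f (fst x, snd x) = g (fst x, snd x)} \<in> sets R" using f g by simp
  from Mi2.AE_commute[OF this] 1 show "AE \<theta> in Mc. AE s in M. f (s, \<theta>) = g (s, \<theta>)" by simp
qed

lemma AE_R_eqI:
  assumes f: "f \<in> borel_measurable R" and g: "g \<in> borel_measurable R"
    and eq: "AE s in M. AE \<theta> in Mc. f (s, \<theta>) = (g (s, \<theta>) :: real)"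
  shows "AE x in R. f x = g x"
  by (rule Mi2.AE_pair_measure) (use f g eq in auto)

subsection \<open>Fourier coefficients\<close>

text \<open>The \<open>k\<close>-th Fourier coefficient on the circle at \<open>s\<close>, without normalization.\<close>

definition co :: "int \<Rightarrow> (real \<times> real \<Rightarrow> real) \<Rightarrow> real \<Rightarrow> real" where
  "co k u s = (\<integral>\<theta>. u (s, \<theta>) * trig k \<theta> \<partial>Mc)"

lemma co_L2: assumes u: "L2 R u" shows "L2 M (co k u)"
  unfolding L2_def
proof
  have "(\<lambda>x. trig k (snd x) * u x) \<in> borel_measurable R" by (rule L2_measurable[OF L2_trig_mult[OF u]])
  then have "(\<lambda>(s, \<theta>). u (s, \<theta>) * trig k \<theta>) \<in> borel_measurable R" by (simp add: case_prod_beta' mult.commute)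
  then show m: "co k u \<in> borel_measurable M"
    unfolding co_def[abs_def] by (rule Mi.borel_measurable_lebesgue_integral)
  show "integrable M (\<lambda>s. (co k u s)\<^sup>2)"
  proof (rule Bochner_Integration.integrable_bound)
    show "integrable M (\<lambda>s. nrm k * (\<integral>\<theta>. (u (s, \<theta>))\<^sup>2 \<partial>Mc))"
      by (intro integrable_mult_right Fubini_s(2)[OF L2_sq[OF u]])
    show "(\<lambda>s. (co k u s)\<^sup>2) \<in> borel_measurable M" using m by simp
    show "AE s in M. norm ((co k u s)\<^sup>2) \<le> norm (nrm k * (\<integral>\<theta>. (u (s, \<theta>))\<^sup>2 \<partial>Mc))"
      using L2_slice_s[OF u]
    proof eventually_elim
      case (elim s)
      have "(co k u s)\<^sup>2 \<le> (\<integral>\<theta>. (u (s, \<theta>))\<^sup>2 \<partial>Mc) * (\<integral>\<theta>. (trig k \<theta>)\<^sup>2 \<partial>Mc)"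
        unfolding co_def by (rule L2_Cauchy_Schwarz[OF elim trig_L2])
      also have "(\<integral>\<theta>. (trig k \<theta>)\<^sup>2 \<partial>Mc) = nrm k" using trig_orthogonal[of k k] by (simp add: power2_eq_square)
      finally show ?case using nrm_pos[of k] by (simp add: mult.commute)
    qed
  qed
qed

lemma co_integral:
  assumes u: "L2 R u" and f: "L2 M f"
  shows "(\<integral>x. u x * (f (fst x) * trig k (snd x)) \<partial>R) = (\<integral>s. co k u s * f s \<partial>M)"
proof -
  have "(\<integral>x. u x * (f (fst x) * trig k (snd x)) \<partial>R) = (\<integral>s. (\<integral>\<theta>. u (s, \<theta>) * (f s * trig k \<theta>) \<partial>Mc) \<partial>M)"
    using Fubini_s(3)[OF L2_mult_integrable[OF u tensor_L2[OF f trig_L2]]] by simp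
  also have "(\<lambda>s. \<integral>\<theta>. u (s, \<theta>) * (f s * trig k \<theta>) \<partial>Mc) = (\<lambda>s. co k u s * f s)"
    unfolding co_def by (subst mult.left_commute) (simp add: mult.commute)
  finally show ?thesis .
qed

lemma co_diff: "L2 R u \<Longrightarrow> L2 R v \<Longrightarrow> AE s in M. co k (\<lambda>x. u x - v x) s = co k u s - co k v s"
proof -
  assume u: "L2 R u" and v: "L2 R v"
  show ?thesis using L2_slice_s[OF u] L2_slice_s[OF v]
  proof eventually_elim
    case (elim s)
    then show ?case unfolding co_def left_diff_distrib
      by (intro Bochner_Integration.integral_diff L2_mult_integrable trig_L2)
  qed
qed

lemma co_scale: "co k (\<lambda>x. c * u x) s = c * co k u s"
  unfolding co_def by (simp add: mult.assoc)

lemma co_all_zero: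
  assumes u: "L2 R u" and z: "\<And>k. AE s in M. co k u s = 0"
  shows "AE x in R. u x = 0"
proof (rule AE_R_eqI)
  have "AE s in M. \<forall>k. co k u s = 0" using z by (simp add: AE_all_countable)
  then show "AE s in M. AE \<theta> in Mc. u (s, \<theta>) = 0"
    using L2_slice_s[OF u]
  proof eventually_elim
    case (elim s)
    then show ?case by (intro Fourier_unique Mi.L2_integrable) (auto simp: co_def)
  qed
qed (use u in \<open>auto intro: L2_measurable\<close>)

subsection \<open>Weak gradient and trace\<close>

text \<open>\<open>G u us ut \<tau>\<close>: the function \<open>u\<close> of class \<open>H\<^sup>1\<close> has weak gradient \<open>(us, ut)\<close> and trace \<open>\<tau>\<close>. The
  chosen representatives in the definition of the index form satisfy this; carrying the data along
  instead makes the predicate linear.\<close>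

definition G :: "(real \<times> real \<Rightarrow> real) \<Rightarrow> (real \<times> real \<Rightarrow> real) \<Rightarrow> (real \<times> real \<Rightarrow> real) \<Rightarrow> (real \<times> real \<Rightarrow> real) \<Rightarrow> bool" where
  "G u us ut \<tau> \<longleftrightarrow> L2 R u \<and> weak_grad l u us ut \<and> L2 Mc (\<lambda>\<theta>. \<tau> (l, \<theta>)) \<and> L2 Mc (\<lambda>\<theta>. \<tau> (- l, \<theta>)) \<and>
     (\<forall>\<psi> \<psi>s \<psi>t. C1_periodic \<psi> \<psi>s \<psi>t \<longrightarrow> (\<integral>x. u x * \<psi>s x + us x * \<psi> x \<partial>R) =
       (\<integral>\<theta>. \<tau> (l, \<theta>) * \<psi> (l, \<theta>) \<partial>Mc) - (\<integral>\<theta>. \<tau> (- l, \<theta>) * \<psi> (- l, \<theta>) \<partial>Mc))"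

lemma weak_grad_L2: "weak_grad l u us ut \<Longrightarrow> L2 R us \<and> L2 R ut"
  by (simp add: weak_grad_def R_L2_on)

lemma weak_grad_R:
  assumes "weak_grad l u us ut" "C1_periodic \<psi> \<psi>s \<psi>t" "\<rho> < l" "\<And>s \<theta>. \<rho> \<le> \<bar>s\<bar> \<Longrightarrow> \<psi> (s, \<theta>) = 0"
  shows "(\<integral>x. u x * \<psi>s x \<partial>R) = - (\<integral>x. us x * \<psi> x \<partial>R)" "(\<integral>x. u x * \<psi>t x \<partial>R) = - (\<integral>x. ut x * \<psi> x \<partial>R)"
  using assms unfolding weak_grad_def R_integral by blast+

lemma C1_test_product:
  assumes "C1_test l \<psi> \<psi>'"
  shows "C1_periodic (\<lambda>x. \<psi> (fst x) * trig k (snd x)) (\<lambda>x. \<psi>' (fst x) * trig k (snd x))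
    (\<lambda>x. \<psi> (fst x) * (- real_of_int k * trig (- k) (snd x)))"
    "\<exists>\<rho><l. \<forall>s \<theta>. \<rho> \<le> \<bar>s\<bar> \<longrightarrow> \<psi> (fst (s, \<theta>)) * trig k (snd (s, \<theta>)) = 0"
proof -
  show "C1_periodic (\<lambda>x. \<psi> (fst x) * trig k (snd x)) (\<lambda>x. \<psi>' (fst x) * trig k (snd x))
    (\<lambda>x. \<psi> (fst x) * (- real_of_int k * trig (- k) (snd x)))"
    using assms by (intro C1_periodic_product) (auto simp: C1_test_def)
  show "\<exists>\<rho><l. \<forall>s \<theta>. \<rho> \<le> \<bar>s\<bar> \<longrightarrow> \<psi> (fst (s, \<theta>)) * trig k (snd (s, \<theta>)) = 0"
    using assms unfolding C1_test_def by force
qed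

text \<open>Test functions \<open>\<psi>(s) trig k \<theta>\<close> turn the weak gradient into weak derivatives of the Fourier coefficients
  in \<open>s\<close> and into multiplication by \<open>k\<close>.\<close>

lemma weak_grad_co:
  assumes u: "L2 R u" and w: "weak_grad l u us ut"
  shows "C1_test l \<psi> \<psi>' \<Longrightarrow> (\<integral>s. co k u s * \<psi>' s \<partial>M) = - (\<integral>s. co k us s * \<psi> s \<partial>M)"
    and "AE s in M. co k ut s = real_of_int k * co (- k) u s"
proof -
  note us = conjunct1[OF weak_grad_L2[OF w]] and ut = conjunct2[OF weak_grad_L2[OF w]]
  have 1: "(\<integral>s. co k u s * \<psi>' s \<partial>M) = - (\<integral>s. co k us s * \<psi> s \<partial>M)"
    "- real_of_int k * (\<integral>s. co (- k) u s * \<psi> s \<partial>M) = - (\<integral>s. co k ut s * \<psi> s \<partial>M)"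
    if \<psi>: "C1_test l \<psi> \<psi>'" for \<psi> \<psi>'
  proof -
    obtain \<rho> where \<rho>: "\<rho> < l" "\<And>s \<theta>. \<rho> \<le> \<bar>s\<bar> \<Longrightarrow> \<psi> (fst (s, \<theta>)) * trig k (snd (s, \<theta>)) = 0"
      using C1_test_product(2)[OF \<psi>] by blast
    note wg = weak_grad_R[OF w C1_test_product(1)[OF \<psi>, of k] \<rho>]
    have L: "L2 M \<psi>" "L2 M \<psi>'" using C1_test_continuous[OF \<psi>] by (auto intro: Mi_continuous_L2)
    show "(\<integral>s. co k u s * \<psi>' s \<partial>M) = - (\<integral>s. co k us s * \<psi> s \<partial>M)"
      using wg(1) by (simp add: co_integral[OF u L(2)] co_integral[OF us L(1)])
    have "(\<integral>x. u x * (\<psi> (fst x) * (- real_of_int k * trig (- k) (snd x))) \<partial>R)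
      = - real_of_int k * (\<integral>s. co (- k) u s * \<psi> s \<partial>M)"
      unfolding co_integral[OF u L(1), symmetric] Bochner_Integration.integral_mult_right_zero[symmetric]
      by (simp only: mult_ac)
    then show "- real_of_int k * (\<integral>s. co (- k) u s * \<psi> s \<partial>M) = - (\<integral>s. co k ut s * \<psi> s \<partial>M)"
      using wg(2) by (simp add: co_integral[OF ut L(1)])
  qed
  show "C1_test l \<psi> \<psi>' \<Longrightarrow> (\<integral>s. co k u s * \<psi>' s \<partial>M) = - (\<integral>s. co k us s * \<psi> s \<partial>M)" by (rule 1(1))
  have "AE s in M. co k ut s - real_of_int k * co (- k) u s = 0"
  proof (rule weak_zero[OF l])
    have L: "L2 M (co k ut)" "L2 M (\<lambda>s. real_of_int k * co (- k) u s)" by (intro co_L2 L2_scale u ut)+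
    then show "integrable M (\<lambda>s. co k ut s - real_of_int k * co (- k) u s)" by (intro Mi.L2_integrable L2_diff)
    fix \<psi> \<psi>' assume \<psi>: "C1_test l \<psi> \<psi>'"
    have "L2 M \<psi>" using C1_test_continuous[OF \<psi>] by (auto intro: Mi_continuous_L2)
    then have "(\<integral>s. (co k ut s - real_of_int k * co (- k) u s) * \<psi> s \<partial>M)
      = (\<integral>s. co k ut s * \<psi> s \<partial>M) - (\<integral>s. real_of_int k * co (- k) u s * \<psi> s \<partial>M)"
      unfolding left_diff_distrib by (intro Bochner_Integration.integral_diff L2_mult_integrable L)
    then show "(\<integral>s. (co k ut s - real_of_int k * co (- k) u s) * \<psi> s \<partial>M) = 0"
      using 1(2)[OF \<psi>] by (simp add: mult.assoc)
  qed
  then show "AE s in M. co k ut s = real_of_int k * co (- k) u s" by eventually_elim simp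
qed

lemma weak_grad_unique:
  assumes w: "weak_grad l u us ut" and w': "weak_grad l u us' ut'"
  shows "AE x in R. us x = us' x" "AE x in R. ut x = ut' x"
proof -
  have *: "AE x in R. v x = v' x"
    if v: "L2 R v" "L2 R v'" and eq: "\<And>\<psi> \<psi>' k. C1_test l \<psi> \<psi>' \<Longrightarrow>
      (\<integral>x. v x * (\<psi> (fst x) * trig k (snd x)) \<partial>R) = (\<integral>x. v' x * (\<psi> (fst x) * trig k (snd x)) \<partial>R)" for v v'
  proof -
    have d: "L2 R (\<lambda>x. v x - v' x)" by (intro L2_diff v)
    have "AE x in R. v x - v' x = 0"
    proof (rule co_all_zero[OF d])
      fix k show "AE s in M. co k (\<lambda>x. v x - v' x) s = 0"
      proof (rule weak_zero[OF l Mi.L2_integrable[OF co_L2[OF d]]])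
        fix \<psi> \<psi>' assume \<psi>: "C1_test l \<psi> \<psi>'"
        have L: "L2 M \<psi>" using C1_test_continuous[OF \<psi>] by (auto intro: Mi_continuous_L2)
        have "(\<integral>s. co k (\<lambda>x. v x - v' x) s * \<psi> s \<partial>M) = (\<integral>x. (v x - v' x) * (\<psi> (fst x) * trig k (snd x)) \<partial>R)"
          by (rule co_integral[OF d L, symmetric])
        also have "\<dots> = (\<integral>x. v x * (\<psi> (fst x) * trig k (snd x)) \<partial>R) - (\<integral>x. v' x * (\<psi> (fst x) * trig k (snd x)) \<partial>R)"
          unfolding left_diff_distrib by (intro Bochner_Integration.integral_diff L2_mult_integrable v tensor_L2 L trig_L2)
        finally show "(\<integral>s. co k (\<lambda>x. v x - v' x) s * \<psi> s \<partial>M) = 0" using eq[OF \<psi>] by simp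
      qed
    qed
    then show ?thesis by eventually_elim simp
  qed
  have wg: "(\<integral>x. us x * (\<psi> (fst x) * trig k (snd x)) \<partial>R) = (\<integral>x. us' x * (\<psi> (fst x) * trig k (snd x)) \<partial>R)"
    "(\<integral>x. ut x * (\<psi> (fst x) * trig k (snd x)) \<partial>R) = (\<integral>x. ut' x * (\<psi> (fst x) * trig k (snd x)) \<partial>R)"
    if \<psi>: "C1_test l \<psi> \<psi>'" for \<psi> \<psi>' k
  proof -
    obtain \<rho> where \<rho>: "\<rho> < l" "\<And>s \<theta>. \<rho> \<le> \<bar>s\<bar> \<Longrightarrow> \<psi> (fst (s, \<theta>)) * trig k (snd (s, \<theta>)) = 0"
      using C1_test_product(2)[OF \<psi>] by blast
    show "(\<integral>x. us x * (\<psi> (fst x) * trig k (snd x)) \<partial>R) = (\<integral>x. us' x * (\<psi> (fst x) * trig k (snd x)) \<partial>R)"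
      "(\<integral>x. ut x * (\<psi> (fst x) * trig k (snd x)) \<partial>R) = (\<integral>x. ut' x * (\<psi> (fst x) * trig k (snd x)) \<partial>R)"
      using weak_grad_R[OF w C1_test_product(1)[OF \<psi>, of k] \<rho>] weak_grad_R[OF w' C1_test_product(1)[OF \<psi>, of k] \<rho>] by linarith+
  qed
  show "AE x in R. us x = us' x" "AE x in R. ut x = ut' x"
    using weak_grad_L2[OF w] weak_grad_L2[OF w'] by (auto intro!: * wg)
qed

lemma G_Green':
  "G u us ut \<tau> \<Longrightarrow> C1_periodic \<psi> \<psi>s \<psi>t \<Longrightarrow> (\<integral>x. u x * \<psi>s x + us x * \<psi> x \<partial>R) =
       (\<integral>\<theta>. \<tau> (l, \<theta>) * \<psi> (l, \<theta>) \<partial>Mc) - (\<integral>\<theta>. \<tau> (- l, \<theta>) * \<psi> (- l, \<theta>) \<partial>Mc)"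
  unfolding G_def by blast

text \<open>The test functions \<open>(s \<plusminus> l) trig k \<theta>\<close> vanish on one boundary circle and give the Fourier coefficients of
  the trace on the other.\<close>

lemma trace_unique:
  assumes g: "G u us ut \<tau>" and g': "G u us' ut' \<tau>'"
  shows "AE \<theta> in Mc. \<tau> (l, \<theta>) = \<tau>' (l, \<theta>)" "AE \<theta> in Mc. \<tau> (-l, \<theta>) = \<tau>' (-l, \<theta>)"
proof -
  note us = conjunct1[OF weak_grad_L2] and u = g[unfolded G_def, THEN conjunct1]
  have w: "weak_grad l u us ut" "weak_grad l u us' ut'" using g g' by (auto simp: G_def)
  have tL: "L2 Mc (\<lambda>\<theta>. \<tau> (l, \<theta>))" "L2 Mc (\<lambda>\<theta>. \<tau> (-l, \<theta>))" "L2 Mc (\<lambda>\<theta>. \<tau>' (l, \<theta>))" "L2 Mc (\<lambda>\<theta>. \<tau>' (-l, \<theta>))"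
    using g g' by (auto simp: G_def)
  have eq: "(\<integral>\<theta>. \<tau> (l, \<theta>) * \<psi> (l, \<theta>) \<partial>Mc) - (\<integral>\<theta>. \<tau> (- l, \<theta>) * \<psi> (- l, \<theta>) \<partial>Mc)
      = (\<integral>\<theta>. \<tau>' (l, \<theta>) * \<psi> (l, \<theta>) \<partial>Mc) - (\<integral>\<theta>. \<tau>' (- l, \<theta>) * \<psi> (- l, \<theta>) \<partial>Mc)"
    if \<psi>: "C1_periodic \<psi> \<psi>s \<psi>t" for \<psi> \<psi>s \<psi>t
  proof -
    have L: "L2 R \<psi>" "L2 R \<psi>s" using C1_periodic_continuous[OF \<psi>] by (auto intro: R_continuous_L2)
    have "(\<integral>x. u x * \<psi>s x + us x * \<psi> x \<partial>R) = (\<integral>x. u x * \<psi>s x + us' x * \<psi> x \<partial>R)"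
    proof (rule integral_cong_AE)
      show "AE x in R. u x * \<psi>s x + us x * \<psi> x = u x * \<psi>s x + us' x * \<psi> x"
        using weak_grad_unique(1)[OF w] by eventually_elim simp
    qed (use L u us[OF w(1)] us[OF w(2)] in \<open>auto intro!: L2_measurable borel_measurable_add borel_measurable_times\<close>)
    then show ?thesis using G_Green'[OF g \<psi>] G_Green'[OF g' \<psi>] by linarith
  qed
  have z: "AE \<theta> in Mc. f \<theta> = g \<theta>" if "L2 Mc f" "L2 Mc g"
    and fg: "\<And>k. (\<integral>\<theta>. f \<theta> * trig k \<theta> \<partial>Mc) = (\<integral>\<theta>. g \<theta> * trig k \<theta> \<partial>Mc)" for f g
  proof -
    have "AE \<theta> in Mc. f \<theta> - g \<theta> = 0"
    proof (rule Fourier_unique[OF Mi.L2_integrable[OF L2_diff[OF that(1,2)]]])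
      fix k show "(\<integral>\<theta>. (f \<theta> - g \<theta>) * trig k \<theta> \<partial>Mc) = 0"
        unfolding left_diff_distrib using fg[of k] that(1,2)
        by (subst Bochner_Integration.integral_diff) (auto intro!: L2_mult_integrable trig_L2)
    qed
    then show ?thesis by eventually_elim simp
  qed
  have p: "C1_periodic (\<lambda>x. (fst x + c) * trig k (snd x)) (\<lambda>x. 1 * trig k (snd x))
      (\<lambda>x. (fst x + c) * (- real_of_int k * trig (- k) (snd x)))" for c k
    by (rule C1_periodic_product) (auto intro!: derivative_eq_intros)
  show "AE \<theta> in Mc. \<tau> (l, \<theta>) = \<tau>' (l, \<theta>)"
  proof (rule z[OF tL(1,3)])
    fix k
    have f: "(\<integral>\<theta>. f \<theta> * ((l + l) * trig k \<theta>) \<partial>Mc) = (l + l) * (\<integral>\<theta>. f \<theta> * trig k \<theta> \<partial>Mc)" for f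
      by (simp only: mult.left_commute[of _ "l + l"] Bochner_Integration.integral_mult_right_zero)
    from eq[OF p[of l k]] show "(\<integral>\<theta>. \<tau> (l, \<theta>) * trig k \<theta> \<partial>Mc) = (\<integral>\<theta>. \<tau>' (l, \<theta>) * trig k \<theta> \<partial>Mc)"
      unfolding fst_conv snd_conv f using l by simp
  qed
  show "AE \<theta> in Mc. \<tau> (-l, \<theta>) = \<tau>' (-l, \<theta>)"
  proof (rule z[OF tL(2,4)])
    fix k
    have f: "(\<integral>\<theta>. f \<theta> * ((- l + - l) * trig k \<theta>) \<partial>Mc) = (- l + - l) * (\<integral>\<theta>. f \<theta> * trig k \<theta> \<partial>Mc)" for f
      by (simp only: mult.left_commute[of _ "- l + - l"] Bochner_Integration.integral_mult_right_zero)
    from eq[OF p[of "-l" k]] show "(\<integral>\<theta>. \<tau> (-l, \<theta>) * trig k \<theta> \<partial>Mc) = (\<integral>\<theta>. \<tau>' (-l, \<theta>) * trig k \<theta> \<partial>Mc)"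
      unfolding fst_conv snd_conv f using l by simp
  qed
qed

lemma G_L2:
  assumes "G u us ut \<tau>"
  shows "L2 R u" "L2 R us" "L2 R ut" "L2 Mc (\<lambda>\<theta>. \<tau> (l, \<theta>))" "L2 Mc (\<lambda>\<theta>. \<tau> (- l, \<theta>))" "weak_grad l u us ut"
  using assms weak_grad_L2 by (auto simp: G_def)

lemma G_Green:
  assumes "G u us ut \<tau>" "C1_periodic \<psi> \<psi>s \<psi>t"
  shows "(\<integral>x. u x * \<psi>s x \<partial>R) + (\<integral>x. us x * \<psi> x \<partial>R) =
    (\<integral>\<theta>. \<tau> (l, \<theta>) * \<psi> (l, \<theta>) \<partial>Mc) - (\<integral>\<theta>. \<tau> (- l, \<theta>) * \<psi> (- l, \<theta>) \<partial>Mc)"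
proof -
  have L: "L2 R \<psi>" "L2 R \<psi>s" using C1_periodic_continuous[OF assms(2)] by (auto intro: R_continuous_L2)
  have "(\<integral>x. u x * \<psi>s x + us x * \<psi> x \<partial>R) = (\<integral>x. u x * \<psi>s x \<partial>R) + (\<integral>x. us x * \<psi> x \<partial>R)"
    by (intro Bochner_Integration.integral_add L2_mult_integrable G_L2[OF assms(1)] L)
  then show ?thesis using G_Green'[OF assms] by linarith
qed

lemma GI:
  assumes L: "L2 R u" "L2 R us" "L2 R ut" "L2 Mc (\<lambda>\<theta>. \<tau> (l, \<theta>))" "L2 Mc (\<lambda>\<theta>. \<tau> (- l, \<theta>))"
    and s: "\<And>\<psi> \<psi>s \<psi>t. C1_periodic \<psi> \<psi>s \<psi>t \<Longrightarrow> (\<integral>x. u x * \<psi>s x \<partial>R) + (\<integral>x. us x * \<psi> x \<partial>R) =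
      (\<integral>\<theta>. \<tau> (l, \<theta>) * \<psi> (l, \<theta>) \<partial>Mc) - (\<integral>\<theta>. \<tau> (- l, \<theta>) * \<psi> (- l, \<theta>) \<partial>Mc)"
    and t: "\<And>\<psi> \<psi>s \<psi>t. C1_periodic \<psi> \<psi>s \<psi>t \<Longrightarrow> \<exists>\<rho><l. \<forall>s \<theta>. \<rho> \<le> \<bar>s\<bar> \<longrightarrow> \<psi> (s, \<theta>) = 0 \<Longrightarrow>
      (\<integral>x. u x * \<psi>t x \<partial>R) = - (\<integral>x. ut x * \<psi> x \<partial>R)"
  shows "G u us ut \<tau>"
  unfolding G_def
proof (intro conjI allI impI L)
  show "weak_grad l u us ut"
    unfolding weak_grad_def R_L2_on R_integral
  proof (intro conjI allI impI L)
    fix \<psi> \<psi>s \<psi>t assume \<psi>: "C1_periodic \<psi> \<psi>s \<psi>t \<and> (\<exists>\<rho><l. \<forall>s \<theta>. \<rho> \<le> \<bar>s\<bar> \<longrightarrow> \<psi> (s, \<theta>) = 0)"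
    then obtain \<rho> where \<rho>: "\<rho> < l" "\<And>s \<theta>. \<rho> \<le> \<bar>s\<bar> \<Longrightarrow> \<psi> (s, \<theta>) = 0" by blast
    have "\<psi> (l, \<theta>) = 0" "\<psi> (-l, \<theta>) = 0" for \<theta> using \<rho> l by auto
    then show "(\<integral>x. u x * \<psi>s x \<partial>R) = - (\<integral>x. us x * \<psi> x \<partial>R)" using s[of \<psi> \<psi>s \<psi>t] \<psi> by simp
    show "(\<integral>x. u x * \<psi>t x \<partial>R) = - (\<integral>x. ut x * \<psi> x \<partial>R)" using t \<psi> by blast
  qed
  fix \<psi> \<psi>s \<psi>t assume \<psi>: "C1_periodic \<psi> \<psi>s \<psi>t"
  have L': "L2 R \<psi>" "L2 R \<psi>s" using C1_periodic_continuous[OF \<psi>] by (auto intro: R_continuous_L2)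
  have "(\<integral>x. u x * \<psi>s x + us x * \<psi> x \<partial>R) = (\<integral>x. u x * \<psi>s x \<partial>R) + (\<integral>x. us x * \<psi> x \<partial>R)"
    by (intro Bochner_Integration.integral_add L2_mult_integrable L L')
  then show "(\<integral>x. u x * \<psi>s x + us x * \<psi> x \<partial>R) =
      (\<integral>\<theta>. \<tau> (l, \<theta>) * \<psi> (l, \<theta>) \<partial>Mc) - (\<integral>\<theta>. \<tau> (- l, \<theta>) * \<psi> (- l, \<theta>) \<partial>Mc)" using s[OF \<psi>] by simp
qed

lemma G_weak_t:
  assumes "G u us ut \<tau>" "C1_periodic \<psi> \<psi>s \<psi>t" "\<exists>\<rho><l. \<forall>s \<theta>. \<rho> \<le> \<bar>s\<bar> \<longrightarrow> \<psi> (s, \<theta>) = 0"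
  shows "(\<integral>x. u x * \<psi>t x \<partial>R) = - (\<integral>x. ut x * \<psi> x \<partial>R)"
  using assms(3) weak_grad_R(2)[OF G_L2(6)[OF assms(1)] assms(2)] by blast

lemma periodic_L2_end: "C1_periodic \<psi> \<psi>s \<psi>t \<Longrightarrow> L2 Mc (\<lambda>\<theta>. \<psi> (s, \<theta>))"
  using DERIV_isCont[OF C1_periodic_partial(2)] by (intro Mi_continuous_L2 continuous_at_imp_continuous_on) auto

lemma G_lin:
  assumes g: "G u us ut \<tau>" and h: "G v vs vt \<sigma>"
  shows "G (\<lambda>x. c * u x + d * v x) (\<lambda>x. c * us x + d * vs x) (\<lambda>x. c * ut x + d * vt x) (\<lambda>x. c * \<tau> x + d * \<sigma> x)"
proof -
  have lin: "(\<integral>x. (c * f x + d * f' x) * q x \<partial>m) = c * (\<integral>x. f x * q x \<partial>m) + d * (\<integral>x. f' x * q x \<partial>m)"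
    if "L2 m f" "L2 m f'" "L2 m q" for m :: "'z measure" and f f' q
  proof -
    have "(\<integral>x. (c * f x + d * f' x) * q x \<partial>m) = (\<integral>x. c * (f x * q x) + d * (f' x * q x) \<partial>m)"
      by (intro Bochner_Integration.integral_cong refl) (simp add: algebra_simps)
    then show ?thesis using L2_mult_integrable[OF that(1,3)] L2_mult_integrable[OF that(2,3)] by simp
  qed
  show ?thesis
  proof (rule GI)
    fix \<psi> \<psi>s \<psi>t assume \<psi>: "C1_periodic \<psi> \<psi>s \<psi>t"
    have L: "L2 R \<psi>" "L2 R \<psi>s" "L2 R \<psi>t" using C1_periodic_continuous[OF \<psi>] by (auto intro: R_continuous_L2)
    show "(\<integral>x. (c * u x + d * v x) * \<psi>s x \<partial>R) + (\<integral>x. (c * us x + d * vs x) * \<psi> x \<partial>R) =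
      (\<integral>\<theta>. (c * \<tau> (l, \<theta>) + d * \<sigma> (l, \<theta>)) * \<psi> (l, \<theta>) \<partial>Mc) - (\<integral>\<theta>. (c * \<tau> (- l, \<theta>) + d * \<sigma> (- l, \<theta>)) * \<psi> (- l, \<theta>) \<partial>Mc)"
      unfolding lin[OF G_L2(1)[OF g] G_L2(1)[OF h] L(2)] lin[OF G_L2(2)[OF g] G_L2(2)[OF h] L(1)]
        lin[OF G_L2(4)[OF g] G_L2(4)[OF h] periodic_L2_end[OF \<psi>]] lin[OF G_L2(5)[OF g] G_L2(5)[OF h] periodic_L2_end[OF \<psi>]]
      using arg_cong[OF G_Green[OF g \<psi>], of "\<lambda>z. c * z"] arg_cong[OF G_Green[OF h \<psi>], of "\<lambda>z. d * z"]
      by (simp add: algebra_simps)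
    assume \<rho>: "\<exists>\<rho><l. \<forall>s \<theta>. \<rho> \<le> \<bar>s\<bar> \<longrightarrow> \<psi> (s, \<theta>) = 0"
    show "(\<integral>x. (c * u x + d * v x) * \<psi>t x \<partial>R) = - (\<integral>x. (c * ut x + d * vt x) * \<psi> x \<partial>R)"
      unfolding lin[OF G_L2(1)[OF g] G_L2(1)[OF h] L(3)] lin[OF G_L2(3)[OF g] G_L2(3)[OF h] L(1)]
      using G_weak_t[OF g \<psi> \<rho>] G_weak_t[OF h \<psi> \<rho>] by simp
  qed (intro L2_add L2_scale G_L2[OF g] G_L2[OF h])+
qed

subsection \<open>Slices\<close>

definition pr :: "(real \<times> real \<Rightarrow> real) \<Rightarrow> real \<times> real \<Rightarrow> real" where
  "pr us x = prim (-l) l (\<lambda>t. us (t, snd x)) (fst x)"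

lemma M_AE_ex: assumes "AE s in M. Q s" shows "\<exists>s. Q s"
proof -
  have "0 \<in> closure {s \<in> {-l<..<l}. Q s}" by (rule Mi_AE_closure[OF assms]) (use l in auto)
  then have "{s \<in> {-l<..<l}. Q s} \<noteq> {}" by (metis closure_empty empty_iff)
  then show ?thesis by blast
qed

lemma integrable_snd: "integrable Mc g \<Longrightarrow> integrable R (\<lambda>x. g (snd x) :: real)"
  by (rule Mi2.Fubini_integrable) (auto intro: snd_measurable)

lemma prim_sq: assumes "L2 M f" "s \<in> {-l..l}" shows "(prim (-l) l f s)\<^sup>2 \<le> 2 * l * (\<integral>t. (f t)\<^sup>2 \<partial>M)"
proof -
  have "(prim (-l) l f s - prim (-l) l f (-l))\<^sup>2 \<le> \<bar>s - (-l)\<bar> * (\<integral>t. (f t)\<^sup>2 \<partial>M)"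
    by (rule ac_Hoelder[OF ac_prim[OF Mi.L2_integrable[OF assms(1)]] assms]) (use l in auto)
  also have "\<dots> \<le> 2 * l * (\<integral>t. (f t)\<^sup>2 \<partial>M)" using assms(2) by (intro mult_right_mono) auto
  finally show ?thesis by (simp add: prim_left)
qed

lemma pr_L2: assumes us: "L2 R us" shows "L2 R (pr us)"
  unfolding L2_def
proof
  note [measurable] = L2_measurable[OF us]
  have m1: "(\<lambda>p. (snd p, snd (fst p))) \<in> measurable (R \<Otimes>\<^sub>M M) R" by measurable
  have [measurable]: "(\<lambda>p. us (snd p, snd (fst p))) \<in> borel_measurable (R \<Otimes>\<^sub>M M)"
    by (rule measurable_compose[OF m1]) simp
  have [measurable]: "(\<lambda>p. fst (fst p)) \<in> borel_measurable (R \<Otimes>\<^sub>M M)" "(\<lambda>p. snd p) \<in> borel_measurable (R \<Otimes>\<^sub>M M)"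
    by (intro measurable_compose[OF measurable_fst fst_measurable] measurable_compose[OF measurable_snd] Mi_borel; simp)+
  have "(\<lambda>x. \<integral>t. (if t < fst x then 1 else 0) * us (t, snd x) \<partial>M) \<in> borel_measurable R"
    by (rule Mi.borel_measurable_lebesgue_integral) (simp add: case_prod_beta')
  moreover have "pr us = (\<lambda>x. \<integral>t. (if t < fst x then 1 else 0) * us (t, snd x) \<partial>M)"
    unfolding pr_def prim_def by (intro ext Bochner_Integration.integral_cong) (auto simp: indicator_def)
  ultimately show m: "pr us \<in> borel_measurable R" by simp
  show "integrable R (\<lambda>x. (pr us x)\<^sup>2)"
  proof (rule Bochner_Integration.integrable_bound)
    show "integrable R (\<lambda>x. 2 * l * (\<integral>t. (us (t, snd x))\<^sup>2 \<partial>M))"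
      by (intro integrable_mult_right integrable_snd Fubini_t(2) L2_sq us)
    show "(\<lambda>x. (pr us x)\<^sup>2) \<in> borel_measurable R" using m by simp
    show "AE x in R. norm ((pr us x)\<^sup>2) \<le> norm (2 * l * (\<integral>t. (us (t, snd x))\<^sup>2 \<partial>M))"
      using AE_R_snd[OF L2_slice_t[OF us]] AE_space
      by eventually_elim (use l prim_sq in \<open>auto simp: pr_def space_R intro: order_trans[OF _ abs_ge_self]\<close>)
  qed
qed

lemma co_pr: assumes us: "L2 R us" shows "co k (pr us) s = prim (-l) l (co k us) s"
proof -
  have iL: "L2 M (indicator {..<s})"
    by (rule Mi.L2_bounded[where C=1]) (auto intro: Mi_borel simp: indicator_def)
  have "co k (pr us) s = (\<integral>\<theta>. (\<integral>t. us (t, \<theta>) * (indicator {..<s} t * trig k \<theta>) \<partial>M) \<partial>Mc)"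
    unfolding co_def pr_def prim_def fst_conv snd_conv Bochner_Integration.integral_mult_left_zero[symmetric]
    by (intro Bochner_Integration.integral_cong refl) (simp add: mult_ac)
  also have "\<dots> = (\<integral>x. us x * (indicator {..<s} (fst x) * trig k (snd x)) \<partial>R)"
    using Fubini_t(3)[OF L2_mult_integrable[OF us tensor_L2[OF iL trig_L2]]] by simp
  also have "\<dots> = (\<integral>t. co k us t * indicator {..<s} t \<partial>M)" by (rule co_integral[OF us iL])
  finally show ?thesis by (simp add: prim_def mult.commute)
qed

text \<open>After subtraction of the primitive of \<open>us\<close>, all Fourier coefficients of \<open>u(s, \<cdot>)\<close> are
  independent of \<open>s\<close>; hence so is the function itself.\<close>

lemma slice_representation:
  assumes u: "L2 R u" and w: "weak_grad l u us ut"
  obtains c where "L2 Mc c" "AE x in R. u x = c (snd x) + pr us x"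
proof -
  note us = conjunct1[OF weak_grad_L2[OF w]]
  define f where "f x = u x - pr us x" for x
  have f: "L2 R f" unfolding f_def by (intro L2_diff u pr_L2 us)
  have "\<exists>d. AE s in M. co k f s = d" for k
  proof -
    obtain d where "AE s in M. co k u s = d + prim (-l) l (co k us) s"
      by (rule weak_primitive[OF l Mi.L2_integrable[OF co_L2[OF u]] Mi.L2_integrable[OF co_L2[OF us]]])
        (rule weak_grad_co(1)[OF u w])
    moreover have "AE s in M. co k f s = co k u s - co k (pr us) s"
      unfolding f_def by (rule co_diff[OF u pr_L2[OF us]])
    ultimately have "AE s in M. co k f s = d" by eventually_elim (simp add: co_pr[OF us])
    then show ?thesis by blast
  qed
  then obtain d where "\<And>k. AE s in M. co k f s = d k" by metis
  then have d: "AE s in M. \<forall>k. co k f s = d k" by (simp add: AE_all_countable)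
  obtain s0 where s0: "\<forall>k. co k f s0 = d k" "L2 Mc (\<lambda>\<theta>. f (s0, \<theta>))"
    using M_AE_ex[OF eventually_conj[OF d L2_slice_s[OF f]]] by blast
  define c where "c \<theta> = f (s0, \<theta>)" for \<theta>
  have c: "L2 Mc c" using s0(2) by (simp add: c_def[abs_def])
  have "AE x in R. f x = c (snd x)"
  proof (rule AE_R_eqI)
    show "AE s in M. AE \<theta> in Mc. f (s, \<theta>) = c (snd (s, \<theta>))"
      using d L2_slice_s[OF f]
    proof eventually_elim
      case (elim s)
      have "AE \<theta> in Mc. f (s, \<theta>) - c \<theta> = 0"
      proof (rule Fourier_unique[OF Mi.L2_integrable[OF L2_diff[OF elim(2) c]]])
        fix k
        have "(\<integral>\<theta>. (f (s, \<theta>) - c \<theta>) * trig k \<theta> \<partial>Mc) = co k f s - co k f s0"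
          unfolding left_diff_distrib co_def c_def[symmetric]
          by (intro Bochner_Integration.integral_diff L2_mult_integrable trig_L2 elim(2) c)
        then show "(\<integral>\<theta>. (f (s, \<theta>) - c \<theta>) * trig k \<theta> \<partial>Mc) = 0" using elim(1) s0(1) by simp
      qed
      then show ?case by eventually_elim simp
    qed
  qed (use f c in \<open>auto intro: L2_measurable snd_measurable\<close>)
  then have "AE x in R. u x = c (snd x) + pr us x" by eventually_elim (simp add: f_def)
  then show ?thesis using that c by blast
qed

lemma int_slice_L2: assumes us: "L2 R us" shows "L2 Mc (\<lambda>\<theta>. \<integral>t. us (t, \<theta>) \<partial>M)"
  unfolding L2_def
proof
  show m: "(\<lambda>\<theta>. \<integral>t. us (t, \<theta>) \<partial>M) \<in> borel_measurable Mc"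
    by (rule borel_measurable_integrable[OF Fubini_t(2)[OF R.L2_integrable[OF us]]])
  show "integrable Mc (\<lambda>\<theta>. (\<integral>t. us (t, \<theta>) \<partial>M)\<^sup>2)"
  proof (rule Bochner_Integration.integrable_bound)
    show "integrable Mc (\<lambda>\<theta>. 2 * l * (\<integral>t. (us (t, \<theta>))\<^sup>2 \<partial>M))"
      by (intro integrable_mult_right Fubini_t(2) L2_sq us)
    show "(\<lambda>\<theta>. (\<integral>t. us (t, \<theta>) \<partial>M)\<^sup>2) \<in> borel_measurable Mc" using m by simp
    show "AE \<theta> in Mc. norm ((\<integral>t. us (t, \<theta>) \<partial>M)\<^sup>2) \<le> norm (2 * l * (\<integral>t. (us (t, \<theta>))\<^sup>2 \<partial>M))"
      using L2_slice_t[OF us]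
    proof eventually_elim
      case (elim \<theta>)
      from prim_sq[OF this, of l] l show ?case by (simp add: prim_right)
    qed
  qed
qed

text \<open>On almost every meridian \<open>u\<close> is the primitive of \<open>us\<close> with initial value \<open>c\<close>; integration by parts there
  shows that the end values form the trace.\<close>

lemma slice_trace:
  assumes u: "L2 R u" and w: "weak_grad l u us ut"
    and c: "L2 Mc c" and rep: "AE x in R. u x = c (snd x) + pr us x"
  shows "G u us ut (\<lambda>x. if fst x = l then c (snd x) + (\<integral>t. us (t, snd x) \<partial>M) else c (snd x))"
proof -
  note us = conjunct1[OF weak_grad_L2[OF w]] and ut = conjunct2[OF weak_grad_L2[OF w]]
  define d where "d \<theta> = c \<theta> + (\<integral>t. us (t, \<theta>) \<partial>M)" for \<theta>
  have d: "L2 Mc d" unfolding d_def by (intro L2_add c int_slice_L2 us)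
  define \<tau> where "\<tau> x = (if fst x = l then d (snd x) else c (snd x))" for x
  have \<tau>: "\<tau> (l, \<theta>) = d \<theta>" "\<tau> (- l, \<theta>) = c \<theta>" for \<theta> using l by (auto simp: \<tau>_def)
  have "G u us ut \<tau>"
  proof (rule GI)
    fix \<psi> \<psi>s \<psi>t assume \<psi>: "C1_periodic \<psi> \<psi>s \<psi>t"
    have L: "L2 R \<psi>" "L2 R \<psi>s" using C1_periodic_continuous[OF \<psi>] by (auto intro: R_continuous_L2)
    have i: "integrable R (\<lambda>x. u x * \<psi>s x)" "integrable R (\<lambda>x. us x * \<psi> x)"
      by (intro L2_mult_integrable u us L)+
    have "(\<integral>x. u x * \<psi>s x \<partial>R) + (\<integral>x. us x * \<psi> x \<partial>R) = (\<integral>x. u x * \<psi>s x + us x * \<psi> x \<partial>R)"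
      using i by simp
    also have "\<dots> = (\<integral>\<theta>. (\<integral>s. u (s, \<theta>) * \<psi>s (s, \<theta>) + us (s, \<theta>) * \<psi> (s, \<theta>) \<partial>M) \<partial>Mc)"
      using i by (intro Fubini_t(3)) simp
    also have "\<dots> = (\<integral>\<theta>. d \<theta> * \<psi> (l, \<theta>) - c \<theta> * \<psi> (- l, \<theta>) \<partial>Mc)"
    proof (rule integral_cong_AE)
      show "(\<lambda>\<theta>. \<integral>s. u (s, \<theta>) * \<psi>s (s, \<theta>) + us (s, \<theta>) * \<psi> (s, \<theta>) \<partial>M) \<in> borel_measurable Mc"
        by (rule borel_measurable_integrable[OF Fubini_t(2)]) (use i in simp)
      show "(\<lambda>\<theta>. d \<theta> * \<psi> (l, \<theta>) - c \<theta> * \<psi> (- l, \<theta>)) \<in> borel_measurable Mc"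
        by (intro borel_measurable_diff borel_measurable_times L2_measurable[OF d] L2_measurable[OF c]
            L2_measurable[OF periodic_L2_end[OF \<psi>]])
      have m: "(\<lambda>x. c (snd x) + pr us x) \<in> borel_measurable R"
        by (intro borel_measurable_add snd_measurable L2_measurable c pr_L2 us)
      show "AE \<theta> in Mc. (\<integral>s. u (s, \<theta>) * \<psi>s (s, \<theta>) + us (s, \<theta>) * \<psi> (s, \<theta>) \<partial>M) = d \<theta> * \<psi> (l, \<theta>) - c \<theta> * \<psi> (- l, \<theta>)"
        using AE_R_swap(2)[OF L2_measurable[OF u] m rep] L2_slice_t[OF us] L2_slice_t[OF u]
      proof eventually_elim
        case (elim \<theta>)
        define v where "v s = c \<theta> + prim (-l) l (\<lambda>t. us (t, \<theta>)) s" for s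
        have v: "ac (-l) l v (\<lambda>s. us (s, \<theta>))"
          by (rule acI) (auto simp: v_def prim_left Mi.L2_integrable[OF elim(2)])
        have p: "ac (-l) l (\<lambda>s. \<psi> (s, \<theta>)) (\<lambda>s. \<psi>s (s, \<theta>))"
        proof (rule ac_C1)
          show "((\<lambda>s. \<psi> (s, \<theta>)) has_real_derivative \<psi>s (s, \<theta>)) (at s)" for s by (rule C1_periodic_partial(1)[OF \<psi>])
          show "continuous_on {-l..l} (\<lambda>s. \<psi>s (s, \<theta>))"
            by (rule continuous_on_compose2[OF C1_periodic_continuous(2)[OF \<psi>, of UNIV]]) (auto intro!: continuous_intros)
        qed
        note vp = ac_mult[OF v p]
        have "(\<integral>s. u (s, \<theta>) * \<psi>s (s, \<theta>) + us (s, \<theta>) * \<psi> (s, \<theta>) \<partial>M)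
          = (\<integral>s. v s * \<psi>s (s, \<theta>) + us (s, \<theta>) * \<psi> (s, \<theta>) \<partial>M)"
        proof (rule integral_cong_AE)
          show "AE s in M. u (s, \<theta>) * \<psi>s (s, \<theta>) + us (s, \<theta>) * \<psi> (s, \<theta>) = v s * \<psi>s (s, \<theta>) + us (s, \<theta>) * \<psi> (s, \<theta>)"
            using elim(1) by eventually_elim (simp add: v_def pr_def)
          show "(\<lambda>s. v s * \<psi>s (s, \<theta>) + us (s, \<theta>) * \<psi> (s, \<theta>)) \<in> borel_measurable M"
            by (rule borel_measurable_integrable[OF ac_integrable[OF vp]])
          have "(\<lambda>s. \<psi>s (s, \<theta>)) \<in> borel_measurable M" "(\<lambda>s. \<psi> (s, \<theta>)) \<in> borel_measurable M"
            by (intro borel_measurable_integrable ac_integrable[OF p] Mi_continuous_integrable[OF ac_continuous[OF p]])+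
          then show "(\<lambda>s. u (s, \<theta>) * \<psi>s (s, \<theta>) + us (s, \<theta>) * \<psi> (s, \<theta>)) \<in> borel_measurable M"
            by (intro borel_measurable_add borel_measurable_times L2_measurable[OF elim(2)] L2_measurable[OF elim(3)])
        qed
        also have "\<dots> = v l * \<psi> (l, \<theta>) - v (-l) * \<psi> (-l, \<theta>)"
          using ac_integral[OF vp] l by simp
        finally show ?case by (simp add: v_def d_def prim_left prim_right)
      qed
    qed
    also have "\<dots> = (\<integral>\<theta>. \<tau> (l, \<theta>) * \<psi> (l, \<theta>) \<partial>Mc) - (\<integral>\<theta>. \<tau> (- l, \<theta>) * \<psi> (- l, \<theta>) \<partial>Mc)"
      unfolding \<tau> by (intro Bochner_Integration.integral_diff L2_mult_integrable c d periodic_L2_end[OF \<psi>])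
    finally show "(\<integral>x. u x * \<psi>s x \<partial>R) + (\<integral>x. us x * \<psi> x \<partial>R)
      = (\<integral>\<theta>. \<tau> (l, \<theta>) * \<psi> (l, \<theta>) \<partial>Mc) - (\<integral>\<theta>. \<tau> (- l, \<theta>) * \<psi> (- l, \<theta>) \<partial>Mc)" .
    assume "\<exists>\<rho><l. \<forall>s \<theta>. \<rho> \<le> \<bar>s\<bar> \<longrightarrow> \<psi> (s, \<theta>) = 0"
    then show "(\<integral>x. u x * \<psi>t x \<partial>R) = - (\<integral>x. ut x * \<psi> x \<partial>R)" using weak_grad_R(2)[OF w \<psi>] by blast
  qed (use u us ut c d in \<open>auto simp: \<tau>\<close>)
  then show ?thesis unfolding \<tau>_def[abs_def] d_def .
qed

lemma H1_annulus_G: "u \<in> H1_annulus l \<Longrightarrow> G u (wds l u) (wdt l u) (bdry_trace l u)"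
proof -
  assume "u \<in> H1_annulus l"
  then obtain us ut where u: "L2 R u" and "weak_grad l u us ut" by (auto simp: H1_annulus_def R_L2_on)
  then have "\<exists>p. case p of (us, ut) \<Rightarrow> weak_grad l u us ut" by auto
  then have "case wgrad l u of (us, ut) \<Rightarrow> weak_grad l u us ut" unfolding wgrad_def by (rule someI_ex)
  then have w: "weak_grad l u (wds l u) (wdt l u)" by (simp add: wds_def wdt_def case_prod_beta)
  obtain c where c: "L2 Mc c" "AE x in R. u x = c (snd x) + pr (wds l u) x"
    using slice_representation[OF u w] by blast
  have *: "is_trace l u \<tau> \<longleftrightarrow> L2 Mc (\<lambda>\<theta>. \<tau> (l, \<theta>)) \<and> L2 Mc (\<lambda>\<theta>. \<tau> (- l, \<theta>)) \<and>
     (\<forall>\<psi> \<psi>s \<psi>t. C1_periodic \<psi> \<psi>s \<psi>t \<longrightarrow> (\<integral>x. u x * \<psi>s x + wds l u x * \<psi> x \<partial>R) =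
       (\<integral>\<theta>. \<tau> (l, \<theta>) * \<psi> (l, \<theta>) \<partial>Mc) - (\<integral>\<theta>. \<tau> (- l, \<theta>) * \<psi> (- l, \<theta>) \<partial>Mc))" for \<tau>
    unfolding is_trace_def R_integral Mi_set_integral Mi_L2_on by auto
  obtain \<tau> where "G u (wds l u) (wdt l u) \<tau>" using slice_trace[OF u w c] by blast
  then have "is_trace l u \<tau>" unfolding * G_def by blast
  then have "\<exists>\<tau>. is_trace l u \<tau>" by blast
  then have "is_trace l u (bdry_trace l u)" unfolding bdry_trace_def by (rule someI_ex)
  then show ?thesis unfolding * G_def using u w by blast
qed

lemma H1_annulus_iff: "u \<in> H1_annulus l \<longleftrightarrow> (\<exists>us ut \<tau>. G u us ut \<tau>)"
proof
  assume "\<exists>us ut \<tau>. G u us ut \<tau>"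
  then obtain us ut \<tau> where "G u us ut \<tau>" by blast
  from G_L2(1,6)[OF this] show "u \<in> H1_annulus l" by (auto simp: H1_annulus_def R_L2_on)
qed (use H1_annulus_G in blast)

lemma G_slice:
  assumes g: "G u us ut \<tau>"
  shows "AE \<theta> in Mc. L2 M (\<lambda>s. us (s, \<theta>)) \<and> (AE s in M. u (s, \<theta>) = \<tau> (- l, \<theta>) + prim (-l) l (\<lambda>t. us (t, \<theta>)) s)
     \<and> \<tau> (l, \<theta>) = \<tau> (- l, \<theta>) + (\<integral>t. us (t, \<theta>) \<partial>M)"
proof -
  note L = G_L2[OF g]
  obtain c where c: "L2 Mc c" "AE x in R. u x = c (snd x) + pr us x"
    using slice_representation[OF L(1,6)] by blast
  have m: "(\<lambda>x. c (snd x) + pr us x) \<in> borel_measurable R"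
    by (intro borel_measurable_add snd_measurable L2_measurable c(1) pr_L2 L(2))
  note t = trace_unique[OF g slice_trace[OF L(1,6) c]]
  show ?thesis
    using t AE_R_swap(2)[OF L2_measurable[OF L(1)] m c(2)] L2_slice_t[OF L(2)]
  proof eventually_elim
    case (elim \<theta>)
    have "\<tau> (- l, \<theta>) = c \<theta>" "\<tau> (l, \<theta>) = c \<theta> + (\<integral>t. us (t, \<theta>) \<partial>M)" using elim(1,2) l by auto
    then show ?case using elim(3,4) by (simp add: pr_def)
  qed
qed

lemma G_coefficient:
  assumes g: "G u us ut \<tau>"
  obtains v where "ac (-l) l v (co k us)" "AE s in M. co k u s = v s"
    "v l = (\<integral>\<theta>. \<tau> (l, \<theta>) * trig k \<theta> \<partial>Mc)" "v (-l) = (\<integral>\<theta>. \<tau> (- l, \<theta>) * trig k \<theta> \<partial>Mc)"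
proof -
  note L = G_L2[OF g]
  have ius: "integrable M (co k us)" by (rule Mi.L2_integrable[OF co_L2[OF L(2)]])
  obtain d where d: "AE s in M. co k u s = d + prim (-l) l (co k us) s"
    by (rule weak_primitive[OF l Mi.L2_integrable[OF co_L2[OF L(1)]] ius]) (rule weak_grad_co(1)[OF L(1,6)])
  define v where "v s = d + prim (-l) l (co k us) s" for s
  have v: "ac (-l) l v (co k us)" by (rule acI[OF ius]) (auto simp: v_def prim_left)
  have vae: "AE s in M. co k u s = v s" using d by (simp add: v_def)
  have gr: "v l * \<psi> l - v (-l) * \<psi> (-l) = (\<integral>\<theta>. \<tau> (l, \<theta>) * trig k \<theta> \<partial>Mc) * \<psi> l - (\<integral>\<theta>. \<tau> (- l, \<theta>) * trig k \<theta> \<partial>Mc) * \<psi> (-l)"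
    if \<psi>: "\<And>s. (\<psi> has_real_derivative \<psi>' s) (at s)" "continuous_on UNIV \<psi>'" for \<psi> \<psi>'
  proof -
    have p: "ac (-l) l \<psi> \<psi>'" by (rule ac_C1[OF \<psi>(1) continuous_on_subset[OF \<psi>(2)]]) auto
    have pL: "L2 M \<psi>" "L2 M \<psi>'"
      by (intro Mi_continuous_L2 ac_continuous[OF p] continuous_on_subset[OF \<psi>(2)] subset_UNIV)+
    have vL: "L2 M v" by (rule Mi_continuous_L2[OF ac_continuous[OF v]])
    have "v l * \<psi> l - v (-l) * \<psi> (-l) = (\<integral>s. v s * \<psi>' s + co k us s * \<psi> s \<partial>M)"
      using ac_integral[OF ac_mult[OF v p]] l by simp
    also have "\<dots> = (\<integral>s. v s * \<psi>' s \<partial>M) + (\<integral>s. co k us s * \<psi> s \<partial>M)"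
      by (intro Bochner_Integration.integral_add L2_mult_integrable vL pL co_L2 L)
    also have "(\<integral>s. v s * \<psi>' s \<partial>M) = (\<integral>s. co k u s * \<psi>' s \<partial>M)"
    proof (rule integral_cong_AE)
      show "AE s in M. v s * \<psi>' s = co k u s * \<psi>' s" using vae by eventually_elim simp
    qed (intro borel_measurable_times L2_measurable vL pL co_L2 L)+
    also have "\<dots> + (\<integral>s. co k us s * \<psi> s \<partial>M)
        = (\<integral>x. u x * (\<psi>' (fst x) * trig k (snd x)) \<partial>R) + (\<integral>x. us x * (\<psi> (fst x) * trig k (snd x)) \<partial>R)"
      by (simp add: co_integral[OF L(1) pL(2)] co_integral[OF L(2) pL(1)])
    also have "\<dots> = (\<integral>\<theta>. \<tau> (l, \<theta>) * (\<psi> l * trig k \<theta>) \<partial>Mc) - (\<integral>\<theta>. \<tau> (- l, \<theta>) * (\<psi> (- l) * trig k \<theta>) \<partial>Mc)"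
      using G_Green[OF g C1_periodic_product[OF \<psi>, of k]] by simp
    also have "\<dots> = (\<integral>\<theta>. \<tau> (l, \<theta>) * trig k \<theta> \<partial>Mc) * \<psi> l - (\<integral>\<theta>. \<tau> (- l, \<theta>) * trig k \<theta> \<partial>Mc) * \<psi> (- l)"
    proof -
      have "(\<integral>\<theta>. f \<theta> * (e * trig k \<theta>) \<partial>Mc) = (\<integral>\<theta>. f \<theta> * trig k \<theta> \<partial>Mc) * e" for f e
        unfolding Bochner_Integration.integral_mult_left_zero[symmetric]
        by (intro Bochner_Integration.integral_cong refl) simp
      then show ?thesis by (simp only:)
    qed
    finally show ?thesis .
  qed
  have d1: "((\<lambda>s. s + e) has_real_derivative 1) (at s)" for s e :: real
    by (auto intro!: derivative_eq_intros)
  have vl: "v l = (\<integral>\<theta>. \<tau> (l, \<theta>) * trig k \<theta> \<partial>Mc)"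
    using gr[OF d1[of l] continuous_on_const] l by simp
  have "v (-l) = (\<integral>\<theta>. \<tau> (- l, \<theta>) * trig k \<theta> \<partial>Mc)"
    using gr[OF d1[of "-l"] continuous_on_const] l by simp
  then show ?thesis using that[OF v vae vl] by blast
qed

lemma G_product:
  assumes f: "ac (-l) l f f'" "L2 M f'"
  shows "G (\<lambda>x. f (fst x) * trig k (snd x)) (\<lambda>x. f' (fst x) * trig k (snd x))
    (\<lambda>x. f (fst x) * (- real_of_int k * trig (- k) (snd x))) (\<lambda>x. f (fst x) * trig k (snd x))"
proof (rule GI)
  have fL: "L2 M f" by (rule Mi_continuous_L2[OF ac_continuous[OF f(1)]])
  show uL: "L2 R (\<lambda>x. f (fst x) * trig k (snd x))" "L2 R (\<lambda>x. f' (fst x) * trig k (snd x))"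
    "L2 R (\<lambda>x. f (fst x) * (- real_of_int k * trig (- k) (snd x)))"
    by (intro tensor_L2 fL f(2) trig_L2 L2_scale)+
  show "L2 Mc (\<lambda>\<theta>. f (fst (l, \<theta>)) * trig k (snd (l, \<theta>)))" "L2 Mc (\<lambda>\<theta>. f (fst (- l, \<theta>)) * trig k (snd (- l, \<theta>)))"
    by (simp_all add: L2_scale trig_L2)
  fix \<psi> \<psi>s \<psi>t assume \<psi>: "C1_periodic \<psi> \<psi>s \<psi>t"
  have L: "L2 R \<psi>" "L2 R \<psi>s" "L2 R \<psi>t" using C1_periodic_continuous[OF \<psi>] by (auto intro: R_continuous_L2)
  have p: "ac (-l) l (\<lambda>s. \<psi> (s, \<theta>)) (\<lambda>s. \<psi>s (s, \<theta>))" for \<theta>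
  proof (rule ac_C1)
    show "((\<lambda>s. \<psi> (s, \<theta>)) has_real_derivative \<psi>s (s, \<theta>)) (at s)" for s by (rule C1_periodic_partial(1)[OF \<psi>])
    show "continuous_on {-l..l} (\<lambda>s. \<psi>s (s, \<theta>))"
      by (rule continuous_on_compose2[OF C1_periodic_continuous(2)[OF \<psi>, of UNIV]]) (auto intro!: continuous_intros)
  qed
  have i: "integrable R (\<lambda>x. f (fst x) * trig k (snd x) * \<psi>s x)" "integrable R (\<lambda>x. f' (fst x) * trig k (snd x) * \<psi> x)"
    by (intro L2_mult_integrable uL L)+
  have "(\<integral>x. f (fst x) * trig k (snd x) * \<psi>s x \<partial>R) + (\<integral>x. f' (fst x) * trig k (snd x) * \<psi> x \<partial>R)
    = (\<integral>x. f (fst x) * trig k (snd x) * \<psi>s x + f' (fst x) * trig k (snd x) * \<psi> x \<partial>R)" using i by simp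
  also have "\<dots> = (\<integral>\<theta>. (\<integral>s. f s * trig k \<theta> * \<psi>s (s, \<theta>) + f' s * trig k \<theta> * \<psi> (s, \<theta>) \<partial>M) \<partial>Mc)"
    using Fubini_t(3)[OF Bochner_Integration.integrable_add[OF i]] by simp
  also have "\<dots> = (\<integral>\<theta>. trig k \<theta> * (f l * \<psi> (l, \<theta>)) - trig k \<theta> * (f (-l) * \<psi> (-l, \<theta>)) \<partial>Mc)"
  proof (intro Bochner_Integration.integral_cong refl)
    fix \<theta>
    have "(\<integral>s. f s * trig k \<theta> * \<psi>s (s, \<theta>) + f' s * trig k \<theta> * \<psi> (s, \<theta>) \<partial>M)
      = (\<integral>s. trig k \<theta> * (f s * \<psi>s (s, \<theta>) + f' s * \<psi> (s, \<theta>)) \<partial>M)"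
      by (intro Bochner_Integration.integral_cong refl) (simp add: algebra_simps)
    also have "\<dots> = trig k \<theta> * (f l * \<psi> (l, \<theta>) - f (-l) * \<psi> (-l, \<theta>))"
      using ac_integral[OF ac_mult[OF f(1) p]] l by simp
    finally show "(\<integral>s. f s * trig k \<theta> * \<psi>s (s, \<theta>) + f' s * trig k \<theta> * \<psi> (s, \<theta>) \<partial>M)
      = trig k \<theta> * (f l * \<psi> (l, \<theta>)) - trig k \<theta> * (f (-l) * \<psi> (-l, \<theta>))" by (simp add: algebra_simps)
  qed
  also have "\<dots> = (\<integral>\<theta>. trig k \<theta> * (f l * \<psi> (l, \<theta>)) \<partial>Mc) - (\<integral>\<theta>. trig k \<theta> * (f (-l) * \<psi> (-l, \<theta>)) \<partial>Mc)"
    by (intro Bochner_Integration.integral_diff L2_mult_integrable trig_L2 L2_scale periodic_L2_end[OF \<psi>])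
  finally show "(\<integral>x. f (fst x) * trig k (snd x) * \<psi>s x \<partial>R) + (\<integral>x. f' (fst x) * trig k (snd x) * \<psi> x \<partial>R) =
      (\<integral>\<theta>. f (fst (l, \<theta>)) * trig k (snd (l, \<theta>)) * \<psi> (l, \<theta>) \<partial>Mc)
      - (\<integral>\<theta>. f (fst (- l, \<theta>)) * trig k (snd (- l, \<theta>)) * \<psi> (- l, \<theta>) \<partial>Mc)"
    by (simp add: mult_ac)
  have i: "integrable R (\<lambda>x. f (fst x) * trig k (snd x) * \<psi>t x)"
    "integrable R (\<lambda>x. f (fst x) * (- real_of_int k * trig (- k) (snd x)) * \<psi> x)"
    by (intro L2_mult_integrable uL L)+
  have "(\<integral>x. f (fst x) * trig k (snd x) * \<psi>t x \<partial>R) + (\<integral>x. f (fst x) * (- real_of_int k * trig (- k) (snd x)) * \<psi> x \<partial>R)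
    = (\<integral>x. f (fst x) * trig k (snd x) * \<psi>t x + f (fst x) * (- real_of_int k * trig (- k) (snd x)) * \<psi> x \<partial>R)"
    using i by (intro Bochner_Integration.integral_add[symmetric])
  also have "\<dots> = (\<integral>s. (\<integral>\<theta>. f s * trig k \<theta> * \<psi>t (s, \<theta>) + f s * (- real_of_int k * trig (- k) \<theta>) * \<psi> (s, \<theta>) \<partial>Mc) \<partial>M)"
    using Fubini_s(3)[OF Bochner_Integration.integrable_add[OF i]] by simp
  also have "\<dots> = (\<integral>s. 0 \<partial>M)"
  proof (intro Bochner_Integration.integral_cong refl)
    fix s
    have pt: "ac 0 (2*pi) (\<lambda>\<theta>. \<psi> (s, \<theta>)) (\<lambda>\<theta>. \<psi>t (s, \<theta>))"
    proof (rule ac_C1)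
      show "((\<lambda>\<theta>. \<psi> (s, \<theta>)) has_real_derivative \<psi>t (s, \<theta>)) (at \<theta>)" for \<theta> by (rule C1_periodic_partial(2)[OF \<psi>])
      show "continuous_on {0..2*pi} (\<lambda>\<theta>. \<psi>t (s, \<theta>))"
        by (rule continuous_on_compose2[OF C1_periodic_continuous(3)[OF \<psi>, of UNIV]]) (auto intro!: continuous_intros)
    qed
    have tr: "ac 0 (2*pi) (trig k) (\<lambda>\<theta>. - real_of_int k * trig (- k) \<theta>)"
      by (rule ac_C1[OF trig_deriv]) (intro continuous_intros)
    have "\<psi> (s, 2 * pi) = \<psi> (s, 0)" using \<psi> unfolding C1_periodic_def by (metis add.left_neutral)
    moreover have "trig k (2 * pi) = trig k 0" using trig_periodic[of k 0] by simp
    ultimately have z: "(\<integral>\<theta>. trig k \<theta> * \<psi>t (s, \<theta>) + (- real_of_int k * trig (- k) \<theta>) * \<psi> (s, \<theta>) \<partial>Mc) = 0"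
      using ac_integral[OF ac_mult[OF tr pt]] by simp
    have "(\<integral>\<theta>. f s * trig k \<theta> * \<psi>t (s, \<theta>) + f s * (- real_of_int k * trig (- k) \<theta>) * \<psi> (s, \<theta>) \<partial>Mc)
      = (\<integral>\<theta>. f s * (trig k \<theta> * \<psi>t (s, \<theta>) + (- real_of_int k * trig (- k) \<theta>) * \<psi> (s, \<theta>)) \<partial>Mc)"
      by (intro Bochner_Integration.integral_cong refl) (simp add: algebra_simps)
    then show "(\<integral>\<theta>. f s * trig k \<theta> * \<psi>t (s, \<theta>) + f s * (- real_of_int k * trig (- k) \<theta>) * \<psi> (s, \<theta>) \<partial>Mc) = 0"
      unfolding Bochner_Integration.integral_mult_right_zero z by simp
  qed
  finally show "(\<integral>x. f (fst x) * trig k (snd x) * \<psi>t x \<partial>R) = - (\<integral>x. f (fst x) * (- real_of_int k * trig (- k) (snd x)) * \<psi> x \<partial>R)"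
    by simp
qed

end

section \<open>The index form on Fourier modes\<close>

context catenoid
begin

sublocale C: cylinder l by unfold_locales (rule l_pos)

abbreviation "R \<equiv> Mi (-l) l \<Otimes>\<^sub>M Mi 0 (2 * pi)"
abbreviation "HA \<equiv> H1_annulus l"
abbreviation "G \<equiv> C.G"
abbreviation "co \<equiv> C.co"

definition J :: "(real \<Rightarrow> real) \<Rightarrow> (real \<times> real \<Rightarrow> real) \<Rightarrow> (real \<times> real \<Rightarrow> real) \<Rightarrow> real" where
  "J g u v = (\<integral>x. g (fst x) * u x * v x \<partial>R)"

lemma J_int: "continuous_on {-l..l} g \<Longrightarrow> L2 R u \<Longrightarrow> L2 R v \<Longrightarrow> integrable R (\<lambda>x. g (fst x) * u x * v x)"
  by (intro L2_mult_integrable C.L2_fst_mult)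

lemma J_cong:
  assumes g: "continuous_on {-l..l} g" and L: "L2 R u" "L2 R u'" "L2 R v" "L2 R v'"
    and eq: "AE x in R. u x = u' x" "AE x in R. v x = v' x"
  shows "J g u v = J g u' v'"
  unfolding J_def
proof (rule integral_cong_AE)
  show "AE x in R. g (fst x) * u x * v x = g (fst x) * u' x * v' x" using eq by eventually_elim simp
qed (use J_int[OF g] L in auto)

lemma J_lin:
  assumes g: "continuous_on {-l..l} g" and L: "L2 R u" "L2 R u'" "L2 R v"
  shows "J g (\<lambda>x. c * u x + d * u' x) v = c * J g u v + d * J g u' v"
proof -
  have "J g (\<lambda>x. c * u x + d * u' x) v = (\<integral>x. c * (g (fst x) * u x * v x) + d * (g (fst x) * u' x * v x) \<partial>R)"
    unfolding J_def by (intro Bochner_Integration.integral_cong refl) (simp add: algebra_simps)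
  then show ?thesis using J_int[OF g L(1,3)] J_int[OF g L(2,3)] by (simp add: J_def)
qed

abbreviation "pB s \<equiv> (II_sq a s - 2) * B s"

lemma pB_cont: "continuous_on S pB"
  unfolding II_sq_def using B_pos by (intro continuous_intros B_cont) (auto simp: less_imp_neq[symmetric])

text \<open>Weak gradient and trace are unique up to null sets, so the index form may be computed with any choice
  of them.\<close>

lemma index_form_G:
  assumes u: "G u us ut \<tau>" and v: "G v vs vt \<sigma>"
  shows "index_form a u v = J B us vs + J (\<lambda>s. 1 / B s) ut vt - J pB u v
    - \<beta> * ((\<integral>\<theta>. \<tau> (l, \<theta>) * \<sigma> (l, \<theta>) \<partial>Mc) + (\<integral>\<theta>. \<tau> (- l, \<theta>) * \<sigma> (- l, \<theta>) \<partial>Mc))"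
proof -
  have u0: "G u (wds l u) (wdt l u) (bdry_trace l u)" and v0: "G v (wds l v) (wdt l v) (bdry_trace l v)"
    using u v C.H1_annulus_iff by (blast intro: C.H1_annulus_G)+
  note Lu = C.G_L2[OF u] and Lv = C.G_L2[OF v] and Lu0 = C.G_L2[OF u0] and Lv0 = C.G_L2[OF v0]
  note eu = C.weak_grad_unique[OF Lu0(6) Lu(6)] and ev = C.weak_grad_unique[OF Lv0(6) Lv(6)]
  let ?F = "\<lambda>(s, \<theta>). (wds l u (s, \<theta>) * wds l v (s, \<theta>) + wdt l u (s, \<theta>) * wdt l v (s, \<theta>) / (B s)\<^sup>2
       - (II_sq a s - 2) * u (s, \<theta>) * v (s, \<theta>)) * B s"
  have "integral\<^sup>L R ?F = (\<integral>x. B (fst x) * wds l u x * wds l v x + 1 / B (fst x) * wdt l u x * wdt l v x - pB (fst x) * u x * v x \<partial>R)"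
  proof (intro Bochner_Integration.integral_cong refl)
    fix x :: "real \<times> real"
    obtain s \<theta> where x: "x = (s, \<theta>)" by (cases x)
    show "?F x = B (fst x) * wds l u x * wds l v x + 1 / B (fst x) * wdt l u x * wdt l v x - pB (fst x) * u x * v x"
      unfolding x using B_pos[of s] by (simp add: field_simps power2_eq_square)
  qed
  also have "\<dots> = J B (wds l u) (wds l v) + J (\<lambda>s. 1 / B s) (wdt l u) (wdt l v) - J pB u v"
    unfolding J_def
    using J_int[OF B_cont Lu0(2) Lv0(2)] J_int[OF inv_B_cont Lu0(3) Lv0(3)] J_int[OF pB_cont Lu(1) Lv(1)]
    by (simp only: Bochner_Integration.integral_add Bochner_Integration.integral_diff Bochner_Integration.integrable_add)
  also have "J B (wds l u) (wds l v) = J B us vs" by (intro J_cong B_cont Lu0 Lu Lv0 Lv eu ev)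
  also have "J (\<lambda>s. 1 / B s) (wdt l u) (wdt l v) = J (\<lambda>s. 1 / B s) ut vt" by (intro J_cong inv_B_cont Lu0 Lu Lv0 Lv eu ev)
  finally have main: "integral\<^sup>L R ?F = J B us vs + J (\<lambda>s. 1 / B s) ut vt - J pB u v" .
  have tr: "(\<integral>\<theta>. bdry_trace l u (s, \<theta>) * bdry_trace l v (s, \<theta>) * B s \<partial>Mc) = B l * (\<integral>\<theta>. \<tau> (s, \<theta>) * \<sigma> (s, \<theta>) \<partial>Mc)"
    if s: "s = l \<or> s = - l" for s
  proof -
    have "(\<integral>\<theta>. bdry_trace l u (s, \<theta>) * bdry_trace l v (s, \<theta>) \<partial>Mc) = (\<integral>\<theta>. \<tau> (s, \<theta>) * \<sigma> (s, \<theta>) \<partial>Mc)"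
    proof (rule integral_cong_AE)
      have "AE \<theta> in Mc. bdry_trace l u (s, \<theta>) = \<tau> (s, \<theta>)" "AE \<theta> in Mc. bdry_trace l v (s, \<theta>) = \<sigma> (s, \<theta>)"
        using s C.trace_unique[OF u0 u] C.trace_unique[OF v0 v] by auto
      then show "AE \<theta> in Mc. bdry_trace l u (s, \<theta>) * bdry_trace l v (s, \<theta>) = \<tau> (s, \<theta>) * \<sigma> (s, \<theta>)"
        by eventually_elim simp
      show "(\<lambda>\<theta>. bdry_trace l u (s, \<theta>) * bdry_trace l v (s, \<theta>)) \<in> borel_measurable Mc"
        "(\<lambda>\<theta>. \<tau> (s, \<theta>) * \<sigma> (s, \<theta>)) \<in> borel_measurable Mc"
        using s by (elim disjE; simp only:;
          intro borel_measurable_times L2_measurable Lu(4,5) Lv(4,5) Lu0(4,5) Lv0(4,5))+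
    qed
    moreover have "B s = B l" using s by (auto simp: B_even)
    ultimately show ?thesis by (simp add: mult.commute)
  qed
  have sum: "(\<Sum>s\<in>{-l, l}. (\<integral>\<theta>. bdry_trace l u (s, \<theta>) * bdry_trace l v (s, \<theta>) * B s \<partial>Mc))
     = B l * ((\<integral>\<theta>. \<tau> (l, \<theta>) * \<sigma> (l, \<theta>) \<partial>Mc) + (\<integral>\<theta>. \<tau> (- l, \<theta>) * \<sigma> (- l, \<theta>) \<partial>Mc))"
  proof -
    have "-l \<noteq> l" using l_pos by simp
    then have "(\<Sum>s\<in>{-l, l}. f s) = f (-l) + f l" for f :: "real \<Rightarrow> real" by simp
    then show ?thesis unfolding tr[OF disjI1[OF refl]] tr[OF disjI2[OF refl]] by (simp only: tr simp_thms) (simp add: algebra_simps)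
  qed
  have "index_form a u v = integral\<^sup>L R ?F
     - coth (rad a) * (\<Sum>s\<in>{-l, l}. (\<integral>\<theta>. bdry_trace l u (s, \<theta>) * bdry_trace l v (s, \<theta>) * B s \<partial>Mc))"
    unfolding index_form_def l_def[symmetric] C.R_integral Mi_set_integral ..
  then show ?thesis unfolding main sum by (simp add: \<beta>_def flip: l_def)
qed

lemma HA_subspace: "linear_subspace HA"
  unfolding linear_subspace_def
proof (intro conjI ballI allI)
  have "H (\<lambda>x. 0) (\<lambda>x. 0)" by (rule R1.H_const)
  from C.G_product[OF R1.H_ac[OF this] R1.H_L2[OF this], of 0] show "(\<lambda>x. 0) \<in> HA"
    unfolding C.H1_annulus_iff by auto
  fix u assume "u \<in> HA"
  then obtain us ut \<tau> where u: "G u us ut \<tau>" using C.H1_annulus_iff by blast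
  show "(\<lambda>x. c * u x) \<in> HA" for c using C.G_lin[OF u u, of c 0] unfolding C.H1_annulus_iff by auto
  fix v assume "v \<in> HA"
  then obtain vs vt \<sigma> where v: "G v vs vt \<sigma>" using C.H1_annulus_iff by blast
  show "(\<lambda>x. u x + v x) \<in> HA" using C.G_lin[OF u v, of 1 1] unfolding C.H1_annulus_iff by auto
qed

lemma index_form_lin:
  assumes "u \<in> HA" "v \<in> HA" "z \<in> HA"
  shows "index_form a (\<lambda>x. c * u x + d * v x) z = c * index_form a u z + d * index_form a v z"
proof -
  obtain us ut \<tau> vs vt \<sigma> zs zt \<rho> where g: "G u us ut \<tau>" "G v vs vt \<sigma>" "G z zs zt \<rho>"
    using assms C.H1_annulus_iff by meson
  note L = C.G_L2[OF g(1)] and L' = C.G_L2[OF g(2)] and L'' = C.G_L2[OF g(3)]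
  have tr: "(\<integral>\<theta>. (c * f \<theta> + d * f' \<theta>) * q \<theta> \<partial>Mc) = c * (\<integral>\<theta>. f \<theta> * q \<theta> \<partial>Mc) + d * (\<integral>\<theta>. f' \<theta> * q \<theta> \<partial>Mc)"
    if "L2 Mc f" "L2 Mc f'" "L2 Mc q" for f f' q
  proof -
    have "(\<integral>\<theta>. (c * f \<theta> + d * f' \<theta>) * q \<theta> \<partial>Mc) = (\<integral>\<theta>. c * (f \<theta> * q \<theta>) + d * (f' \<theta> * q \<theta>) \<partial>Mc)"
      by (intro Bochner_Integration.integral_cong refl) (simp add: algebra_simps)
    then show ?thesis using L2_mult_integrable[OF that(1,3)] L2_mult_integrable[OF that(2,3)] by simp
  qed
  show ?thesis
    unfolding index_form_G[OF C.G_lin[OF g(1,2)] g(3)] index_form_G[OF g(1,3)] index_form_G[OF g(2,3)]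
      J_lin[OF B_cont L(2) L'(2) L''(2)] J_lin[OF inv_B_cont L(3) L'(3) L''(3)] J_lin[OF pB_cont L(1) L'(1) L''(1)]
      tr[OF L(4) L'(4) L''(4)] tr[OF L(5) L'(5) L''(5)]
    by (simp add: algebra_simps)
qed

sublocale A: sym_form HA "index_form a"
proof
  show "linear_subspace HA" by (rule HA_subspace)
  show "index_form a (\<lambda>x. u x + v x) z = index_form a u z + index_form a v z" if "u \<in> HA" "v \<in> HA" "z \<in> HA" for u v z
    using index_form_lin[OF that, of 1 1] by simp
  show "index_form a (\<lambda>x. c * u x) z = c * index_form a u z" if "u \<in> HA" "z \<in> HA" for u z c
    using index_form_lin[OF that(1,1,2), of c 0] by simp
  fix u v assume "u \<in> HA" "v \<in> HA"
  then obtain us ut \<tau> vs vt \<sigma> where g: "G u us ut \<tau>" "G v vs vt \<sigma>" using C.H1_annulus_iff by meson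
  show "index_form a u v = index_form a v u"
    unfolding index_form_G[OF g] index_form_G[OF g(2,1)] J_def by (simp add: mult_ac)
qed

lemma null_iff: "u \<in> null_annulus l \<longleftrightarrow> (AE x in R. u x = 0)"
  by (simp add: null_annulus_def C.R_AE)

lemma index_form_null:
  assumes u: "u \<in> HA" "u \<in> null_annulus l" and v: "v \<in> HA"
  shows "index_form a u v = 0"
proof -
  have ae: "AE x in R. u x = 0" using u(2) null_iff by simp
  have uL: "L2 R u" using u(1) C.H1_annulus_iff C.G_L2(1) by blast
  have z: "(\<integral>x. u x * f x \<partial>R) = 0" for f
    by (rule integral_eq_zero_AE) (use ae in \<open>eventually_elim, simp\<close>)
  have g: "G u (\<lambda>x. 0) (\<lambda>x. 0) (\<lambda>x. 0)" by (rule C.GI) (simp_all add: uL z)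
  obtain vs vt \<sigma> where h: "G v vs vt \<sigma>" using v C.H1_annulus_iff by blast
  have "J pB u v = 0" unfolding J_def
    by (rule integral_eq_zero_AE) (use ae in \<open>eventually_elim, simp\<close>)
  then show ?thesis unfolding index_form_G[OF g h] by (simp add: J_def)
qed

abbreviation mode :: "int \<Rightarrow> (real \<Rightarrow> real) \<Rightarrow> real \<times> real \<Rightarrow> real" where
  "mode k f \<equiv> (\<lambda>x. f (fst x) * trig k (snd x))"

lemma mode_HA: "f \<in> H1 \<Longrightarrow> mode k f \<in> HA"
proof -
  assume "f \<in> H1"
  then obtain f' where f: "H f f'" using R1.H1_iff by blast
  show ?thesis unfolding C.H1_annulus_iff using C.G_product[OF R1.H_ac[OF f] R1.H_L2[OF f]] by blast
qed

lemma rf_cong: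
  assumes u: "H u u'" and v: "v \<in> H1" and eq: "\<And>s. s \<in> {-l..l} \<Longrightarrow> u s = u2 s" and f: "f \<in> H1"
  shows "rf k u f = rf k u2 f"
proof -
  have "ac (-l) l u2 u'"
  proof (rule acI[OF ac_integrable[OF R1.H_ac[OF u]]])
    fix x assume x: "x \<in> {-l..l}"
    then have "-l \<in> {-l..l}" by auto
    then show "u2 x = u2 (-l) + prim (-l) l u' x" using ac_eq[OF R1.H_ac[OF u] x] eq[OF x] eq[of "-l"] by simp
  qed
  then have u2: "H u2 u'" using R1.H_L2[OF u] by (simp add: R1.H_def)
  obtain f' where f: "H f f'" using f R1.H1_iff by blast
  have "(\<integral>s. P k s * u s * f s \<partial>M) = (\<integral>s. P k s * u2 s * f s \<partial>M)"
    by (intro Bochner_Integration.integral_cong refl) (simp add: eq)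
  moreover have "u l = u2 l" "u (-l) = u2 (-l)" using eq[of l] eq[of "-l"] l_pos by auto
  ultimately show ?thesis unfolding rf_eq[OF u f] rf_eq[OF u2 f] by simp
qed

text \<open>\<open>CF k u v\<close>: the continuous function \<open>v\<close> represents the \<open>k\<close>-th Fourier coefficient of \<open>u\<close>.\<close>

definition CF :: "int \<Rightarrow> (real \<times> real \<Rightarrow> real) \<Rightarrow> (real \<Rightarrow> real) \<Rightarrow> bool" where
  "CF k u v \<longleftrightarrow> v \<in> H1 \<and> (AE s in M. co k u s = v s)"

lemma H1_AE_eq:
  assumes "u \<in> H1" "v \<in> H1" "AE s in M. u s = v s" "s \<in> {-l..l}" shows "u s = v s"
proof -
  have "(\<lambda>s. u s - v s) \<in> H1" by (intro F.D_diff assms)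
  then have c: "continuous_on {-l..l} (\<lambda>s. u s - v s)" using H1_intervalD(3)[OF l_pos] by blast
  have "AE s in M. u s - v s = 0" using assms(3) by eventually_elim simp
  from continuous_AE_eq[OF this c assms(4)] show ?thesis using l_pos by simp
qed

lemma CF_ex: "u \<in> HA \<Longrightarrow> \<exists>v. CF k u v"
proof -
  assume "u \<in> HA"
  then obtain us ut \<tau> where g: "G u us ut \<tau>" using C.H1_annulus_iff by blast
  obtain v where v: "ac (-l) l v (co k us)" "AE s in M. co k u s = v s"
    by (rule C.G_coefficient[OF g, of k]) (rule that)
  have "H v (co k us)" using v(1) C.co_L2[OF C.G_L2(2)[OF g]] by (simp add: R1.H_def)
  then show ?thesis using v(2) R1.H1_iff by (auto simp: CF_def)
qed

lemma CF_lin: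
  assumes u: "u \<in> HA" "v \<in> HA" and cf: "CF k u f" "CF k v g"
  shows "CF k (\<lambda>x. c * u x + d * v x) (\<lambda>s. c * f s + d * g s)"
  unfolding CF_def
proof
  show "(\<lambda>s. c * f s + d * g s) \<in> H1" using cf by (intro F.D_add F.D_scale) (auto simp: CF_def)
  have L: "L2 R u" "L2 R v" using u C.H1_annulus_iff C.G_L2(1) by blast+
  have "AE s in M. co k u s = f s" "AE s in M. co k v s = g s" using cf by (auto simp: CF_def)
  then show "AE s in M. co k (\<lambda>x. c * u x + d * v x) s = c * f s + d * g s"
    using C.co_diff[OF L2_scale[OF L(1)] L2_scale[OF L(2)], of k c "-d"]
    by eventually_elim (simp add: C.co_scale C.co_scale[of k "-d" v, simplified])
qed

lemma co_mode: "co j (mode k f) s = (if j = k then nrm k * f s else 0)"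
proof -
  have "co j (mode k f) s = (\<integral>\<theta>. f s * (trig k \<theta> * trig j \<theta>) \<partial>Mc)"
    unfolding C.co_def by (intro Bochner_Integration.integral_cong refl) simp
  then show ?thesis by (simp add: trig_orthogonal)
qed

lemma CF_mode: "f \<in> H1 \<Longrightarrow> CF j (mode k f) (\<lambda>s. (if j = k then nrm k else 0) * f s)"
  unfolding CF_def co_mode using F.D_scale[of f "if j = k then nrm k else 0"] by auto

text \<open>Pairing with a mode reduces the index form to the radial form of that mode.\<close>

lemma index_form_mode:
  assumes u: "u \<in> HA" and cf: "CF k u v" and f: "f \<in> H1"
  shows "index_form a u (mode k f) = rf k v f"
proof -
  obtain us ut \<tau> where g: "G u us ut \<tau>" using u C.H1_annulus_iff by blast
  note L = C.G_L2[OF g]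
  obtain z where z: "ac (-l) l z (co k us)" "AE s in M. co k u s = z s"
    "z l = (\<integral>\<theta>. \<tau> (l, \<theta>) * trig k \<theta> \<partial>Mc)" "z (-l) = (\<integral>\<theta>. \<tau> (- l, \<theta>) * trig k \<theta> \<partial>Mc)"
    by (rule C.G_coefficient[OF g, of k]) (rule that)
  have Hz: "H z (co k us)" using z(1) C.co_L2[OF L(2)] by (simp add: R1.H_def)
  then have zH: "z \<in> H1" using R1.H1_iff by blast
  have vH: "v \<in> H1" and vae: "AE s in M. co k u s = v s" using cf by (auto simp: CF_def)
  have "AE s in M. z s = v s" using z(2) vae by eventually_elim simp
  from H1_AE_eq[OF zH vH this] have rz: "rf k z f = rf k v f" by (intro rf_cong[OF Hz vH _ f])
  obtain f' where Hf: "H f f'" using f R1.H1_iff by blast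
  note fL = R1.H_L2'[OF Hf] R1.H_L2[OF Hf]
  note h = C.G_product[OF R1.H_ac[OF Hf] R1.H_L2[OF Hf], of k]
  have zL: "L2 M z" by (rule R1.H_L2'[OF Hz])
  have 1: "J B us (\<lambda>x. f' (fst x) * trig k (snd x)) = (\<integral>s. B s * co k us s * f' s \<partial>M)"
  proof -
    have "J B us (\<lambda>x. f' (fst x) * trig k (snd x)) = (\<integral>x. us x * ((B (fst x) * f' (fst x)) * trig k (snd x)) \<partial>R)"
      unfolding J_def by (intro Bochner_Integration.integral_cong refl) simp
    also have "\<dots> = (\<integral>s. co k us s * (B s * f' s) \<partial>M)"
      by (rule C.co_integral[OF L(2) L2_mult_continuous[OF B_cont fL(2)]])
    finally show ?thesis by (simp add: mult_ac)
  qed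
  have co_eq: "(\<integral>s. co k u s * q s \<partial>M) = (\<integral>s. z s * q s \<partial>M)" if "L2 M q" for q
  proof (rule integral_cong_AE)
    show "AE s in M. co k u s * q s = z s * q s" using z(2) by eventually_elim simp
  qed (intro borel_measurable_times L2_measurable that zL C.co_L2 L)+
  have 2: "J pB u (mode k f) = (\<integral>s. z s * (pB s * f s) \<partial>M)"
  proof -
    have pf: "L2 M (\<lambda>s. pB s * f s)" by (rule L2_mult_continuous[OF pB_cont fL(1)])
    have "J pB u (mode k f) = (\<integral>x. u x * ((pB (fst x) * f (fst x)) * trig k (snd x)) \<partial>R)"
      unfolding J_def by (intro Bochner_Integration.integral_cong refl) simp
    also have "\<dots> = (\<integral>s. co k u s * (pB s * f s) \<partial>M)" by (rule C.co_integral[OF L(1) pf])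
    finally show ?thesis using co_eq[OF pf] by simp
  qed
  have 3: "J (\<lambda>s. 1 / B s) ut (\<lambda>x. f (fst x) * (- real_of_int k * trig (- k) (snd x))) = (real_of_int k)\<^sup>2 * (\<integral>s. z s * (1 / B s * f s) \<partial>M)"
  proof -
    have bf: "L2 M (\<lambda>s. 1 / B s * f s)" by (rule L2_mult_continuous[OF inv_B_cont fL(1)])
    have "J (\<lambda>s. 1 / B s) ut (\<lambda>x. f (fst x) * (- real_of_int k * trig (- k) (snd x)))
      = (\<integral>x. - real_of_int k * (ut x * ((1 / B (fst x) * f (fst x)) * trig (- k) (snd x))) \<partial>R)"
      unfolding J_def by (intro Bochner_Integration.integral_cong refl) simp
    also have "\<dots> = - real_of_int k * (\<integral>s. co (- k) ut s * (1 / B s * f s) \<partial>M)"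
      unfolding Bochner_Integration.integral_mult_right_zero C.co_integral[OF L(3) bf] ..
    also have "(\<integral>s. co (- k) ut s * (1 / B s * f s) \<partial>M) = (\<integral>s. - real_of_int k * (co k u s * (1 / B s * f s)) \<partial>M)"
    proof (rule integral_cong_AE)
      show "AE s in M. co (- k) ut s * (1 / B s * f s) = - real_of_int k * (co k u s * (1 / B s * f s))"
        using C.weak_grad_co(2)[OF L(1,6), of "- k"] by eventually_elim simp
    qed (intro borel_measurable_times L2_measurable bf C.co_L2 L borel_measurable_const)+
    also have "\<dots> = - real_of_int k * (\<integral>s. z s * (1 / B s * f s) \<partial>M)"
      unfolding Bochner_Integration.integral_mult_right_zero co_eq[OF bf] ..
    finally show ?thesis by (simp add: power2_eq_square)
  qed
  have 4: "(\<integral>\<theta>. \<tau> (s, \<theta>) * (f (fst (s, \<theta>)) * trig k (snd (s, \<theta>))) \<partial>Mc) = (\<integral>\<theta>. \<tau> (s, \<theta>) * trig k \<theta> \<partial>Mc) * f s" for s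
    unfolding Bochner_Integration.integral_mult_left_zero[symmetric] by (intro Bochner_Integration.integral_cong refl) simp
  have 5: "(\<integral>s. P k s * z s * f s \<partial>M) = (\<integral>s. z s * (pB s * f s) \<partial>M) - (real_of_int k)\<^sup>2 * (\<integral>s. z s * (1 / B s * f s) \<partial>M)"
  proof -
    have i: "integrable M (\<lambda>s. z s * (pB s * f s))" "integrable M (\<lambda>s. (real_of_int k)\<^sup>2 * (z s * (1 / B s * f s)))"
      by (intro integrable_mult_right L2_mult_integrable zL L2_mult_continuous pB_cont inv_B_cont fL)+
    have "(\<integral>s. P k s * z s * f s \<partial>M) = (\<integral>s. z s * (pB s * f s) - (real_of_int k)\<^sup>2 * (z s * (1 / B s * f s)) \<partial>M)"
    proof (intro Bochner_Integration.integral_cong refl)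
      fix s show "P k s * z s * f s = z s * (pB s * f s) - (real_of_int k)\<^sup>2 * (z s * (1 / B s * f s))"
        using B_pos[of s] by (simp add: potential_def field_simps power2_eq_square)
    qed
    also have "\<dots> = (\<integral>s. z s * (pB s * f s) \<partial>M) - (\<integral>s. (real_of_int k)\<^sup>2 * (z s * (1 / B s * f s)) \<partial>M)"
      by (rule Bochner_Integration.integral_diff[OF i])
    finally show ?thesis unfolding Bochner_Integration.integral_mult_right_zero .
  qed
  have "index_form a u (mode k f) = rf k z f"
    unfolding index_form_G[OF g h] rf_eq[OF Hz Hf] 1 2 3 4 5 z(3)[symmetric] z(4)[symmetric] by simp
  then show ?thesis using rz by simp
qed

lemma index_form_modes:
  assumes "f \<in> H1" "g \<in> H1"
  shows "index_form a (mode j f) (mode k g) = (if j = k then nrm k * rf k f g else 0)"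
proof -
  have "index_form a (mode j f) (mode k g) = rf k (\<lambda>s. (if k = j then nrm j else 0) * f s) g"
    by (rule index_form_mode[OF mode_HA CF_mode assms(2)]) (rule assms)+
  also have "\<dots> = (if k = j then nrm j else 0) * rf k f g" by (rule F.b_scale[OF assms])
  finally show ?thesis by auto
qed

lemma rf_minus: "rf (- k) = rf k"
  by (intro ext) (simp add: radial_form_def potential_def)

text \<open>If the modes \<open>0\<close> and \<open>\<plusminus>1\<close> of \<open>v\<close> vanish, Wirtinger's inequality on the circles bounds the energy in
  \<open>\<theta>\<close> below by the term \<open>4 / B\<^sup>2\<close> of the mode \<open>2\<close> potential; what remains is the mode \<open>2\<close> form of \<open>v\<close>
  on every meridian.\<close>

lemma high_modes:
  assumes \<delta>: "\<And>f. f \<in> H1 \<Longrightarrow> \<delta> * ri f f \<le> rf 2 f f"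
    and v: "v \<in> HA" and cf: "\<And>k. \<bar>k\<bar> \<le> 1 \<Longrightarrow> CF k v (\<lambda>s. 0)"
  shows "\<delta> * J B v v \<le> index_form a v v"
proof -
  obtain vs vt \<sigma> where g: "G v vs vt \<sigma>" using v C.H1_annulus_iff by blast
  note L = C.G_L2[OF g]
  have iB: "integrable R (\<lambda>x. 1 / B (fst x) * vt x * vt x)" "integrable R (\<lambda>x. 1 / B (fst x) * v x * v x)"
    by (intro J_int inv_B_cont L)+
  have wirt: "4 * J (\<lambda>s. 1 / B s) v v \<le> J (\<lambda>s. 1 / B s) vt vt"
  proof -
    have co0: "AE s in M. \<forall>k\<in>{-1..1}. co k v s = 0"
      using cf by (subst AE_ball_countable) (auto simp: CF_def)
    have cot: "AE s in M. \<forall>k. co k vt s = real_of_int k * co (- k) v s"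
      using C.weak_grad_co(2)[OF L(1,6)] by (simp add: AE_all_countable)
    have "AE s in M. 4 * (\<integral>\<theta>. 1 / B s * v (s, \<theta>) * v (s, \<theta>) \<partial>Mc) \<le> (\<integral>\<theta>. 1 / B s * vt (s, \<theta>) * vt (s, \<theta>) \<partial>Mc)"
      using co0 cot C.L2_slice_s[OF L(1)] C.L2_slice_s[OF L(3)]
    proof eventually_elim
      case (elim s)
      have "4 * (\<integral>\<theta>. (v (s, \<theta>))\<^sup>2 \<partial>Mc) \<le> (\<integral>\<theta>. (vt (s, \<theta>))\<^sup>2 \<partial>Mc)"
        by (rule Wirtinger[OF elim(3,4)]) (use elim(1,2) in \<open>auto simp: C.co_def abs_le_iff\<close>)
      then have "1 / B s * (4 * (\<integral>\<theta>. (v (s, \<theta>))\<^sup>2 \<partial>Mc)) \<le> 1 / B s * (\<integral>\<theta>. (vt (s, \<theta>))\<^sup>2 \<partial>Mc)"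
        using B_pos[of s] by (intro mult_left_mono) auto
      moreover have "(\<integral>\<theta>. 1 / B s * q \<theta> * q \<theta> \<partial>Mc) = 1 / B s * (\<integral>\<theta>. (q \<theta>)\<^sup>2 \<partial>Mc)" for q
        unfolding Bochner_Integration.integral_mult_right_zero[symmetric] by (simp add: power2_eq_square mult.assoc)
      ultimately show ?case by (simp only: mult.left_commute)
    qed
    then have "(\<integral>s. 4 * (\<integral>\<theta>. 1 / B s * v (s, \<theta>) * v (s, \<theta>) \<partial>Mc) \<partial>M) \<le> (\<integral>s. (\<integral>\<theta>. 1 / B s * vt (s, \<theta>) * vt (s, \<theta>) \<partial>Mc) \<partial>M)"
      using C.Fubini_s(2)[OF iB(1)] C.Fubini_s(2)[OF iB(2)] by (intro integral_mono_AE integrable_mult_right) simp_all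
    then show ?thesis unfolding J_def C.Fubini_s(3)[OF iB(1)] C.Fubini_s(3)[OF iB(2)]
        Bochner_Integration.integral_mult_right_zero fst_conv .
  qed
  have i1: "integrable R (\<lambda>x. B (fst x) * vs x * vs x)" and i2: "integrable R (\<lambda>x. P 2 (fst x) * v x * v x)"
    and i3: "integrable R (\<lambda>x. B (fst x) * v x * v x)"
    by (intro J_int B_cont P_cont L)+
  have i4: "integrable Mc (\<lambda>\<theta>. \<sigma> (l, \<theta>) * \<sigma> (l, \<theta>))" "integrable Mc (\<lambda>\<theta>. \<sigma> (- l, \<theta>) * \<sigma> (- l, \<theta>))"
    by (intro L2_mult_integrable L)+
  have merid: "AE \<theta> in Mc. \<delta> * (\<integral>s. B s * v (s, \<theta>) * v (s, \<theta>) \<partial>M) \<le>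
      (\<integral>s. B s * vs (s, \<theta>) * vs (s, \<theta>) \<partial>M) - (\<integral>s. P 2 s * v (s, \<theta>) * v (s, \<theta>) \<partial>M)
       - \<beta> * (\<sigma> (l, \<theta>) * \<sigma> (l, \<theta>) + \<sigma> (- l, \<theta>) * \<sigma> (- l, \<theta>))"
    using C.G_slice[OF g] C.L2_slice_t[OF L(1)]
  proof eventually_elim
    case (elim \<theta>)
    define z where "z s = \<sigma> (- l, \<theta>) + prim (-l) l (\<lambda>t. vs (t, \<theta>)) s" for s
    have vsL: "L2 M (\<lambda>s. vs (s, \<theta>))" and zae: "AE s in M. v (s, \<theta>) = z s" using elim(1) by (auto simp: z_def)
    have "ac (-l) l z (\<lambda>s. vs (s, \<theta>))" by (rule acI) (auto simp: z_def prim_left Mi.L2_integrable[OF vsL])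
    then have Hz: "H z (\<lambda>s. vs (s, \<theta>))" using vsL by (simp add: R1.H_def)
    then have zH: "z \<in> H1" using R1.H1_iff by blast
    have zl: "z l = \<sigma> (l, \<theta>)" "z (-l) = \<sigma> (- l, \<theta>)" using elim(1) by (simp_all add: z_def prim_left prim_right)
    have eq: "(\<integral>s. q s * v (s, \<theta>) * v (s, \<theta>) \<partial>M) = (\<integral>s. q s * z s * z s \<partial>M)" if q: "continuous_on {-l..l} q" for q
    proof (rule integral_cong_AE)
      show "AE s in M. q s * v (s, \<theta>) * v (s, \<theta>) = q s * z s * z s" using zae by eventually_elim simp
    qed (intro borel_measurable_times L2_measurable[OF elim(2)] L2_measurable[OF R1.H_L2'[OF Hz]] Mi_continuous_measurable q)+
    show ?case using \<delta>[OF zH] unfolding rf_eq[OF Hz Hz] ri_eq zl eq[OF B_cont] eq[OF P_cont] .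
  qed
  have "\<delta> * J B v v \<le> J B vs vs - J (P 2) v v
     - \<beta> * ((\<integral>\<theta>. \<sigma> (l, \<theta>) * \<sigma> (l, \<theta>) \<partial>Mc) + (\<integral>\<theta>. \<sigma> (- l, \<theta>) * \<sigma> (- l, \<theta>) \<partial>Mc))"
  proof -
    note F1 = C.Fubini_t[OF i1] and F2 = C.Fubini_t[OF i2] and F3 = C.Fubini_t[OF i3]
    have "(\<integral>\<theta>. \<delta> * (\<integral>s. B s * v (s, \<theta>) * v (s, \<theta>) \<partial>M) \<partial>Mc) \<le>
      (\<integral>\<theta>. (\<integral>s. B s * vs (s, \<theta>) * vs (s, \<theta>) \<partial>M) - (\<integral>s. P 2 s * v (s, \<theta>) * v (s, \<theta>) \<partial>M)
       - \<beta> * (\<sigma> (l, \<theta>) * \<sigma> (l, \<theta>) + \<sigma> (- l, \<theta>) * \<sigma> (- l, \<theta>)) \<partial>Mc)"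
      using merid F1(2) F2(2) F3(2) i4 by (intro integral_mono_AE) auto
    then show ?thesis unfolding J_def F1(3) F2(3) F3(3) using F1(2) F2(2) F3(2) i4 by simp
  qed
  moreover have "J (P 2) v v = J pB v v - 4 * J (\<lambda>s. 1 / B s) v v"
  proof -
    have "J (P 2) v v = (\<integral>x. pB (fst x) * v x * v x - 4 * (1 / B (fst x) * v x * v x) \<partial>R)"
      unfolding J_def
    proof (intro Bochner_Integration.integral_cong refl)
      fix x show "P 2 (fst x) * v x * v x = pB (fst x) * v x * v x - 4 * (1 / B (fst x) * v x * v x)"
        using B_pos[of "fst x"] by (simp add: potential_def field_simps power2_eq_square)
    qed
    also have "\<dots> = (\<integral>x. pB (fst x) * v x * v x \<partial>R) - (\<integral>x. 4 * (1 / B (fst x) * v x * v x) \<partial>R)"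
      by (intro Bochner_Integration.integral_diff integrable_mult_right J_int pB_cont inv_B_cont L)
    finally show ?thesis unfolding J_def Bochner_Integration.integral_mult_right_zero .
  qed
  ultimately show ?thesis unfolding index_form_G[OF g g] using wirt by linarith
qed

lemma J_B_null:
  assumes v: "v \<in> HA" and le: "J B v v \<le> 0" shows "v \<in> null_annulus l"
proof -
  have L: "L2 R v" using v C.H1_annulus_iff C.G_L2(1) by blast
  have nn: "0 \<le> B (fst x) * v x * v x" for x
    using B_pos[of "fst x"] mult_nonneg_nonneg[of "B (fst x)" "v x * v x"] by (simp add: mult.assoc)
  then have "0 \<le> J B v v" unfolding J_def by (intro Bochner_Integration.integral_nonneg) auto
  then have "J B v v = 0" using le by simp
  then have "AE x in R. B (fst x) * v x * v x = 0"
    using integral_nonneg_eq_0_iff_AE[OF J_int[OF B_cont L L]] nn by (auto simp: J_def)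
  then have "AE x in R. v x = 0" by eventually_elim (use B_pos in \<open>auto simp: less_imp_neq[symmetric]\<close>)
  then show ?thesis by (simp add: null_iff)
qed

lemma J_B_nonneg: "0 \<le> J B v v"
proof -
  have nn: "0 \<le> B (fst x) * v x * v x" for x
    using B_pos[of "fst x"] mult_nonneg_nonneg[of "B (fst x)" "v x * v x"] by (simp add: mult.assoc)
  then show ?thesis unfolding J_def by (intro Bochner_Integration.integral_nonneg) auto
qed

text \<open>The cross terms between different modes, and between the low modes and the remainder, vanish by
  \<open>index_form_mode\<close>.\<close>

lemma split_low_modes:
  assumes u: "u \<in> HA" and cf: "CF 0 u f" "CF 1 u g" "CF (-1) u h"
  obtains v where "v \<in> HA" "\<And>k. \<bar>k\<bar> \<le> 1 \<Longrightarrow> CF k v (\<lambda>s. 0)"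
    "index_form a u u = rf 0 f f / (2 * pi) + rf 1 g g / pi + rf 1 h h / pi + index_form a v v"
    "\<And>x. u x = f (fst x) / (2 * pi) + g (fst x) / pi * trig 1 (snd x) + h (fst x) / pi * trig (-1) (snd x) + v x"
proof -
  define f0 g0 h0 where "f0 s = 1 / (2 * pi) * f s" and "g0 s = 1 / pi * g s" and "h0 s = 1 / pi * h s" for s
  have D: "f \<in> H1" "g \<in> H1" "h \<in> H1" using cf by (auto simp: CF_def)
  have D0: "f0 \<in> H1" "g0 \<in> H1" "h0 \<in> H1" unfolding f0_def[abs_def] g0_def[abs_def] h0_def[abs_def] by (intro F.D_scale D)+
  define p where "p x = mode 0 f0 x + (mode 1 g0 x + mode (-1) h0 x)" for x
  note mD = mode_HA[OF D0(1), of 0] mode_HA[OF D0(2), of 1] mode_HA[OF D0(3), of "-1"]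
  have p: "p \<in> HA" unfolding p_def[abs_def] by (intro A.D_add mD)
  define v where "v x = u x - p x" for x
  have v: "v \<in> HA" unfolding v_def[abs_def] by (intro A.D_diff u p)
  have cfv: "CF k v (\<lambda>s. 0)" if k: "\<bar>k\<bar> \<le> 1" for k
  proof -
    have kk: "k = 0 \<or> k = 1 \<or> k = -1" using k by linarith
    define q where "q s = (if k = 0 then nrm 0 else 0) * f0 s + ((if k = 1 then nrm 1 else 0) * g0 s + (if k = -1 then nrm (-1) else 0) * h0 s)" for s
    have "CF k p q"
      using CF_lin[OF mD(1) A.D_add[OF mD(2,3)] CF_mode[OF D0(1)] CF_lin[OF mD(2,3) CF_mode[OF D0(2)] CF_mode[OF D0(3)], of k 1 1, simplified], of 1 1]
      by (simp add: p_def[abs_def] q_def[abs_def])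
    moreover have "q = (if k = 0 then f else if k = 1 then g else h)"
      using kk by (auto simp: q_def f0_def g0_def h0_def nrm_def fun_eq_iff)
    moreover have "CF k u (if k = 0 then f else if k = 1 then g else h)" using cf kk by auto
    ultimately have "CF k u q" "CF k p q" by simp_all
    from CF_lin[OF u p this, of 1 "-1"] show ?thesis by (simp add: v_def[abs_def])
  qed
  have vm: "index_form a v (mode k e) = 0" if "\<bar>k\<bar> \<le> 1" "e \<in> H1" for k e
    using index_form_mode[OF v cfv[OF that(1)] that(2)] F.b_zero[OF that(2)] by simp
  have vp: "index_form a v p = 0"
    unfolding p_def[abs_def] A.b_add2[OF mD(1) A.D_add[OF mD(2,3)] v] A.b_add2[OF mD(2,3) v]
    using vm[of 0 f0] vm[of 1 g0] vm[of "-1" h0] D0 by simp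
  have pp: "index_form a p p = nrm 0 * rf 0 f0 f0 + (nrm 1 * rf 1 g0 g0 + nrm (-1) * rf (-1) h0 h0)"
  proof -
    note ij = index_form_modes[OF D0(1) D0(1)] index_form_modes[OF D0(1) D0(2)] index_form_modes[OF D0(1) D0(3)]
      index_form_modes[OF D0(2) D0(1)] index_form_modes[OF D0(2) D0(2)] index_form_modes[OF D0(2) D0(3)]
      index_form_modes[OF D0(3) D0(1)] index_form_modes[OF D0(3) D0(2)] index_form_modes[OF D0(3) D0(3)]
    show ?thesis
      unfolding p_def[abs_def] A.b_add[OF mD(1) A.D_add[OF mD(2,3)] p[unfolded p_def[abs_def]]]
        A.b_add[OF mD(2,3) p[unfolded p_def[abs_def]]]
        A.b_add2[OF mD(1) A.D_add[OF mD(2,3)] mD(1)] A.b_add2[OF mD(1) A.D_add[OF mD(2,3)] mD(2)] A.b_add2[OF mD(1) A.D_add[OF mD(2,3)] mD(3)]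
        A.b_add2[OF mD(2,3) mD(1)] A.b_add2[OF mD(2,3) mD(2)] A.b_add2[OF mD(2,3) mD(3)]
        ij
      by simp
  qed
  have sc: "rf 0 f0 f0 = (1 / (2 * pi))\<^sup>2 * rf 0 f f" "rf 1 g0 g0 = (1 / pi)\<^sup>2 * rf 1 g g" "rf 1 h0 h0 = (1 / pi)\<^sup>2 * rf 1 h h"
    unfolding f0_def[abs_def] g0_def[abs_def] h0_def[abs_def] by (intro F.b_sq_scale D)+
  have "u = (\<lambda>x. p x + v x)" by (simp add: v_def)
  then have "index_form a u u = index_form a p p + index_form a v v"
    using A.b_sq_add[OF p v] vp A.b_sym[OF p v] by simp
  then have "index_form a u u = rf 0 f f / (2 * pi) + rf 1 g g / pi + rf 1 h h / pi + index_form a v v"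
    unfolding pp rf_minus sc by (simp add: nrm_def power2_eq_square)
  moreover have "u x = f (fst x) / (2 * pi) + g (fst x) / pi * trig 1 (snd x) + h (fst x) / pi * trig (-1) (snd x) + v x" for x
    by (simp add: v_def p_def f0_def g0_def h0_def)
  ultimately show ?thesis using that[of v] v cfv by blast
qed

lemma index_form_nonneg:
  assumes E: "mu_even a 2 0 > 0" and u: "u \<in> HA" and cf: "CF 0 u f" "CF 1 u g" "CF (-1) u h"
    and nn: "0 \<le> rf 0 f f" "0 \<le> rf 1 g g" "0 \<le> rf 1 h h"
  shows "0 \<le> index_form a u u"
proof -
  obtain \<delta> where \<delta>: "\<delta> > 0" "\<And>u. u \<in> H1 \<Longrightarrow> \<delta> * ri u u \<le> rf 2 u u"
    by (rule rf2_coercive[OF E]) (rule that; assumption)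
  obtain v where v: "v \<in> HA" "\<And>k. \<bar>k\<bar> \<le> 1 \<Longrightarrow> CF k v (\<lambda>s. 0)"
    "index_form a u u = rf 0 f f / (2 * pi) + rf 1 g g / pi + rf 1 h h / pi + index_form a v v"
    by (rule split_low_modes[OF u cf]) (rule that; assumption)
  have "0 \<le> index_form a v v"
    using high_modes[OF \<delta>(2) v(1,2)] mult_nonneg_nonneg[OF less_imp_le[OF \<delta>(1)] J_B_nonneg[of v]] by linarith
  then show ?thesis unfolding v(3) using nn by simp
qed

section \<open>Index and nullity\<close>

lemma ri_null: "u \<in> H1 \<Longrightarrow> ri u u = 0 \<longleftrightarrow> u \<in> null_interval l"
proof -
  assume u: "u \<in> H1"
  obtain C where "compact_form (null_interval l) H1 (robin.rq l \<beta> B (P 0)) (robin.rm l B) C"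
    by (rule robin.robin_compact[OF robin disjI1[OF refl]])
  from compact_form.m_null[OF this u] show ?thesis by (simp add: ri_robin)
qed

lemma CF_lincomb:
  assumes "\<And>i. i < n \<Longrightarrow> u i \<in> HA" "\<And>i. i < n \<Longrightarrow> CF k (u i) (v i)"
  shows "CF k (lincomb n c u) (lincomb n c v)"
  using assms
proof (induction n)
  case 0
  then show ?case by (simp add: CF_def C.co_def F.D_zero)
next
  case (Suc n)
  have "lincomb n c u \<in> HA" using Suc.prems by (intro A.D_lincomb) auto
  from CF_lin[OF this _ Suc.IH, of "u n" "v n" 1 "c n"] Suc.prems show ?case by simp
qed

lemma CF_null:
  assumes cf: "CF k u v" and u: "u \<in> null_annulus l"
  shows "v \<in> null_interval l"
proof -
  have v: "v \<in> H1" "AE s in M. co k u s = v s" using cf by (auto simp: CF_def)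
  have "AE s in M. AE \<theta> in Mc. u (s, \<theta>) = 0"
    using u unfolding null_iff by (rule Mi2.AE_pair)
  then have "AE s in M. co k u s = 0"
  proof eventually_elim
    case (elim s)
    show ?case unfolding C.co_def by (rule integral_eq_zero_AE) (use elim in \<open>eventually_elim, simp\<close>)
  qed
  with v(2) have "AE s in M. v s = 0" by eventually_elim simp
  from H1_AE_eq[OF v(1) F.D_zero this] show ?thesis by (auto simp: null_interval_def)
qed

subsection \<open>Lower bounds from explicit families of modes\<close>

lemma modes_independent:
  assumes f: "\<And>i. i < n \<Longrightarrow> f i \<in> H1" "\<And>i. i < n \<Longrightarrow> f i \<notin> null_interval l" and k: "inj_on k {..<n}"
  shows "independent_mod (null_annulus l) n (\<lambda>i. mode (k i) (f i))"
  unfolding independent_mod_def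
proof (intro allI impI)
  fix c i assume N: "lincomb n c (\<lambda>i. mode (k i) (f i)) \<in> null_annulus l" and i: "i < n"
  have "CF (k i) (lincomb n c (\<lambda>j. mode (k j) (f j)))
      (lincomb n c (\<lambda>j s. (if k i = k j then nrm (k j) else 0) * f j s))"
    by (intro CF_lincomb CF_mode mode_HA f)
  from CF_null[OF this N]
  have z: "(\<Sum>j<n. c j * ((if k i = k j then nrm (k j) else 0) * f j s)) = 0" if "s \<in> {-l..l}" for s
    using that unfolding null_interval_def by blast
  have eq: "(\<Sum>j<n. c j * ((if k i = k j then nrm (k j) else 0) * f j s)) = c i * (nrm (k i) * f i s)" for s
  proof -
    have "(\<Sum>j<n. c j * ((if k i = k j then nrm (k j) else 0) * f j s))
        = (\<Sum>j<n. if j = i then c i * (nrm (k i) * f i s) else 0)"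
      using k i by (intro sum.cong refl) (auto dest: inj_onD)
    then show ?thesis using i by simp
  qed
  obtain s where s: "s \<in> {-l..l}" "f i s \<noteq> 0" using f(2)[OF i] by (auto simp: null_interval_def)
  show "c i = 0" using z[OF s(1)] s(2) nrm_pos[of "k i"] unfolding eq by simp
qed

text \<open>A list of pairs of a mode and a radial function in the kernel of its radial form. Modes have to be
  distinct, which makes the family independent.\<close>

lemma nul_ge_modes:
  fixes fs :: "(int \<times> (real \<Rightarrow> real)) list"
  assumes f: "\<And>k f. (k, f) \<in> set fs \<Longrightarrow> f \<in> H1 \<and> f \<notin> null_interval l \<and> (\<forall>g\<in>H1. rf k f g = 0)"
    and d: "distinct (map fst fs)"
  shows "enat (length fs) \<le> nul a"
proof -
  have fi: "snd (fs ! i) \<in> H1" "snd (fs ! i) \<notin> null_interval l" "\<And>g. g \<in> H1 \<Longrightarrow> rf (fst (fs ! i)) (snd (fs ! i)) g = 0"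
    if "i < length fs" for i
    using f[of "fst (fs ! i)" "snd (fs ! i)"] that by auto
  show ?thesis unfolding nul_def l_def[symmetric]
  proof (rule dim_mod_ge)
    show "independent_mod (null_annulus l) (length fs) (\<lambda>i. mode (fst (fs ! i)) (snd (fs ! i)))"
    proof (rule modes_independent)
      show "inj_on (\<lambda>i. fst (fs ! i)) {..<length fs}"
        using d by (auto simp: inj_on_def distinct_conv_nth)
    qed (use fi in auto)
    fix i assume i: "i < length fs"
    let ?u = "mode (fst (fs ! i)) (snd (fs ! i))"
    have u: "?u \<in> HA" by (rule mode_HA[OF fi(1)[OF i]])
    have "index_form a ?u v = 0" if v: "v \<in> HA" for v
    proof -
      obtain g where g: "CF (fst (fs ! i)) v g" using CF_ex[OF v] by blast
      then have gH: "g \<in> H1" by (simp add: CF_def)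
      have "index_form a ?u v = rf (fst (fs ! i)) g (snd (fs ! i))"
        unfolding A.b_sym[OF u v] by (rule index_form_mode[OF v g fi(1)[OF i]])
      also have "\<dots> = rf (fst (fs ! i)) (snd (fs ! i)) g" by (rule F.b_sym[OF gH fi(1)[OF i]])
      finally show ?thesis using fi(3)[OF i gH] by simp
    qed
    then show "?u \<in> form_kernel HA (index_form a)" using u by (simp add: form_kernel_def)
  qed
qed

text \<open>The form is diagonal and negative on the span, and the family is independent because a null function
  is orthogonal to everything.\<close>

lemma index_ge:
  assumes F: "\<And>i. i < n \<Longrightarrow> F i \<in> HA" and orth: "\<And>i j. i < n \<Longrightarrow> j < n \<Longrightarrow> i \<noteq> j \<Longrightarrow> index_form a (F i) (F j) = 0"
    and neg: "\<And>i. i < n \<Longrightarrow> index_form a (F i) (F i) < 0"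
  shows "enat n \<le> ind a"
proof -
  have inHA: "lincomb n c F \<in> HA" for c using F by (rule A.D_lincomb)
  have q: "index_form a (lincomb n c F) (lincomb n c F) = (\<Sum>i<n. (c i)\<^sup>2 * index_form a (F i) (F i))" for c
  proof -
    have "index_form a (lincomb n c F) (lincomb n c F) = (\<Sum>i<n. c i * index_form a (F i) (lincomb n c F))"
      by (rule A.b_lincomb[OF F inHA])
    also have "\<dots> = (\<Sum>i<n. (c i)\<^sup>2 * index_form a (F i) (F i))"
    proof (intro sum.cong refl)
      fix i assume "i \<in> {..<n}"
      then have i: "i < n" by simp
      have "index_form a (F i) (lincomb n c F) = (\<Sum>j<n. c j * index_form a (F j) (F i))"
        unfolding A.b_sym[OF F[OF i] inHA] by (rule A.b_lincomb[OF F F[OF i]])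
      also have "\<dots> = (\<Sum>j<n. if j = i then c i * index_form a (F i) (F i) else 0)"
        using orth i by (intro sum.cong refl) auto
      also have "\<dots> = c i * index_form a (F i) (F i)" using i by simp
      finally show "c i * index_form a (F i) (lincomb n c F) = (c i)\<^sup>2 * index_form a (F i) (F i)"
        by (simp add: power2_eq_square)
    qed
    finally show ?thesis .
  qed
  have neg_comb: "index_form a (lincomb n c F) (lincomb n c F) < 0" if "i < n" "c i \<noteq> 0" for c i
  proof -
    have "0 < (\<Sum>i<n. - ((c i)\<^sup>2 * index_form a (F i) (F i)))"
    proof (rule sum_pos2[of _ i])
      show "0 < - ((c i)\<^sup>2 * index_form a (F i) (F i))" using neg that by (simp add: mult_pos_neg)
      show "0 \<le> - ((c j)\<^sup>2 * index_form a (F j) (F j))" if "j \<in> {..<n}" for j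
        using neg[of j] that by (simp add: mult_nonneg_nonpos)
    qed (use that in auto)
    then show ?thesis unfolding q by (simp add: sum_negf)
  qed
  define V where "V = range (\<lambda>c. lincomb n c F)"
  have inV: "lincomb n c F \<in> V" for c unfolding V_def by (rule rangeI)
  have "linear_subspace V"
    unfolding linear_subspace_def
  proof (intro conjI ballI allI)
    show "(\<lambda>x. 0) \<in> V" using inV[of "\<lambda>_. 0"] by simp
    fix u assume "u \<in> V"
    then obtain c where u: "u = lincomb n c F" by (auto simp: V_def)
    show "(\<lambda>x. r * u x) \<in> V" for r
    proof -
      have "(\<lambda>x. r * u x) = lincomb n (\<lambda>i. r * c i) F"
        unfolding u by (simp add: sum_distrib_left mult.assoc)
      also have "\<dots> \<in> V" by (rule inV)
      finally show ?thesis .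
    qed
    fix v assume "v \<in> V"
    then obtain d where v: "v = lincomb n d F" by (auto simp: V_def)
    have "(\<lambda>x. u x + v x) = lincomb n (\<lambda>i. c i + d i) F"
      unfolding u v by (simp add: sum.distrib distrib_right)
    also have "\<dots> \<in> V" by (rule inV)
    finally show "(\<lambda>x. u x + v x) \<in> V" .
  qed
  moreover have "V \<subseteq> HA" using inHA by (auto simp: V_def)
  moreover have "index_form a u u < 0" if uV: "u \<in> V - null_annulus l" for u
  proof -
    obtain c where u: "u = lincomb n c F" using uV by (auto simp: V_def)
    have "\<exists>i<n. c i \<noteq> 0"
    proof (rule ccontr)
      assume "\<not> (\<exists>i<n. c i \<noteq> 0)"
      then have "u = (\<lambda>x. 0)" unfolding u by (simp add: fun_eq_iff)
      then show False using uV by (simp add: null_annulus_def)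
    qed
    then show ?thesis unfolding u using neg_comb by blast
  qed
  ultimately have "dim_mod (null_annulus l) V \<le> ind a"
    unfolding ind_def form_index_def l_def[symmetric] by (intro Sup_upper) blast
  moreover have "enat n \<le> dim_mod (null_annulus l) V"
  proof (rule dim_mod_ge[where f = F])
    show "F i \<in> V" if "i < n" for i
    proof -
      have "F i = lincomb n (\<lambda>j. if j = i then 1 else 0) F"
      proof
        fix x
        have "(\<Sum>j<n. (if j = i then 1 else 0) * F j x) = (\<Sum>j<n. if j = i then F i x else 0)"
          by (intro sum.cong refl) simp
        then show "F i x = (\<Sum>j<n. (if j = i then 1 else 0) * F j x)" using that by simp
      qed
      also have "\<dots> \<in> V" by (rule inV)
      finally show ?thesis .
    qed
    show "independent_mod (null_annulus l) n F"
      unfolding independent_mod_def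
    proof (intro allI impI, rule ccontr)
      fix c i assume N: "lincomb n c F \<in> null_annulus l" and "i < n" "c i \<noteq> 0"
      then show False using neg_comb[of i c] index_form_null[OF inHA N inHA] by simp
    qed
  qed
  ultimately show ?thesis by (rule order_trans[rotated])
qed

lemma ind_ge_modes:
  fixes fs :: "(int \<times> (real \<Rightarrow> real)) list"
  assumes f: "\<And>k f. (k, f) \<in> set fs \<Longrightarrow> f \<in> H1 \<and> rf k f f < 0"
    and d: "sorted_wrt (\<lambda>(j, f) (k, g). j = k \<longrightarrow> rf k f g = 0) fs"
  shows "enat (length fs) \<le> ind a"
proof -
  have fi: "snd (fs ! i) \<in> H1" "rf (fst (fs ! i)) (snd (fs ! i)) (snd (fs ! i)) < 0" if "i < length fs" for i
    using f[of "fst (fs ! i)" "snd (fs ! i)"] that by auto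
  have lt: "rf (fst (fs ! j)) (snd (fs ! i)) (snd (fs ! j)) = 0"
    if "i < j" "j < length fs" "fst (fs ! i) = fst (fs ! j)" for i j
    using sorted_wrt_nth_less[OF d that(1,2)] that(3) by (simp add: case_prod_beta)
  show ?thesis
  proof (rule index_ge[where F = "\<lambda>i. mode (fst (fs ! i)) (snd (fs ! i))"])
    fix i assume i: "i < length fs"
    show "mode (fst (fs ! i)) (snd (fs ! i)) \<in> HA" by (rule mode_HA[OF fi(1)[OF i]])
    show "index_form a (mode (fst (fs ! i)) (snd (fs ! i))) (mode (fst (fs ! i)) (snd (fs ! i))) < 0"
      unfolding index_form_modes[OF fi(1)[OF i] fi(1)[OF i]] using fi(2)[OF i] nrm_pos by (simp add: mult_pos_neg)
    fix j assume j: "j < length fs" and ij: "i \<noteq> j"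
    have "rf (fst (fs ! j)) (snd (fs ! i)) (snd (fs ! j)) = 0" if e: "fst (fs ! i) = fst (fs ! j)"
    proof (cases "i < j")
      case True
      then show ?thesis by (rule lt[OF _ j e])
    next
      case False
      then have "rf (fst (fs ! i)) (snd (fs ! j)) (snd (fs ! i)) = 0" using ij i e by (intro lt) auto
      then show ?thesis using F.b_sym[OF fi(1)[OF i] fi(1)[OF j]] e by simp
    qed
    then show "index_form a (mode (fst (fs ! i)) (snd (fs ! i))) (mode (fst (fs ! j)) (snd (fs ! j))) = 0"
      unfolding index_form_modes[OF fi(1)[OF i] fi(1)[OF j]] by simp
  qed
qed

lemma rf_eigenfunctions:
  assumes "\<And>n. e n \<in> H1" "\<And>i j. ri (e i) (e j) = (if i = j then 1 else 0)"
    "\<And>n v. v \<in> H1 \<Longrightarrow> rf k (e n) v = mu a k n * ri (e n) v"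
  shows "rf k (e i) (e j) = (if i = j then mu a k i else 0)" "e i \<notin> null_interval l"
  using assms(3)[OF assms(1)] ri_null[OF assms(1), of i] by (auto simp: assms(2))

text \<open>The mode \<open>0\<close> form is negative on the plane spanned by \<open>w\<close> and \<open>y\<close>, and this plane contains a
  function orthogonal to the first eigenfunction.\<close>

lemma mu0_negative: "mu a 0 0 < 0" "mu a 0 1 < 0"
proof -
  obtain e where e: "\<And>n. e n \<in> H1" "\<And>i j. ri (e i) (e j) = (if i = j then 1 else 0)"
    "\<And>n v. v \<in> H1 \<Longrightarrow> rf 0 (e n) v = mu a 0 n * ri (e n) v"
    "\<And>n v. v \<in> H1 \<Longrightarrow> (\<And>i. i < n \<Longrightarrow> ri v (e i) = 0) \<Longrightarrow> mu a 0 n * ri v v \<le> rf 0 v v" "mono (mu a 0)"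
    by (rule spectrum[of 0]) (rule that, (assumption | blast)+)
  obtain c d :: real where cd: "c \<noteq> 0 \<or> d \<noteq> 0" "c * ri w (e 0) + d * ri y (e 0) = 0"
  proof (cases "ri w (e 0) = 0")
    case True
    then show ?thesis using that[of 1 0] by simp
  next
    case False
    then show ?thesis using that[of "ri y (e 0)" "- ri w (e 0)"] by simp
  qed
  let ?u = "\<lambda>s. c * w s + d * y s"
  have u: "?u \<in> H1" by (intro F.D_add F.D_scale w_H1 y_H1)
  have "ri ?u (e 0) = 0" using cd(2) by (simp add: I.b_add I.b_scale F.D_scale w_H1 y_H1 e(1))
  then have "mu a 0 1 * ri ?u ?u \<le> rf 0 ?u ?u" by (intro e(4)[OF u]) simp
  also have "\<dots> < 0" by (rule rf0_negative[OF cd(1)])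
  finally show "mu a 0 1 < 0" using I.b_nonneg[OF u] by (simp add: mult_less_0_iff)
  then show "mu a 0 0 < 0" using monoD[OF e(5), of 0 1] by simp
qed

lemma ind_ge_4: "4 \<le> ind a"
proof -
  obtain e where e: "\<And>n. e n \<in> H1" "\<And>i j. ri (e i) (e j) = (if i = j then 1 else 0)"
    "\<And>n v. v \<in> H1 \<Longrightarrow> rf 0 (e n) v = mu a 0 n * ri (e n) v"
    by (rule spectrum[of 0]) (rule that, (assumption | blast)+)
  note q = rf_eigenfunctions[OF e]
  have "enat (length [(0 :: int, e 0), (0, e 1), (1, y), (-1, y)]) \<le> ind a"
    by (rule ind_ge_modes) (auto simp: e q mu0_negative mu0_negative(2)[unfolded One_nat_def] y_H1 rf1_y_negative rf_minus)
  then show ?thesis by (simp add: numeral_eq_enat eval_nat_numeral)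
qed

lemma nul_ge_2: "2 \<le> nul a"
proof -
  have "enat (length [(1 :: int, w), (-1, w)]) \<le> nul a"
    by (rule nul_ge_modes) (auto simp: w_H1 w_nonzero rf_w rf_minus)
  then show ?thesis by (simp add: numeral_eq_enat eval_nat_numeral)
qed

text \<open>A further radial solution in a mode other than \<open>\<plusminus>1\<close> adds to the span of \<open>w cos \<theta>\<close> and
  \<open>w sin \<theta>\<close> in the kernel.\<close>

lemma nul_ge_3:
  assumes "f \<in> H1" "f \<notin> null_interval l" "\<And>g. g \<in> H1 \<Longrightarrow> rf k f g = 0" "\<bar>k\<bar> \<noteq> 1"
  shows "3 \<le> nul a"
proof -
  have "enat (length [(1 :: int, w), (-1, w), (k, f)]) \<le> nul a"
    by (rule nul_ge_modes) (use assms in \<open>auto simp: w_H1 w_nonzero rf_w rf_minus\<close>)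
  then show ?thesis by (simp add: numeral_eq_enat eval_nat_numeral)
qed

text \<open>If one of the conditions fails, a further mode joins the four negative directions (two eigenfunctions
  in the mode \<open>0\<close>, and \<open>y\<close> in the modes \<open>\<plusminus>1\<close>) or the two directions \<open>w\<close> in the modes \<open>\<plusminus>1\<close> of the kernel.\<close>

lemma eigenvalue_conditions:
  assumes ind: "ind a = 4" and nul: "nul a = 2"
  shows "mu_even a 2 0 > 0" "mu a 0 n \<noteq> 0" "mu a 0 2 > 0"
proof -
  have no3: "\<not> 3 \<le> nul a" unfolding nul by (simp add: numeral_eq_enat eval_nat_numeral)
  have no5: "\<not> 5 \<le> ind a" unfolding ind by (simp add: numeral_eq_enat eval_nat_numeral)
  obtain e where e: "\<And>n. e n \<in> H1" "\<And>i j. ri (e i) (e j) = (if i = j then 1 else 0)"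
    "\<And>n v. v \<in> H1 \<Longrightarrow> rf 0 (e n) v = mu a 0 n * ri (e n) v"
    by (rule spectrum[of 0]) (rule that, (assumption | blast)+)
  note q = rf_eigenfunctions[OF e]
  have five: False if "f \<in> H1" "rf k f f < 0" "\<bar>k\<bar> \<noteq> 1" "k = 0 \<Longrightarrow> rf 0 (e 0) f = 0 \<and> rf 0 (e 1) f = 0" for k f
  proof -
    have "enat (length [(0 :: int, e 0), (0, e 1), (1, y), (-1, y), (k, f)]) \<le> ind a"
      by (rule ind_ge_modes)
        (use that in \<open>auto simp: e q mu0_negative mu0_negative(2)[unfolded One_nat_def] y_H1 rf1_y_negative rf_minus\<close>)
    then show False using no5 by (simp add: numeral_eq_enat eval_nat_numeral)
  qed
  show nz: "mu a 0 n \<noteq> 0" for n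
  proof
    assume "mu a 0 n = 0"
    then have "3 \<le> nul a" using nul_ge_3[of "e n" 0] e q by simp
    then show False using no3 by simp
  qed
  show "mu a 0 2 > 0"
  proof (rule ccontr)
    assume "\<not> mu a 0 2 > 0"
    then have "mu a 0 2 < 0" using nz[of 2] by simp
    then show False using five[of "e 2" 0] by (simp add: e q)
  qed
  show "mu_even a 2 0 > 0"
  proof (rule ccontr)
    assume neg: "\<not> mu_even a 2 0 > 0"
    obtain f where f: "\<And>n. f n \<in> H1_even l" "\<And>i j. ri (f i) (f j) = (if i = j then 1 else 0)"
      "\<And>n v. v \<in> H1_even l \<Longrightarrow> rf 2 (f n) v = mu_even a 2 n * ri (f n) v"
      by (rule spectrum_even[of 2]) (rule that)
    have f0: "f 0 \<in> H1" "f 0 \<notin> null_interval l"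
      using f(1)[of 0] f(2)[of 0 0] ri_null[of "f 0"] by (auto simp: H1_even_def)
    (* a negative direction in the mode 2 would raise the index *)
    interpret P2: psd_form H1 "rf 2"
      by unfold_locales (use five[of _ 2] in force)
    have "rf 2 (f 0) (f 0) = 0"
      using f(3)[OF f(1), of 0 0] f(2)[of 0 0] neg P2.b_nonneg[OF f0(1)] by simp
    then have "rf 2 (f 0) g = 0" if "g \<in> H1" for g
      using P2.Cauchy_Schwarz[OF f0(1) that] by simp
    then show False using nul_ge_3[of "f 0" 2] f0 no3 by simp
  qed
qed

subsection \<open>Upper bounds\<close>

text \<open>Four linear conditions put the low modes of a function into the regions where the radial
  forms are nonnegative: orthogonality of its mode \<open>0\<close> to the two negative eigenfunctions, and
  vanishing of its modes \<open>\<plusminus>1\<close> on the circle \<open>s = 0\<close>.\<close>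

lemma ind_le_4:
  assumes E: "mu_even a 2 0 > 0" and F: "mu a 0 2 > 0"
  shows "ind a \<le> 4"
  unfolding ind_def form_index_def l_def[symmetric]
proof (rule Sup_least, clarify)
  fix V assume V: "V \<subseteq> HA" "linear_subspace V" "\<forall>u\<in>V - null_annulus l. index_form a u u < 0"
  obtain e where e: "\<And>n. e n \<in> H1" "\<And>i j. ri (e i) (e j) = (if i = j then 1 else 0)"
    "\<And>n v. v \<in> H1 \<Longrightarrow> rf 0 (e n) v = mu a 0 n * ri (e n) v"
    "\<And>n v. v \<in> H1 \<Longrightarrow> (\<And>i. i < n \<Longrightarrow> ri v (e i) = 0) \<Longrightarrow> mu a 0 n * ri v v \<le> rf 0 v v"
    by (rule spectrum[of 0]) (rule that, (assumption | blast)+)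
  show "dim_mod (null_annulus l) V \<le> 4"
  proof (rule dim_mod_le, rule ccontr)
    fix n f assume f: "\<And>i. i < n \<Longrightarrow> f i \<in> V" and ind: "independent_mod (null_annulus l) n f"
      and "\<not> enat n \<le> 4"
    then have n: "4 < n" by (simp add: numeral_eq_enat eval_nat_numeral)
    have fHA: "f i \<in> HA" if "i < n" for i using f[OF that] V(1) by blast
    have "\<forall>k. \<forall>i\<in>{..<n}. \<exists>v. CF k (f i) v" using CF_ex fHA by blast
    then obtain v where v: "\<And>k i. i < n \<Longrightarrow> CF k (f i) (v k i)" by (metis lessThan_iff)
    have vH: "v k i \<in> H1" if "i < n" for k i using v[OF that] by (simp add: CF_def)
    define L where "L j i = [ri (v 0 i) (e 0), ri (v 0 i) (e 1), v 1 i 0, v (-1) i 0] ! j" for j i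
    obtain c where c: "\<exists>i\<in>{..<n}. c i \<noteq> 0" "\<forall>j<4. (\<Sum>i\<in>{..<n}. c i * L j i) = 0"
      using homogeneous_system[of "{..<n}" 4 L] n by auto
    let ?u = "lincomb n c f" and ?v = "\<lambda>k. lincomb n c (v k)"
    have u: "?u \<in> V" using V(2) f by (rule linear_subspace_lincomb)
    have cf: "CF k ?u (?v k)" for k by (intro CF_lincomb fHA v)
    then have vkH: "?v k \<in> H1" for k by (simp add: CF_def)
    have "ri (?v 0) (e 0) = 0" "ri (?v 0) (e 1) = 0"
      using c(2)[rule_format, of 0] c(2)[rule_format, of 1] I.b_lincomb[OF vH e(1)] by (auto simp: L_def)
    then have "ri (?v 0) (e i) = 0" if "i < 2" for i using that by (auto simp: less_2_cases_iff)
    then have "mu a 0 2 * ri (?v 0) (?v 0) \<le> rf 0 (?v 0) (?v 0)" by (rule e(4)[OF vkH])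
    then have nn0: "0 \<le> rf 0 (?v 0) (?v 0)" using F I.b_nonneg[OF vkH[of 0]] by (meson less_imp_le mult_nonneg_nonneg order_trans)
    have z: "?v 1 0 = 0" "?v (-1) 0 = 0"
      using c(2)[rule_format, of 2] c(2)[rule_format, of 3] by (auto simp: L_def eval_nat_numeral)
    have "0 \<le> index_form a ?u ?u"
      by (rule index_form_nonneg[OF E _ cf cf cf nn0]) (use u V(1) in blast, (rule rf1_nonneg[OF vkH], rule z)+)
    moreover have "?u \<notin> null_annulus l" using ind c(1) unfolding independent_mod_def by blast
    then have "index_form a ?u ?u < 0" by (intro V(3)[rule_format] DiffI u)
    ultimately show False by linarith
  qed
qed

text \<open>For a function in the kernel each radial component lies in the kernel of its radial form:
  the mode \<open>0\<close> component vanishes, since \<open>0\<close> is not an eigenvalue, the components in the modes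
  \<open>\<plusminus>1\<close> are multiples of \<open>w\<close>, and the remainder vanishes by coercivity.\<close>

lemma kernel_structure:
  assumes E: "mu_even a 2 0 > 0" and F: "mu a 0 2 > 0" "\<And>n. mu a 0 n \<noteq> 0"
    and u: "u \<in> form_kernel HA (index_form a)"
  obtains p q where "AE x in R. u x = p * mode 1 w x + q * mode (-1) w x"
proof -
  obtain e where e: "\<And>n. e n \<in> H1"
    "\<And>n v. v \<in> H1 \<Longrightarrow> rf 0 (e n) v = mu a 0 n * ri (e n) v"
    "\<And>n v. v \<in> H1 \<Longrightarrow> (\<And>i. i < n \<Longrightarrow> ri v (e i) = 0) \<Longrightarrow> mu a 0 n * ri v v \<le> rf 0 v v"
    by (rule spectrum[of 0]) (rule that, (assumption | blast)+)
  have uH: "u \<in> HA" and ker: "\<And>v. v \<in> HA \<Longrightarrow> index_form a u v = 0" using u by (auto simp: form_kernel_def)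
  obtain f g h where cf: "CF 0 u f" "CF 1 u g" "CF (-1) u h" using CF_ex[OF uH] by meson
  then have fgh: "f \<in> H1" "g \<in> H1" "h \<in> H1" by (auto simp: CF_def)
  have rad: "rf 0 f z = 0" "rf 1 g z = 0" "rf 1 h z = 0" if z: "z \<in> H1" for z
    using index_form_mode[OF uH cf(1) z] index_form_mode[OF uH cf(2) z] index_form_mode[OF uH cf(3) z]
      ker[OF mode_HA[OF z, of 0]] ker[OF mode_HA[OF z, of 1]] ker[OF mode_HA[OF z, of "-1"]] by (simp_all add: rf_minus)
  have "ri f (e n) = 0" for n
    using rad(1)[OF e(1)[of n]] e(2)[OF fgh(1), of n] F(2)[of n] F.b_sym[OF fgh(1) e(1)[of n], of 0]
      I.b_sym[OF fgh(1) e(1)[of n]] by simp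
  then have "mu a 0 2 * ri f f \<le> 0" using e(3)[OF fgh(1), of 2] rad(1)[OF fgh(1)] by simp
  then have "ri f f = 0" using F(1) I.b_nonneg[OF fgh(1)] by (simp add: mult_le_0_iff)
  then have f0: "\<And>s. s \<in> {-l..l} \<Longrightarrow> f s = 0" using ri_null[OF fgh(1)] by (simp add: null_interval_def)
  obtain p where p: "\<And>s. s \<in> {-l..l} \<Longrightarrow> g s = p * w s" by (rule rf1_kernel[OF fgh(2) rad(2)]) (assumption, rule that)
  obtain q where q: "\<And>s. s \<in> {-l..l} \<Longrightarrow> h s = q * w s" by (rule rf1_kernel[OF fgh(3) rad(3)]) (assumption, rule that)
  obtain \<delta> where \<delta>: "\<delta> > 0" "\<And>u. u \<in> H1 \<Longrightarrow> \<delta> * ri u u \<le> rf 2 u u"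
    by (rule rf2_coercive[OF E]) (rule that; assumption)
  obtain v where v: "v \<in> HA" "\<And>k. \<bar>k\<bar> \<le> 1 \<Longrightarrow> CF k v (\<lambda>s. 0)"
    "index_form a u u = rf 0 f f / (2 * pi) + rf 1 g g / pi + rf 1 h h / pi + index_form a v v"
    "\<And>x. u x = f (fst x) / (2 * pi) + g (fst x) / pi * trig 1 (snd x) + h (fst x) / pi * trig (-1) (snd x) + v x"
    by (rule split_low_modes[OF uH cf]) (rule that; assumption)
  have "index_form a v v = 0" using v(3) ker[OF uH] rad(1)[OF fgh(1)] rad(2)[OF fgh(2)] rad(3)[OF fgh(3)] by simp
  then have "\<delta> * J B v v \<le> 0" using high_modes[OF \<delta>(2) v(1,2)] by simp
  then have "J B v v \<le> 0" using \<delta>(1) by (simp add: mult_le_0_iff)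
  then have ae: "AE x in R. v x = 0" using J_B_null[OF v(1)] null_iff by simp
  have "AE x in R. u x = p / pi * mode 1 w x + q / pi * mode (-1) w x"
  proof (rule AE_mp[OF ae], rule AE_I2, rule impI)
    fix x assume x: "x \<in> space R" and "v x = 0"
    then have "fst x \<in> {-l..l}" by (auto simp: C.space_R)
    then show "u x = p / pi * mode 1 w x + q / pi * mode (-1) w x"
      unfolding v(4)[of x] using f0 p q \<open>v x = 0\<close> by simp
  qed
  then show ?thesis by (rule that)
qed

lemma nul_le_2:
  assumes E: "mu_even a 2 0 > 0" and F: "mu a 0 2 > 0" "\<And>n. mu a 0 n \<noteq> 0"
  shows "nul a \<le> 2"
  unfolding nul_def l_def[symmetric]
proof (rule dim_mod_le, rule ccontr)
  fix n f assume f: "\<And>i. i < n \<Longrightarrow> f i \<in> form_kernel HA (index_form a)"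
    and ind: "independent_mod (null_annulus l) n f" and "\<not> enat n \<le> 2"
  then have n: "2 < n" by (simp add: numeral_eq_enat eval_nat_numeral)
  have "\<exists>r. i < n \<longrightarrow> (AE x in R. f i x = fst r * mode 1 w x + snd r * mode (-1) w x)" for i
  proof (cases "i < n")
    case True
    obtain p q where "AE x in R. f i x = p * mode 1 w x + q * mode (-1) w x"
      by (rule kernel_structure[OF E F f[OF True]])
    then show ?thesis by (intro exI[of _ "(p, q)"]) simp
  qed simp
  then obtain r where r: "\<forall>i. i < n \<longrightarrow> (AE x in R. f i x = fst (r i) * mode 1 w x + snd (r i) * mode (-1) w x)"
    using choice[of "\<lambda>i r. i < n \<longrightarrow> (AE x in R. f i x = fst r * mode 1 w x + snd r * mode (-1) w x)"] by blast
  define p q where "p i = fst (r i)" and "q i = snd (r i)" for i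
  have pq: "AE x in R. f i x = p i * mode 1 w x + q i * mode (-1) w x" if "i < n" for i
    using r that by (simp add: p_def q_def)
  obtain c where c: "\<exists>i\<in>{..<n}. c i \<noteq> 0" "\<forall>j<2. (\<Sum>i\<in>{..<n}. c i * [p i, q i] ! j) = 0"
    using homogeneous_system[of "{..<n}" 2 "\<lambda>j i. [p i, q i] ! j"] n by auto
  have z: "(\<Sum>i<n. c i * p i) = 0" "(\<Sum>i<n. c i * q i) = 0"
    using c(2)[rule_format, of 0] c(2)[rule_format, of 1] by simp_all
  have "AE x in R. \<forall>i\<in>{..<n}. f i x = p i * mode 1 w x + q i * mode (-1) w x"
    using pq by (subst AE_ball_countable) auto
  then have "AE x in R. lincomb n c f x = 0"
  proof eventually_elim
    case (elim x)
    have "lincomb n c f x = (\<Sum>i<n. c i * p i * mode 1 w x + c i * q i * mode (-1) w x)"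
      using elim by (intro sum.cong refl) (simp add: distrib_left mult.assoc)
    also have "\<dots> = (\<Sum>i<n. c i * p i) * mode 1 w x + (\<Sum>i<n. c i * q i) * mode (-1) w x"
      by (simp only: sum.distrib sum_distrib_right)
    finally show ?case using z by simp
  qed
  then show False using ind c(1) unfolding independent_mod_def null_iff by blast
qed

theorem index_nullity_iff:
  "ind a = 4 \<and> nul a = 2 \<longleftrightarrow> mu_even a 2 0 > 0 \<and> mu a 0 2 > 0 \<and> (\<forall>n. mu a 0 n \<noteq> 0)"
  using eigenvalue_conditions ind_ge_4 nul_ge_2 ind_le_4 nul_le_2 by (blast intro: antisym)

end

theorem theorem4:
  shows "(\<forall>a>1/2. ind a = 4 \<and> nul a = 2) \<longleftrightarrow>
    (\<forall>a>1/2. mu_even a 2 0 > 0) \<and> (\<forall>a>1/2. mu a 0 2 > 0 \<and> (\<forall>n. mu a 0 n \<noteq> 0))"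
  using catenoid.index_nullity_iff[OF catenoid.intro] by blast

end
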